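(* Let $A$ be an integer valued (positive definite) quadratic form of rank $n$ and level $l$. Then: (i) $\Theta_A$ is a modular form of weight $\frac{n}{2}$ and level $l$. (ii) $\partial_B\Theta_A$ is a modular form of weight $\frac{n+4}{2}$ if and only if $B\in T_A^0$. In particular, $\partial_B\Theta_A=0$ holds only for $B\in T_A^0$. (iii) The differential $\mathrm{D}\Theta$ of the theta map at $A$ vanishes identically on $T_A^0$ if and only if $\Theta_{1,1;A}=0$.
   Context: $\mathrm{Quad}_n$ is the real vector space of symmetric real $n\times n$ matrices (quadratic forms in $n$ variables), and $\mathrm{Quad}_n^+\subset \mathrm{Quad}_n$ is the open cone of positive definite ones. The form $A\in\mathrm{Quad}_n^+$ is integer valued if ${}^t\lambda A\lambda\in\mathbb{Z}$ for all $\lambda\in\mathbb{Z}^n$; its level is the usual level of the even integral matrix $2A$, i.e. the least positive integer $l$ such that $l(2A)^{-1}$ is integral with even diagonal. For $A\in\mathrm{Quad}_n^+$ the theta series is the holomorphic function on the upper half plane given by $\Theta_A(z)=\sum_{\lambda\in\mathbb{Z}^n}\exp(2\pi i({}^t\lambda A\lambda)z)$; the theta map is $\Theta: A\mapsto\Theta_A$. The tangent space of $\mathrm{Quad}_n^+$ at $A$ is $\mathrm{Quad}_n=\mathbb{R}A\oplus T_A^0$ with $T_A^0=\{B\in\mathrm{Quad}_n : \mathrm{tr}(BA^{-1})=0\}$ (infinitesimal deformations with fixed discriminant). For $B\in\mathrm{Quad}_n$ set $$\partial_B\Theta_A(z):=\frac{1}{2\pi i z}\frac{\partial}{\partial t}\Theta_{A+tB}(z)\Big|_{t=0}=\sum_{\lambda\in\mathbb{Z}^n}({}^t\lambda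 B\lambda)\exp(2\pi i({}^t\lambda A\lambda)z).$$ That $\mathrm{D}\Theta$ vanishes identically on $T_A^0$ means $\partial_B\Theta_A=0$ for all $B\in T_A^0$. The lattice $\Lambda\subset\mathbb{E}^n$ (Euclidean $n$-space) associated to $A$ is generated by the columns of a real matrix $Q$ with $A={}^tQQ$; it is unique up to $\mathrm{O}(n)$. For a lattice $\Lambda\subset\mathbb{E}^n$ of rank $n$, $$\Theta_{1,1;\Lambda}(z)=\sum_{(\gamma,\delta)\in\Lambda\times\Lambda}\left(\frac12\langle\gamma,\delta\rangle^2-\frac1{2n}\|\gamma\|^2\|\delta\|^2\right)\exp\bigl(2\pi i(\|\gamma\|^2+\|\delta\|^2)z\bigr),$$ and $\Theta_{1,1;A}:=\Theta_{1,1;\Lambda}$ for $\Lambda$ associated to $A$. *)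

theory Defs
  imports "HOL-Complex_Analysis.Complex_Analysis"
begin

section \<open>Quadratic forms\<close>

definition Quad :: "(real ^ 'n ^ 'n) set" where
  "Quad = {A. transpose A = A}"

definition Quad_pos :: "(real ^ 'n ^ 'n) set" where
  "Quad_pos = {A \<in> Quad. \<forall>x. x \<noteq> 0 \<longrightarrow> x \<bullet> (A *v x) > 0}"

definition int_vec :: "int ^ 'n \<Rightarrow> real ^ 'n" where
  "int_vec v = (\<chi> i. of_int (v $ i))"

definition integer_valued :: "real ^ 'n ^ 'n \<Rightarrow> bool" where
  "integer_valued A \<longleftrightarrow> (\<forall>v. int_vec v \<bullet> (A *v int_vec v) \<in> \<int>)"

definition even_integral :: "real ^ 'n ^ 'n \<Rightarrow> bool" where
  "even_integral M \<longleftrightarrow> (\<forall>i j. M $ i $ j \<in> \<int>) \<and> (\<forall>i. \<exists>m::int. M $ i $ i = 2 * of_int m)"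

definition form_level :: "real ^ 'n ^ 'n \<Rightarrow> nat" where
  "form_level A = (LEAST l. l > 0 \<and> even_integral (real l *\<^sub>R matrix_inv (2 *\<^sub>R A)))"

text \<open>The infinitesimal deformations of a form with fixed discriminant.\<close>

definition tangent0 :: "real ^ 'n ^ 'n \<Rightarrow> (real ^ 'n ^ 'n) set" where
  "tangent0 A = {B \<in> Quad. trace (B ** matrix_inv A) = 0}"


section \<open>Theta series\<close>

definition upper_half_plane :: "complex set" where
  "upper_half_plane = {z. Im z > 0}"

definition theta_series :: "real ^ 'n ^ 'n \<Rightarrow> complex \<Rightarrow> complex" where
  "theta_series A z =
     (\<Sum>\<^sub>\<infinity>v::int ^ 'n. exp (2 * of_real pi * \<i> * of_real (int_vec v \<bullet> (A *v int_vec v)) * z))"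

definition partial_theta :: "real ^ 'n ^ 'n \<Rightarrow> real ^ 'n ^ 'n \<Rightarrow> complex \<Rightarrow> complex" where
  "partial_theta B A z =
     vector_derivative (\<lambda>t::real. theta_series (A + t *\<^sub>R B) z) (at 0) / (2 * of_real pi * \<i> * z)"

definition DTheta_vanishes_on :: "real ^ 'n ^ 'n \<Rightarrow> (real ^ 'n ^ 'n) set \<Rightarrow> bool" where
  "DTheta_vanishes_on A T \<longleftrightarrow> (\<forall>B\<in>T. \<forall>z\<in>upper_half_plane. partial_theta B A z = 0)"

text \<open>The integral linear combinations of the columns of \<open>Q\<close>.\<close>

definition column_lattice :: "real ^ 'n ^ 'n \<Rightarrow> (real ^ 'n) set" where
  "column_lattice Q = range (\<lambda>v. Q *v int_vec v)"

definition associated_lattice :: "real ^ 'n ^ 'n \<Rightarrow> (real ^ 'n) set \<Rightarrow> bool" where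
  "associated_lattice A \<Lambda> \<longleftrightarrow> (\<exists>Q. A = transpose Q ** Q \<and> \<Lambda> = column_lattice Q)"

definition theta11_lattice :: "(real ^ 'n) set \<Rightarrow> complex \<Rightarrow> complex" where
  "theta11_lattice \<Lambda> z =
     (\<Sum>\<^sub>\<infinity>(\<gamma>, \<delta>)\<in>\<Lambda> \<times> \<Lambda>.
        of_real (1 / 2 * (\<gamma> \<bullet> \<delta>)\<^sup>2 - 1 / (2 * real CARD('n)) * (norm \<gamma>)\<^sup>2 * (norm \<delta>)\<^sup>2)
        * exp (2 * of_real pi * \<i> * of_real ((norm \<gamma>)\<^sup>2 + (norm \<delta>)\<^sup>2) * z))"

text \<open>
  The associated lattice is unique only up to orthogonal transformations; the choice does not
  matter by \<open>theta11_lattice_unique\<close> below.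
\<close>

definition theta11_form :: "real ^ 'n ^ 'n \<Rightarrow> complex \<Rightarrow> complex" where
  "theta11_form A = theta11_lattice (SOME \<Lambda>. associated_lattice A \<Lambda>)"

lemma gram_inner:
  fixes Q :: "real ^ 'n ^ 'n"
  assumes "A = transpose Q ** Q"
  shows "(Q *v x) \<bullet> (Q *v y) = x \<bullet> (A *v y)"
  unfolding assms
  by (metis dot_lmul_matrix inner_commute matrix_vector_mul_assoc transpose_matrix_vector)

lemma theta11_lattice_gram:
  fixes A :: "real ^ 'n ^ 'n"
  assumes A: "A \<in> Quad_pos" and Q: "A = transpose Q ** Q"
  shows "theta11_lattice (column_lattice Q) z =
    (\<Sum>\<^sub>\<infinity>(v, w)\<in>UNIV.
        of_real (1 / 2 * (int_vec v \<bullet> (A *v int_vec w))\<^sup>2 - 1 / (2 * real CARD('n)) *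
           (int_vec v \<bullet> (A *v int_vec v)) * (int_vec w \<bullet> (A *v int_vec w)))
        * exp (2 * of_real pi * \<i> *
            of_real (int_vec v \<bullet> (A *v int_vec v) + int_vec w \<bullet> (A *v int_vec w)) * z))"
proof -
  have inj: "inj (\<lambda>v. Q *v int_vec v)"
  proof (rule injI)
    fix v w :: "int ^ 'n" assume eq: "Q *v int_vec v = Q *v int_vec w"
    let ?d = "int_vec v - int_vec w"
    have "Q *v ?d = 0"
      using eq by (simp add: matrix_vector_mult_diff_distrib)
    hence "?d \<bullet> (A *v ?d) = 0"
      using gram_inner[OF Q, of ?d ?d] by simp
    hence "?d = 0"
      using A by (metis (mono_tags, lifting) Quad_pos_def less_irrefl mem_Collect_eq)
    thus "v = w"
      by (simp add: int_vec_def vec_eq_iff)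
  qed
  let ?f = "map_prod (\<lambda>v. Q *v int_vec v) (\<lambda>v. Q *v int_vec v)"
  have range: "column_lattice Q \<times> column_lattice Q = range ?f"
    by (auto simp: column_lattice_def map_prod_def)
  have "inj ?f"
    using inj by (rule prod.inj_map) (rule inj)
  thus ?thesis
    unfolding theta11_lattice_def range
    by (subst infsum_reindex)
       (auto simp: o_def case_prod_beta power2_norm_eq_inner gram_inner[OF Q] intro!: infsum_cong)
qed

lemma theta11_lattice_unique:
  assumes "A \<in> Quad_pos" "associated_lattice A \<Lambda>" "associated_lattice A \<Lambda>'"
  shows "theta11_lattice \<Lambda> = theta11_lattice \<Lambda>'"
  using assms theta11_lattice_gram unfolding associated_lattice_def by fastforce


section \<open>Modular forms of integral and half-integral weight\<close>

definition moebius :: "int \<Rightarrow> int \<Rightarrow> int \<Rightarrow> int \<Rightarrow> complex \<Rightarrow> complex" where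
  "moebius a b c d z = (of_int a * z + of_int b) / (of_int c * z + of_int d)"

definition jacobi_theta :: "complex \<Rightarrow> complex" where
  "jacobi_theta z = (\<Sum>\<^sub>\<infinity>m::int. exp (2 * of_real pi * \<i> * of_int (m\<^sup>2) * z))"

text \<open>
  For integral weight \<open>k\<close> this is \<open>(cz + d)\<^sup>k\<close>. For half-integral weight it is Shimura's
  \<open>j(g, z)\<^sup>2\<^sup>k\<close>, where \<open>j(g, z) = \<theta>(gz) / \<theta>(z)\<close> for \<open>g \<in> \<Gamma>\<^sub>0(4)\<close>.
\<close>

definition automorphy_factor :: "real \<Rightarrow> int \<Rightarrow> int \<Rightarrow> int \<Rightarrow> int \<Rightarrow> complex \<Rightarrow> complex" where
  "automorphy_factor k a b c d z =
     (if k \<in> \<int> then (of_int c * z + of_int d) powi \<lfloor>k\<rfloor>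
      else (jacobi_theta (moebius a b c d z) / jacobi_theta z) powi \<lfloor>2 * k\<rfloor>)"

definition dirichlet_char :: "nat \<Rightarrow> (int \<Rightarrow> complex) \<Rightarrow> bool" where
  "dirichlet_char N \<psi> \<longleftrightarrow>
     \<psi> 1 = 1 \<and> (\<forall>a b. \<psi> (a * b) = \<psi> a * \<psi> b) \<and> (\<forall>a. \<psi> (a + int N) = \<psi> a) \<and>
     (\<forall>a. \<psi> a = 0 \<longleftrightarrow> \<not> coprime a (int N))"

text \<open>
  Holomorphic functions on the upper half plane which transform under \<open>\<Gamma>\<^sub>0(N)\<close> with weight \<open>k\<close> and
  some character modulo \<open>N\<close>, and which are holomorphic at all cusps: the transform of \<open>f\<close> by any
  element of \<open>SL\<^sub>2(\<int>)\<close> stays bounded as \<open>Im z \<rightarrow> \<infinity>\<close>. The branch of the root in the latter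
  condition only affects a factor of modulus 1.
\<close>

definition modular_form :: "real \<Rightarrow> nat \<Rightarrow> (complex \<Rightarrow> complex) \<Rightarrow> bool" where
  "modular_form k N f \<longleftrightarrow>
     N > 0 \<and> 2 * k \<in> \<int> \<and> (k \<notin> \<int> \<longrightarrow> 4 dvd N) \<and>
     f holomorphic_on upper_half_plane \<and>
     (\<exists>\<psi>. dirichlet_char N \<psi> \<and>
        (\<forall>a b c d. a * d - b * c = 1 \<longrightarrow> int N dvd c \<longrightarrow>
           (\<forall>z\<in>upper_half_plane.
              f (moebius a b c d z) = \<psi> d * automorphy_factor k a b c d z * f z))) \<and>
     (\<forall>a b c d. a * d - b * c = 1 \<longrightarrow>
        (\<exists>Y>0. bounded ((\<lambda>z. (of_int c * z + of_int d) powr (- of_real k) * f (moebius a b c d z))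
                   ` {z. Im z \<ge> Y})))"

end

theory Submission
  imports Defs "HOL-Number_Theory.Residue_Primitive_Roots"
begin

text \<open>
  Poisson summation expresses the theta series of the shifted lattice \<open>\<int>\<^sup>n + h\<close> at \<open>z\<close> by the dual
  series at \<open>- 1 / (4 z)\<close>. Differentiating twice in \<open>h\<close> gives the inversion formula of the theta
  series weighted with \<open>B[x]\<close>, with an additional multiple of \<open>tr (B A\<^sup>-\<^sup>1) \<Theta>\<^sub>A\<close>. For
  \<open>g = (a, b; c, d)\<close> in \<open>\<Gamma>\<^sub>0(l)\<close> one has \<open>g z = b / d + \<tau> / d\<^sup>2\<close> with \<open>\<tau> = d z / (c z + d)\<close>, and splitting
  \<open>\<int>\<^sup>n\<close> modulo \<open>d\<close> turns the inversion formulas into transformation laws under \<open>g\<close> whose multiplier is a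
  Gauss sum. This sum depends on \<open>b\<close> through the \<open>n\<close>-th power of the Jacobi symbol \<open>(b/d)\<close>, exactly as
  the \<open>n\<close>-th power of the Gauss sum of Jacobi's theta function, so that dividing by the latter leaves a
  character of \<open>d\<close>. The additional term cancels only if \<open>tr (B A\<^sup>-\<^sup>1) = 0\<close>, because \<open>\<Theta>\<^sub>A\<close> has no zeros on
  the imaginary axis.

  For the last part, choose coordinates in which \<open>A\<close> is the unit form, let \<open>E\<^sub>i\<^sub>j\<close> be the theta series
  weighted with \<open>x\<^sub>i x\<^sub>j\<close> and let \<open>F\<close> be the traceless part of \<open>E\<close>. The series \<open>\<partial>\<^sub>B \<Theta>\<^sub>A\<close> for tangential
  \<open>B\<close> are the linear combinations of the \<open>F\<^sub>i\<^sub>j\<close>, and \<open>\<Theta>\<^sub>1\<^sub>,\<^sub>1\<close> is half the sum of their squares. The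
  \<open>F\<^sub>i\<^sub>j\<close> are real on the imaginary axis, so there the sum of squares vanishes only if all of them do.
\<close>

section \<open>Gaussian sums over the integer lattice\<close>

text \<open>The obstacle is that the inversion z \<mapsto> - 1 / (4 z) links A to its dual and lies
  outside the group, so each g in Gamma_0(l) is treated directly through cosets. That works for d >
  0, and the Jacobi symbols require d to be odd. All other d are reached by group theory: the
  multiplier does not change under right translations or right multiplication by (1, 0; e, 1) with
  \<open>l\<close> dividing e, and it depends only on d modulo \<open>l\<close>. The Gaussian mean
  is known only up to a constant factor, which cancels in the quotient of its values at \<tau> and z
  and only scales the bounds at the cusps. For odd n two facts must be secured beforehand. The level
  is divisible by 4, which follows from integrality by Gauss sums modulo 2. And Jacobi's theta
  function has no zeros, because the automorphy factor divides by it. Theta series carry an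
  arbitrary weight of at most quadratic growth and an arbitrary shift, so that one set of estimates
  covers everything that differentiation produces.\<close>

definition qf :: "real ^ 'n ^ 'n \<Rightarrow> real ^ 'n \<Rightarrow> real" where
  "qf A x = x \<bullet> (A *v x)"

definition ex :: "complex \<Rightarrow> complex" where
  "ex w = exp (2 * of_real pi * \<i> * w)"

lemma ex_add: "ex (w + w') = ex w * ex w'"
  by (simp add: ex_def exp_add ring_distribs)

lemma ex_0 [simp]: "ex 0 = 1"
  by (simp add: ex_def)

lemma ex_nonzero [simp]: "ex w \<noteq> 0"
  by (simp add: ex_def)

lemma norm_ex: "norm (ex w) = exp (- 2 * pi * Im w)"
  by (simp add: ex_def)

lemma ex_of_real: "ex (of_real t) = cis (2 * pi * t)"
  by (simp add: ex_def cis_conv_exp mult_ac)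

lemma ex_int: "ex (of_int k) = 1"
  by (metis ex_of_real cis_multiple_2pi Ints_of_int of_real_of_int_eq)

lemma ex_Ints: "w \<in> \<int> \<Longrightarrow> ex w = 1"
  by (auto elim!: Ints_cases simp: ex_int)

lemma ex_cong_Ints: "w - w' \<in> \<int> \<Longrightarrow> ex w = ex w'"
  by (metis diff_add_cancel ex_Ints ex_add mult_1)

section \<open>Summability of Gaussians over the lattice\<close>

lemma abs_summable_int_exp:
  assumes "e > 0"
  shows "(\<lambda>m::int. exp (- e * (real_of_int m)\<^sup>2)) summable_on UNIV"
proof -
  define f where "f = (\<lambda>m::int. exp (- e * (real_of_int m)\<^sup>2))"
  have geo: "(\<lambda>k::nat. exp (- e) ^ k) summable_on UNIV"
  proof -
    have "summable (\<lambda>k::nat. exp (- e) ^ k)"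
      using assms by (intro summable_geometric) auto
    thus ?thesis by (intro norm_summable_imp_summable_on) (simp only: real_norm_def abs_of_nonneg[OF zero_le_power[OF exp_ge_zero]])
  qed
  have le: "f m \<le> exp (- e) ^ nat \<bar>m\<bar>" for m
  proof -
    have "real_of_int \<bar>m\<bar> \<le> real_of_int (m\<^sup>2)"
    proof (subst of_int_le_iff)
      have "\<bar>m\<bar> * 1 \<le> \<bar>m\<bar> * \<bar>m\<bar>"
        by (cases "m = 0") (simp, intro mult_left_mono, linarith+)
      thus "\<bar>m\<bar> \<le> m\<^sup>2"
        by (simp add: power2_eq_square)
    qed
    hence "- e * (real_of_int m)\<^sup>2 \<le> real (nat \<bar>m\<bar>) * (- e)"
      using assms by (simp add: mult.commute)
    thus ?thesis
      unfolding f_def by (metis exp_le_cancel_iff exp_of_nat_mult)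
  qed
  have 1: "f summable_on (range int)"
  proof (subst summable_on_reindex)
    show "(f \<circ> int) summable_on UNIV"
      by (rule summable_on_comparison_test[OF geo]) (use le[of "int _"] in \<open>auto simp: f_def\<close>)
  qed auto
  have 2: "f summable_on (range (\<lambda>k. - int k))"
  proof (subst summable_on_reindex)
    show "(f \<circ> (\<lambda>k. - int k)) summable_on UNIV"
      by (rule summable_on_comparison_test[OF geo]) (use le[of "- int _"] in \<open>auto simp: f_def\<close>)
  qed (auto simp: inj_on_def)
  have U: "UNIV = range int \<union> range (\<lambda>k. - int k)"
    by (auto) (metis int_cases2 rangeI)
  have "f summable_on UNIV"
    unfolding U using 1 2 by (meson summable_on_union)
  thus ?thesis by (simp add: f_def)
qed

text \<open>The Gaussian is a product over the coordinates, so the product theorem for absolutely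
  summable families indexed by functions applies; \<open>vec_nth\<close> carries the result over to
  vectors.\<close>

lemma summable_gaussian_lattice:
  assumes "e > 0"
  shows "(\<lambda>v::int ^ 'n. exp (- e * (norm (int_vec v))\<^sup>2)) summable_on UNIV"
proof -
  let ?f = "\<lambda>m::int. exp (- e * (real_of_int m)\<^sup>2)"
  have "Infinite_Set_Sum.abs_summable_on (\<lambda>g::'n \<Rightarrow> int. \<Prod>i\<in>UNIV. ?f (g i)) (PiE UNIV (\<lambda>_. UNIV))"
    using abs_summable_int_exp[OF assms]
    by (intro abs_summable_on_prod_PiE) (auto simp: abs_summable_equivalent[symmetric])
  hence "(\<lambda>g::'n \<Rightarrow> int. \<Prod>i\<in>UNIV. ?f (g i)) summable_on UNIV"
    by (auto simp: abs_summable_equivalent[symmetric] PiE_UNIV_domain prod_nonneg)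
  moreover have "range (vec_nth :: int ^ 'n \<Rightarrow> _) = UNIV"
  proof -
    have "g \<in> range (vec_nth :: int ^ 'n \<Rightarrow> _)" for g
      by (rule range_eqI[of _ _ "vec_lambda g"]) auto
    thus ?thesis by blast
  qed
  ultimately have "(\<lambda>g::'n \<Rightarrow> int. \<Prod>i\<in>UNIV. ?f (g i)) summable_on range (vec_nth :: int ^ 'n \<Rightarrow> _)"
    by simp
  hence "((\<lambda>g::'n \<Rightarrow> int. \<Prod>i\<in>UNIV. ?f (g i)) \<circ> vec_nth) summable_on UNIV"
    by (subst (asm) summable_on_reindex) (auto simp: inj_on_def vec_nth_inject)
  moreover have "(\<Prod>i\<in>UNIV. ?f (v $ i)) = exp (- e * (norm (int_vec v))\<^sup>2)" for v :: "int ^ 'n"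
    unfolding power2_norm_eq_inner inner_vec_def
    by (simp add: int_vec_def sum_distrib_left power2_eq_square flip: exp_sum)
  ultimately show ?thesis by (simp add: o_def)
qed

lemma int_vec_component [simp]: "int_vec v $ i = of_int (v $ i)"
  by (simp add: int_vec_def)

lemma int_vec_add: "int_vec (v + w) = int_vec v + int_vec w"
  by (simp add: vec_eq_iff)

lemma int_vec_minus: "int_vec (- w) = - int_vec w"
  by (simp add: vec_eq_iff)

lemma int_vec_zero [simp]: "int_vec 0 = 0"
  by (simp add: vec_eq_iff)

lemma int_vec_scale: "int_vec (k *s w) = of_int k *\<^sub>R int_vec w"
  by (simp add: vec_eq_iff)

text \<open>The majorants for lattice sums attached to a form all come from here: a quadratic
  weight, a linear term in the exponent and a bounded shift are absorbed at once. One quarter of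
  \<open>c\<close> pays for the weight, one quarter for the linear term by completing a square, and
  one quarter for replacing v + h by v.\<close>

lemma gaussian_domination:
  assumes c: "c > 0" and K: "K \<ge> 0"
  obtains M where "M summable_on (UNIV :: (int ^ 'n) set)"
    "\<And>v h. norm h \<le> R \<Longrightarrow> (1 + (norm (int_vec v + h))\<^sup>2) *
       exp (- c * (norm (int_vec v + h))\<^sup>2 + K * norm (int_vec v + h) + K) \<le> M v"
proof -
  define D where "D = (1 + 4 / c) * exp (K + K\<^sup>2 / c + (c/2) * R\<^sup>2)"
  define M where "M = (\<lambda>v::int ^ 'n. D * exp (- (c/4) * (norm (int_vec v))\<^sup>2))"
  have 1: "M summable_on UNIV"
    unfolding M_def using summable_gaussian_lattice[of "c/4"] c
    by (intro summable_on_cmult_right) auto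
  have 2: "(1 + (norm (int_vec v + h))\<^sup>2) *
       exp (- c * (norm (int_vec v + h))\<^sup>2 + K * norm (int_vec v + h) + K) \<le> M v"
    if h: "norm h \<le> R" for v :: "int ^ 'n" and h
  proof -
    define t where "t = norm (int_vec v + h)"
    have t: "t \<ge> 0" by (simp add: t_def)
    have R: "R \<ge> 0" using h norm_ge_zero order_trans by blast
    have "c * t\<^sup>2 / 4 \<le> exp (c * t\<^sup>2 / 4)"
      using exp_ge_add_one_self[of "c * t\<^sup>2 / 4"] by linarith
    hence "t\<^sup>2 \<le> 4 / c * exp (c * t\<^sup>2 / 4)"
      using c by (simp add: field_simps)
    moreover have "1 \<le> exp (c * t\<^sup>2 / 4)" using c by simp
    ultimately have "1 + t\<^sup>2 \<le> exp (c * t\<^sup>2 / 4) + 4 / c * exp (c * t\<^sup>2 / 4)"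
      by (rule add_mono[rotated])
    hence A: "1 + t\<^sup>2 \<le> (1 + 4 / c) * exp (c * t\<^sup>2 / 4)"
      by (simp only: ring_distribs mult_1)
    have "0 \<le> (c * t / 2 - K)\<^sup>2" by simp
    also have "\<dots> = c * ((c/4) * t\<^sup>2 + K\<^sup>2 / c - K * t)"
      using c by (simp add: power2_eq_square field_simps)
    finally have B: "K * t \<le> (c/4) * t\<^sup>2 + K\<^sup>2 / c"
      using c by (simp add: zero_le_mult_iff)
    have "norm (int_vec v) \<le> t + R"
      using h norm_triangle_ineq4[of "int_vec v + h" h] by (simp add: t_def)
    hence "(norm (int_vec v))\<^sup>2 \<le> (t + R)\<^sup>2"
      by (intro power_mono) auto
    also have "\<dots> \<le> 2 * t\<^sup>2 + 2 * R\<^sup>2"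
      using sum_squares_bound[of t R] by (simp add: power2_sum)
    finally have C: "- (c/2) * t\<^sup>2 \<le> (c/2) * R\<^sup>2 - (c/4) * (norm (int_vec v))\<^sup>2"
      using c mult_left_mono[of "(norm (int_vec v))\<^sup>2" "2 * t\<^sup>2 + 2 * R\<^sup>2" "c/4"]
      by (simp add: algebra_simps)
    have "(1 + t\<^sup>2) * exp (- c * t\<^sup>2 + K * t + K) \<le>
        ((1 + 4 / c) * exp (c * t\<^sup>2 / 4)) * exp (- (3 * c / 4) * t\<^sup>2 + K\<^sup>2 / c + K)"
      using A B c by (intro mult_mono) (auto simp: algebra_simps)
    also have "\<dots> = (1 + 4 / c) * exp (- (c/2) * t\<^sup>2 + (K\<^sup>2 / c + K))"
      unfolding mult.assoc exp_add[symmetric]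
      by (intro arg_cong2[of _ _ _ _ "(*)"] refl arg_cong[of _ _ exp]) (simp add: field_simps)
    also have "\<dots> \<le> (1 + 4 / c) * exp ((c/2) * R\<^sup>2 - (c/4) * (norm (int_vec v))\<^sup>2 + (K\<^sup>2 / c + K))"
      using C c by (intro mult_left_mono) auto
    also have "\<dots> = M v"
      unfolding M_def D_def mult.assoc exp_add[symmetric]
      by (intro arg_cong2[of _ _ _ _ "(*)"] refl arg_cong[of _ _ exp]) simp
    finally show ?thesis by (simp add: t_def)
  qed
  show ?thesis using that 1 2 by blast
qed

text \<open>The minimum over the compact unit sphere is positive, and homogeneity of degree 2
  extends the bound to all vectors.\<close>

lemma Quad_pos_lower_bound:
  assumes "A \<in> Quad_pos"
  obtains a where "a > 0" "\<And>x. qf A x \<ge> a * (norm x)\<^sup>2"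
proof -
  have cont: "continuous_on (sphere 0 1) (qf A)"
    unfolding qf_def by (intro continuous_intros linear_continuous_on) (simp add: linear_linear)
  obtain x0 :: "real ^ 'a" where x0: "x0 \<in> sphere 0 1" "\<And>x. x \<in> sphere 0 1 \<Longrightarrow> qf A x0 \<le> qf A x"
    using continuous_attains_inf[OF compact_sphere _ cont] by (auto simp: sphere_eq_empty)
  have "qf A x \<ge> qf A x0 * (norm x)\<^sup>2" for x
  proof (cases "x = 0")
    case False
    have "qf A x = (norm x)\<^sup>2 * qf A (x /\<^sub>R norm x)"
      using False by (simp add: qf_def matrix_vector_mult_scaleR power2_eq_square field_simps)
    also have "\<dots> \<ge> (norm x)\<^sup>2 * qf A x0"
      using x0(2)[of "x /\<^sub>R norm x"] False by (intro mult_left_mono) auto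
    finally show ?thesis by (simp add: mult.commute)
  qed (simp add: qf_def)
  moreover have "qf A x0 > 0"
  proof -
    have "x0 \<noteq> 0" using x0(1) by auto
    thus ?thesis using assms by (simp add: Quad_pos_def qf_def)
  qed
  ultimately show ?thesis using that by blast
qed

lemma matrix_bilinear_bound:
  fixes B :: "real ^ 'n ^ 'm"
  obtains b where "b \<ge> 0" "\<And>x y. \<bar>x \<bullet> (B *v y)\<bar> \<le> b * norm x * norm y"
proof -
  obtain b where b: "\<And>y. norm (B *v y) \<le> b * norm y" "b > 0"
    using linear_bounded_pos[of "(*v) B"] by auto
  have "\<bar>x \<bullet> (B *v y)\<bar> \<le> b * norm x * norm y" for x y
    using Cauchy_Schwarz_ineq2[of x "B *v y"] b(1)[of y] mult_left_mono[of "norm (B *v y)" "b * norm y" "norm x"]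
    by (simp add: mult_ac)
  thus ?thesis using that b(2) by (meson less_imp_le)
qed

section \<open>Termwise differentiation and holomorphy of infinite sums\<close>

lemma has_vector_derivative_at_0_iff:
  fixes f :: "real \<Rightarrow> 'b::real_normed_vector"
  shows "(f has_vector_derivative d) (at 0) \<longleftrightarrow> ((\<lambda>s. (f s - f 0) /\<^sub>R s) \<longlongrightarrow> d) (at 0)"
proof -
  have "((\<lambda>s. (f s - f 0) /\<^sub>R s) \<longlongrightarrow> d) (at 0) \<longleftrightarrow> ((\<lambda>s. norm ((f s - f 0) /\<^sub>R s - d)) \<longlongrightarrow> 0) (at 0)"
    by (simp add: tendsto_norm_zero_iff Lim_null[of _ d])
  also have "\<dots> \<longleftrightarrow> ((\<lambda>s. norm (f s - f 0 - s *\<^sub>R d) / norm s) \<longlongrightarrow> 0) (at 0)"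
  proof (rule tendsto_cong, unfold eventually_at_filter, intro always_eventually allI impI)
    fix s :: real assume "s \<noteq> 0"
    hence "(f s - f 0) /\<^sub>R s - d = (f s - f 0 - s *\<^sub>R d) /\<^sub>R s"
      by (simp add: scaleR_diff_right)
    thus "norm ((f s - f 0) /\<^sub>R s - d) = norm (f s - f 0 - s *\<^sub>R d) / norm s"
      by (simp add: divide_inverse_commute)
  qed
  also have "\<dots> \<longleftrightarrow> (f has_vector_derivative d) (at 0)"
    by (simp add: has_vector_derivative_def has_derivative_at bounded_linear_scaleR_left)
  finally show ?thesis by simp
qed

text \<open>By the mean value inequality a bound on the derivatives bounds the difference quotients
  by the same \<open>M\<close>. The Weierstrass test then gives convergence uniform in s, and the
  limit s \<rightarrow> 0 passes under the sum.\<close>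

lemma infsum_has_vector_derivative:
  fixes f :: "'v \<Rightarrow> real \<Rightarrow> 'b::banach"
  assumes r: "r > 0"
    and deriv: "\<And>v s. \<bar>s\<bar> < r \<Longrightarrow> (f v has_vector_derivative f' v s) (at s)"
    and bound: "\<And>v s. \<bar>s\<bar> < r \<Longrightarrow> norm (f' v s) \<le> M v"
    and M: "M summable_on UNIV"
    and f: "\<And>s. \<bar>s\<bar> < r \<Longrightarrow> (\<lambda>v. f v s) summable_on UNIV"
  shows "((\<lambda>s. \<Sum>\<^sub>\<infinity>v. f v s) has_vector_derivative (\<Sum>\<^sub>\<infinity>v. f' v 0)) (at 0)"
proof -
  \<comment> \<open>Filling in the derivative at s = 0 makes the bound by \<open>M\<close> hold on
    the whole ball.\<close>
  define \<phi> where "\<phi> = (\<lambda>v s. if s = 0 then f' v 0 else (f v s - f v 0) /\<^sub>R s)"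
  have lim: "(\<phi> v \<longlongrightarrow> f' v 0) (at 0)" for v
  proof -
    have "((\<lambda>s. (f v s - f v 0) /\<^sub>R s) \<longlongrightarrow> f' v 0) (at 0)"
      using deriv[of 0 v] r by (simp add: has_vector_derivative_at_0_iff)
    thus ?thesis
      by (rule Lim_transform_eventually) (auto simp: eventually_at_filter \<phi>_def)
  qed
  have le: "norm (\<phi> v s) \<le> M v" if "s \<in> ball 0 r" for v s
  proof (cases "s = 0")
    case True thus ?thesis using bound[of 0 v] r by (simp add: \<phi>_def)
  next
    case False
    have "norm (f v s - f v 0) \<le> M v * norm (s - 0)"
    proof (rule differentiable_bound[of "ball 0 r" _ "\<lambda>x h. h *\<^sub>R f' v x"])
      show "(f v has_derivative (\<lambda>h. h *\<^sub>R f' v x)) (at x within ball 0 r)" if "x \<in> ball 0 r" for x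
        using deriv[of x v] that by (simp add: has_vector_derivative_def has_derivative_at_withinI)
      show "onorm (\<lambda>h. h *\<^sub>R f' v x) \<le> M v" if "x \<in> ball 0 r" for x
        using bound[of x v] that by (intro onorm_le) (auto simp: mult.commute intro: mult_left_mono)
    qed (use that r in auto)
    thus ?thesis using False by (simp add: \<phi>_def divide_simps mult.commute)
  qed
  have "uniform_limit (ball 0 r) (\<lambda>X s. \<Sum>v\<in>X. \<phi> v s) (\<lambda>s. \<Sum>\<^sub>\<infinity>v. \<phi> v s) (finite_subsets_at_top UNIV)"
    using le M by (intro Weierstrass_m_test_general) auto
  moreover have "((\<lambda>X. \<Sum>v\<in>X. f' v 0) \<longlongrightarrow> (\<Sum>\<^sub>\<infinity>v. f' v 0)) (finite_subsets_at_top UNIV)"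
  proof -
    have "(\<lambda>v. f' v 0) summable_on UNIV"
      using bound[of 0] r
      by (intro abs_summable_summable[OF Infinite_Sum.abs_summable_on_comparison_test'[OF M]]) auto
    thus ?thesis using has_sum_infsum has_sum_def by blast
  qed
  ultimately have "((\<lambda>s. \<Sum>\<^sub>\<infinity>v. \<phi> v s) \<longlongrightarrow> (\<Sum>\<^sub>\<infinity>v. f' v 0)) (at 0 within ball 0 r)"
    by (intro swap_uniform_limit[where f = "\<lambda>X s. \<Sum>v\<in>X. \<phi> v s" and F = "finite_subsets_at_top UNIV"
          and g = "\<lambda>X. \<Sum>v\<in>X. f' v 0"])
       (auto intro!: always_eventually tendsto_sum tendsto_within_subset[OF lim])
  hence "((\<lambda>s. \<Sum>\<^sub>\<infinity>v. \<phi> v s) \<longlongrightarrow> (\<Sum>\<^sub>\<infinity>v. f' v 0)) (at 0)"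
    using r by (simp add: at_within_open[of 0 "ball 0 r"])
  moreover have "\<forall>\<^sub>F s in at 0. (\<Sum>\<^sub>\<infinity>v. \<phi> v s) = ((\<Sum>\<^sub>\<infinity>v. f v s) - (\<Sum>\<^sub>\<infinity>v. f v 0)) /\<^sub>R s"
    unfolding eventually_at
  proof (intro exI[of _ r] conjI ballI impI r)
    fix s :: real assume "s \<noteq> 0 \<and> dist s 0 < r"
    hence s: "s \<noteq> 0" "\<bar>s\<bar> < r" by (auto simp: dist_norm)
    have "(\<Sum>\<^sub>\<infinity>v. \<phi> v s) = (\<Sum>\<^sub>\<infinity>v. (f v s - f v 0) /\<^sub>R s)"
      using s by (simp add: \<phi>_def)
    also have "\<dots> = (\<Sum>\<^sub>\<infinity>v. f v s - f v 0) /\<^sub>R s"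
      by (rule infsum_scaleR_right)
    also have "(\<Sum>\<^sub>\<infinity>v. f v s - f v 0) = (\<Sum>\<^sub>\<infinity>v. f v s) - (\<Sum>\<^sub>\<infinity>v. f v 0)"
      using infsum_add[of "\<lambda>v. f v s" UNIV "\<lambda>v. - f v 0"] f s r
      by (simp add: infsum_uminus summable_on_uminus)
    finally show "(\<Sum>\<^sub>\<infinity>v. \<phi> v s) = ((\<Sum>\<^sub>\<infinity>v. f v s) - (\<Sum>\<^sub>\<infinity>v. f v 0)) /\<^sub>R s" .
  qed
  ultimately show ?thesis
    unfolding has_vector_derivative_at_0_iff by (rule Lim_transform_eventually)
qed

text \<open>The majorant is allowed to depend on the point, since the terms of a theta series have
  no common summable majorant all the way down to the real axis.\<close>

lemma infsum_holomorphic: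
  fixes f :: "'v \<Rightarrow> complex \<Rightarrow> complex"
  assumes S: "open S" and hol: "\<And>v. f v holomorphic_on S"
    and dom: "\<And>z. z \<in> S \<Longrightarrow> \<exists>r>0. \<exists>M. M summable_on UNIV \<and> cball z r \<subseteq> S \<and>
        (\<forall>v. \<forall>w\<in>cball z r. norm (f v w) \<le> M v)"
  shows "(\<lambda>z. \<Sum>\<^sub>\<infinity>v. f v z) holomorphic_on S"
proof -
  have "\<exists>r>0. (\<lambda>z. \<Sum>\<^sub>\<infinity>v. f v z) holomorphic_on ball z r" if z: "z \<in> S" for z
  proof -
    from dom[OF z] obtain r M where r: "r > 0" "M summable_on UNIV" "cball z r \<subseteq> S"
      "\<And>v w. w \<in> cball z r \<Longrightarrow> norm (f v w) \<le> M v" by blast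
    have "uniform_limit (cball z r) (\<lambda>X w. \<Sum>v\<in>X. f v w) (\<lambda>w. \<Sum>\<^sub>\<infinity>v. f v w) (finite_subsets_at_top UNIV)"
      using r by (intro Weierstrass_m_test_general) auto
    moreover have "(\<lambda>w. \<Sum>v\<in>X. f v w) holomorphic_on cball z r" for X
      using hol r(3) by (intro holomorphic_on_sum) (auto intro: holomorphic_on_subset)
    hence "eventually (\<lambda>X. continuous_on (cball z r) (\<lambda>w. \<Sum>v\<in>X. f v w) \<and>
        (\<lambda>w. \<Sum>v\<in>X. f v w) holomorphic_on ball z r) (finite_subsets_at_top UNIV)"
      by (intro always_eventually allI conjI holomorphic_on_imp_continuous_on)
         (auto intro: holomorphic_on_subset[OF _ ball_subset_cball])
    ultimately have "(\<lambda>z. \<Sum>\<^sub>\<infinity>v. f v z) holomorphic_on ball z r"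
      by (rule_tac holomorphic_uniform_limit[of z r "\<lambda>X w. \<Sum>v\<in>X. f v w" "finite_subsets_at_top UNIV"
            "\<lambda>z. \<Sum>\<^sub>\<infinity>v. f v z"]) auto
    thus ?thesis using r(1) by blast
  qed
  thus ?thesis
    using S by (metis analytic_imp_holomorphic analytic_on_def)
qed

section \<open>Fourier series on the torus\<close>

definition torus_mean :: "(real ^ 'n \<Rightarrow> complex) \<Rightarrow> complex" where
  "torus_mean f = integral (cbox 0 1) f"

definition lattice_periodic :: "(real ^ 'n \<Rightarrow> complex) \<Rightarrow> bool" where
  "lattice_periodic f \<longleftrightarrow> (\<forall>h v. f (h + int_vec v) = f h)"

text \<open>The shifted cube is cut at coordinate 1 in direction \<open>k\<close>. Moving the
  protruding slab back by one period reassembles the unit cube.\<close>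

lemma torus_mean_shift_axis_unit:
  fixes f :: "real ^ 'n \<Rightarrow> complex"
  assumes f: "continuous_on UNIV f" "lattice_periodic f" and s: "0 \<le> s" "s \<le> 1"
  shows "torus_mean (\<lambda>h. f (h + s *\<^sub>R axis k 1)) = torus_mean f"
proof -
  define e where "e = (axis k 1 :: real ^ 'n)"
  have e: "e \<in> Basis" by (simp add: e_def)
  have ek: "e $ i = (if i = k then 1 else 0)" for i by (simp add: e_def axis_def)
  have int: "f integrable_on cbox a b" for a b
    using f(1) by (intro integrable_continuous) (auto intro: continuous_on_subset)
  have per: "f \<circ> ((+) e) = f"
  proof
    fix h
    have "e = int_vec (axis k 1)" by (simp add: vec_eq_iff ek axis_def)
    thus "(f \<circ> ((+) e)) h = f h" using f(2) by (simp add: lattice_periodic_def add.commute)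
  qed
  have inner: "x \<bullet> e = x $ k" for x by (simp add: e_def inner_axis)
  have split_le: "cbox a b \<inter> {x. x $ k \<le> c} = cbox a (\<chi> i. if i = k then min (b $ k) c else b $ i)"
    and split_ge: "cbox a b \<inter> {x. x $ k \<ge> c} = cbox (\<chi> i. if i = k then max (a $ k) c else a $ i) b"
    for a b :: "real ^ 'n" and c
    by (auto simp: set_eq_iff mem_box_cart)
  have "torus_mean (\<lambda>h. f (h + s *\<^sub>R e)) = integral (cbox (0 + s *\<^sub>R e) (1 + s *\<^sub>R e)) f"
    unfolding torus_mean_def by (subst integral_shift_cbox_plus[symmetric]) (simp add: o_def add.commute)
  also have "\<dots> = integral (cbox (s *\<^sub>R e) (1 + s *\<^sub>R e) \<inter> {x. x \<bullet> e \<le> 1}) f +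
     integral (cbox (s *\<^sub>R e) (1 + s *\<^sub>R e) \<inter> {x. x \<bullet> e \<ge> 1}) f"
    using integral_split[OF int e] by simp
  also have "cbox (s *\<^sub>R e) (1 + s *\<^sub>R e) \<inter> {x. x \<bullet> e \<le> 1} = cbox (s *\<^sub>R e) 1"
    unfolding inner split_le using s
    by (intro arg_cong2[of _ _ _ _ cbox]) (auto simp: vec_eq_iff ek)
  also have "cbox (s *\<^sub>R e) (1 + s *\<^sub>R e) \<inter> {x. x \<bullet> e \<ge> 1} = cbox (0 + e) ((1 + (s - 1) *\<^sub>R e) + e)"
    unfolding inner split_ge using s
    by (intro arg_cong2[of _ _ _ _ cbox]) (auto simp: vec_eq_iff ek)
  also have "integral (cbox (0 + e) ((1 + (s - 1) *\<^sub>R e) + e)) f = integral (cbox 0 (1 + (s - 1) *\<^sub>R e)) f"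
    by (subst integral_shift_cbox_plus[symmetric]) (simp add: per)
  also have "cbox 0 (1 + (s - 1) *\<^sub>R e) = cbox 0 1 \<inter> {x. x \<bullet> e \<le> s}"
    unfolding inner split_le using s
    by (intro arg_cong2[of _ _ _ _ cbox]) (auto simp: vec_eq_iff ek)
  also have "cbox (s *\<^sub>R e) 1 = cbox 0 1 \<inter> {x. x \<bullet> e \<ge> s}"
    unfolding inner split_ge using s
    by (intro arg_cong2[of _ _ _ _ cbox]) (auto simp: vec_eq_iff ek)
  also have "integral (cbox 0 1 \<inter> {x. x \<bullet> e \<ge> s}) f + integral (cbox 0 1 \<inter> {x. x \<bullet> e \<le> s}) f = torus_mean f"
    unfolding torus_mean_def using integral_split[OF int e, of 0 1 s] by simp
  finally show ?thesis by (simp add: e_def)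
qed

text \<open>A shift is a composition of shifts along the axes, and periodicity reduces each of these
  to its fractional part.\<close>

lemma torus_mean_shift:
  fixes f :: "real ^ 'n \<Rightarrow> complex"
  assumes f: "continuous_on UNIV f" "lattice_periodic f"
  shows "torus_mean (\<lambda>h. f (h + c)) = torus_mean f"
proof -
  have axis: "torus_mean (\<lambda>h. g (h + s *\<^sub>R axis k 1)) = torus_mean g"
    if g: "continuous_on UNIV g" "lattice_periodic g" for g :: "real ^ 'n \<Rightarrow> complex" and s k
  proof -
    have "g (h + s *\<^sub>R axis k 1) = g (h + frac s *\<^sub>R axis k 1)" for h
    proof -
      have "s *\<^sub>R axis k 1 = frac s *\<^sub>R axis k 1 + int_vec (axis k \<lfloor>s\<rfloor>)"
        by (simp add: vec_eq_iff axis_def frac_def)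
      hence "h + s *\<^sub>R axis k 1 = (h + frac s *\<^sub>R axis k 1) + int_vec (axis k \<lfloor>s\<rfloor>)"
        by (simp only: add.assoc)
      thus ?thesis using g(2) by (simp only: lattice_periodic_def)
    qed
    thus ?thesis
      using torus_mean_shift_axis_unit[OF g, of "frac s" k] by (simp only: frac_ge_0 less_imp_le[OF frac_lt_1] simp_thms)
  qed
  have "torus_mean (\<lambda>h. f (h + (\<Sum>k\<in>S. (c $ k) *\<^sub>R axis k 1))) = torus_mean f" if "finite S" for S
    using that
  proof induction
    case (insert j S)
    define g where "g = (\<lambda>h. f (h + (\<Sum>k\<in>S. (c $ k) *\<^sub>R axis k 1)))"
    have "continuous_on UNIV g"
      unfolding g_def by (rule continuous_on_compose2[OF f(1)]) (auto intro!: continuous_intros)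
    moreover have "lattice_periodic g"
      using f(2) unfolding g_def lattice_periodic_def by (metis (no_types, lifting) add.assoc add.commute)
    ultimately have "torus_mean (\<lambda>h. g (h + (c $ j) *\<^sub>R axis j 1)) = torus_mean g"
      by (rule axis)
    thus ?case using insert by (simp add: g_def add_ac)
  qed simp
  from this[of UNIV] show ?thesis
    using basis_expansion[of c] by (simp add: scalar_mult_eq_scaleR)
qed

section \<open>Characters and trigonometric polynomials on the torus\<close>

definition chr :: "int ^ 'n \<Rightarrow> real ^ 'n \<Rightarrow> complex" where
  "chr \<xi> h = ex (of_real (int_vec \<xi> \<bullet> h))"

lemma continuous_on_chr [continuous_intros]: "continuous_on S (chr \<xi>)"
  unfolding chr_def[abs_def] ex_def by (intro continuous_intros)

lemma norm_chr [simp]: "norm (chr \<xi> h) = 1"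
  by (simp add: chr_def norm_ex)

lemma chr_add: "chr (\<xi> + \<eta>) h = chr \<xi> h * chr \<eta> h"
  by (simp add: chr_def int_vec_add inner_add_left ex_add)

lemma chr_minus: "chr (- \<xi>) h * chr \<xi> h = 1"
  by (simp add: chr_def int_vec_minus flip: ex_add)

lemma chr_0 [simp]: "chr 0 h = 1"
  by (simp add: chr_def)

lemma chr_at_0 [simp]: "chr \<xi> 0 = 1"
  by (simp add: chr_def)

lemma chr_shift: "chr \<xi> (h + c) = chr \<xi> h * chr \<xi> c"
  by (simp add: chr_def inner_add_right ex_add)

lemma inner_int_vec_Ints: "int_vec \<xi> \<bullet> int_vec v \<in> \<int>"
  by (auto simp: inner_vec_def intro!: Ints_sum Ints_mult)

lemma chr_int_vec: "chr \<xi> (int_vec v) = 1"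
  unfolding chr_def by (rule ex_Ints) (metis inner_int_vec_Ints Ints_cases Ints_of_int of_real_of_int_eq)

lemma lattice_periodic_chr: "lattice_periodic (chr \<xi>)"
  by (simp add: lattice_periodic_def chr_shift chr_int_vec)

lemma torus_mean_const [simp]: "torus_mean (\<lambda>_. c :: complex) = c"
  by (auto simp: torus_mean_def content_cbox_cart box_eq_empty Basis_vec_def inner_axis)

lemma torus_mean_chr: "torus_mean (chr \<xi>) = (if \<xi> = 0 then 1 else 0)"
proof (cases "\<xi> = 0")
  case True
  have "chr 0 = (\<lambda>_::real ^ 'a. 1)" by (simp add: fun_eq_iff)
  thus ?thesis using True by simp
next
  case False
  then obtain k where k: "\<xi> $ k \<noteq> 0" by (auto simp: vec_eq_iff)
  \<comment> \<open>Half a period in a direction where \<xi> is nonzero: this shift reverses the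
    sign of the character, so its mean equals its own negative.\<close>
  define c where "c = (1 / (2 * real_of_int (\<xi> $ k))) *\<^sub>R (axis k 1 :: real ^ 'a)"
  have "chr \<xi> c = -1"
    using k by (simp add: chr_def c_def inner_axis ex_def)
  hence "torus_mean (chr \<xi>) = torus_mean (\<lambda>h. - chr \<xi> h)"
    using torus_mean_shift[OF continuous_on_chr lattice_periodic_chr, of \<xi> c] by (simp add: chr_shift)
  also have "\<dots> = - torus_mean (chr \<xi>)"
    unfolding torus_mean_def by simp
  finally show ?thesis using False by simp
qed

inductive trig_poly :: "(real ^ 'n \<Rightarrow> complex) \<Rightarrow> bool" where
  trig_poly_chr: "trig_poly (\<lambda>h. c * chr \<xi> h)"
| trig_poly_add: "trig_poly f \<Longrightarrow> trig_poly g \<Longrightarrow> trig_poly (\<lambda>h. f h + g h)"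

lemma trig_poly_const: "trig_poly (\<lambda>_. c)"
  using trig_poly_chr[of c 0] by simp

lemma trig_poly_sum: "finite I \<Longrightarrow> (\<And>i. i \<in> I \<Longrightarrow> trig_poly (f i)) \<Longrightarrow> trig_poly (\<lambda>h. \<Sum>i\<in>I. f i h)"
  by (induction I rule: finite_induct) (auto intro: trig_poly_const trig_poly_add)

lemma trig_poly_chr_mult: "trig_poly f \<Longrightarrow> trig_poly (\<lambda>h. (c * chr \<xi> h) * f h)"
proof (induction rule: trig_poly.induct)
  case (trig_poly_chr c' \<eta>)
  have "(\<lambda>h. (c * chr \<xi> h) * (c' * chr \<eta> h)) = (\<lambda>h. (c * c') * chr (\<xi> + \<eta>) h)"
    by (simp add: chr_add mult_ac)
  thus ?case using trig_poly.trig_poly_chr by metis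
next
  case (trig_poly_add f g)
  thus ?case by (simp add: ring_distribs trig_poly.trig_poly_add)
qed

lemma trig_poly_mult: "trig_poly f \<Longrightarrow> trig_poly g \<Longrightarrow> trig_poly (\<lambda>h. f h * g h)"
proof (induction rule: trig_poly.induct)
  case (trig_poly_chr c \<xi>)
  thus ?case by (rule trig_poly_chr_mult)
next
  case (trig_poly_add f f')
  thus ?case by (simp add: ring_distribs trig_poly.trig_poly_add)
qed

lemma trig_poly_continuous: "trig_poly f \<Longrightarrow> continuous_on S f"
  by (induction rule: trig_poly.induct) (auto intro!: continuous_intros)

text \<open>Embeds the torus in a vector space, where polynomials are dense by Stone-Weierstrass;
  polynomials in these coordinates pull back to trigonometric polynomials.\<close>

definition torus_map :: "real ^ 'n \<Rightarrow> complex ^ 'n" where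
  "torus_map h = (\<chi> i. ex (of_real (h $ i)))"

lemma ex_axis: "ex (of_real (h $ i)) = chr (axis i 1) h"
proof -
  have "int_vec (axis i 1) = axis i 1" by (simp add: vec_eq_iff axis_def)
  thus ?thesis by (simp add: chr_def inner_axis')
qed

lemma trig_poly_Re_Im:
  "trig_poly (\<lambda>h. of_real (Re (torus_map h $ i)))" "trig_poly (\<lambda>h. of_real (Im (torus_map h $ i)))"
proof -
  let ?e = "axis i 1 :: int ^ 'a"
  have c: "cnj (chr ?e h) = chr (- ?e) h" for h
    unfolding chr_def ex_of_real by (simp add: int_vec_minus cis_cnj)
  have "(\<lambda>h. of_real (Re (torus_map h $ i))) = (\<lambda>h. (1/2) * chr ?e h + (1/2) * chr (- ?e) h)"
    by (simp add: fun_eq_iff torus_map_def ex_axis c[symmetric] complex_eq_iff)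
  thus "trig_poly (\<lambda>h. of_real (Re (torus_map h $ i)))"
    by (simp only:) (intro trig_poly.intros)
  have "(\<lambda>h. of_real (Im (torus_map h $ i))) = (\<lambda>h. (- \<i>/2) * chr ?e h + (\<i>/2) * chr (- ?e) h)"
    by (simp add: fun_eq_iff torus_map_def ex_axis c[symmetric] complex_eq_iff)
  thus "trig_poly (\<lambda>h. of_real (Im (torus_map h $ i)))"
    by (simp only:) (intro trig_poly.intros)
qed

lemma trig_poly_linear:
  fixes f :: "complex ^ 'n \<Rightarrow> real"
  assumes "bounded_linear f"
  shows "trig_poly (\<lambda>h. of_real (f (torus_map h)))"
proof -
  interpret f: bounded_linear f by fact
  have fw: "f w = (\<Sum>i\<in>UNIV. Re (w $ i) * f (axis i 1) + Im (w $ i) * f (axis i \<i>))" for w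
  proof -
    have "w = (\<Sum>i\<in>UNIV. Re (w $ i) *\<^sub>R axis i 1 + Im (w $ i) *\<^sub>R axis i \<i>)"
    proof (subst vec_eq_iff, intro allI)
      fix j
      have "(\<Sum>i\<in>UNIV. Re (w $ i) *\<^sub>R axis i 1 + Im (w $ i) *\<^sub>R axis i \<i>) $ j =
          (\<Sum>i\<in>UNIV. if j = i then Re (w $ i) *\<^sub>R 1 + Im (w $ i) *\<^sub>R \<i> else 0)"
        unfolding sum_component by (intro sum.cong) (auto simp: axis_def)
      also have "\<dots> = w $ j"
        by (simp add: complex_eq_iff)
      finally show "w $ j = (\<Sum>i\<in>UNIV. Re (w $ i) *\<^sub>R axis i 1 + Im (w $ i) *\<^sub>R axis i \<i>) $ j" ..
    qed
    hence "f w = f (\<Sum>i\<in>UNIV. Re (w $ i) *\<^sub>R axis i 1 + Im (w $ i) *\<^sub>R axis i \<i>)" by simp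
    thus ?thesis by (simp add: f.sum f.add f.scaleR)
  qed
  have eq: "(\<lambda>h. complex_of_real (f (torus_map h))) =
      (\<lambda>h. \<Sum>i\<in>UNIV. of_real (Re (torus_map h $ i)) * of_real (f (axis i 1)) +
                    of_real (Im (torus_map h $ i)) * of_real (f (axis i \<i>)))"
    by (intro ext, subst fw) simp
  show ?thesis
    unfolding eq
    by (rule trig_poly_sum[OF finite_class.finite_UNIV trig_poly_add[OF
          trig_poly_mult[OF trig_poly_Re_Im(1) trig_poly_const]
          trig_poly_mult[OF trig_poly_Re_Im(2) trig_poly_const]]])
qed

lemma trig_poly_real_polynomial:
  "real_polynomial_function p \<Longrightarrow> trig_poly (\<lambda>h. of_real (p (torus_map h)))"
  by (induction rule: real_polynomial_function.induct)
     (auto intro: trig_poly_linear trig_poly_const trig_poly_add trig_poly_mult)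

lemma trig_poly_polynomial:
  assumes "polynomial_function p"
  shows "trig_poly (\<lambda>h. p (torus_map h) :: complex)"
proof -
  have "real_polynomial_function (Re \<circ> p)" "real_polynomial_function (Im \<circ> p)"
    using assms unfolding polynomial_function_def by (auto intro: bounded_linear_Re bounded_linear_Im)
  hence "trig_poly (\<lambda>h. of_real ((Re \<circ> p) (torus_map h)) + \<i> * of_real ((Im \<circ> p) (torus_map h)))"
    by (intro trig_poly_add trig_poly_mult trig_poly_const trig_poly_real_polynomial)
  thus ?thesis by (simp add: complex_eq flip: complex_eq)
qed

lemma torus_map_eqD:
  assumes "torus_map h = torus_map h'"
  obtains v where "h' = h + int_vec v"
proof -
  have "\<exists>k::int. h' $ i = h $ i + of_int k" for i
  proof -
    have "ex (of_real (h $ i)) = ex (of_real (h' $ i))"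
      using assms by (simp add: torus_map_def vec_eq_iff)
    hence "cis (2 * pi * (h' $ i - h $ i)) = 1"
      by (simp add: ex_of_real right_diff_distrib flip: cis_divide)
    then obtain k :: int where "2 * pi * (h' $ i - h $ i) = 2 * pi * of_int k"
      by (auto simp: complex_eq_iff sin_cos_eq_iff cos_one_2pi_int mult_ac)
    thus ?thesis by (intro exI[of _ k]) simp
  qed
  then obtain v where "\<And>i. h' $ i = h $ i + of_int (v i)" by metis
  hence "h' = h + int_vec (\<chi> i. v i)" by (simp add: vec_eq_iff)
  thus ?thesis using that by blast
qed

lemma continuous_on_torus_map: "continuous_on S torus_map"
  unfolding torus_map_def[abs_def] ex_def by (intro continuous_intros continuous_on_vec_lambda)

text \<open>A periodic function factors through \<open>torus_map\<close>, hence through a compact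
  image on which polynomial approximation is available.\<close>

lemma trig_poly_dense:
  fixes f :: "real ^ 'n \<Rightarrow> complex"
  assumes f: "continuous_on UNIV f" "lattice_periodic f" and e: "e > 0"
  obtains p where "trig_poly p" "\<And>h. h \<in> cbox 0 1 \<Longrightarrow> norm (f h - p h) < e"
proof -
  let ?C = "cbox 0 1 :: (real ^ 'n) set"
  define T where "T = torus_map ` ?C"
  define g where "g = (\<lambda>w. f (SOME h. torus_map h = w))"
  have g: "g (torus_map h) = f h" for h
  proof -
    define x where "x = (SOME h'. torus_map h' = torus_map h)"
    have "torus_map x = torus_map h"
      unfolding x_def by (rule someI_ex) blast
    then obtain v where "h = x + int_vec v"
      by (rule torus_map_eqD)
    hence "f h = f (x + int_vec v)" by (rule arg_cong)
    also have "\<dots> = f x" using f(2) by (simp only: lattice_periodic_def)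
    finally show ?thesis by (simp only: g_def x_def)
  qed
  have T: "compact T"
    unfolding T_def by (intro compact_continuous_image continuous_on_torus_map compact_cbox)
  \<comment> \<open>Continuity of the factored function: the preimage of a closed set is the image
    under \<open>torus_map\<close> of a closed part of the compact cube, hence compact.\<close>
  have "continuous_on T g"
  proof (subst continuous_on_closed_vimage[OF compact_imp_closed[OF T]], intro allI impI)
    fix C :: "complex set" assume C: "closed C"
    have "g -` C \<inter> T = torus_map ` (f -` C \<inter> ?C)"
      by (auto simp: T_def g)
    moreover have "closed (f -` C \<inter> ?C)"
      using continuous_on_closed_vimage[of ?C f] f(1) C continuous_on_subset by blast
    hence "compact (f -` C \<inter> ?C)"
      by (rule compact_eq_bounded_closed[THEN iffD2, OF conjI, rotated])
         (rule bounded_subset[OF bounded_cbox[of 0 1]], blast)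
    ultimately show "closed (g -` C \<inter> T)"
      by (metis compact_continuous_image compact_imp_closed continuous_on_torus_map)
  qed
  then obtain q where q: "polynomial_function q" "\<And>w. w \<in> T \<Longrightarrow> norm (g w - q w) < e"
    using Stone_Weierstrass_polynomial_function[OF T _ e, of g] by blast
  show ?thesis
    using that[OF trig_poly_polynomial[OF q(1)]] q(2) by (force simp: T_def g)
qed

text \<open>Vanishing coefficients make f orthogonal to all trigonometric polynomials. Approximating
  the conjugate of f by such polynomials shows that the mean of the squared modulus of f is
  arbitrarily small, hence zero.\<close>

lemma fourier_unique:
  fixes f :: "real ^ 'n \<Rightarrow> complex"
  assumes f: "continuous_on UNIV f" "lattice_periodic f"
    and 0: "\<And>\<xi>. torus_mean (\<lambda>h. f h * chr \<xi> h) = 0"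
  shows "f h = 0"
proof -
  let ?C = "cbox 0 1 :: (real ^ 'n) set"
  have cont: "continuous_on ?C f" using f(1) continuous_on_subset by blast
  have trig0: "torus_mean (\<lambda>h. f h * p h) = 0" if "trig_poly p" for p
    using that
  proof (induction rule: trig_poly.induct)
    case (trig_poly_chr c \<xi>)
    have "torus_mean (\<lambda>h. f h * (c * chr \<xi> h)) = torus_mean (\<lambda>h. c * (f h * chr \<xi> h))"
      by (simp add: mult_ac)
    also have "\<dots> = c * torus_mean (\<lambda>h. f h * chr \<xi> h)"
      unfolding torus_mean_def by (rule integral_mult_right)
    finally show ?case using 0 by simp
  next
    case (trig_poly_add p q)
    have "(\<lambda>h. f h * p h) integrable_on ?C" "(\<lambda>h. f h * q h) integrable_on ?C"
      by (intro integrable_continuous continuous_on_mult cont trig_poly_continuous trig_poly_add.hyps)+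
    thus ?case using trig_poly_add by (simp add: torus_mean_def ring_distribs integral_add)
  qed
  obtain B where B: "B > 0" "\<And>h. h \<in> ?C \<Longrightarrow> norm (f h) \<le> B"
    using compact_imp_bounded[OF compact_continuous_image[OF cont compact_cbox]]
    by (auto simp: bounded_pos)
  have int: "(\<lambda>h. f h * cnj (f h)) integrable_on ?C"
    by (intro integrable_continuous continuous_on_mult cont continuous_on_cnj)
  have small: "norm (torus_mean (\<lambda>h. f h * cnj (f h))) \<le> B * e" if e: "e > 0" for e
  proof -
    obtain p where p: "trig_poly p" "\<And>h. h \<in> ?C \<Longrightarrow> norm (cnj (f h) - p h) < e"
      using trig_poly_dense[of "\<lambda>h. cnj (f h)" e] f e
      by (auto simp: lattice_periodic_def intro: continuous_on_cnj)
    have int2: "(\<lambda>h. f h * p h) integrable_on ?C"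
      by (intro integrable_continuous continuous_on_mult cont trig_poly_continuous p)
    have "torus_mean (\<lambda>h. f h * cnj (f h)) = torus_mean (\<lambda>h. f h * cnj (f h)) - torus_mean (\<lambda>h. f h * p h)"
      using trig0[OF p(1)] by simp
    also have "\<dots> = integral ?C (\<lambda>h. f h * (cnj (f h) - p h))"
      unfolding torus_mean_def by (subst integral_diff[OF int int2, symmetric]) (simp add: ring_distribs)
    also have "norm \<dots> \<le> (B * e) * measure lborel ?C"
    proof (rule has_integral_bound)
      have "(\<lambda>h. f h * (cnj (f h) - p h)) integrable_on ?C"
        using integrable_diff[OF int int2] by (simp add: ring_distribs)
      thus "((\<lambda>h. f h * (cnj (f h) - p h)) has_integral integral ?C (\<lambda>h. f h * (cnj (f h) - p h))) ?C"
        by (rule integrable_integral)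
      show "norm (f h * (cnj (f h) - p h)) \<le> B * e" if "h \<in> ?C" for h
        unfolding norm_mult using B(2)[OF that] p(2)[OF that] B(1) by (intro mult_mono) auto
    qed (use B e in auto)
    also have "measure lborel ?C = 1"
      by (auto simp: content_cbox_cart box_eq_empty Basis_vec_def inner_axis)
    finally show ?thesis by simp
  qed
  have "torus_mean (\<lambda>h. f h * cnj (f h)) = 0"
  proof (rule ccontr)
    assume "torus_mean (\<lambda>h. f h * cnj (f h)) \<noteq> 0"
    hence "norm (torus_mean (\<lambda>h. f h * cnj (f h))) > 0" by simp
    thus False
      using small[of "norm (torus_mean (\<lambda>h. f h * cnj (f h))) / (2 * B)"] B(1) by (simp add: field_simps)
  qed
  hence "((\<lambda>h. f h * cnj (f h)) has_integral 0) ?C"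
    using int by (metis integrable_integral torus_mean_def)
  hence "((\<lambda>h. Re (f h * cnj (f h))) has_integral Re 0) ?C"
    by (rule has_integral_Re)
  hence h0: "((\<lambda>h. (norm (f h))\<^sup>2) has_integral 0) ?C"
    by (simp add: complex_mult_cnj cmod_power2)
  have z: "f h = 0" if "h \<in> ?C" for h
  proof -
    have "(norm (f h))\<^sup>2 = 0"
      by (rule has_integral_0_cbox_imp_0[OF _ _ h0 _ that])
         (auto intro!: continuous_intros cont simp: box_ne_empty Basis_vec_def inner_axis)
    thus ?thesis by simp
  qed
  have "f h = f ((\<chi> i. frac (h $ i)) + int_vec (\<chi> i. \<lfloor>h $ i\<rfloor>))"
    by (rule arg_cong[of _ _ f]) (simp add: vec_eq_iff frac_def)
  also have "\<dots> = f (\<chi> i. frac (h $ i))"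
    using f(2) by (simp only: lattice_periodic_def)
  also have "\<dots> = 0"
    by (rule z) (simp add: mem_box_cart less_imp_le frac_lt_1)
  finally show ?thesis .
qed

section \<open>Theta series with weights and their inversion\<close>

lemma qf_add: 
  assumes "transpose A = A"
  shows "qf A (x + y) = qf A x + qf A y + 2 * (x \<bullet> (A *v y))"
proof -
  have "y \<bullet> (A *v x) = x \<bullet> (A *v y)"
    by (metis assms dot_lmul_matrix inner_commute transpose_matrix_vector)
  thus ?thesis
    by (simp add: qf_def matrix_vector_right_distrib inner_add_left inner_add_right)
qed

lemma qf_scaleR: "qf A (c *\<^sub>R x) = c\<^sup>2 * qf A x"
  by (simp add: qf_def matrix_vector_mult_scaleR power2_eq_square)

lemma qf_minus [simp]: "qf A (- x) = qf A x"
  using qf_scaleR[of A "-1" x] by simp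

lemma qf_zero [simp]: "qf A 0 = 0"
  by (simp add: qf_def)

lemma has_field_derivative_ex: "(ex has_field_derivative (2 * of_real pi * \<i> * ex w)) (at w)"
  unfolding ex_def[abs_def] by (auto intro!: derivative_eq_intros)

lemma has_vector_derivative_ex:
  assumes "(g has_vector_derivative g') (at s)"
  shows "((\<lambda>s. ex (g s)) has_vector_derivative (2 * of_real pi * \<i> * g' * ex (g s))) (at s)"
  using field_vector_diff_chain_at[OF assms has_field_derivative_ex]
  by (simp add: o_def mult_ac)

lemma continuous_on_ex [continuous_intros]:
  "continuous_on S f \<Longrightarrow> continuous_on S (\<lambda>x. ex (f x))"
  unfolding ex_def by (intro continuous_intros)

lemma holomorphic_on_ex [holomorphic_intros]:
  "f holomorphic_on S \<Longrightarrow> (\<lambda>x. ex (f x)) holomorphic_on S"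
  unfolding ex_def by (intro holomorphic_intros)

lemma torus_mean_infsum:
  fixes g :: "'v \<Rightarrow> real ^ 'n \<Rightarrow> complex"
  assumes cont: "\<And>v. continuous_on (cbox 0 1) (g v)"
    and bound: "\<And>v h. h \<in> cbox 0 1 \<Longrightarrow> norm (g v h) \<le> M v" and M: "M summable_on UNIV"
  shows "((\<lambda>v. torus_mean (g v)) has_sum torus_mean (\<lambda>h. \<Sum>\<^sub>\<infinity>v. g v h)) UNIV"
proof -
  have int: "g v integrable_on cbox 0 1" for v
    using cont by (rule integrable_continuous)
  have "uniform_limit (cbox 0 1) (\<lambda>X h. \<Sum>v\<in>X. g v h) (\<lambda>h. \<Sum>\<^sub>\<infinity>v. g v h) (finite_subsets_at_top UNIV)"
    using bound M by (intro Weierstrass_m_test_general) auto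
  then obtain I J where IJ: "\<And>X. ((\<lambda>h. \<Sum>v\<in>X. g v h) has_integral I X) (cbox 0 1)"
      "((\<lambda>h. \<Sum>\<^sub>\<infinity>v. g v h) has_integral J) (cbox 0 1)" "(I \<longlongrightarrow> J) (finite_subsets_at_top UNIV)"
    by (rule uniform_limit_integral_cbox) (auto intro!: continuous_on_sum cont)
  have "I X = (\<Sum>v\<in>X. torus_mean (g v))" if "finite X" for X
    using integral_unique[OF IJ(1)[of X]] int that by (simp add: torus_mean_def integral_sum)
  hence "((\<lambda>X. \<Sum>v\<in>X. torus_mean (g v)) \<longlongrightarrow> J) (finite_subsets_at_top UNIV)"
    using IJ(3) by (rule_tac Lim_transform_eventually[OF IJ(3)])
      (auto intro: eventually_finite_subsets_at_top_weakI)
  moreover have "J = torus_mean (\<lambda>h. \<Sum>\<^sub>\<infinity>v. g v h)"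
    using IJ(2) by (simp add: torus_mean_def integral_unique)
  ultimately show ?thesis by (simp add: has_sum_def)
qed

lemma norm_torus_mean_le:
  fixes f :: "real ^ 'n \<Rightarrow> complex"
  assumes "continuous_on (cbox 0 1) f" "\<And>h. h \<in> cbox 0 1 \<Longrightarrow> norm (f h) \<le> B"
  shows "norm (torus_mean f) \<le> B"
proof -
  have "B \<ge> 0"
    by (rule order_trans[OF norm_ge_zero[of "f 0"] assms(2)]) (simp add: mem_box_cart)
  hence "norm (torus_mean f) \<le> B * measure lborel (cbox 0 1 :: (real ^ 'n) set)"
    unfolding torus_mean_def using assms
    by (intro has_integral_bound[OF _ integrable_integral] integrable_continuous) auto
  also have "measure lborel (cbox 0 1 :: (real ^ 'n) set) = 1"
    by (auto simp: content_cbox_cart box_eq_empty Basis_vec_def inner_axis)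
  finally show ?thesis by simp
qed

lemma torus_mean_cmult: "torus_mean (\<lambda>h. c * f h) = c * torus_mean f"
  unfolding torus_mean_def by (rule integral_mult_right)

lemma norm_cube_le: "h \<in> cbox 0 (1 :: real ^ 'n) \<Longrightarrow> norm h \<le> real CARD('n)"
proof -
  assume h: "h \<in> cbox 0 (1 :: real ^ 'n)"
  have "norm h \<le> (\<Sum>i\<in>UNIV. \<bar>h $ i\<bar>)" by (rule norm_le_l1_cart)
  also have "\<dots> \<le> (\<Sum>i\<in>(UNIV::'n set). 1)"
    using h by (intro sum_mono) (auto simp: mem_box_cart)
  finally show ?thesis by simp
qed

lemma Im_neg_inverse: "Im (- 1 / (4 * z)) = Im z / (4 * (norm z)\<^sup>2)"
proof -
  have "- 1 / (4 * z) = (- 1 / 4) * (1 / z)" by simp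
  also have "Im \<dots> = Im z / (4 * (norm z)\<^sup>2)"
    unfolding cmod_power2 by (simp add: Im_divide divide_simps add_eq_0_iff) 
  finally show ?thesis .
qed

text \<open>Quadratic growth covers the constant weight together with everything that two
  differentiations in the shift create, and also the weights B[x].\<close>

definition quad_growth :: "(real ^ 'n \<Rightarrow> complex) \<Rightarrow> bool" where
  "quad_growth p \<longleftrightarrow> (\<exists>C. \<forall>x. norm (p x) \<le> C * (1 + (norm x)\<^sup>2))"

lemma quad_growth_const [simp]: "quad_growth (\<lambda>_. c)"
  unfolding quad_growth_def
  by (rule exI[of _ "norm c"]) (simp add: mult_le_cancel_left1)

lemma quad_growth_add: "quad_growth p \<Longrightarrow> quad_growth q \<Longrightarrow> quad_growth (\<lambda>x. p x + q x)"
  unfolding quad_growth_def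
  by (elim exE, rule_tac x = "C + Ca" in exI)
     (metis (no_types, lifting) add_mono distrib_right norm_triangle_le)

lemma quad_growth_cmult: "quad_growth p \<Longrightarrow> quad_growth (\<lambda>x. c * p x)"
  unfolding quad_growth_def
  by (elim exE, rule_tac x = "norm c * C" in exI) (simp add: norm_mult mult_left_mono mult.assoc)

lemma quad_growth_linear:
  fixes u :: "real ^ 'n"
  shows "quad_growth (\<lambda>x. of_real (x \<bullet> u))"
  unfolding quad_growth_def
proof (intro exI[of _ "norm u"] allI)
  fix x :: "real ^ 'n"
  have "norm x \<le> 1 + (norm x)\<^sup>2"
    using sum_squares_bound[of 1 "norm x"] zero_le_power2[of "norm x"] by (simp, linarith)
  hence "norm x * norm u \<le> (1 + (norm x)\<^sup>2) * norm u" by (intro mult_right_mono) auto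
  thus "norm (complex_of_real (x \<bullet> u)) \<le> norm u * (1 + (norm x)\<^sup>2)"
    using Cauchy_Schwarz_ineq2[of x u] by (simp add: mult.commute)
qed

lemma quad_growth_bilinear:
  fixes u :: "real ^ 'n"
  shows "quad_growth (\<lambda>x. of_real ((x \<bullet> u) * (x \<bullet> w)))"
  unfolding quad_growth_def
proof (intro exI[of _ "norm u * norm w"] allI)
  fix x :: "real ^ 'n"
  have "\<bar>x \<bullet> u\<bar> * \<bar>x \<bullet> w\<bar> \<le> (norm x * norm u) * (norm x * norm w)"
    by (intro mult_mono Cauchy_Schwarz_ineq2) auto
  also have "\<dots> \<le> norm u * norm w * (1 + (norm x)\<^sup>2)"
    by (simp add: power2_eq_square algebra_simps)
  finally show "norm (complex_of_real ((x \<bullet> u) * (x \<bullet> w))) \<le> norm u * norm w * (1 + (norm x)\<^sup>2)"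
    by (simp add: norm_mult)
qed

lemma quad_growth_qf: "quad_growth (\<lambda>x. of_real (qf B x))"
proof -
  obtain b where b: "b \<ge> 0" "\<And>x y. \<bar>x \<bullet> (B *v y)\<bar> \<le> b * norm x * norm y"
    using matrix_bilinear_bound by blast
  have "\<bar>qf B x\<bar> \<le> b * (1 + (norm x)\<^sup>2)" for x
    using b(2)[of x x] b(1) unfolding qf_def by (simp add: power2_eq_square algebra_simps)
  thus ?thesis unfolding quad_growth_def by (intro exI[of _ b]) simp
qed

section \<open>Weighted theta series and their derivatives in the shift\<close>

locale posdef_form =
  fixes A :: "real ^ 'n ^ 'n"
  assumes posdef: "A \<in> Quad_pos"
begin

definition Ai where "Ai = matrix_inv A"

lemma sym: "transpose A = A"
  using posdef by (simp add: Quad_pos_def Quad_def)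

lemma pos: "x \<noteq> 0 \<Longrightarrow> qf A x > 0"
  using posdef by (simp add: Quad_pos_def qf_def)

lemma inner_sym: "y \<bullet> (A *v x) = x \<bullet> (A *v y)"
  by (metis sym dot_lmul_matrix inner_commute transpose_matrix_vector)

lemma A_Ai: "A ** Ai = mat 1" and Ai_A: "Ai ** A = mat 1"
proof -
  have "x = 0" if "A *v x = 0" for x
    using pos[of x] that by (auto simp: qf_def)
  hence "invertible A"
    by (metis invertible_left_inverse matrix_left_invertible_ker)
  thus "A ** Ai = mat 1" "Ai ** A = mat 1"
    unfolding Ai_def matrix_inv_def invertible_def by (metis (mono_tags, lifting) someI_ex)+
qed

lemma A_Ai_vec [simp]: "A *v (Ai *v x) = x" and Ai_A_vec [simp]: "Ai *v (A *v x) = x"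
  by (simp_all add: matrix_vector_mul_assoc A_Ai Ai_A)

lemma Ai_sym: "transpose Ai = Ai"
proof -
  have "transpose Ai ** A = mat 1"
    by (metis A_Ai matrix_transpose_mul sym transpose_mat)
  thus ?thesis
    by (metis A_Ai matrix_mul_assoc matrix_mul_lid matrix_mul_rid)
qed

lemma qf_Ai: "qf Ai x = qf A (Ai *v x)"
  by (simp add: qf_def inner_commute)

lemma Ai_posdef: "Ai \<in> Quad_pos"
proof -
  have "qf Ai x > 0" if "x \<noteq> 0" for x
  proof -
    have "Ai *v x \<noteq> 0" using that by (metis A_Ai_vec matrix_vector_mult_0_right)
    thus ?thesis using pos qf_Ai by metis
  qed
  thus ?thesis using Ai_sym by (simp add: Quad_pos_def Quad_def qf_def)
qed

lemma theta_domination: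
  assumes Y: "Y > 0"
  obtains M where "M summable_on (UNIV :: (int ^ 'n) set)"
    "\<And>v h z. norm h \<le> R \<Longrightarrow> Im z \<ge> Y \<Longrightarrow>
      (1 + (norm (int_vec v + h))\<^sup>2) * norm (ex (of_real (qf A (int_vec v + h)) * z)) \<le> M v"
proof -
  obtain a where a: "a > 0" "\<And>x. qf A x \<ge> a * (norm x)\<^sup>2"
    using Quad_pos_lower_bound[OF posdef] by blast
  obtain M where M: "M summable_on (UNIV :: (int ^ 'n) set)"
    "\<And>v h. norm h \<le> R \<Longrightarrow> (1 + (norm (int_vec v + h))\<^sup>2) *
       exp (- (2 * pi * a * Y) * (norm (int_vec v + h))\<^sup>2 + 0 * norm (int_vec v + h) + 0) \<le> M v"
    using gaussian_domination[of "2 * pi * a * Y" 0 R] a(1) Y by auto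
  have "(1 + (norm (int_vec v + h))\<^sup>2) * norm (ex (of_real (qf A (int_vec v + h)) * z)) \<le> M v"
    if h: "norm h \<le> R" and z: "Im z \<ge> Y" for v h z
  proof -
    have "a * (norm (int_vec v + h))\<^sup>2 * Y \<le> qf A (int_vec v + h) * Im z"
      using a z Y by (intro mult_mono) (auto intro: order_trans[OF _ a(2)])
    hence "norm (ex (of_real (qf A (int_vec v + h)) * z)) \<le> exp (- (2 * pi * a * Y) * (norm (int_vec v + h))\<^sup>2)"
      by (simp add: norm_ex mult_ac)
    hence "(1 + (norm (int_vec v + h))\<^sup>2) * norm (ex (of_real (qf A (int_vec v + h)) * z)) \<le>
        (1 + (norm (int_vec v + h))\<^sup>2) * exp (- (2 * pi * a * Y) * (norm (int_vec v + h))\<^sup>2)"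
      by (intro mult_left_mono) auto
    also have "\<dots> \<le> M v" using M(2)[OF h, of v] by simp
    finally show ?thesis .
  qed
  thus ?thesis using that M(1) by blast
qed

definition wtheta :: "(real ^ 'n \<Rightarrow> complex) \<Rightarrow> real ^ 'n \<Rightarrow> complex \<Rightarrow> complex" where
  "wtheta p h z = (\<Sum>\<^sub>\<infinity>v. p (int_vec v + h) * ex (of_real (qf A (int_vec v + h)) * z))"

lemma wtheta_domination:
  assumes p: "quad_growth p" and Y: "Y > 0"
  obtains M where "M summable_on (UNIV :: (int ^ 'n) set)"
    "\<And>v h z. norm h \<le> R \<Longrightarrow> Im z \<ge> Y \<Longrightarrow>
      norm (p (int_vec v + h) * ex (of_real (qf A (int_vec v + h)) * z)) \<le> M v"
proof -
  obtain M where M: "M summable_on (UNIV :: (int ^ 'n) set)"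
    "\<And>v h z. norm h \<le> R \<Longrightarrow> Im z \<ge> Y \<Longrightarrow>
      (1 + (norm (int_vec v + h))\<^sup>2) * norm (ex (of_real (qf A (int_vec v + h)) * z)) \<le> M v"
    using theta_domination[OF Y] by blast
  obtain C0 where C0: "\<And>x. norm (p x) \<le> C0 * (1 + (norm x)\<^sup>2)"
    using p by (auto simp: quad_growth_def)
  define C where "C = max C0 0"
  have C: "norm (p x) \<le> C * (1 + (norm x)\<^sup>2)" "C \<ge> 0" for x
    using C0[of x] mult_right_mono[of C0 C "1 + (norm x)\<^sup>2"] by (auto simp: C_def)
  have "norm (p (int_vec v + h) * ex (of_real (qf A (int_vec v + h)) * z)) \<le> C * M v"
    if "norm h \<le> R" "Im z \<ge> Y" for v h z
  proof -
    have "norm (p (int_vec v + h) * ex (of_real (qf A (int_vec v + h)) * z)) \<le>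
       (C * (1 + (norm (int_vec v + h))\<^sup>2)) * norm (ex (of_real (qf A (int_vec v + h)) * z))"
      unfolding norm_mult using C by (intro mult_right_mono) auto
    also have "\<dots> \<le> C * M v"
      unfolding mult.assoc using M(2)[OF that] C(2) by (intro mult_left_mono) auto
    finally show ?thesis .
  qed
  moreover have "(\<lambda>v. C * M v) summable_on UNIV"
    using M(1) by (rule summable_on_cmult_right)
  ultimately show ?thesis using that by blast
qed

lemma wtheta_summable:
  assumes p: "quad_growth p" and z: "Im z > 0"
  shows "(\<lambda>v. norm (p (int_vec v + h) * ex (of_real (qf A (int_vec v + h)) * z))) summable_on UNIV"
proof -
  obtain M where "M summable_on (UNIV :: (int ^ 'n) set)"
    "\<And>v h' z'. norm h' \<le> norm h \<Longrightarrow> Im z' \<ge> Im z \<Longrightarrow>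
      norm (p (int_vec v + h') * ex (of_real (qf A (int_vec v + h')) * z')) \<le> M v"
    using wtheta_domination[OF p z] by metis
  thus ?thesis
    by (intro Infinite_Sum.abs_summable_on_comparison_test'[of M]) auto
qed

text \<open>The directional derivative of weight times exponential is another weight
  \<open>r\<close> times the same exponential. If \<open>r\<close> also grows at most quadratically,
  domination passes this from single terms to the series.\<close>

lemma wtheta_shift_deriv:
  assumes p: "quad_growth p" "quad_growth r" and z: "Im z > 0"
    and deriv: "\<And>x s. ((\<lambda>s. p (x + s *\<^sub>R u) * ex (of_real (qf A (x + s *\<^sub>R u)) * z)) has_vector_derivative
        r (x + s *\<^sub>R u) * ex (of_real (qf A (x + s *\<^sub>R u)) * z)) (at s)"
  shows "((\<lambda>s. wtheta p (h + s *\<^sub>R u) z) has_vector_derivative wtheta r h z) (at 0)"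
proof -
  obtain M where M: "M summable_on (UNIV :: (int ^ 'n) set)"
    "\<And>v h' z'. norm h' \<le> norm h + norm u \<Longrightarrow> Im z' \<ge> Im z \<Longrightarrow>
      norm (r (int_vec v + h') * ex (of_real (qf A (int_vec v + h')) * z')) \<le> M v"
    using wtheta_domination[OF p(2) z] by metis
  have nrm: "norm (h + s *\<^sub>R u) \<le> norm h + norm u" if "\<bar>s\<bar> < 1" for s
    using norm_triangle_ineq[of h "s *\<^sub>R u"] that mult_right_mono[of "\<bar>s\<bar>" 1 "norm u"] by simp
  have "((\<lambda>s. \<Sum>\<^sub>\<infinity>v. p (int_vec v + (h + s *\<^sub>R u)) * ex (of_real (qf A (int_vec v + (h + s *\<^sub>R u))) * z))
     has_vector_derivative
     (\<Sum>\<^sub>\<infinity>v. r (int_vec v + (h + 0 *\<^sub>R u)) * ex (of_real (qf A (int_vec v + (h + 0 *\<^sub>R u))) * z))) (at 0)"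
  proof (rule infsum_has_vector_derivative[where M = M and r = 1])
    show "((\<lambda>s. p (int_vec v + (h + s *\<^sub>R u)) * ex (of_real (qf A (int_vec v + (h + s *\<^sub>R u))) * z))
      has_vector_derivative r (int_vec v + (h + s *\<^sub>R u)) * ex (of_real (qf A (int_vec v + (h + s *\<^sub>R u))) * z)) (at s)" for v s
      using deriv[of "int_vec v + h" s] by (simp add: add.assoc)
    show "norm (r (int_vec v + (h + s *\<^sub>R u)) * ex (of_real (qf A (int_vec v + (h + s *\<^sub>R u))) * z)) \<le> M v"
      if "\<bar>s\<bar> < 1" for v s
      by (rule M(2)) (use nrm[OF that] in auto)
    show "(\<lambda>v. p (int_vec v + (h + s *\<^sub>R u)) * ex (of_real (qf A (int_vec v + (h + s *\<^sub>R u))) * z)) summable_on UNIV" for s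
      by (rule abs_summable_summable[OF wtheta_summable[OF p(1) z]])
  qed (use M in auto)
  thus ?thesis by (simp add: wtheta_def)
qed

lemma has_vector_derivative_qf_shift:
  "((\<lambda>s. complex_of_real (qf A (x + s *\<^sub>R u))) has_vector_derivative
     of_real (2 * ((x + s *\<^sub>R u) \<bullet> (A *v u)))) (at s)"
proof -
  have eq: "(\<lambda>s. complex_of_real (qf A (x + s *\<^sub>R u))) =
     (\<lambda>s. of_real (qf A x + s\<^sup>2 * qf A u + 2 * s * (x \<bullet> (A *v u))))"
    by (simp add: qf_add[OF sym] qf_scaleR matrix_vector_mult_scaleR mult_ac)
  have "((\<lambda>s. qf A x + s\<^sup>2 * qf A u + 2 * s * (x \<bullet> (A *v u))) has_real_derivative
     2 * ((x + s *\<^sub>R u) \<bullet> (A *v u))) (at s)"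
    by (auto intro!: derivative_eq_intros simp: inner_add_left qf_def)
  thus ?thesis
    unfolding eq by (intro has_vector_derivative_of_real) (simp add: has_real_derivative_iff_has_vector_derivative)
qed

lemma wtheta_deriv1:
  assumes z: "Im z > 0"
  shows "((\<lambda>s. wtheta (\<lambda>_. 1) (h + s *\<^sub>R u) z) has_vector_derivative
     4 * of_real pi * \<i> * z * wtheta (\<lambda>x. of_real (x \<bullet> (A *v u))) h z) (at 0)"
proof -
  have "((\<lambda>s. wtheta (\<lambda>_. 1) (h + s *\<^sub>R u) z) has_vector_derivative
     wtheta (\<lambda>x. (4 * of_real pi * \<i> * z) * of_real (x \<bullet> (A *v u))) h z) (at 0)"
  proof (rule wtheta_shift_deriv[OF _ _ z])
    fix x s
    show "((\<lambda>s. 1 * ex (complex_of_real (qf A (x + s *\<^sub>R u)) * z)) has_vector_derivative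
      4 * complex_of_real pi * \<i> * z * complex_of_real ((x + s *\<^sub>R u) \<bullet> (A *v u)) * ex (of_real (qf A (x + s *\<^sub>R u)) * z)) (at s)"
      by (rule has_vector_derivative_eq_rhs[OF _ ], simp only: mult_1,
          rule has_vector_derivative_ex[OF has_vector_derivative_mult_left[OF has_vector_derivative_qf_shift]])
         (simp add: mult_ac)
  qed (auto intro: quad_growth_cmult quad_growth_linear)
  thus ?thesis by (simp add: wtheta_def infsum_cmult_right' mult.assoc)
qed

lemma wtheta_deriv2:
  assumes z: "Im z > 0"
  shows "((\<lambda>s. wtheta (\<lambda>x. of_real (x \<bullet> (A *v w))) (h + s *\<^sub>R u) z) has_vector_derivative
     of_real (u \<bullet> (A *v w)) * wtheta (\<lambda>_. 1) h z +
     4 * of_real pi * \<i> * z * wtheta (\<lambda>x. of_real ((x \<bullet> (A *v w)) * (x \<bullet> (A *v u)))) h z) (at 0)"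
proof -
  let ?r = "\<lambda>x. of_real (u \<bullet> (A *v w)) + (4 * of_real pi * \<i> * z) * of_real ((x \<bullet> (A *v w)) * (x \<bullet> (A *v u)))"
  have "((\<lambda>s. wtheta (\<lambda>x. of_real (x \<bullet> (A *v w))) (h + s *\<^sub>R u) z) has_vector_derivative wtheta ?r h z) (at 0)"
  proof (rule wtheta_shift_deriv[OF _ _ z])
    fix x s
    have "((\<lambda>s. complex_of_real ((x + s *\<^sub>R u) \<bullet> (A *v w))) has_vector_derivative of_real (u \<bullet> (A *v w))) (at s)"
      unfolding inner_add_left inner_scaleR_left by (auto intro!: derivative_eq_intros)
    from has_vector_derivative_mult[OF this
        has_vector_derivative_ex[OF has_vector_derivative_mult_left[OF has_vector_derivative_qf_shift]]]
    show "((\<lambda>s. complex_of_real ((x + s *\<^sub>R u) \<bullet> (A *v w)) * ex (complex_of_real (qf A (x + s *\<^sub>R u)) * z)) has_vector_derivative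
      ?r (x + s *\<^sub>R u) * ex (of_real (qf A (x + s *\<^sub>R u)) * z)) (at s)"
      by (rule has_vector_derivative_eq_rhs) (simp add: algebra_simps)
  qed (intro quad_growth_add quad_growth_const quad_growth_cmult quad_growth_linear quad_growth_bilinear)+
  moreover have "wtheta ?r h z = of_real (u \<bullet> (A *v w)) * wtheta (\<lambda>_. 1) h z +
     4 * of_real pi * \<i> * z * wtheta (\<lambda>x. of_real ((x \<bullet> (A *v w)) * (x \<bullet> (A *v u)))) h z"
  proof -
    note s = abs_summable_summable[OF wtheta_summable[OF _ z]]
    have "wtheta ?r h z = (\<Sum>\<^sub>\<infinity>v. of_real (u \<bullet> (A *v w)) * (1 * ex (of_real (qf A (int_vec v + h)) * z)) +
      (4 * of_real pi * \<i> * z) * (of_real (((int_vec v + h) \<bullet> (A *v w)) * ((int_vec v + h) \<bullet> (A *v u))) *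
          ex (of_real (qf A (int_vec v + h)) * z)))"
      unfolding wtheta_def by (intro infsum_cong) (simp add: algebra_simps)
    also have "\<dots> = (\<Sum>\<^sub>\<infinity>v. of_real (u \<bullet> (A *v w)) * (1 * ex (of_real (qf A (int_vec v + h)) * z))) +
      (\<Sum>\<^sub>\<infinity>v. (4 * of_real pi * \<i> * z) * (of_real (((int_vec v + h) \<bullet> (A *v w)) * ((int_vec v + h) \<bullet> (A *v u))) *
          ex (of_real (qf A (int_vec v + h)) * z)))"
      by (intro infsum_add summable_on_cmult_right s quad_growth_const quad_growth_bilinear)
    finally show ?thesis by (simp only: infsum_cmult_right' wtheta_def)
  qed
  ultimately show ?thesis by simp
qed

end

text \<open>The 4 is due to the normalisation exp (2 pi i A[x] z), with A[x] and not A[x] / 2: the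
  Fourier transform of this Gaussian has exponent \<open>A\<^sup>-\<^sup>1[\<xi>]\<close> at - 1 /
  (4 z).\<close>

definition dual_pt :: "complex \<Rightarrow> complex" where
  "dual_pt z = - 1 / (4 * z)"

lemma Im_dual_pt: "Im (dual_pt z) = Im z / (4 * (norm z)\<^sup>2)"
  unfolding dual_pt_def by (rule Im_neg_inverse)

lemma Im_dual_pos: "Im z > 0 \<Longrightarrow> Im (dual_pt z) > 0"
  unfolding Im_dual_pt by (intro divide_pos_pos mult_pos_pos zero_less_power) auto

section \<open>The dual series and Poisson summation\<close>

context posdef_form
begin

definition wdual :: "(real ^ 'n \<Rightarrow> complex) \<Rightarrow> real ^ 'n \<Rightarrow> complex \<Rightarrow> complex" where
  "wdual p h z = (\<Sum>\<^sub>\<infinity>\<xi>. p (int_vec \<xi>) * ex (of_real (qf Ai (int_vec \<xi>)) * dual_pt z) * chr \<xi> h)"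

lemma dual_form: "posdef_form Ai"
  by unfold_locales (rule Ai_posdef)

lemma dual_domination:
  assumes p: "quad_growth p" and Y: "Y > 0"
  obtains M where "M summable_on (UNIV :: (int ^ 'n) set)"
    "\<And>\<xi> z h. Im (dual_pt z) \<ge> Y \<Longrightarrow>
      norm (p (int_vec \<xi>) * ex (of_real (qf Ai (int_vec \<xi>)) * dual_pt z) * chr \<xi> h) \<le> M \<xi>"
proof -
  obtain M where M: "M summable_on (UNIV :: (int ^ 'n) set)"
    "\<And>v h z. norm h \<le> 0 \<Longrightarrow> Im z \<ge> Y \<Longrightarrow>
      norm (p (int_vec v + h) * ex (of_real (qf Ai (int_vec v + h)) * z)) \<le> M v"
    using posdef_form.wtheta_domination[OF dual_form p Y] by metis
  show ?thesis
    by (rule that[OF M(1)]) (use M(2)[of 0] in \<open>simp add: norm_mult\<close>)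
qed

lemma wdual_summable:
  assumes p: "quad_growth p" and z: "Im z > 0"
  shows "(\<lambda>\<xi>. p (int_vec \<xi>) * ex (of_real (qf Ai (int_vec \<xi>)) * dual_pt z) * chr \<xi> h) summable_on UNIV"
proof -
  obtain M where M: "M summable_on (UNIV :: (int ^ 'n) set)"
    "\<And>\<xi> z' h. Im (dual_pt z') \<ge> Im (dual_pt z) \<Longrightarrow>
      norm (p (int_vec \<xi>) * ex (of_real (qf Ai (int_vec \<xi>)) * dual_pt z') * chr \<xi> h) \<le> M \<xi>"
    using dual_domination[OF p Im_dual_pos[OF z]] by metis
  show ?thesis
    by (rule abs_summable_summable[OF Infinite_Sum.abs_summable_on_comparison_test'[OF M(1) M(2)[OF order_refl]]])
qed

lemma wdual_deriv:
  assumes p: "quad_growth p" "quad_growth (\<lambda>x. p x * of_real (x \<bullet> u))" and z: "Im z > 0"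
  shows "((\<lambda>s. wdual p (h + s *\<^sub>R u) z) has_vector_derivative
     2 * of_real pi * \<i> * wdual (\<lambda>x. p x * of_real (x \<bullet> u)) h z) (at 0)"
proof -
  let ?c = "\<lambda>\<xi>. ex (of_real (qf Ai (int_vec \<xi>)) * dual_pt z)"
  obtain M where M: "M summable_on (UNIV :: (int ^ 'n) set)"
    "\<And>\<xi> z' h. Im (dual_pt z') \<ge> Im (dual_pt z) \<Longrightarrow>
      norm (((p (int_vec \<xi>) * of_real (int_vec \<xi> \<bullet> u)) * ex (of_real (qf Ai (int_vec \<xi>)) * dual_pt z') * chr \<xi> h)) \<le> M \<xi>"
    using dual_domination[OF p(2) Im_dual_pos[OF z]] by metis
  have "((\<lambda>s. \<Sum>\<^sub>\<infinity>\<xi>. p (int_vec \<xi>) * ?c \<xi> * chr \<xi> (h + s *\<^sub>R u)) has_vector_derivative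
     (\<Sum>\<^sub>\<infinity>\<xi>. 2 * of_real pi * \<i> * ((p (int_vec \<xi>) * of_real (int_vec \<xi> \<bullet> u)) * ?c \<xi> * chr \<xi> (h + 0 *\<^sub>R u)))) (at 0)"
  proof (rule infsum_has_vector_derivative[where M = "\<lambda>\<xi>. 2 * pi * M \<xi>" and r = 1])
    fix \<xi> s
    have "((\<lambda>s. of_real (int_vec \<xi> \<bullet> (h + s *\<^sub>R u)) :: complex) has_vector_derivative of_real (int_vec \<xi> \<bullet> u)) (at s)"
      unfolding inner_add_right inner_scaleR_right by (auto intro!: derivative_eq_intros)
    from has_vector_derivative_mult_right[OF has_vector_derivative_ex[OF this], of "p (int_vec \<xi>) * ?c \<xi>"]
    show "((\<lambda>s. p (int_vec \<xi>) * ?c \<xi> * chr \<xi> (h + s *\<^sub>R u)) has_vector_derivative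
        2 * of_real pi * \<i> * ((p (int_vec \<xi>) * of_real (int_vec \<xi> \<bullet> u)) * ?c \<xi> * chr \<xi> (h + s *\<^sub>R u))) (at s)"
      unfolding chr_def by (rule has_vector_derivative_eq_rhs) (simp add: mult_ac)
    show "norm (2 * of_real pi * \<i> * ((p (int_vec \<xi>) * of_real (int_vec \<xi> \<bullet> u)) * ?c \<xi> * chr \<xi> (h + s *\<^sub>R u))) \<le> 2 * pi * M \<xi>"
      using M(2)[of z \<xi> "h + s *\<^sub>R u"] by (simp add: norm_mult)
  qed (use M(1) in \<open>auto intro!: summable_on_cmult_right wdual_summable[OF p(1) z]\<close>)
  thus ?thesis by (simp add: wdual_def infsum_cmult_right')
qed

text \<open>The zeroth Fourier coefficient of the shifted theta series, in other words the integral
  of the Gaussian over the whole space.\<close>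

definition theta_mean :: "complex \<Rightarrow> complex" where
  "theta_mean z = torus_mean (\<lambda>h. wtheta (\<lambda>_. 1) h z)"

lemma continuous_on_qf: "continuous_on S (qf B)"
  unfolding qf_def[abs_def]
  by (intro continuous_intros linear_continuous_on) (simp add: linear_linear)

lemma lattice_periodic_wtheta: "lattice_periodic (\<lambda>h. wtheta p h z)"
  unfolding lattice_periodic_def
proof (intro allI)
  fix h v
  have "wtheta p (h + int_vec v) z =
      (\<Sum>\<^sub>\<infinity>w. p (int_vec (w + v) + h) * ex (of_real (qf A (int_vec (w + v) + h)) * z))"
    unfolding wtheta_def by (simp add: int_vec_add add_ac)
  also have "\<dots> = wtheta p h z"
    unfolding wtheta_def
    by (rule infsum_reindex_bij_witness[of _ "\<lambda>w. w - v" "\<lambda>w. w + v"]) auto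
  finally show "wtheta p (h + int_vec v) z = wtheta p h z" .
qed

lemma continuous_wtheta:
  assumes z: "Im z > 0"
  shows "continuous_on UNIV (\<lambda>h. wtheta (\<lambda>_. 1) h z)"
proof -
  have "continuous_on (ball 0 R) (\<lambda>h. wtheta (\<lambda>_. 1) h z)" for R
  proof -
    obtain M where M: "M summable_on (UNIV :: (int ^ 'n) set)"
      "\<And>v h z'. norm h \<le> R \<Longrightarrow> Im z' \<ge> Im z \<Longrightarrow>
        norm (1 * ex (of_real (qf A (int_vec v + h)) * z')) \<le> M v"
      using wtheta_domination[OF quad_growth_const z] by metis
    have "uniform_limit (ball 0 R) (\<lambda>X h. \<Sum>v\<in>X. 1 * ex (of_real (qf A (int_vec v + h)) * z))
        (\<lambda>h. wtheta (\<lambda>_. 1) h z) (finite_subsets_at_top UNIV)"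
      unfolding wtheta_def using M by (intro Weierstrass_m_test_general) auto
    thus ?thesis
      by (rule uniform_limit_theorem[rotated])
         (auto intro!: always_eventually continuous_intros continuous_on_compose2[OF continuous_on_qf])
  qed
  moreover have "h \<in> ball 0 (norm h + 1)" for h :: "real ^ 'n" by simp
  ultimately show ?thesis
    by (metis continuous_on_eq_continuous_at iso_tuple_UNIV_I open_UNIV open_ball)
qed

lemma continuous_wdual:
  assumes p: "quad_growth p" and z: "Im z > 0"
  shows "continuous_on S (\<lambda>h. wdual p h z)"
proof -
  obtain M where M: "M summable_on (UNIV :: (int ^ 'n) set)"
    "\<And>\<xi> z' h. Im (dual_pt z') \<ge> Im (dual_pt z) \<Longrightarrow>
      norm (p (int_vec \<xi>) * ex (of_real (qf Ai (int_vec \<xi>)) * dual_pt z') * chr \<xi> h) \<le> M \<xi>"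
    using dual_domination[OF p Im_dual_pos[OF z]] by metis
  have "uniform_limit S (\<lambda>X h. \<Sum>\<xi>\<in>X. p (int_vec \<xi>) * ex (of_real (qf Ai (int_vec \<xi>)) * dual_pt z) * chr \<xi> h)
      (\<lambda>h. wdual p h z) (finite_subsets_at_top UNIV)"
    unfolding wdual_def using M by (intro Weierstrass_m_test_general) auto
  thus ?thesis
    by (rule uniform_limit_theorem[rotated]) (auto intro!: always_eventually continuous_intros)
qed

lemma torus_mean_wdual:
  assumes z: "Im z > 0"
  shows "torus_mean (\<lambda>h. wdual (\<lambda>_. 1) h z * chr \<eta> h) = ex (of_real (qf Ai (int_vec \<eta>)) * dual_pt z)"
proof -
  let ?c = "\<lambda>\<xi>. ex (of_real (qf Ai (int_vec \<xi>)) * dual_pt z)"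
  obtain M where M: "M summable_on (UNIV :: (int ^ 'n) set)"
    "\<And>\<xi> z' h. Im (dual_pt z') \<ge> Im (dual_pt z) \<Longrightarrow>
      norm (1 * ex (of_real (qf Ai (int_vec \<xi>)) * dual_pt z') * chr \<xi> h) \<le> M \<xi>"
    using dual_domination[OF quad_growth_const Im_dual_pos[OF z]] by metis
  have "torus_mean (\<lambda>h. wdual (\<lambda>_. 1) h z * chr \<eta> h) =
      torus_mean (\<lambda>h. \<Sum>\<^sub>\<infinity>\<xi>. ?c \<xi> * chr (\<xi> + \<eta>) h)"
    unfolding wdual_def by (simp add: chr_add infsum_cmult_left' flip: mult.assoc)
  also have "\<dots> = (\<Sum>\<^sub>\<infinity>\<xi>. torus_mean (\<lambda>h. ?c \<xi> * chr (\<xi> + \<eta>) h))"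
    by (rule infsumI[OF torus_mean_infsum[where M = M], symmetric])
       (use M(1) M(2)[of z] in \<open>auto intro!: continuous_intros simp: norm_mult\<close>)
  also have "\<dots> = (\<Sum>\<^sub>\<infinity>\<xi>. if \<xi> = - \<eta> then ?c (- \<eta>) else 0)"
    by (intro infsum_cong) (simp add: torus_mean_cmult torus_mean_chr eq_neg_iff_add_eq_0[symmetric])
  also have "\<dots> = (\<Sum>\<^sub>\<infinity>\<xi>\<in>{- \<eta>}. ?c (- \<eta>))"
    by (intro infsum_cong_neutral) auto
  also have "\<dots> = ?c \<eta>" by (simp add: int_vec_minus)
  finally show ?thesis .
qed

text \<open>
  Shifting \<open>h\<close> by \<open>s u\<close>, where \<open>u = A\<^sup>-\<^sup>1 \<xi>\<close>, does not change the mean for real \<open>s\<close>. As a function of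
  complex \<open>s\<close> the mean of the shifted summands is entire, hence constant, and at \<open>s = 1 / (2 z)\<close> the
  term linear in \<open>s\<close> cancels the character.
\<close>

lemma fourier_coefficient_wtheta:
  assumes z: "Im z > 0"
  shows "torus_mean (\<lambda>h. wtheta (\<lambda>_. 1) h z * chr (- \<xi>) h) =
    theta_mean z * ex (of_real (qf Ai (int_vec \<xi>)) * dual_pt z)"
proof -
  define u where "u = Ai *v int_vec \<xi>"
  have Au: "A *v u = int_vec \<xi>" by (simp add: u_def)
  define q where "q = qf A u"
  have q: "int_vec \<xi> \<bullet> u = q" "qf Ai (int_vec \<xi>) = q"
    by (simp_all add: q_def qf_def Au inner_commute u_def)
  \<comment> \<open>For real s this is the exponent at the argument shifted by s u, combined with
    the factor that the character picks up; written as a polynomial in s it extends to complex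
    s.\<close>
  define E where "E = (\<lambda>v s h. z * (of_real (qf A (int_vec v + h)) + 2 * s * of_real ((int_vec v + h) \<bullet> int_vec \<xi>)
       + s\<^sup>2 * of_real q) - s * of_real q)"
  define \<phi> where "\<phi> = (\<lambda>v s h. ex (E v s h) * chr (- \<xi>) h)"
  define \<Phi> where "\<Phi> = (\<lambda>s. \<Sum>\<^sub>\<infinity>v. torus_mean (\<phi> v s))"
  have cont: "continuous_on S (\<phi> v s)" for v s S
    unfolding \<phi>_def E_def by (intro continuous_intros continuous_on_compose2[OF continuous_on_qf]) auto
  \<comment> \<open>The terms that involve s grow at most linearly in the norm of v + h, so for
    bounded complex s the Gaussian still dominates.\<close>
  have bound: "\<exists>M. M summable_on (UNIV :: (int ^ 'n) set) \<and>
     (\<forall>v s h. norm s \<le> S \<longrightarrow> h \<in> cbox 0 1 \<longrightarrow> norm (\<phi> v s h) \<le> M v)" if S: "S \<ge> 0" for S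
  proof -
    obtain a where a: "a > 0" "\<And>x. qf A x \<ge> a * (norm x)\<^sup>2"
      using Quad_pos_lower_bound[OF posdef] by blast
    define K where "K = 2 * pi * (2 * norm z * S * norm (int_vec \<xi>) + norm z * S\<^sup>2 * \<bar>q\<bar> + S * \<bar>q\<bar>)"
    have K: "K \<ge> 0" using S by (simp add: K_def)
    obtain M where M: "M summable_on (UNIV :: (int ^ 'n) set)"
      "\<And>v h. norm h \<le> real CARD('n) \<Longrightarrow> (1 + (norm (int_vec v + h))\<^sup>2) *
         exp (- (2 * pi * a * Im z) * (norm (int_vec v + h))\<^sup>2 + K * norm (int_vec v + h) + K) \<le> M v"
      using gaussian_domination[of "2 * pi * a * Im z" K "real CARD('n)"] a(1) z K by auto
    have "norm (\<phi> v s h) \<le> M v" if s: "norm s \<le> S" and h: "h \<in> cbox 0 1" for v s h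
    proof -
      define x where "x = int_vec v + h"
      define w where "w = z * (2 * s * of_real (x \<bullet> int_vec \<xi>) + s\<^sup>2 * of_real q) - s * of_real q"
      have "E v s h = z * of_real (qf A x) + w"
        by (simp add: E_def x_def w_def algebra_simps)
      hence "norm (\<phi> v s h) = exp (- (2 * pi) * Im z * qf A x + - (2 * pi) * Im w)"
        by (simp add: \<phi>_def norm_mult norm_ex algebra_simps)
      also have "\<dots> \<le> exp (- (2 * pi * a * Im z) * (norm x)\<^sup>2 + (K * norm x + K))"
      proof (intro exp_le_cancel_iff[THEN iffD2] add_mono)
        show "- (2 * pi) * Im z * qf A x \<le> - (2 * pi * a * Im z) * (norm x)\<^sup>2"
          using mult_left_mono[OF a(2)[of x], of "2 * pi * Im z"] z by (simp add: mult_ac)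
        have "\<bar>x \<bullet> int_vec \<xi>\<bar> \<le> norm x * norm (int_vec \<xi>)" by (rule Cauchy_Schwarz_ineq2)
        hence "norm w \<le> norm z * (2 * S * (norm x * norm (int_vec \<xi>)) + S\<^sup>2 * \<bar>q\<bar>) + S * \<bar>q\<bar>"
          unfolding w_def using s S
          by (intro norm_triangle_le_diff add_mono order_trans[OF norm_mult_ineq] mult_mono
              order_trans[OF norm_triangle_ineq]) (auto simp: norm_power power_mono intro: mult_mono)
        hence "2 * pi * norm w \<le> 2 * pi * (norm z * (2 * S * (norm x * norm (int_vec \<xi>)) + S\<^sup>2 * \<bar>q\<bar>) + S * \<bar>q\<bar>)"
          by (intro mult_left_mono) auto
        also have "\<dots> \<le> K * norm x + K"
        proof -
          have "0 \<le> 2 * pi * (norm z * S\<^sup>2 * \<bar>q\<bar> + S * \<bar>q\<bar>) * norm x"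
               "0 \<le> 2 * pi * (2 * norm z * S * norm (int_vec \<xi>))"
            using S by auto
          thus ?thesis by (simp add: K_def algebra_simps)
        qed
        finally have "2 * pi * norm w \<le> K * norm x + K" .
        moreover have "- (2 * pi) * Im w \<le> 2 * pi * norm w"
          using abs_Im_le_cmod[of w] mult_left_mono[of "- Im w" "norm w" "2 * pi"] by simp
        ultimately show "- (2 * pi) * Im w \<le> K * norm x + K" by linarith
      qed
      also have "\<dots> \<le> (1 + (norm x)\<^sup>2) * exp (- (2 * pi * a * Im z) * (norm x)\<^sup>2 + K * norm x + K)"
        unfolding add.assoc by (simp add: mult_le_cancel_right1)
      also have "\<dots> \<le> M v" unfolding x_def by (rule M(2)[OF norm_cube_le[OF h]])
      finally show ?thesis .
    qed
    thus ?thesis using M(1) by blast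
  qed
  have hol: "(\<lambda>s. torus_mean (\<phi> v s)) holomorphic_on UNIV" for v
    unfolding torus_mean_def
  proof (rule leibniz_rule_holomorphic)
    fix s h
    let ?d = "z * (2 * of_real ((int_vec v + h) \<bullet> int_vec \<xi>) + 2 * s * of_real q) - of_real q"
    have "((\<lambda>s. E v s h) has_field_derivative ?d) (at s)"
      unfolding E_def by (auto intro!: derivative_eq_intros)
    from DERIV_cmult_right[OF DERIV_chain2[OF has_field_derivative_ex this], of "chr (- \<xi>) h"]
    show "((\<lambda>s. \<phi> v s h) has_field_derivative
       2 * of_real pi * \<i> * ex (E v s h) * ?d * chr (- \<xi>) h) (at s within UNIV)"
      by (simp add: \<phi>_def)
  next
    show "\<phi> v s integrable_on cbox 0 1" for s
      by (intro integrable_continuous cont)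
  next
    show "continuous_on (UNIV \<times> cbox 0 1) (\<lambda>(s, h). 2 * of_real pi * \<i> * ex (E v s h) *
        (z * (2 * of_real ((int_vec v + h) \<bullet> int_vec \<xi>) + 2 * s * of_real q) - of_real q) * chr (- \<xi>) h)"
      unfolding E_def case_prod_unfold
      by (intro continuous_intros continuous_on_compose2[OF continuous_on_qf]
           continuous_on_compose2[OF continuous_on_chr[of UNIV]]) auto
  qed auto
  have "\<Phi> holomorphic_on UNIV"
    unfolding \<Phi>_def
  proof (rule infsum_holomorphic[OF open_UNIV hol])
    fix s0 :: complex
    obtain M where M: "M summable_on (UNIV :: (int ^ 'n) set)"
      "\<And>v s h. norm s \<le> norm s0 + 1 \<Longrightarrow> h \<in> cbox 0 1 \<Longrightarrow> norm (\<phi> v s h) \<le> M v"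
      using bound[of "norm s0 + 1"] by auto
    have "norm (torus_mean (\<phi> v s)) \<le> M v" if "s \<in> cball s0 1" for v s
    proof (rule norm_torus_mean_le[OF cont])
      have "norm s \<le> norm s0 + 1"
        using that norm_triangle_sub[of s s0] by (simp add: dist_norm norm_minus_commute)
      thus "norm (\<phi> v s h) \<le> M v" if "h \<in> cbox 0 1" for h using M(2) that by blast
    qed
    thus "\<exists>r>0. \<exists>M. M summable_on UNIV \<and> cball s0 r \<subseteq> UNIV \<and> (\<forall>v. \<forall>w\<in>cball s0 r. norm (torus_mean (\<phi> v w)) \<le> M v)"
      using M(1) by (intro exI[of _ 1] conjI exI[of _ M]) auto
  qed
  moreover have real: "\<Phi> (of_real s) = torus_mean (\<lambda>h. wtheta (\<lambda>_. 1) h z * chr (- \<xi>) h)" for s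
  proof -
    obtain M where M: "M summable_on (UNIV :: (int ^ 'n) set)"
      "\<And>v s' h. norm s' \<le> \<bar>s\<bar> \<Longrightarrow> h \<in> cbox 0 1 \<Longrightarrow> norm (\<phi> v s' h) \<le> M v"
      using bound[of "\<bar>s\<bar>"] by auto
    let ?g = "\<lambda>h. wtheta (\<lambda>_. 1) h z * chr (- \<xi>) h"
    have eq: "\<phi> v (of_real s) h = ex (of_real (qf A (int_vec v + (h + s *\<^sub>R u))) * z) * chr (- \<xi>) (h + s *\<^sub>R u)" for v h
    proof -
      have "qf A (int_vec v + (h + s *\<^sub>R u)) = qf A (int_vec v + h) + s\<^sup>2 * q + 2 * (s * ((int_vec v + h) \<bullet> int_vec \<xi>))"
        unfolding add.assoc[symmetric]
        by (subst qf_add[OF sym]) (simp add: qf_scaleR q_def matrix_vector_mult_scaleR Au)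
      moreover have "chr (- \<xi>) (s *\<^sub>R u) = ex (- of_real s * of_real q)"
        by (simp add: chr_def int_vec_minus q)
      ultimately show ?thesis
        unfolding \<phi>_def chr_shift mult.assoc[symmetric]
        by (simp add: E_def mult_ac flip: ex_add) (simp add: algebra_simps)
    qed
    have "\<Phi> (of_real s) = torus_mean (\<lambda>h. \<Sum>\<^sub>\<infinity>v. \<phi> v (of_real s) h)"
      unfolding \<Phi>_def
      by (rule infsumI[OF torus_mean_infsum[where M = M]]) (use M in \<open>auto intro: cont\<close>)
    also have "\<dots> = torus_mean (\<lambda>h. ?g (h + s *\<^sub>R u))"
      unfolding wtheta_def eq by (simp add: infsum_cmult_left')
    also have "\<dots> = torus_mean ?g"
    proof (rule torus_mean_shift)
      show "continuous_on UNIV ?g" by (intro continuous_intros continuous_wtheta z)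
      show "lattice_periodic ?g"
        using lattice_periodic_wtheta[of "\<lambda>_. 1" z] lattice_periodic_chr[of "- \<xi>"]
        unfolding lattice_periodic_def by simp
    qed
    finally show ?thesis .
  qed
  ultimately have const: "\<Phi> s = \<Phi> 0" for s
  proof -
    assume hol: "\<Phi> holomorphic_on UNIV"
    have "\<Phi> s - \<Phi> 0 = 0"
    proof (rule analytic_continuation[of "\<lambda>s. \<Phi> s - \<Phi> 0" UNIV "range of_real" 0])
      show "(0 :: complex) islimpt range of_real"
        unfolding islimpt_approachable
      proof (intro allI impI)
        fix e :: real assume "e > 0"
        thus "\<exists>x'\<in>range complex_of_real. x' \<noteq> 0 \<and> dist x' 0 < e"
          by (intro bexI[of _ "of_real (e/2)"] rangeI) auto
      qed
    qed (use hol real[of 0] real in \<open>auto intro!: holomorphic_intros\<close>)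
    thus ?thesis by simp
  qed
  have "torus_mean (\<lambda>h. wtheta (\<lambda>_. 1) h z * chr (- \<xi>) h) = \<Phi> (1 / (2 * z))"
    using real[of 0] const[of "1 / (2 * z)"] by simp
  also have "\<Phi> (1 / (2 * z)) = (\<Sum>\<^sub>\<infinity>v. torus_mean (\<lambda>h. ex (of_real q * dual_pt z) * ex (of_real (qf A (int_vec v + h)) * z)))"
    unfolding \<Phi>_def
  proof (intro infsum_cong arg_cong[of _ _ torus_mean] ext)
    fix v h
    have z0: "z \<noteq> 0" using z by auto
    \<comment> \<open>Of the linear term, the part with v is an integer and the part with h is the
      character; q / (4 z) - q / (2 z) leaves the exponent at the dual point.\<close>
    have e: "E v (1 / (2 * z)) h = of_real (qf A (int_vec v + h)) * z +
       of_real (int_vec v \<bullet> int_vec \<xi>) + of_real (int_vec \<xi> \<bullet> h) + of_real q * dual_pt z"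
      using z0 by (simp add: E_def dual_pt_def inner_add_left inner_commute[of h] field_simps power2_eq_square)
    have i: "ex (of_real (int_vec v \<bullet> int_vec \<xi>)) = 1"
      using chr_int_vec[of v \<xi>] by (simp add: chr_def)
    have "chr \<xi> h * chr (- \<xi>) h = 1" using chr_minus[of \<xi> h] by (simp add: mult.commute)
    thus "\<phi> v (1 / (2 * z)) h = ex (of_real q * dual_pt z) * ex (of_real (qf A (int_vec v + h)) * z)"
      unfolding \<phi>_def e ex_add i unfolding chr_def[symmetric] by (simp add: mult_ac)
  qed
  also have "\<dots> = ex (of_real q * dual_pt z) * (\<Sum>\<^sub>\<infinity>v. torus_mean (\<lambda>h. ex (of_real (qf A (int_vec v + h)) * z)))"
    by (simp add: torus_mean_cmult infsum_cmult_right')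
  also have "(\<Sum>\<^sub>\<infinity>v. torus_mean (\<lambda>h. ex (of_real (qf A (int_vec v + h)) * z))) = theta_mean z"
  proof -
    obtain M where M: "M summable_on (UNIV :: (int ^ 'n) set)"
      "\<And>v h z'. norm h \<le> real CARD('n) \<Longrightarrow> Im z' \<ge> Im z \<Longrightarrow>
        norm (1 * ex (of_real (qf A (int_vec v + h)) * z')) \<le> M v"
      using wtheta_domination[OF quad_growth_const z] by metis
    show ?thesis
      unfolding theta_mean_def wtheta_def mult_1
      by (rule infsumI[OF torus_mean_infsum[where M = M]])
         (use M norm_cube_le in \<open>auto intro!: continuous_intros continuous_on_compose2[OF continuous_on_qf]\<close>)
  qed
  finally show ?thesis by (simp add: q mult.commute)
qed

text \<open>Both sides are continuous and periodic in h with the same Fourier coefficients.\<close>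

lemma theta_inversion_mean:
  assumes z: "Im z > 0"
  shows "wtheta (\<lambda>_. 1) h z = theta_mean z * wdual (\<lambda>_. 1) h z"
proof -
  define D where "D = (\<lambda>h. wtheta (\<lambda>_. 1) h z - theta_mean z * wdual (\<lambda>_. 1) h z)"
  have cw: "continuous_on S (\<lambda>h. wtheta (\<lambda>_. 1) h z)" for S
    using continuous_wtheta[OF z] continuous_on_subset by blast
  have cd: "continuous_on S (\<lambda>h. wdual (\<lambda>_. 1) h z)" for S
    by (rule continuous_wdual[OF quad_growth_const z])
  have "D h = 0"
  proof (rule fourier_unique)
    show "continuous_on UNIV D"
      unfolding D_def by (intro continuous_intros cw cd)
    show "lattice_periodic D"
      using lattice_periodic_wtheta[of "\<lambda>_. 1" z]
      unfolding D_def lattice_periodic_def wdual_def by (simp add: chr_shift chr_int_vec)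
    show "torus_mean (\<lambda>h. D h * chr \<eta> h) = 0" for \<eta>
    proof -
      have "torus_mean (\<lambda>h. D h * chr \<eta> h) = torus_mean (\<lambda>h. wtheta (\<lambda>_. 1) h z * chr \<eta> h)
          - torus_mean (\<lambda>h. theta_mean z * (wdual (\<lambda>_. 1) h z * chr \<eta> h))"
        unfolding torus_mean_def
        by (subst integral_diff[symmetric])
           (auto intro!: integrable_continuous continuous_intros cw cd simp: D_def algebra_simps)
      also have "\<dots> = 0"
        using fourier_coefficient_wtheta[OF z, of "- \<eta>"] torus_mean_wdual[OF z, of \<eta>]
        by (simp add: torus_mean_cmult int_vec_minus)
      finally show ?thesis .
    qed
  qed
  thus ?thesis by (simp add: D_def)
qed

end

section \<open>Inversion with linear and quadratic weights\<close>

lemma qf_expand: "qf C y = (\<Sum>(i, j)\<in>UNIV. C $ i $ j * (y $ i * y $ j))"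
proof -
  have "qf C y = (\<Sum>i\<in>UNIV. \<Sum>j\<in>UNIV. C $ i $ j * (y $ i * y $ j))"
    by (simp add: qf_def inner_vec_def matrix_vector_mult_def sum_distrib_left mult_ac)
  thus ?thesis by (simp add: sum.cartesian_product)
qed

context posdef_form
begin

lemma wtheta_sum:
  assumes z: "Im z > 0" and p: "\<And>i. i \<in> I \<Longrightarrow> quad_growth (p i)" and "finite I"
  shows "wtheta (\<lambda>x. \<Sum>i\<in>I. c i * p i x) h z = (\<Sum>i\<in>I. c i * wtheta (p i) h z)"
  using assms(3) p
proof (induction I rule: finite_induct)
  case empty
  thus ?case by (simp add: wtheta_def)
next
  case (insert j I)
  let ?e = "\<lambda>v. ex (of_real (qf A (int_vec v + h)) * z)"
  have g: "quad_growth (\<lambda>x. \<Sum>i\<in>I. c i * p i x)" if "\<And>i. i \<in> I \<Longrightarrow> quad_growth (p i)"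
    using insert.hyps(1) that
    by (induction I rule: finite_induct) (auto intro!: quad_growth_add quad_growth_cmult)
  have "wtheta (\<lambda>x. \<Sum>i\<in>insert j I. c i * p i x) h z =
     (\<Sum>\<^sub>\<infinity>v. c j * (p j (int_vec v + h) * ?e v) + (\<Sum>i\<in>I. c i * p i (int_vec v + h)) * ?e v)"
    unfolding wtheta_def using insert.hyps by (intro infsum_cong) (simp add: algebra_simps)
  also have "\<dots> = (\<Sum>\<^sub>\<infinity>v. c j * (p j (int_vec v + h) * ?e v)) + (\<Sum>\<^sub>\<infinity>v. (\<Sum>i\<in>I. c i * p i (int_vec v + h)) * ?e v)"
    using insert.prems
    by (intro infsum_add summable_on_cmult_right abs_summable_summable[OF wtheta_summable[OF _ z]] g) auto
  also have "\<dots> = c j * wtheta (p j) h z + wtheta (\<lambda>x. \<Sum>i\<in>I. c i * p i x) h z"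
    by (simp add: wtheta_def infsum_cmult_right')
  finally show ?case using insert by simp
qed

lemma wdual_sum:
  assumes z: "Im z > 0" and p: "\<And>i. i \<in> I \<Longrightarrow> quad_growth (p i)" and "finite I"
  shows "wdual (\<lambda>x. \<Sum>i\<in>I. c i * p i x) h z = (\<Sum>i\<in>I. c i * wdual (p i) h z)"
  using assms(3) p
proof (induction I rule: finite_induct)
  case empty
  thus ?case by (simp add: wdual_def)
next
  case (insert j I)
  let ?e = "\<lambda>v. ex (of_real (qf Ai (int_vec v)) * dual_pt z) * chr v h"
  have g: "quad_growth (\<lambda>x. \<Sum>i\<in>I. c i * p i x)" if "\<And>i. i \<in> I \<Longrightarrow> quad_growth (p i)"
    using insert.hyps(1) that
    by (induction I rule: finite_induct) (auto intro!: quad_growth_add quad_growth_cmult)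
  note s = wdual_summable[OF _ z, of _ h, unfolded mult.assoc]
  have "wdual (\<lambda>x. \<Sum>i\<in>insert j I. c i * p i x) h z =
     (\<Sum>\<^sub>\<infinity>v. c j * (p j (int_vec v) * ?e v) + (\<Sum>i\<in>I. c i * p i (int_vec v)) * ?e v)"
    unfolding wdual_def using insert.hyps by (intro infsum_cong) (simp add: algebra_simps)
  also have "\<dots> = (\<Sum>\<^sub>\<infinity>v. c j * (p j (int_vec v) * ?e v)) + (\<Sum>\<^sub>\<infinity>v. (\<Sum>i\<in>I. c i * p i (int_vec v)) * ?e v)"
    using insert.prems by (intro infsum_add summable_on_cmult_right s g) auto
  also have "\<dots> = c j * wdual (p j) h z + wdual (\<lambda>x. \<Sum>i\<in>I. c i * p i x) h z"
    by (simp add: wdual_def infsum_cmult_right' mult.assoc)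
  finally show ?case using insert by simp
qed

lemma theta_inversion_linear:
  assumes z: "Im z > 0"
  shows "4 * of_real pi * \<i> * z * wtheta (\<lambda>x. of_real (x \<bullet> (A *v u))) h z =
    theta_mean z * (2 * of_real pi * \<i> * wdual (\<lambda>x. of_real (x \<bullet> u)) h z)"
proof -
  have 1: "((\<lambda>s. theta_mean z * wdual (\<lambda>_. 1) (h + s *\<^sub>R u) z) has_vector_derivative
      theta_mean z * (2 * of_real pi * \<i> * wdual (\<lambda>x. 1 * of_real (x \<bullet> u)) h z)) (at 0)"
    by (rule has_vector_derivative_mult_right[OF wdual_deriv[OF _ _ z]])
       (auto intro: quad_growth_linear)
  have "(\<lambda>s. wtheta (\<lambda>_. 1) (h + s *\<^sub>R u) z) = (\<lambda>s. theta_mean z * wdual (\<lambda>_. 1) (h + s *\<^sub>R u) z)"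
    by (rule ext) (rule theta_inversion_mean[OF z])
  from vector_derivative_unique_at[OF wtheta_deriv1[OF z, of h u, unfolded this] 1]
  show ?thesis by simp
qed

text \<open>The second derivative of Poisson summation in two directions. On the theta side the
  product rule leaves the term u \<bullet> A w, from which the trace obstruction arises.\<close>

lemma theta_inversion_bilinear:
  assumes z: "Im z > 0"
  shows "4 * of_real pi * \<i> * z * (of_real (u \<bullet> (A *v w)) * wtheta (\<lambda>_. 1) h z +
      4 * of_real pi * \<i> * z * wtheta (\<lambda>x. of_real ((x \<bullet> (A *v w)) * (x \<bullet> (A *v u)))) h z) =
    theta_mean z * (2 * of_real pi * \<i>)\<^sup>2 * wdual (\<lambda>x. of_real ((x \<bullet> w) * (x \<bullet> u))) h z"
proof -
  have 1: "((\<lambda>s. (theta_mean z * (2 * of_real pi * \<i>)) * wdual (\<lambda>x. of_real (x \<bullet> w)) (h + s *\<^sub>R u) z) has_vector_derivative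
      (theta_mean z * (2 * of_real pi * \<i>)) *
      (2 * of_real pi * \<i> * wdual (\<lambda>x. of_real (x \<bullet> w) * of_real (x \<bullet> u)) h z)) (at 0)"
    by (rule has_vector_derivative_mult_right[OF wdual_deriv[OF _ _ z]])
       (use quad_growth_linear quad_growth_bilinear in simp_all)
  have 2: "((\<lambda>s. (4 * of_real pi * \<i> * z) * wtheta (\<lambda>x. of_real (x \<bullet> (A *v w))) (h + s *\<^sub>R u) z) has_vector_derivative
     (4 * of_real pi * \<i> * z) * (of_real (u \<bullet> (A *v w)) * wtheta (\<lambda>_. 1) h z +
     4 * of_real pi * \<i> * z * wtheta (\<lambda>x. of_real ((x \<bullet> (A *v w)) * (x \<bullet> (A *v u)))) h z)) (at 0)"
    by (rule has_vector_derivative_mult_right[OF wtheta_deriv2[OF z]])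
  have eq: "(\<lambda>s. (4 * of_real pi * \<i> * z) * wtheta (\<lambda>x. of_real (x \<bullet> (A *v w))) (h + s *\<^sub>R u) z) =
     (\<lambda>s. (theta_mean z * (2 * of_real pi * \<i>)) * wdual (\<lambda>x. of_real (x \<bullet> w)) (h + s *\<^sub>R u) z)"
    using theta_inversion_linear[OF z] by (simp add: mult_ac fun_eq_iff)
  show ?thesis
    using vector_derivative_unique_at[OF 2[unfolded eq] 1] by (simp add: power2_eq_square mult_ac)
qed

text \<open>The weight B evaluated at \<open>A\<^sup>-\<^sup>1 \<xi>\<close>, which is what B
  becomes on the dual side.\<close>

definition conj_form :: "real ^ 'n ^ 'n \<Rightarrow> real ^ 'n ^ 'n" where
  "conj_form B = Ai ** B ** Ai"

text \<open>
  The trace term is the obstruction to modularity: it vanishes exactly on the tangent space of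
  forms with fixed discriminant.
\<close>

lemma theta_inversion_qf:
  assumes z: "Im z > 0"
  shows "wtheta (\<lambda>x. of_real (qf B x)) h z =
    theta_mean z / (4 * z\<^sup>2) * wdual (\<lambda>x. of_real (qf (conj_form B) x)) h z
    - of_real (trace (B ** Ai)) / (4 * of_real pi * \<i> * z) * wtheta (\<lambda>_. 1) h z"
proof -
  let ?C = "conj_form B"
  let ?e = "\<lambda>i::'n. axis i (1::real)"
  let ?I = "UNIV :: ('n \<times> 'n) set"
  let ?c = "\<lambda>(i, j). complex_of_real (?C $ i $ j)"
  have z0: "z \<noteq> 0" using z by auto
  \<comment> \<open>Expanded in the linear forms x \<bullet> A e_i, the form B has the coefficients
    of \<open>conj_form B\<close>; the bilinear inversion then applies term by term.\<close>
  have A1: "qf B x = (\<Sum>(i, j)\<in>?I. ?C $ i $ j * ((x \<bullet> (A *v ?e i)) * (x \<bullet> (A *v ?e j))))" for x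
  proof -
    have "qf ?C (A *v x) = (Ai *v (B *v x)) \<bullet> (A *v x)"
      by (simp add: qf_def conj_form_def inner_commute flip: matrix_vector_mul_assoc)
    also have "\<dots> = qf B x"
      by (subst inner_sym) (simp add: qf_def)
    finally have "qf B x = qf ?C (A *v x)" ..
    also have "(A *v x) $ i = x \<bullet> (A *v ?e i)" for i
      by (simp add: inner_sym[of x] inner_axis' inner_commute)
    hence "qf ?C (A *v x) = (\<Sum>(i, j)\<in>?I. ?C $ i $ j * ((x \<bullet> (A *v ?e i)) * (x \<bullet> (A *v ?e j))))"
      unfolding qf_expand by simp
    finally show ?thesis .
  qed
  have T: "wtheta (\<lambda>x. of_real (qf B x)) h z =
      (\<Sum>(i, j)\<in>?I. of_real (?C $ i $ j) * wtheta (\<lambda>x. of_real ((x \<bullet> (A *v ?e i)) * (x \<bullet> (A *v ?e j)))) h z)"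
    using wtheta_sum[OF z, of ?I "\<lambda>(i,j) x. of_real ((x \<bullet> (A *v ?e i)) * (x \<bullet> (A *v ?e j)))" ?c h] 
    by (simp only: case_prod_unfold A1 of_real_sum of_real_mult) (use quad_growth_bilinear in auto)
  have D: "wdual (\<lambda>x. of_real (qf ?C x)) h z =
      (\<Sum>(i, j)\<in>?I. of_real (?C $ i $ j) * wdual (\<lambda>x. of_real ((x \<bullet> ?e i) * (x \<bullet> ?e j))) h z)"
    using wdual_sum[OF z, of ?I "\<lambda>(i,j) x. of_real ((x \<bullet> ?e i) * (x \<bullet> ?e j))" ?c h] 
    by (simp only: case_prod_unfold qf_expand of_real_sum of_real_mult inner_axis)
       (use quad_growth_bilinear[of "axis _ 1" "axis _ 1"] in \<open>auto simp: inner_axis\<close>)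
  have tr: "trace (B ** Ai) = (\<Sum>(i, j)\<in>?I. ?C $ i $ j * (?e j \<bullet> (A *v ?e i)))"
  proof -
    have "trace (B ** Ai) = trace (?C ** A)"
      by (metis A_Ai Ai_A conj_form_def matrix_mul_assoc matrix_mul_rid trace_mul_sym)
    also have "\<dots> = (\<Sum>(i, j)\<in>?I. ?C $ i $ j * A $ j $ i)"
      by (simp add: trace_def matrix_matrix_mult_def sum.cartesian_product)
    also have "\<dots> = (\<Sum>(i, j)\<in>?I. ?C $ i $ j * (?e j \<bullet> (A *v ?e i)))"
      by (simp add: inner_axis' matrix_vector_mul_component column_def matrix_vector_mult_basis)
    finally show ?thesis .
  qed
  have "4 * of_real pi * \<i> * z * (of_real (trace (B ** Ai)) * wtheta (\<lambda>_. 1) h z +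
      4 * of_real pi * \<i> * z * wtheta (\<lambda>x. of_real (qf B x)) h z) =
    (\<Sum>(i, j)\<in>?I. of_real (?C $ i $ j) * (4 * of_real pi * \<i> * z * (of_real (?e j \<bullet> (A *v ?e i)) * wtheta (\<lambda>_. 1) h z +
      4 * of_real pi * \<i> * z * wtheta (\<lambda>x. of_real ((x \<bullet> (A *v ?e i)) * (x \<bullet> (A *v ?e j)))) h z)))"
    unfolding T tr of_real_sum sum_distrib_right sum_distrib_left sum.distrib[symmetric]
    by (intro sum.cong) (auto simp: algebra_simps)
  also have "\<dots> = theta_mean z * (2 * of_real pi * \<i>)\<^sup>2 * wdual (\<lambda>x. of_real (qf ?C x)) h z"
    unfolding D theta_inversion_bilinear[OF z] sum_distrib_left
    by (intro sum.cong) (auto simp: algebra_simps)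
  finally have "4 * of_real pi * \<i> * z * (of_real (trace (B ** Ai)) * wtheta (\<lambda>_. 1) h z +
      4 * of_real pi * \<i> * z * wtheta (\<lambda>x. of_real (qf B x)) h z) =
      theta_mean z * (2 * of_real pi * \<i>)\<^sup>2 * wdual (\<lambda>x. of_real (qf ?C x)) h z" .
  note e = this
  have "T = R / P\<^sup>2 - t / P * W" if "P * (t * W + P * T) = R" "P \<noteq> 0" for P T R t W :: complex
    using that(2) unfolding that(1)[symmetric] by (simp add: field_simps power2_eq_square)
  from this[OF e] have "wtheta (\<lambda>x. of_real (qf B x)) h z =
      theta_mean z * (2 * of_real pi * \<i>)\<^sup>2 * wdual (\<lambda>x. of_real (qf ?C x)) h z / (4 * of_real pi * \<i> * z)\<^sup>2
      - of_real (trace (B ** Ai)) / (4 * of_real pi * \<i> * z) * wtheta (\<lambda>_. 1) h z"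
    using z0 by simp
  moreover have "4 * of_real pi * \<i> * z = 2 * z * (2 * of_real pi * \<i>)" by simp
  hence "(4 * of_real pi * \<i> * z)\<^sup>2 = 4 * z\<^sup>2 * (2 * of_real pi * \<i>)\<^sup>2"
    by (simp only: power_mult_distrib) simp
  moreover have "m * Q * D / (4 * z\<^sup>2 * Q) = m / (4 * z\<^sup>2) * D" if "Q \<noteq> 0" for m Q D :: complex
    using that by simp
  hence "theta_mean z * (2 * of_real pi * \<i>)\<^sup>2 * wdual (\<lambda>x. of_real (qf ?C x)) h z / (4 * z\<^sup>2 * (2 * of_real pi * \<i>)\<^sup>2)
     = theta_mean z / (4 * z\<^sup>2) * wdual (\<lambda>x. of_real (qf ?C x)) h z"
    by simp
  ultimately show ?thesis by simp
qed

section \<open>The heat equation and the Gaussian mean\<close>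

lemma wtheta_deriv_z:
  assumes z: "Im z > 0"
  shows "((\<lambda>s. wtheta (\<lambda>_. 1) h (z + of_real s)) has_vector_derivative
     2 * of_real pi * \<i> * wtheta (\<lambda>x. of_real (qf A x)) h z) (at 0)"
proof -
  obtain M where M: "M summable_on (UNIV :: (int ^ 'n) set)"
    "\<And>v h' z'. norm h' \<le> norm h \<Longrightarrow> Im z' \<ge> Im z \<Longrightarrow>
      norm (of_real (qf A (int_vec v + h')) * ex (of_real (qf A (int_vec v + h')) * z')) \<le> M v"
    using wtheta_domination[OF quad_growth_qf z] by metis
  have "((\<lambda>s. \<Sum>\<^sub>\<infinity>v. 1 * ex (of_real (qf A (int_vec v + h)) * (z + of_real s))) has_vector_derivative
     (\<Sum>\<^sub>\<infinity>v. 2 * of_real pi * \<i> * (of_real (qf A (int_vec v + h)) * ex (of_real (qf A (int_vec v + h)) * (z + of_real 0))))) (at 0)"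
  proof (rule infsum_has_vector_derivative[where M = "\<lambda>v. 2 * pi * M v" and r = 1])
    fix v s
    have "((\<lambda>s. of_real (qf A (int_vec v + h)) * (z + of_real s)) has_vector_derivative of_real (qf A (int_vec v + h))) (at s)"
      by (auto intro!: derivative_eq_intros)
    from has_vector_derivative_ex[OF this]
    show "((\<lambda>s. 1 * ex (of_real (qf A (int_vec v + h)) * (z + of_real s))) has_vector_derivative
        2 * of_real pi * \<i> * (of_real (qf A (int_vec v + h)) * ex (of_real (qf A (int_vec v + h)) * (z + of_real s)))) (at s)"
      by (simp add: mult_ac)
    show "norm (2 * of_real pi * \<i> * (of_real (qf A (int_vec v + h)) * ex (of_real (qf A (int_vec v + h)) * (z + of_real s)))) \<le> 2 * pi * M v"
      using M(2)[of h "z + of_real s" v] by (simp add: norm_mult)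
  next
    fix s :: real
    show "(\<lambda>v. 1 * ex (of_real (qf A (int_vec v + h)) * (z + of_real s))) summable_on UNIV"
      using abs_summable_summable[OF wtheta_summable[OF quad_growth_const[of 1], of "z + of_real s" h]] z by simp
  qed (use M(1) in \<open>auto intro!: summable_on_cmult_right\<close>)
  thus ?thesis by (simp add: wtheta_def infsum_cmult_right')
qed

lemma wdual_deriv_z:
  assumes z: "Im z > 0"
  shows "((\<lambda>s. wdual (\<lambda>_. 1) h (z + of_real s)) has_vector_derivative
     2 * of_real pi * \<i> / (4 * z\<^sup>2) * wdual (\<lambda>x. of_real (qf Ai x)) h z) (at 0)"
proof -
  \<comment> \<open>For real s of modulus below 1, z + s has norm at most \<open>norm z + 1\<close>
    and the same imaginary part, so the dual point stays at height at least Y.\<close>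
  define Y where "Y = Im z / (4 * (norm z + 1)\<^sup>2)"
  have z0: "norm z > 0" using z by auto
  have "norm z + 1 > 0" by (simp add: add_nonneg_pos)
  hence Y: "Y > 0" using z by (simp add: Y_def)
  obtain M where M: "M summable_on (UNIV :: (int ^ 'n) set)"
    "\<And>\<xi> z' h. Im (dual_pt z') \<ge> Y \<Longrightarrow>
      norm (of_real (qf Ai (int_vec \<xi>)) * ex (of_real (qf Ai (int_vec \<xi>)) * dual_pt z') * chr \<xi> h) \<le> M \<xi>"
    using dual_domination[OF quad_growth_qf Y] by metis
  let ?f = "\<lambda>\<xi> s. 1 * ex (of_real (qf Ai (int_vec \<xi>)) * dual_pt (z + of_real s)) * chr \<xi> h"
  let ?f' = "\<lambda>\<xi> s. 2 * of_real pi * \<i> / (4 * (z + of_real s)\<^sup>2) *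
     (of_real (qf Ai (int_vec \<xi>)) * ex (of_real (qf Ai (int_vec \<xi>)) * dual_pt (z + of_real s)) * chr \<xi> h)"
  have "((\<lambda>s. \<Sum>\<^sub>\<infinity>\<xi>. ?f \<xi> s) has_vector_derivative (\<Sum>\<^sub>\<infinity>\<xi>. ?f' \<xi> 0)) (at 0)"
  proof (rule infsum_has_vector_derivative[where M = "\<lambda>\<xi>. 2 * pi / (4 * (Im z)\<^sup>2) * M \<xi>" and r = 1])
    fix \<xi> s
    have zs: "z + of_real s \<noteq> 0" using z by (auto simp: complex_eq_iff)
    have dp: "dual_pt = (\<lambda>w. (- 1 / 4) * inverse w)" by (simp add: fun_eq_iff dual_pt_def inverse_eq_divide)
    have "(dual_pt has_field_derivative 1 / (4 * (z + of_real s)\<^sup>2)) (at (z + of_real s))"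
      unfolding dp by (rule DERIV_cong[OF DERIV_cmult[OF DERIV_inverse[OF zs]]]) (simp add: power2_eq_square inverse_eq_divide)
    moreover have "((\<lambda>s. z + of_real s) has_vector_derivative 0 + of_real 1) (at s)"
      by (intro has_vector_derivative_add has_vector_derivative_const has_vector_derivative_of_real DERIV_ident)
    ultimately have "((\<lambda>s. dual_pt (z + of_real s)) has_vector_derivative 1 / (4 * (z + of_real s)\<^sup>2)) (at s)"
      using field_vector_diff_chain_at[of "\<lambda>s. z + of_real s" 1 s dual_pt] by (simp add: o_def)
    from has_vector_derivative_mult_left[OF has_vector_derivative_ex[OF has_vector_derivative_mult_right[OF this,
          of "of_real (qf Ai (int_vec \<xi>))"]], of "chr \<xi> h"]
    show "(?f \<xi> has_vector_derivative ?f' \<xi> s) (at s)"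
      unfolding mult_1 by (rule has_vector_derivative_eq_rhs) simp
  next
    fix \<xi> and s :: real assume s: "\<bar>s\<bar> < 1"
    have zs: "norm (z + of_real s) \<ge> Im z" using abs_Im_le_cmod[of "z + of_real s"] z by simp
    have "norm (z + of_real s) \<le> norm z + 1"
      using norm_triangle_ineq[of z "of_real s"] s by simp
    hence "(norm (z + of_real s))\<^sup>2 \<le> (norm z + 1)\<^sup>2" by (intro power_mono) auto
    hence "Im (dual_pt (z + of_real s)) \<ge> Y"
      unfolding Im_dual_pt Y_def plus_complex.sel Im_complex_of_real add_0_right
      using z zs \<open>norm z + 1 > 0\<close>
      by (intro divide_left_mono mult_pos_pos) auto
    hence "norm (of_real (qf Ai (int_vec \<xi>)) * ex (of_real (qf Ai (int_vec \<xi>)) * dual_pt (z + of_real s)) * chr \<xi> h) \<le> M \<xi>"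
      by (rule M(2))
    moreover have "norm (2 * of_real pi * \<i> / (4 * (z + of_real s)\<^sup>2)) \<le> 2 * pi / (4 * (Im z)\<^sup>2)"
    proof -
      have "2 * pi / (4 * (norm (z + of_real s))\<^sup>2) \<le> 2 * pi / (4 * (Im z)\<^sup>2)"
        using zs z by (intro divide_left_mono mult_left_mono power_mono mult_pos_pos zero_less_power) auto
      thus ?thesis by (simp add: norm_divide norm_mult norm_power)
    qed
    ultimately show "norm (?f' \<xi> s) \<le> 2 * pi / (4 * (Im z)\<^sup>2) * M \<xi>"
      unfolding norm_mult[of "2 * of_real pi * \<i> / (4 * (z + of_real s)\<^sup>2)"] using z by (intro mult_mono) auto
  next
    fix s :: real
    show "(\<lambda>\<xi>. ?f \<xi> s) summable_on UNIV"
      by (rule wdual_summable) (use z in auto)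
    show "(\<lambda>\<xi>. 2 * pi / (4 * (Im z)\<^sup>2) * M \<xi>) summable_on UNIV"
      by (rule summable_on_cmult_right[OF M(1)])
  qed simp
  thus ?thesis unfolding wdual_def infsum_cmult_right' by simp
qed

lemma theta_mean_has_sum:
  assumes z: "Im z > 0"
  shows "((\<lambda>v. torus_mean (\<lambda>h. ex (of_real (qf A (int_vec v + h)) * z))) has_sum theta_mean z) UNIV"
proof -
  obtain M where M: "M summable_on (UNIV :: (int ^ 'n) set)"
    "\<And>v h z'. norm h \<le> real CARD('n) \<Longrightarrow> Im z' \<ge> Im z \<Longrightarrow>
      norm (1 * ex (of_real (qf A (int_vec v + h)) * z')) \<le> M v"
    using wtheta_domination[OF quad_growth_const z] by metis
  show ?thesis
    unfolding theta_mean_def wtheta_def mult_1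
    by (rule torus_mean_infsum[where M = M])
       (use M norm_cube_le in \<open>auto intro!: continuous_intros continuous_on_compose2[OF continuous_on_qf]\<close>)
qed

lemma open_upper_half_plane: "open {z. Im z > 0}"
  by (rule open_halfspace_Im_gt)

lemma theta_mean_holomorphic: "theta_mean holomorphic_on {z. Im z > 0}"
proof -
  have "(\<lambda>z. \<Sum>\<^sub>\<infinity>v. torus_mean (\<lambda>h. ex (of_real (qf A (int_vec v + h)) * z))) holomorphic_on {z. Im z > 0}"
  proof (rule infsum_holomorphic[OF open_upper_half_plane])
    fix v
    show "(\<lambda>z. torus_mean (\<lambda>h. ex (of_real (qf A (int_vec v + h)) * z))) holomorphic_on {z. Im z > 0}"
      unfolding torus_mean_def
    proof (rule leibniz_rule_holomorphic)
      fix z :: complex and h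
      have "((\<lambda>z. of_real (qf A (int_vec v + h)) * z) has_field_derivative of_real (qf A (int_vec v + h))) (at z)"
        by (auto intro!: derivative_eq_intros)
      from DERIV_chain2[where f = ex and g = "\<lambda>z. of_real (qf A (int_vec v + h)) * z", OF has_field_derivative_ex this]
      show "((\<lambda>z. ex (of_real (qf A (int_vec v + h)) * z)) has_field_derivative
        2 * of_real pi * \<i> * ex (of_real (qf A (int_vec v + h)) * z) * of_real (qf A (int_vec v + h))) (at z within {z. Im z > 0})"
        by (rule has_field_derivative_at_within)
    next
      fix z
      show "(\<lambda>h. ex (of_real (qf A (int_vec v + h)) * z)) integrable_on cbox 0 1"
        by (intro integrable_continuous continuous_intros continuous_on_compose2[OF continuous_on_qf]) auto
    next
      show "continuous_on ({z. Im z > 0} \<times> cbox 0 1) (\<lambda>(z, h). 2 * of_real pi * \<i> *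
          ex (of_real (qf A (int_vec v + h)) * z) * of_real (qf A (int_vec v + h)))"
        unfolding case_prod_unfold
        by (intro continuous_intros continuous_on_compose2[OF continuous_on_qf]) auto
    qed (auto simp: convex_halfspace_Im_gt)
  next
    fix z0 assume "z0 \<in> {z. Im z > 0}"
    hence z0: "Im z0 / 2 > 0" by simp
    obtain M where M: "M summable_on (UNIV :: (int ^ 'n) set)"
      "\<And>v h z'. norm h \<le> real CARD('n) \<Longrightarrow> Im z' \<ge> Im z0 / 2 \<Longrightarrow>
        norm (1 * ex (of_real (qf A (int_vec v + h)) * z')) \<le> M v"
      using wtheta_domination[OF quad_growth_const z0] by metis
    have ball: "Im z \<ge> Im z0 / 2" if "z \<in> cball z0 (Im z0 / 2)" for z
      using that abs_Im_le_cmod[of "z0 - z"] by (simp add: dist_norm)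
    have "norm (torus_mean (\<lambda>h. ex (of_real (qf A (int_vec v + h)) * z))) \<le> M v"
      if "z \<in> cball z0 (Im z0 / 2)" for v z
      using M(2)[OF norm_cube_le ball[OF that]]
      by (intro norm_torus_mean_le) (auto intro!: continuous_intros continuous_on_compose2[OF continuous_on_qf])
    moreover have "cball z0 (Im z0 / 2) \<subseteq> {z. Im z > 0}"
      using ball z0 by force
    ultimately show "\<exists>r>0. \<exists>M. M summable_on UNIV \<and> cball z0 r \<subseteq> {z. Im z > 0} \<and>
        (\<forall>v. \<forall>w\<in>cball z0 r. norm (torus_mean (\<lambda>h. ex (of_real (qf A (int_vec v + h)) * w))) \<le> M v)"
      using M(1) z0 by blast
  qed
  thus ?thesis
    by (rule holomorphic_transform) (simp add: infsumI[OF theta_mean_has_sum])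
qed

text \<open>
  The heat equation: contracting the second derivatives in \<open>h\<close> with \<open>A\<^sup>-\<^sup>1\<close> gives the derivative in \<open>z\<close>.
\<close>

lemma theta_mean_ode:
  assumes z: "Im z > 0"
  shows "(theta_mean has_field_derivative - (of_nat CARD('n) / (2 * z)) * theta_mean z) (at z)"
proof -
  have z0: "z \<noteq> 0" using z by auto
  define a' where "a' = deriv theta_mean z"
  have D: "(theta_mean has_field_derivative a') (at z)"
    unfolding a'_def using theta_mean_holomorphic open_upper_half_plane z
    by (intro holomorphic_derivI) auto
  \<comment> \<open>As a function of h the dual series has zeroth Fourier coefficient 1, so it is
    nonzero somewhere and can be cancelled there.\<close>
  obtain h where h: "wdual (\<lambda>_. 1) h z \<noteq> 0"
  proof (rule ccontr)
    assume "\<not> thesis"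
    hence "wdual (\<lambda>_. 1) h z = 0" for h using that by blast
    thus False using torus_mean_wdual[OF z, of 0] by simp
  qed
  \<comment> \<open>The choice B = A turns the trace into n and the dual weight into the inverse
    form; this is the origin of the weight n / 2.\<close>
  have tr: "trace (A ** Ai) = real CARD('n)" by (simp add: A_Ai trace_I)
  have cf: "conj_form A = Ai" by (simp add: conj_form_def Ai_A)
  have "((\<lambda>s. theta_mean (z + of_real s) * wdual (\<lambda>_. 1) h (z + of_real s)) has_vector_derivative
     theta_mean (z + of_real 0) * (2 * of_real pi * \<i> / (4 * z\<^sup>2) * wdual (\<lambda>x. of_real (qf Ai x)) h z) +
     a' * wdual (\<lambda>_. 1) h (z + of_real 0)) (at 0)"
  proof (rule has_vector_derivative_mult[OF _ wdual_deriv_z[OF z]])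
    have "((\<lambda>s. z + of_real s) has_vector_derivative 1) (at 0)"
      by (auto intro!: derivative_eq_intros)
    from field_vector_diff_chain_at[OF this, of theta_mean a'] D
    show "((\<lambda>s. theta_mean (z + of_real s)) has_vector_derivative a') (at 0)"
      by (simp add: o_def)
  qed
  moreover have "(\<lambda>s. theta_mean (z + of_real s) * wdual (\<lambda>_. 1) h (z + of_real s)) =
     (\<lambda>s. wtheta (\<lambda>_. 1) h (z + of_real s))"
    using z by (simp add: theta_inversion_mean)
  ultimately have "2 * of_real pi * \<i> * wtheta (\<lambda>x. of_real (qf A x)) h z =
     theta_mean z * (2 * of_real pi * \<i> / (4 * z\<^sup>2) * wdual (\<lambda>x. of_real (qf Ai x)) h z) + a' * wdual (\<lambda>_. 1) h z"
    using wtheta_deriv_z[OF z, of h] by (simp add: vector_derivative_unique_at)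
  hence "a' * wdual (\<lambda>_. 1) h z =
      - (2 * of_real pi * \<i> * (of_nat CARD('n) / (4 * of_real pi * \<i> * z))) * (theta_mean z * wdual (\<lambda>_. 1) h z)"
    unfolding theta_inversion_qf[OF z] tr cf theta_inversion_mean[OF z]
    by (simp add: algebra_simps eq_neg_iff_add_eq_0)
  also have "2 * of_real pi * \<i> * (of_nat CARD('n) / (4 * of_real pi * \<i> * z)) = of_nat CARD('n) / (2 * z)"
    using z0 by (simp add: divide_simps)
  finally have "a' * wdual (\<lambda>_. 1) h z = - (of_nat CARD('n) / (2 * z)) * theta_mean z * wdual (\<lambda>_. 1) h z"
    by (simp only: mult.assoc)
  hence "a' = - (of_nat CARD('n) / (2 * z)) * theta_mean z"
    by (rule mult_right_cancel[OF h, THEN iffD1])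
  thus ?thesis using D by simp
qed

text \<open>The logarithmic derivative is - n / (2 z), so the quotient by this power is constant. On
  the upper half plane - i z has positive real part, which keeps the principal branch
  holomorphic.\<close>

lemma theta_mean_powr:
  obtains C where "\<And>z. Im z > 0 \<Longrightarrow> theta_mean z = C * (- \<i> * z) powr (- (of_nat CARD('n) / 2))"
proof -
  let ?k = "of_nat CARD('n) / 2 :: complex"
  have "\<exists>C. \<forall>z\<in>{z. Im z > 0}. theta_mean z * (- \<i> * z) powr ?k = C"
  proof (rule has_field_derivative_zero_constant)
    show "convex {z. Im z > 0}" by (rule convex_halfspace_Im_gt)
    fix z assume "z \<in> {z. Im z > 0}"
    hence z: "Im z > 0" by simp
    have z0: "z \<noteq> 0" using z by auto
    have nr: "- \<i> * z \<notin> \<real>\<^sub>\<le>\<^sub>0" using z by (auto simp: complex_nonpos_Reals_iff)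
    have "((\<lambda>z. (- \<i> * z) powr ?k) has_field_derivative ?k * (- \<i> * z) powr (?k - 1) * (- \<i>)) (at z)"
      using nr by (auto intro!: derivative_eq_intros)
    also have "?k * (- \<i> * z) powr (?k - 1) * (- \<i>) = ?k / z * (- \<i> * z) powr ?k"
      using z0 by (simp add: powr_diff)
    finally have "((\<lambda>z. theta_mean z * (- \<i> * z) powr ?k) has_field_derivative
       - (of_nat CARD('n) / (2 * z)) * theta_mean z * (- \<i> * z) powr ?k + ?k / z * (- \<i> * z) powr ?k * theta_mean z) (at z)"
      by (rule DERIV_mult[OF theta_mean_ode[OF z]])
    thus "((\<lambda>z. theta_mean z * (- \<i> * z) powr ?k) has_field_derivative 0) (at z within {z. Im z > 0})"
      by (rule_tac has_field_derivative_at_within) simp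
  qed
  then obtain C where C: "\<And>z. Im z > 0 \<Longrightarrow> theta_mean z * (- \<i> * z) powr ?k = C" by auto
  have "theta_mean z = C * (- \<i> * z) powr (- ?k)" if z: "Im z > 0" for z
  proof -
    have "(- \<i> * z) powr ?k \<noteq> 0" using z by (auto simp: powr_def)
    thus ?thesis using C[OF z] by (simp add: powr_minus field_simps)
  qed
  thus ?thesis using that by blast
qed

end

section \<open>Transformation under congruence subgroups\<close>

definition box_mod :: "int \<Rightarrow> (int ^ 'n) set" where
  "box_mod d = {v. \<forall>i. 0 \<le> v $ i \<and> v $ i < d}"

definition vmod :: "int \<Rightarrow> int ^ 'n \<Rightarrow> int ^ 'n" where
  "vmod d v = (\<chi> i. v $ i mod d)"

definition periodic_mod :: "int \<Rightarrow> (int ^ 'n \<Rightarrow> 'b) \<Rightarrow> bool" where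
  "periodic_mod d F \<longleftrightarrow> (\<forall>v w. F (v + d *s w) = F v)"

lemma finite_box_mod [simp]: "finite (box_mod d :: (int ^ 'n) set)"
proof -
  have "(box_mod d :: (int ^ 'n) set) \<subseteq> vec_lambda ` PiE UNIV (\<lambda>_. {0..<d})"
    by (auto simp: box_mod_def intro!: image_eqI[of _ _ "vec_nth _"])
  thus ?thesis by (rule finite_subset) (intro finite_imageI finite_PiE, auto)
qed

lemma vmod_in_box: "d > 0 \<Longrightarrow> vmod d v \<in> box_mod d"
  by (simp add: vmod_def box_mod_def)

lemma vmod_box: "v \<in> box_mod d \<Longrightarrow> vmod d v = v"
  by (simp add: vmod_def box_mod_def vec_eq_iff)

lemma vmod_eq: "v = vmod d v + d *s (\<chi> i. v $ i div d)"
  by (simp add: vmod_def vec_eq_iff)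

lemma vmod_add_mult [simp]: "vmod d (v + d *s w) = vmod d v"
  by (simp add: vmod_def vec_eq_iff)

lemma periodic_vmod: "periodic_mod d F \<Longrightarrow> F (vmod d v) = F v"
  by (metis periodic_mod_def vmod_eq)

lemma vmod_vmod_add [simp]: "vmod d (vmod d v + w) = vmod d (v + w)" "vmod d (v + vmod d w) = vmod d (v + w)"
  "vmod d (vmod d v - w) = vmod d (v - w)" "vmod d (v - vmod d w) = vmod d (v - w)"
  by (simp_all add: vmod_def vec_eq_iff mod_simps)

lemma sum_box_shift:
  fixes F :: "int ^ 'n \<Rightarrow> 'b :: comm_monoid_add"
  assumes d: "d > 0" and F: "periodic_mod d F"
  shows "(\<Sum>g\<in>box_mod d. F (g + w)) = (\<Sum>g\<in>box_mod d. F g)"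
  by (rule sum.reindex_bij_witness[of _ "\<lambda>g. vmod d (g - w)" "\<lambda>g. vmod d (g + w)"])
     (use d F in \<open>auto simp: vmod_in_box vmod_box periodic_vmod\<close>)

lemma infsum_box_split:
  fixes f :: "int ^ 'n \<Rightarrow> complex"
  assumes d: "d > 0" and f: "f summable_on UNIV"
  shows "(\<Sum>\<^sub>\<infinity>v. f v) = (\<Sum>g\<in>box_mod d. \<Sum>\<^sub>\<infinity>w. f (g + d *s w))"
proof -
  have bij: "bij_betw (\<lambda>(g, w). g + d *s w) (box_mod d \<times> UNIV) (UNIV :: (int ^ 'n) set)"
  proof (rule bij_betw_byWitness[where f' = "\<lambda>v. (vmod d v, \<chi> i. v $ i div d)"])
    show "\<forall>a\<in>box_mod d \<times> UNIV. (vmod d (case a of (g, w) \<Rightarrow> g + d *s w), \<chi> i. (case a of (g, w) \<Rightarrow> g + d *s w) $ i div d) = a"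
      using d by (auto simp: vmod_box) (auto simp: box_mod_def vec_eq_iff)
  qed (use d in \<open>auto simp: vmod_in_box vmod_eq[symmetric]\<close>)
  have s: "(\<lambda>(g, w). f (g + d *s w)) summable_on (box_mod d \<times> UNIV)"
    using summable_on_reindex_bij_betw[OF bij, of f] f by (simp add: case_prod_unfold)
  have "(\<Sum>\<^sub>\<infinity>v. f v) = (\<Sum>\<^sub>\<infinity>(g, w)\<in>box_mod d \<times> UNIV. f (g + d *s w))"
    using infsum_reindex_bij_betw[OF bij, of f] by (simp add: case_prod_unfold)
  also have "\<dots> = (\<Sum>\<^sub>\<infinity>g\<in>box_mod d. \<Sum>\<^sub>\<infinity>w. f (g + d *s w))"
    using infsum_Sigma'_banach[of "\<lambda>g w. f (g + d *s w)" "box_mod d" "\<lambda>_. UNIV"] s by simp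
  finally show ?thesis by simp
qed

context posdef_form
begin

lemma theta_series_wtheta: "theta_series A z = wtheta (\<lambda>_. 1) 0 z"
  by (simp add: theta_series_def wtheta_def ex_def qf_def mult_ac)

lemma wtheta_holomorphic:
  assumes p: "quad_growth p"
  shows "wtheta p h holomorphic_on {z. Im z > 0}"
  unfolding wtheta_def
proof (rule infsum_holomorphic[OF open_upper_half_plane])
  show "(\<lambda>z. p (int_vec v + h) * ex (of_real (qf A (int_vec v + h)) * z)) holomorphic_on {z. Im z > 0}" for v
    by (intro holomorphic_intros)
  fix z0 assume "z0 \<in> {z. Im z > 0}"
  hence z0: "Im z0 / 2 > 0" by simp
  obtain M where M: "M summable_on (UNIV :: (int ^ 'n) set)"
    "\<And>v h' z'. norm h' \<le> norm h \<Longrightarrow> Im z' \<ge> Im z0 / 2 \<Longrightarrow>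
      norm (p (int_vec v + h') * ex (of_real (qf A (int_vec v + h')) * z')) \<le> M v"
    using wtheta_domination[OF p z0] by metis
  have ball: "Im z \<ge> Im z0 / 2" if "z \<in> cball z0 (Im z0 / 2)" for z
    using that abs_Im_le_cmod[of "z0 - z"] by (simp add: dist_norm)
  moreover have "cball z0 (Im z0 / 2) \<subseteq> {z. Im z > 0}"
    using ball z0 by force
  ultimately show "\<exists>r>0. \<exists>M. M summable_on UNIV \<and> cball z0 r \<subseteq> {z. Im z > 0} \<and>
      (\<forall>v. \<forall>w\<in>cball z0 r. norm (p (int_vec v + h) * ex (of_real (qf A (int_vec v + h)) * w)) \<le> M v)"
    using M z0 by blast
qed

text \<open>Termwise differentiation is legitimate because A + t B stays, for small t, above half of
  the lower bound of A.\<close>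

lemma partial_theta_wtheta:
  assumes z: "Im z > 0"
  shows "partial_theta B A z = wtheta (\<lambda>x. of_real (qf B x)) 0 z"
proof -
  obtain a where a: "a > 0" "\<And>x. qf A x \<ge> a * (norm x)\<^sup>2"
    using Quad_pos_lower_bound[OF posdef] by blast
  obtain b where b: "b \<ge> 0" "\<And>x y. \<bar>x \<bullet> (B *v y)\<bar> \<le> b * norm x * norm y"
    using matrix_bilinear_bound by blast
  \<comment> \<open>For t below r in modulus, t B costs at most half of the bound a; adding 1 to b
    keeps the quotient meaningful for b = 0.\<close>
  define r where "r = a / (2 * (b + 1))"
  have r: "r > 0" using a b by (simp add: r_def)
  obtain M where M: "M summable_on (UNIV :: (int ^ 'n) set)"
    "\<And>v h. norm h \<le> 0 \<Longrightarrow> (1 + (norm (int_vec v + h))\<^sup>2) *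
       exp (- (2 * pi * (a / 2) * Im z) * (norm (int_vec v + h))\<^sup>2 + 0 * norm (int_vec v + h) + 0) \<le> M v"
    using gaussian_domination[of "2 * pi * (a / 2) * Im z" 0 0] a(1) z by auto
  have qB: "\<bar>qf B x\<bar> \<le> b * (norm x)\<^sup>2" for x
    using b(2)[of x x] by (simp add: qf_def power2_eq_square mult_ac)
  have q: "qf (A + t *\<^sub>R B) x = qf A x + t * qf B x" for t x
    by (simp add: qf_def matrix_vector_mult_add_rdistrib inner_add_right scaleR_matrix_vector_assoc[symmetric])
  let ?e = "\<lambda>v t. ex (of_real (qf (A + t *\<^sub>R B) (int_vec v)) * z)"
  have bnd: "(1 + (norm (int_vec v))\<^sup>2) * norm (?e v t) \<le> M v" if t: "\<bar>t\<bar> < r" for v t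
  proof -
    let ?x = "int_vec v"
    have "\<bar>t * qf B ?x\<bar> \<le> r * ((b + 1) * (norm ?x)\<^sup>2)"
      unfolding abs_mult using t r
      by (intro mult_mono order_trans[OF qB[of ?x]] mult_right_mono) auto
    also have "r * (b + 1) = a / 2" using b(1) by (simp add: r_def field_simps)
    hence "r * ((b + 1) * (norm ?x)\<^sup>2) = (a / 2) * (norm ?x)\<^sup>2" by (simp only: mult.assoc[symmetric])
    finally have "qf A ?x + t * qf B ?x \<ge> (a / 2) * (norm ?x)\<^sup>2"
      using a(2)[of ?x] by (simp add: abs_le_iff)
    hence "2 * pi * Im z * ((a / 2) * (norm ?x)\<^sup>2) \<le> 2 * pi * Im z * (qf A ?x + t * qf B ?x)"
      using z by (intro mult_left_mono) auto
    hence "norm (?e v t) \<le> exp (- (2 * pi * (a / 2) * Im z) * (norm ?x)\<^sup>2)"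
      by (simp add: norm_ex q mult_ac)
    hence "(1 + (norm ?x)\<^sup>2) * norm (?e v t) \<le> (1 + (norm ?x)\<^sup>2) * exp (- (2 * pi * (a / 2) * Im z) * (norm ?x)\<^sup>2)"
      by (intro mult_left_mono) auto
    also have "\<dots> \<le> M v" using M(2)[of 0 v] by simp
    finally show ?thesis .
  qed
  have "((\<lambda>t. \<Sum>\<^sub>\<infinity>v. ?e v t) has_vector_derivative
      (\<Sum>\<^sub>\<infinity>v. 2 * of_real pi * \<i> * z * (of_real (qf B (int_vec v)) * ?e v 0))) (at 0)"
  proof (rule infsum_has_vector_derivative[where M = "\<lambda>v. (2 * pi * norm z * b) * M v", OF r])
    fix v t
    have "((\<lambda>t. complex_of_real (qf A (int_vec v) + t * qf B (int_vec v))) has_vector_derivative of_real (qf B (int_vec v))) (at t)"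
      by (rule has_vector_derivative_of_real) (auto intro!: derivative_eq_intros)
    from has_vector_derivative_ex[OF has_vector_derivative_mult_left[OF this, of z]]
    show "((\<lambda>t. ?e v t) has_vector_derivative 2 * of_real pi * \<i> * z * (of_real (qf B (int_vec v)) * ?e v t)) (at t)"
      unfolding q by (rule has_vector_derivative_eq_rhs) simp
  next
    fix v t assume t: "\<bar>t\<bar> < r"
    have "\<bar>qf B (int_vec v)\<bar> * norm (?e v t) \<le> (b * (1 + (norm (int_vec v))\<^sup>2)) * norm (?e v t)"
      using qB[of "int_vec v"] b(1) by (intro mult_right_mono) (auto simp: algebra_simps)
    also have "\<dots> \<le> b * M v" using bnd[OF t, of v] b(1) by (simp add: mult.assoc mult_left_mono)
    finally have "2 * pi * norm z * (\<bar>qf B (int_vec v)\<bar> * norm (?e v t)) \<le> 2 * pi * norm z * (b * M v)"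
      by (intro mult_left_mono) auto
    thus "norm (2 * of_real pi * \<i> * z * (of_real (qf B (int_vec v)) * ?e v t)) \<le> (2 * pi * norm z * b) * M v"
      by (simp add: norm_mult mult_ac)
  next
    show "(\<lambda>v. (2 * pi * norm z * b) * M v) summable_on UNIV"
      by (rule summable_on_cmult_right[OF M(1)])
  next
    fix t assume t: "\<bar>t\<bar> < r"
    have "norm (?e v t) \<le> M v" for v
    proof -
      have "1 * norm (?e v t) \<le> (1 + (norm (int_vec v))\<^sup>2) * norm (?e v t)"
        by (intro mult_right_mono) auto
      thus ?thesis using bnd[OF t, of v] by linarith
    qed
    thus "(\<lambda>v. ?e v t) summable_on UNIV"
      by (intro abs_summable_summable[OF Infinite_Sum.abs_summable_on_comparison_test'[OF M(1)]])
  qed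
  moreover have "(\<lambda>t. \<Sum>\<^sub>\<infinity>v. ?e v t) = (\<lambda>t. theta_series (A + t *\<^sub>R B) z)"
    by (simp add: theta_series_def ex_def qf_def mult_ac)
  ultimately have "((\<lambda>t. theta_series (A + t *\<^sub>R B) z) has_vector_derivative
      (2 * of_real pi * \<i> * z) * wtheta (\<lambda>x. of_real (qf B x)) 0 z) (at 0)"
    by (simp only: infsum_cmult_right' wtheta_def) simp
  hence "vector_derivative (\<lambda>t. theta_series (A + t *\<^sub>R B) z) (at 0) =
      (2 * of_real pi * \<i> * z) * wtheta (\<lambda>x. of_real (qf B x)) 0 z"
    by (rule vector_derivative_at)
  moreover have "z \<noteq> 0" using z by auto
  ultimately show ?thesis by (simp add: partial_theta_def)
qed

end

text \<open>The condition that \<open>form_level\<close> minimises, stated for any \<open>l\<close>: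
  it is also applied to the dual form with the same \<open>l\<close> and to the unit form with
  4.\<close>

definition even_mat :: "real ^ 'n ^ 'n \<Rightarrow> nat \<Rightarrow> bool" where
  "even_mat A l \<longleftrightarrow> l > 0 \<and> even_integral (real l *\<^sub>R matrix_inv (2 *\<^sub>R A))"

section \<open>Integral forms, the adjoint of 2A and twisted Gauss sums\<close>

locale integral_form = posdef_form A for A :: "real ^ 'n ^ 'n" +
  fixes l :: nat
  assumes integer_valued: "integer_valued A" and level: "even_mat A l"
begin

lemma l_pos: "l > 0" using level by (simp add: even_mat_def)

lemma qf_Ints: "qf A (int_vec v) \<in> \<int>"
  using integer_valued by (simp add: integer_valued_def qf_def)

definition q :: "int ^ 'n \<Rightarrow> int" where
  "q v = \<lfloor>qf A (int_vec v)\<rfloor>"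

text \<open>The polar form of \<open>q\<close>, with matrix 2A: integral even where A itself has
  half-integral entries.\<close>

definition bl :: "int ^ 'n \<Rightarrow> int ^ 'n \<Rightarrow> int" where
  "bl v w = q (v + w) - q v - q w"

lemma of_int_q: "of_int (q v) = qf A (int_vec v)"
  using qf_Ints[of v] by (auto simp: q_def elim: Ints_cases)

lemma of_int_bl: "of_int (bl v w) = 2 * (int_vec v \<bullet> (A *v int_vec w))"
  by (simp add: bl_def of_int_q int_vec_add qf_add[OF sym])

lemma bl_add_left: "bl (u + v) w = bl u w + bl v w"
proof -
  have "real_of_int (bl (u + v) w) = of_int (bl u w + bl v w)"
    by (simp add: of_int_bl int_vec_add inner_add_left)
  thus ?thesis by (simp only: of_int_eq_iff)
qed

lemma bl_scale_left: "bl (k *s v) w = k * bl v w"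
proof -
  have "real_of_int (bl (k *s v) w) = of_int (k * bl v w)"
    by (simp add: of_int_bl int_vec_scale)
  thus ?thesis by (simp only: of_int_eq_iff)
qed

lemma bl_commute: "bl v w = bl w v"
  by (simp add: bl_def add.commute)

lemma bl_scale_right: "bl w (k *s v) = k * bl w v"
  using bl_scale_left bl_commute by metis

lemma q_add: "q (v + w) = q v + q w + bl v w"
  by (simp add: bl_def)

lemma q_scale: "q (k *s v) = k\<^sup>2 * q v"
proof -
  have "real_of_int (q (k *s v)) = of_int (k\<^sup>2 * q v)"
    by (simp add: of_int_q int_vec_scale qf_scaleR)
  thus ?thesis by (simp only: of_int_eq_iff)
qed

lemma bl_self: "bl v v = 2 * q v"
proof -
  have "real_of_int (bl v v) = of_int (2 * q v)" by (simp add: of_int_bl of_int_q qf_def)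
  thus ?thesis by (simp only: of_int_eq_iff)
qed

lemma q_minus: "q (- v) = q v"
  by (simp add: q_def int_vec_minus)

definition phase :: "int \<Rightarrow> int \<Rightarrow> int ^ 'n \<Rightarrow> complex" where
  "phase b d v = ex (of_int (b * q v) / of_int d)"

definition gauss :: "int \<Rightarrow> int \<Rightarrow> complex" where
  "gauss b d = (\<Sum>g\<in>box_mod d. phase b d g)"

lemma periodic_phase: "d \<noteq> 0 \<Longrightarrow> periodic_mod d (phase b d)"
  unfolding periodic_mod_def
proof (intro allI)
  fix v w assume d: "d \<noteq> 0"
  have "of_int (b * q (v + d *s w)) / of_int d - of_int (b * q v) / (of_int d :: complex)
     = of_int (b * (d * q w + bl v w))"
    using d by (simp add: q_add q_scale bl_scale_right field_simps power2_eq_square)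
  thus "phase b d (v + d *s w) = phase b d v"
    unfolding phase_def by (intro ex_cong_Ints) (metis Ints_of_int)
qed

lemma inv_two: "matrix_inv (2 *\<^sub>R A) = (1/2) *\<^sub>R Ai"
proof -
  have 1: "(2 *\<^sub>R A) ** ((1/2) *\<^sub>R Ai) = mat 1" "((1/2) *\<^sub>R Ai) ** (2 *\<^sub>R A) = mat 1"
    using A_Ai Ai_A by (simp_all add: matrix_matrix_mult_def)
  hence "\<exists>X. (2 *\<^sub>R A) ** X = mat 1 \<and> X ** (2 *\<^sub>R A) = mat 1" by blast
  hence "(2 *\<^sub>R A) ** matrix_inv (2 *\<^sub>R A) = mat 1"
    unfolding matrix_inv_def by (metis (mono_tags, lifting) someI_ex)
  thus ?thesis
    by (metis 1(2) matrix_mul_assoc matrix_mul_lid matrix_mul_rid)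
qed

lemma level_matrix: "even_integral ((real l / 2) *\<^sub>R Ai)"
  using level by (simp add: even_mat_def inv_two)

text \<open>\<open>adj\<close> is the matrix \<open>l (2A)\<^sup>-\<^sup>1\<close> acting on integer vectors.\<close>

definition adj :: "int ^ 'n \<Rightarrow> int ^ 'n" where
  "adj v = (\<chi> i. \<lfloor>(((real l / 2) *\<^sub>R Ai) *v int_vec v) $ i\<rfloor>)"

lemma int_vec_adj: "int_vec (adj v) = (real l / 2) *\<^sub>R (Ai *v int_vec v)"
proof (subst vec_eq_iff, intro allI)
  fix i
  have "(((real l / 2) *\<^sub>R Ai) *v int_vec v) $ i \<in> \<int>"
    unfolding matrix_vector_mult_def vec_lambda_beta
    by (intro Ints_sum Ints_mult) (use level_matrix in \<open>auto simp: even_integral_def\<close>)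
  hence "int_vec (adj v) $ i = (((real l / 2) *\<^sub>R Ai) *v int_vec v) $ i"
    by (auto simp: adj_def elim: Ints_cases)
  also have "((real l / 2) *\<^sub>R Ai) *v int_vec v = (real l / 2) *\<^sub>R (Ai *v int_vec v)"
    by (rule scaleR_matrix_vector_assoc[symmetric])
  finally show "int_vec (adj v) $ i = ((real l / 2) *\<^sub>R (Ai *v int_vec v)) $ i" .
qed

lemma even_integral_qf:
  fixes N :: "real ^ 'n ^ 'n"
  assumes N: "even_integral N" and s: "transpose N = N"
  obtains k :: int where "qf N (int_vec v) = 2 * of_int k"
proof -
  have "qf N (int_vec (\<Sum>i\<in>S. axis i (v $ i))) \<in> range (\<lambda>k::int. 2 * of_int k)" if "finite S" for S
    using that
  proof (induction S rule: finite_induct)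
    case empty
    show ?case by (auto intro: range_eqI[of _ _ 0])
  next
    case (insert j S)
    let ?u = "int_vec (axis j (v $ j)) :: real ^ 'n" and ?w = "int_vec (\<Sum>i\<in>S. axis i (v $ i)) :: real ^ 'n"
    have u: "?u = of_int (v $ j) *\<^sub>R axis j 1" by (simp add: vec_eq_iff axis_def)
    obtain k where k: "qf N ?w = 2 * of_int k" using insert.IH by auto
    obtain m :: int where m: "N $ j $ j = 2 * of_int m" using N unfolding even_integral_def by blast
    have "qf N ?u = 2 * of_int ((v $ j)\<^sup>2 * m)"
      unfolding u qf_scaleR by (simp add: qf_def inner_axis' matrix_vector_mult_basis column_def m)
    moreover have "?u \<bullet> (N *v ?w) \<in> \<int>"
      unfolding inner_vec_def matrix_vector_mult_def vec_lambda_beta inner_real_def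
      by (intro Ints_sum Ints_mult) (use N in \<open>auto simp: even_integral_def\<close>)
    then obtain p where "?u \<bullet> (N *v ?w) = of_int p" by (auto elim: Ints_cases)
    ultimately have "qf N (?u + ?w) = 2 * of_int ((v $ j)\<^sup>2 * m + k + p)"
      unfolding qf_add[OF s] using k by simp
    hence "qf N (?u + ?w) \<in> range (\<lambda>k::int. 2 * of_int k)" by blast
    moreover have "int_vec (\<Sum>i\<in>insert j S. axis i (v $ i)) = ?u + ?w"
      using insert.hyps by (simp add: int_vec_add)
    ultimately show ?case by (simp only:)
  qed
  moreover have "(\<Sum>i\<in>UNIV. axis i (v $ i)) = v"
    by (simp add: vec_eq_iff axis_def)
  ultimately have "qf N (int_vec v) \<in> range (\<lambda>k::int. 2 * of_int k)"
    by (metis finite_class.finite_UNIV)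
  thus ?thesis using that by blast
qed

text \<open>The matrix \<open>l (2A)\<^sup>-\<^sup>1\<close> has an even diagonal and its
  off-diagonal entries occur twice, so its values are even; this accounts for the denominator 4
  instead of 2.\<close>

lemma level_qf: "real l * qf Ai (int_vec v) / 4 \<in> \<int>"
proof -
  have s: "transpose ((real l / 2) *\<^sub>R Ai) = (real l / 2) *\<^sub>R Ai"
    using Ai_sym by (metis transpose_scalar)
  obtain k :: int where "qf ((real l / 2) *\<^sub>R Ai) (int_vec v) = 2 * of_int k"
    using even_integral_qf[OF level_matrix s] by blast
  hence "real l * qf Ai (int_vec v) / 4 = of_int k"
    by (simp add: qf_def flip: scaleR_matrix_vector_assoc)
  thus ?thesis by simp
qed

text \<open>Since \<open>l\<close> divides \<open>c\<close>, the vector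
  \<open>w = (c / 2) A\<^sup>-\<^sup>1 \<xi>\<close> is integral. Replacing g by g - w in the Gauss
  sum, and using that b c is - 1 modulo d, produces exactly the character and the correction factor;
  hence the twisted sum does not depend on \<xi>.\<close>

lemma gauss_twist:
  assumes det: "a * d - b * c = 1" and lc: "int l dvd c" and d: "d > 0"
  shows "(\<Sum>g\<in>box_mod d. phase b d g * chr \<xi> ((1 / of_int d) *\<^sub>R int_vec g)) *
     ex (- of_int c * of_real (qf Ai (int_vec \<xi>)) / (4 * of_int d)) = gauss b d"
proof -
  obtain c' where c': "c = int l * c'" using lc by auto
  define w where "w = c' *s adj \<xi>"
  have w: "int_vec w = (of_int c / 2) *\<^sub>R (Ai *v int_vec \<xi>)"
    by (simp add: w_def int_vec_scale int_vec_adj c')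
  have qw: "of_int (q w) = (of_int c)\<^sup>2 * qf Ai (int_vec \<xi>) / 4"
    by (simp add: of_int_q w qf_scaleR qf_Ai power2_eq_square)
  obtain k where k: "of_int c * qf Ai (int_vec \<xi>) / 4 = of_int k"
  proof -
    have "of_int c' * (real l * qf Ai (int_vec \<xi>) / 4) \<in> \<int>" by (intro Ints_mult level_qf) auto
    thus ?thesis using that by (auto simp: c' mult_ac elim!: Ints_cases)
  qed
  have qw': "q w = c * k"
  proof -
    have "real_of_int (q w) = of_int (c * k)" by (simp add: qw k[symmetric] power2_eq_square)
    thus ?thesis by (simp only: of_int_eq_iff)
  qed
  have blw: "of_int (bl g w) = of_int c * (int_vec g \<bullet> int_vec \<xi>)" for g
    by (simp add: of_int_bl w matrix_vector_mult_scaleR)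
  have "phase b d (g + (- w)) = phase b d g * chr \<xi> ((1 / of_int d) *\<^sub>R int_vec g) * ex (- of_int c * of_real (qf Ai (int_vec \<xi>)) / (4 * of_int d))" for g
  proof -
    obtain m where m: "int_vec g \<bullet> int_vec \<xi> = of_int m"
      using inner_int_vec_Ints by (metis Ints_cases)
    have blm: "bl g w = c * m"
      using blw[of g] unfolding m by (metis of_int_eq_iff of_int_mult)
    have "bl g (- w) = - (c * m)"
    proof -
      have "- w = (-1) *s w" by (simp add: vec_eq_iff)
      thus ?thesis using bl_scale_right[of g "-1" w] blm by (simp only:)
    qed
    hence "q (g + - w) = q g + c * k - c * m"
      unfolding q_add q_minus qw' by simp
    moreover have "b * (q g + c * k - c * m) = b * q g + (b * c) * (k - m)"
      by (simp add: algebra_simps)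
    moreover have "b * c = a * d - 1" using det by simp
    ultimately have "b * q (g + - w) = b * q g + (a * d - 1) * (k - m)"
      by (simp only:)
    hence "of_int (b * q (g + - w)) / (of_int d :: complex) = of_int (b * q g + (a * d - 1) * (k - m)) / of_int d"
      by (simp only:)
    also have "\<dots> = (of_int (b * q g) / of_int d + of_int m / of_int d - of_int k / of_int d) + (of_int ((k - m) * a) :: complex)"
      using d by (simp add: divide_simps) (simp add: algebra_simps)
    finally have "of_int (b * q (g + - w)) / (of_int d :: complex) = (of_int (b * q g) / of_int d + of_int m / of_int d - of_int k / of_int d) + of_int ((k - m) * a)" .
    hence "phase b d (g + - w) = ex (of_int (b * q g) / of_int d + of_int m / of_int d - of_int k / of_int d)"
      unfolding phase_def by (intro ex_cong_Ints) (simp del: of_int_mult)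
    also have "\<dots> = ex (of_int (b * q g) / of_int d) * ex (of_int m / of_int d) * ex (- (of_int k / of_int d))"
      by (simp flip: ex_add)
    also have "ex (of_int m / of_int d) = chr \<xi> ((1 / of_int d) *\<^sub>R int_vec g)"
      using m by (simp add: chr_def inner_commute)
    also have "- (of_int k / of_int d) = - of_int c * complex_of_real (qf Ai (int_vec \<xi>)) / (4 * of_int d)"
    proof -
      have "(of_int k :: complex) = of_real (of_int c * qf Ai (int_vec \<xi>) / 4)" by (simp only: k of_real_of_int_eq)
      thus ?thesis using d by (simp add: field_simps)
    qed
    finally show ?thesis by (simp add: phase_def)
  qed
  hence "(\<Sum>g\<in>box_mod d. phase b d g * chr \<xi> ((1 / of_int d) *\<^sub>R int_vec g)) *
     ex (- of_int c * of_real (qf Ai (int_vec \<xi>)) / (4 * of_int d)) = (\<Sum>g\<in>box_mod d. phase b d (g + (- w)))"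
    by (simp add: sum_distrib_right)
  also have "\<dots> = gauss b d"
    unfolding gauss_def using d by (intro sum_box_shift periodic_phase) auto
  finally show ?thesis .
qed

end

lemma infsum_finite_sum:
  fixes f :: "'a \<Rightarrow> 'b \<Rightarrow> 'c :: {topological_comm_monoid_add, t2_space}"
  assumes "finite I" "\<And>i. i \<in> I \<Longrightarrow> f i summable_on X"
  shows "(\<Sum>\<^sub>\<infinity>x\<in>X. \<Sum>i\<in>I. f i x) = (\<Sum>i\<in>I. \<Sum>\<^sub>\<infinity>x\<in>X. f i x)
    \<and> (\<lambda>x. \<Sum>i\<in>I. f i x) summable_on X"
  using assms by (induction I rule: finite_induct) (simp_all add: infsum_add summable_on_add)

lemma norm_powr_of_real:
  fixes w :: complex
  assumes "w \<noteq> 0"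
  shows "norm (w powr of_real s) = norm w powr s"
  using assms by (simp add: powr_def)

section \<open>Moebius maps, the point \<tau> and the square root factor\<close>

lemma Im_real_moebius:
  fixes \<alpha> \<beta> \<gamma> \<delta> :: real
  shows "Im ((of_real \<alpha> * z + of_real \<beta>) / (of_real \<gamma> * z + of_real \<delta>)) =
    (\<alpha> * \<delta> - \<beta> * \<gamma>) * Im z / (norm (of_real \<gamma> * z + of_real \<delta>))\<^sup>2"
proof -
  let ?u = "of_real \<alpha> * z + of_real \<beta>" and ?v = "of_real \<gamma> * z + of_real \<delta>"
  have "Im (?u / ?v) = (Im ?u * Re ?v - Re ?u * Im ?v) / (norm ?v)\<^sup>2"
    by (simp add: Im_divide cmod_power2)
  also have "Im ?u * Re ?v - Re ?u * Im ?v = (\<alpha> * \<delta> - \<beta> * \<gamma>) * Im z"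
    by (simp add: algebra_simps)
  finally show ?thesis .
qed

lemma linear_nonzero:
  assumes "Im z > 0" "(c :: int) \<noteq> 0 \<or> d \<noteq> 0"
  shows "of_int c * z + of_int d \<noteq> (0 :: complex)"
proof
  assume eq: "of_int c * z + of_int d = 0"
  hence "Im (of_int c * z + of_int d) = 0" by simp
  hence c: "c = 0" using assms by simp
  thus False using eq assms by simp
qed

lemma Im_moebius:
  assumes "a * d - b * c = 1"
  shows "Im (moebius a b c d z) = Im z / (norm (of_int c * z + of_int d))\<^sup>2"
proof -
  have "real_of_int a * of_int d - of_int b * of_int c = 1"
    using assms by (metis of_int_1 of_int_diff of_int_mult)
  thus ?thesis
    using Im_real_moebius[of "of_int a" z "of_int b" "of_int c" "of_int d"]
    by (simp add: moebius_def)
qed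

lemma Im_moebius_pos:
  assumes "a * d - b * c = 1" "Im z > 0"
  shows "Im (moebius a b c d z) > 0"
proof -
  have "c \<noteq> 0 \<or> d \<noteq> 0" using assms(1) by auto
  thus ?thesis using linear_nonzero[OF assms(2)] assms(2) by (simp add: Im_moebius[OF assms(1)])
qed

definition tau :: "int \<Rightarrow> int \<Rightarrow> complex \<Rightarrow> complex" where
  "tau c d z = of_int d * z / (of_int c * z + of_int d)"

text \<open>A square root of (c z + d) / d. Built from the branch used for the Gaussian mean, its
  n-th power is exactly the quotient of the means at \<tau> and z, with no sign left to
  determine.\<close>

definition rho :: "int \<Rightarrow> int \<Rightarrow> complex \<Rightarrow> complex" where
  "rho c d z = (- \<i> * tau c d z) powr (- 1 / 2) / (- \<i> * z) powr (- 1 / 2)"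

lemma Im_tau_pos:
  assumes "Im z > 0" "d \<noteq> 0"
  shows "Im (tau c d z) > 0"
  using Im_real_moebius[of "of_int d" z 0 "of_int c" "of_int d"] linear_nonzero[OF assms(1), of c d] assms
  by (simp add: tau_def flip: power2_eq_square)

lemma powr_half_sq: "w \<noteq> 0 \<Longrightarrow> (w powr (- 1 / 2))\<^sup>2 = 1 / (w :: complex)"
  by (simp add: power2_eq_square powr_minus inverse_eq_divide flip: powr_add)

lemma rho_sq:
  assumes z: "Im z > 0" and d: "d \<noteq> 0"
  shows "(rho c d z)\<^sup>2 = (of_int c * z + of_int d) / of_int d"
proof -
  have nz: "z \<noteq> 0" "tau c d z \<noteq> 0" "of_int c * z + of_int d \<noteq> 0"
    using z Im_tau_pos[OF z d, of c] linear_nonzero[OF z, of c d] d by auto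
  have "(rho c d z)\<^sup>2 = z / tau c d z"
  proof -
    have w: "- \<i> * tau c d z \<noteq> 0" "- \<i> * z \<noteq> 0" using nz by auto
    show ?thesis
      unfolding rho_def power_divide powr_half_sq[OF w(1)] powr_half_sq[OF w(2)] using nz by simp
  qed
  also have "\<dots> = (of_int c * z + of_int d) / of_int d"
    using nz d by (simp add: tau_def)
  finally show ?thesis .
qed

lemma rho_nonzero: "Im z > 0 \<Longrightarrow> d \<noteq> 0 \<Longrightarrow> rho c d z \<noteq> 0"
  using rho_sq[of z d c] linear_nonzero[of z c d] by auto

lemma powr_half_power: "w \<noteq> 0 \<Longrightarrow> (w powr (- 1 / 2)) ^ n = (w :: complex) powr (- (of_nat n / 2))"
proof (induction n)
  case (Suc n)
  have "(w powr (- 1 / 2)) ^ Suc n = w powr (- 1 / 2) * w powr (- (of_nat n / 2))"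
    using Suc by simp
  also have "\<dots> = w powr (- 1 / 2 + - (of_nat n / 2))" by (rule powr_add[symmetric])
  also have "- 1 / 2 + - (of_nat n / 2) = - (of_nat (Suc n) / (2 :: complex))"
    by (simp add: field_simps)
  finally show ?case .
qed simp

lemma moebius_tau:
  assumes det: "a * d - b * c = 1" and z: "Im z > 0" and d: "d \<noteq> 0"
  shows "moebius a b c d z = of_int b / of_int d + tau c d z / (of_int d)\<^sup>2"
proof -
  have nz: "of_int c * z + of_int d \<noteq> 0" using linear_nonzero[OF z, of c d] d by auto
  have "complex_of_int a * of_int d = of_int b * of_int c + 1"
    using det by (metis add.commute diff_add_cancel of_int_1 of_int_add of_int_mult)
  hence "(of_int a * z + of_int b) * of_int d = of_int b * (of_int c * z + of_int d) + z"
    by (simp add: algebra_simps)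
  thus ?thesis
    unfolding moebius_def tau_def using nz d by (simp add: divide_simps power2_eq_square) algebra
qed

text \<open>In the coordinate - 1 / (4 z) the passage from z to \<tau> is a real translation, so
  each term of the dual series only acquires a phase.\<close>

lemma dual_tau:
  assumes "Im z > 0" "d \<noteq> 0"
  shows "dual_pt (tau c d z) = - of_int c / (4 * of_int d) + dual_pt z"
proof -
  have "z \<noteq> 0" "of_int c * z + of_int d \<noteq> 0" using linear_nonzero[OF assms(1), of c d] assms by auto
  thus ?thesis using assms(2) by (simp add: dual_pt_def tau_def divide_simps) algebra
qed

context posdef_form
begin

lemma theta_mean_tau:
  assumes z: "Im z > 0" and d: "d \<noteq> 0"
  shows "theta_mean (tau c d z) = rho c d z ^ CARD('n) * theta_mean z"
proof -
  obtain C where C: "\<And>z. Im z > 0 \<Longrightarrow> theta_mean z = C * (- \<i> * z) powr (- (of_nat CARD('n) / 2))"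
    using theta_mean_powr by blast
  have nz: "- \<i> * z \<noteq> 0" "- \<i> * tau c d z \<noteq> 0"
    using z Im_tau_pos[OF z d, of c] by auto
  have "(- \<i> * z) powr (- (of_nat CARD('n) / 2)) \<noteq> 0" using nz by (simp add: powr_def)
  thus ?thesis
    unfolding C[OF z] C[OF Im_tau_pos[OF z d]] rho_def power_divide
      powr_half_power[OF nz(1)] powr_half_power[OF nz(2)]
    by simp
qed

lemma norm_theta_mean:
  obtains C where "C \<ge> 0" "\<And>z. Im z > 0 \<Longrightarrow> norm (theta_mean z) = C * norm z powr (- (real CARD('n) / 2))"
proof -
  obtain C where C: "\<And>z. Im z > 0 \<Longrightarrow> theta_mean z = C * (- \<i> * z) powr (- (of_nat CARD('n) / 2))"
    using theta_mean_powr by blast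
  have "norm (theta_mean z) = norm C * norm z powr (- (real CARD('n) / 2))" if z: "Im z > 0" for z
  proof -
    have eq: "- (of_nat CARD('n) / 2) = complex_of_real (- (real CARD('n) / 2))" by simp
    have nz: "- \<i> * z \<noteq> 0" using z by auto
    show ?thesis
      unfolding C[OF z] norm_mult[of C] eq norm_powr_of_real[OF nz] by (simp add: norm_mult)
  qed
  thus ?thesis using that[of "norm C"] by simp
qed

end

section \<open>Transformation laws from cosets modulo d\<close>

context integral_form
begin

text \<open>Every lattice vector is g + d w, that is, d times w + g / d. The scaling by d is
  absorbed by the division of t by the square of d and by \<open>\<delta>\<close>, while b / d
  leaves a phase depending only on the class of g.\<close>

lemma wtheta_cosets:
  assumes d: "d > 0" and t: "Im t > 0" and p: "quad_growth p"
    and hom: "\<And>x. p (of_int d *\<^sub>R x) = \<delta> * p x"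
  shows "wtheta p 0 (of_int b / of_int d + t / (of_int d)\<^sup>2) =
    \<delta> * (\<Sum>g\<in>box_mod d. phase b d g * wtheta p ((1 / of_int d) *\<^sub>R int_vec g) t)"
proof -
  let ?z = "of_int b / of_int d + t / (of_int d)\<^sup>2 :: complex"
  have "?z = of_real (of_int b / of_int d) + t / of_real ((of_int d)\<^sup>2)" by simp
  hence "Im ?z = Im t / (of_int d)\<^sup>2" by (simp only: plus_complex.sel Im_complex_of_real Im_divide_of_real)
  hence z: "Im ?z > 0" using t d by simp
  let ?f = "\<lambda>v. p (int_vec v) * ex (of_real (qf A (int_vec v)) * ?z)"
  have "?f summable_on UNIV"
    using abs_summable_summable[OF wtheta_summable[OF p z, of 0]] by simp
  hence "wtheta p 0 ?z = (\<Sum>g\<in>box_mod d. \<Sum>\<^sub>\<infinity>w. ?f (g + d *s w))"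
    using infsum_box_split[OF d] by (simp add: wtheta_def)
  also have "\<dots> = (\<Sum>g\<in>box_mod d. \<Sum>\<^sub>\<infinity>w. (\<delta> * phase b d g) *
     (p (int_vec w + (1 / of_int d) *\<^sub>R int_vec g) * ex (of_real (qf A (int_vec w + (1 / of_int d) *\<^sub>R int_vec g)) * t)))"
  proof (intro sum.cong infsum_cong refl)
    fix g w :: "int ^ 'n"
    let ?x = "int_vec w + (1 / of_int d) *\<^sub>R int_vec g"
    have v: "int_vec (g + d *s w) = of_int d *\<^sub>R ?x"
      using d by (simp add: int_vec_add int_vec_scale scaleR_add_right)
    have "of_real (qf A (int_vec (g + d *s w))) * ?z =
       of_int (b * q (g + d *s w)) / of_int d + of_real (qf A ?x) * t"
    proof -
      have "of_int (q (g + d *s w)) = complex_of_real (qf A (int_vec (g + d *s w)))"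
        by (metis of_int_q of_real_of_int_eq)
      moreover have "complex_of_real (qf A (int_vec (g + d *s w))) = (of_int d)\<^sup>2 * of_real (qf A ?x)"
        unfolding v qf_scaleR by simp
      ultimately show ?thesis using d by (simp add: field_simps power2_eq_square)
    qed
    hence "ex (of_real (qf A (int_vec (g + d *s w))) * ?z) = phase b d (g + d *s w) * ex (of_real (qf A ?x) * t)"
      by (simp add: ex_add phase_def)
    moreover have "phase b d (g + d *s w) = phase b d g"
      using periodic_phase[of d b] d by (simp add: periodic_mod_def)
    ultimately show "?f (g + d *s w) = (\<delta> * phase b d g) * (p ?x * ex (of_real (qf A ?x) * t))"
      unfolding v hom by simp
  qed
  also have "\<dots> = \<delta> * (\<Sum>g\<in>box_mod d. phase b d g * wtheta p ((1 / of_int d) *\<^sub>R int_vec g) t)"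
    by (simp add: infsum_cmult_right' wtheta_def sum_distrib_left mult.assoc)
  finally show ?thesis .
qed

text \<open>After the interchange of sums, the phase from \<open>dual_tau\<close> meets the inner
  sum over g; by \<open>gauss_twist\<close> their product is the same for every \<xi>.\<close>

lemma wdual_cosets:
  assumes det: "a * d - b * c = 1" and lc: "int l dvd c" and d: "d > 0" and z: "Im z > 0"
    and p: "quad_growth p"
  shows "(\<Sum>g\<in>box_mod d. phase b d g * wdual p ((1 / of_int d) *\<^sub>R int_vec g) (tau c d z)) =
    gauss b d * wdual p 0 z"
proof -
  have t: "Im (tau c d z) > 0" using Im_tau_pos[OF z] d by simp
  let ?T = "\<lambda>g \<xi>. p (int_vec \<xi>) * ex (of_real (qf Ai (int_vec \<xi>)) * dual_pt (tau c d z)) * chr \<xi> ((1 / of_int d) *\<^sub>R int_vec g)"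
  have "(\<Sum>g\<in>box_mod d. phase b d g * wdual p ((1 / of_int d) *\<^sub>R int_vec g) (tau c d z)) =
     (\<Sum>g\<in>box_mod d. \<Sum>\<^sub>\<infinity>\<xi>. phase b d g * ?T g \<xi>)"
    by (simp add: wdual_def infsum_cmult_right')
  also have "\<dots> = (\<Sum>\<^sub>\<infinity>\<xi>. \<Sum>g\<in>box_mod d. phase b d g * ?T g \<xi>)"
    by (rule infsum_finite_sum[THEN conjunct1, symmetric])
       (intro finite_box_mod summable_on_cmult_right wdual_summable[OF p t])+
  also have "\<dots> = (\<Sum>\<^sub>\<infinity>\<xi>. gauss b d * (p (int_vec \<xi>) * ex (of_real (qf Ai (int_vec \<xi>)) * dual_pt z) * chr \<xi> 0))"
  proof (intro infsum_cong)
    fix \<xi>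
    have "ex (of_real (qf Ai (int_vec \<xi>)) * dual_pt (tau c d z)) =
       ex (- of_int c * of_real (qf Ai (int_vec \<xi>)) / (4 * of_int d)) * ex (of_real (qf Ai (int_vec \<xi>)) * dual_pt z)"
    proof -
      have "of_real (qf Ai (int_vec \<xi>)) * dual_pt (tau c d z) =
          - of_int c * of_real (qf Ai (int_vec \<xi>)) / (4 * of_int d) + of_real (qf Ai (int_vec \<xi>)) * dual_pt z"
        using d by (subst dual_tau[OF z]) (simp_all add: ring_distribs mult_ac)
      thus ?thesis by (simp only: ex_add)
    qed
    hence "(\<Sum>g\<in>box_mod d. phase b d g * ?T g \<xi>) =
      ((\<Sum>g\<in>box_mod d. phase b d g * chr \<xi> ((1 / of_int d) *\<^sub>R int_vec g)) *
        ex (- of_int c * of_real (qf Ai (int_vec \<xi>)) / (4 * of_int d))) *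
      (p (int_vec \<xi>) * ex (of_real (qf Ai (int_vec \<xi>)) * dual_pt z))"
      by (simp only: sum_distrib_right) (intro sum.cong refl, simp only: mult_ac)
    thus "(\<Sum>g\<in>box_mod d. phase b d g * ?T g \<xi>) =
        gauss b d * (p (int_vec \<xi>) * ex (of_real (qf Ai (int_vec \<xi>)) * dual_pt z) * chr \<xi> 0)"
      using gauss_twist[OF det lc d] by simp
  qed
  also have "\<dots> = gauss b d * wdual p 0 z"
    by (simp only: infsum_cmult_right' wdual_def)
  finally show ?thesis .
qed

lemma theta_transform:
  assumes det: "a * d - b * c = 1" and lc: "int l dvd c" and d: "d > 0" and z: "Im z > 0"
  shows "wtheta (\<lambda>_. 1) 0 (moebius a b c d z) = gauss b d * rho c d z ^ CARD('n) * wtheta (\<lambda>_. 1) 0 z"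
proof -
  have d0: "d \<noteq> 0" using d by simp
  have t: "Im (tau c d z) > 0" using Im_tau_pos[OF z d0] .
  have "wtheta (\<lambda>_. 1) 0 (moebius a b c d z) =
     (\<Sum>g\<in>box_mod d. phase b d g * wtheta (\<lambda>_. 1) ((1 / of_int d) *\<^sub>R int_vec g) (tau c d z))"
    unfolding moebius_tau[OF det z d0] by (subst wtheta_cosets[OF d t, of _ 1]) auto
  also have "\<dots> = theta_mean (tau c d z) * (gauss b d * wdual (\<lambda>_. 1) 0 z)"
    unfolding theta_inversion_mean[OF t] wdual_cosets[OF det lc d z quad_growth_const, symmetric]
    by (simp add: sum_distrib_left mult_ac)
  finally show ?thesis
    by (simp add: theta_mean_tau[OF z d0] theta_inversion_mean[OF z] mult_ac)
qed

text \<open>Inversion is used at \<tau> and backwards at z. The two trace terms carry different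
  functions of z, and their mismatch is what prevents modularity when the trace is nonzero.\<close>

lemma theta_qf_transform:
  assumes det: "a * d - b * c = 1" and lc: "int l dvd c" and d: "d > 0" and z: "Im z > 0"
  shows "wtheta (\<lambda>x. of_real (qf B x)) 0 (moebius a b c d z) =
    gauss b d * rho c d z ^ CARD('n) * (of_int c * z + of_int d)\<^sup>2 *
      (wtheta (\<lambda>x. of_real (qf B x)) 0 z + of_real (trace (B ** Ai)) / (4 * of_real pi * \<i> * z) * wtheta (\<lambda>_. 1) 0 z)
    - (of_int d)\<^sup>2 * of_real (trace (B ** Ai)) / (4 * of_real pi * \<i> * tau c d z) * wtheta (\<lambda>_. 1) 0 (moebius a b c d z)"
proof -
  have d0: "d \<noteq> 0" using d by simp
  have t: "Im (tau c d z) > 0" using Im_tau_pos[OF z d0] .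
  have z0: "z \<noteq> 0" using z by auto
  have nz: "of_int c * z + of_int d \<noteq> 0" using linear_nonzero[OF z, of c d] d0 by auto
  let ?T = "complex_of_real (trace (B ** Ai))" and ?C = "\<lambda>x. complex_of_real (qf (conj_form B) x)"
  let ?h = "\<lambda>g. (1 / of_int d) *\<^sub>R int_vec g :: real ^ 'n"
  have 1: "wtheta (\<lambda>_. 1) 0 (moebius a b c d z) = (\<Sum>g\<in>box_mod d. phase b d g * wtheta (\<lambda>_. 1) (?h g) (tau c d z))"
    unfolding moebius_tau[OF det z d0] by (subst wtheta_cosets[OF d t, of _ 1]) auto
  have "wtheta (\<lambda>x. of_real (qf B x)) 0 (moebius a b c d z) =
     (of_int d)\<^sup>2 * (\<Sum>g\<in>box_mod d. phase b d g * wtheta (\<lambda>x. of_real (qf B x)) (?h g) (tau c d z))"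
    unfolding moebius_tau[OF det z d0]
    by (subst wtheta_cosets[OF d t quad_growth_qf, of _ "(of_int d)\<^sup>2"]) (auto simp: qf_scaleR)
  also have "(\<Sum>g\<in>box_mod d. phase b d g * wtheta (\<lambda>x. of_real (qf B x)) (?h g) (tau c d z)) =
     theta_mean (tau c d z) / (4 * (tau c d z)\<^sup>2) * (\<Sum>g\<in>box_mod d. phase b d g * wdual ?C (?h g) (tau c d z))
     - ?T / (4 * of_real pi * \<i> * tau c d z) * wtheta (\<lambda>_. 1) 0 (moebius a b c d z)"
    unfolding theta_inversion_qf[OF t] 1 sum_distrib_left sum_subtractf[symmetric]
    by (intro sum.cong refl) (simp add: algebra_simps)
  also have "(\<Sum>g\<in>box_mod d. phase b d g * wdual ?C (?h g) (tau c d z)) = gauss b d * wdual ?C 0 z"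
    by (rule wdual_cosets[OF det lc d z quad_growth_qf])
  also have "theta_mean (tau c d z) / (4 * (tau c d z)\<^sup>2) * (gauss b d * wdual ?C 0 z) =
     gauss b d * rho c d z ^ CARD('n) * (z\<^sup>2 / (tau c d z)\<^sup>2) * (theta_mean z / (4 * z\<^sup>2) * wdual ?C 0 z)"
    unfolding theta_mean_tau[OF z d0] using z0 by (simp add: mult_ac)
  also have "theta_mean z / (4 * z\<^sup>2) * wdual ?C 0 z =
     wtheta (\<lambda>x. of_real (qf B x)) 0 z + ?T / (4 * of_real pi * \<i> * z) * wtheta (\<lambda>_. 1) 0 z"
    unfolding theta_inversion_qf[OF z] by simp
  \<comment> \<open>The two additional units of weight: the denominators
    \<open>4 * z\<^sup>2\<close> and the same expression at \<tau> leave the square of c z + d, up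
    to the square of d.\<close>
  also have "z\<^sup>2 / (tau c d z)\<^sup>2 = (of_int c * z + of_int d)\<^sup>2 / (of_int d)\<^sup>2"
    using z0 nz d0 by (simp add: tau_def power_divide power_mult_distrib)
  finally show ?thesis using d0 by (simp add: right_diff_distrib)
qed

end

section \<open>Bounds at the cusps and nonvanishing on the imaginary axis\<close>

context posdef_form
begin

lemma norm_wdual_bounded:
  assumes p: "quad_growth p" and Y: "Y > 0"
  obtains W where "W \<ge> 0" "\<And>z h. Im (dual_pt z) \<ge> Y \<Longrightarrow> norm (wdual p h z) \<le> W"
proof -
  obtain M where M: "M summable_on (UNIV :: (int ^ 'n) set)"
    "\<And>\<xi> z h. Im (dual_pt z) \<ge> Y \<Longrightarrow>
      norm (p (int_vec \<xi>) * ex (of_real (qf Ai (int_vec \<xi>)) * dual_pt z) * chr \<xi> h) \<le> M \<xi>"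
    using dual_domination[OF p Y] by metis
  have "norm (wdual p h z) \<le> max 0 (\<Sum>\<^sub>\<infinity>\<xi>. M \<xi>)" if "Im (dual_pt z) \<ge> Y" for z h
  proof -
    have "(\<lambda>\<xi>. p (int_vec \<xi>) * ex (of_real (qf Ai (int_vec \<xi>)) * dual_pt z) * chr \<xi> h) summable_on UNIV"
      by (rule abs_summable_summable[OF Infinite_Sum.abs_summable_on_comparison_test'[OF M(1) M(2)[OF that]]])
    hence "norm (wdual p h z) \<le> (\<Sum>\<^sub>\<infinity>\<xi>. M \<xi>)"
      unfolding wdual_def by (rule norm_infsum_le[OF has_sum_infsum has_sum_infsum[OF M(1)] M(2)[OF that]])
    thus ?thesis by simp
  qed
  thus ?thesis using that[of "max 0 (\<Sum>\<^sub>\<infinity>\<xi>. M \<xi>)"] by simp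
qed

lemma norm_wtheta_bounded:
  assumes p: "quad_growth p" and Y: "Y > 0"
  obtains W where "\<And>z. Im z \<ge> Y \<Longrightarrow> norm (wtheta p 0 z) \<le> W"
proof -
  obtain M where M: "M summable_on (UNIV :: (int ^ 'n) set)"
    "\<And>v h z. norm h \<le> 0 \<Longrightarrow> Im z \<ge> Y \<Longrightarrow>
      norm (p (int_vec v + h) * ex (of_real (qf A (int_vec v + h)) * z)) \<le> M v"
    using wtheta_domination[OF p Y] by metis
  have "norm (wtheta p 0 z) \<le> (\<Sum>\<^sub>\<infinity>\<xi>. M \<xi>)" if "Im z \<ge> Y" for z
  proof -
    have "(\<lambda>v. p (int_vec v + 0) * ex (of_real (qf A (int_vec v + 0)) * z)) summable_on UNIV"
      using M(2)[of 0 z] that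
      by (intro abs_summable_summable[OF Infinite_Sum.abs_summable_on_comparison_test'[OF M(1)]]) simp
    thus ?thesis
      unfolding wtheta_def
      by (rule norm_infsum_le[OF has_sum_infsum has_sum_infsum[OF M(1)] M(2)]) (use that in auto)
  qed
  thus ?thesis using that by blast
qed

text \<open>On the imaginary axis every term is positive, and the zero vector alone contributes
  1.\<close>

lemma theta_nonzero:
  assumes "y > 0"
  shows "wtheta (\<lambda>_. 1) 0 (\<i> * of_real y) \<noteq> 0"
proof -
  let ?f = "\<lambda>v. exp (- (2 * pi * y * qf A (int_vec v)))"
  have e: "1 * ex (of_real (qf A (int_vec v + 0)) * (\<i> * of_real y)) = of_real (?f v)" for v
    by (simp add: ex_def exp_of_real[symmetric] mult_ac)
  have "(\<lambda>v. norm (1 * ex (of_real (qf A (int_vec v + 0)) * (\<i> * of_real y)))) summable_on UNIV"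
    by (rule wtheta_summable) (use assms in auto)
  hence s: "?f summable_on UNIV" unfolding e by simp
  have "infsum ?f {0} \<le> infsum ?f UNIV"
    using s by (intro infsum_mono_neutral) auto
  hence "infsum ?f UNIV \<ge> 1" by simp
  moreover have "wtheta (\<lambda>_. 1) 0 (\<i> * of_real y) = of_real (infsum ?f UNIV)"
    unfolding wtheta_def e by (rule infsumI[OF has_sum_of_real_iff[THEN iffD2, OF has_sum_infsum[OF s]]])
  ultimately show ?thesis by (metis of_real_eq_0_iff not_one_le_zero)
qed

end

context integral_form
begin

lemma norm_phase [simp]: "norm (phase b d v) = 1"
proof -
  have "of_int (b * q v) / of_int d = complex_of_real (of_int (b * q v) / of_int d)" by simp
  thus ?thesis unfolding phase_def by (simp only: norm_ex Im_complex_of_real) simp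
qed

lemma wtheta_periodic: "wtheta p 0 (z + of_int m) = wtheta p 0 z"
proof -
  have "ex (of_real (qf A (int_vec v)) * (z + of_int m)) = ex (of_real (qf A (int_vec v)) * z)" for v
  proof (rule ex_cong_Ints)
    have "complex_of_real (qf A (int_vec v)) = of_int (q v)" by (metis of_int_q of_real_of_int_eq)
    hence "of_real (qf A (int_vec v)) * (z + of_int m) - of_real (qf A (int_vec v)) * z = of_int (q v * m)"
      by (simp add: algebra_simps)
    thus "of_real (qf A (int_vec v)) * (z + of_int m) - of_real (qf A (int_vec v)) * z \<in> \<int>"
      by (metis Ints_of_int)
  qed
  thus ?thesis by (simp add: wtheta_def)
qed

text \<open>With j = c z + d and t = - c / j one has g z = a / c + t / c^2. The dual point of t is j
  / (4 c), of height Im z / 4, so the dual series stays bounded, while the Gaussian mean and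
  \<kappa> together grow at most like the power of j that the prefactor removes. For the theta
  series \<kappa> is 1 and m = 0; for weights of trace zero it is 1 / (4 t^2) and m = 2.\<close>

lemma cusp_bounded_pos:
  assumes det: "a * d - b * c = 1" and c: "c > 0"
    and p: "quad_growth p" "quad_growth p'"
    and hom: "\<And>k x. p (k *\<^sub>R x) = of_real (k ^ m) * p x"
    and inv: "\<And>h t. Im t > 0 \<Longrightarrow> wtheta p h t = theta_mean t * \<kappa> t * wdual p' h t"
    and \<kappa>: "\<And>t. Im t > 0 \<Longrightarrow> norm (\<kappa> t) \<le> norm t powr (- real m)"
  shows "\<exists>W. \<forall>z. Im z \<ge> 1 \<longrightarrow> norm ((of_int c * z + of_int d) powr (- of_real (real CARD('n) / 2 + real m)) *
      wtheta p 0 (moebius a b c d z)) \<le> W"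
proof -
  define k where "k = real CARD('n) / 2 + real m"
  obtain W where W: "W \<ge> 0" "\<And>z h. Im (dual_pt z) \<ge> 1 / 4 \<Longrightarrow> norm (wdual p' h z) \<le> W"
    using norm_wdual_bounded[OF p(2), of "1/4"] by auto
  obtain C where C: "C \<ge> 0" "\<And>z. Im z > 0 \<Longrightarrow> norm (theta_mean z) = C * norm z powr (- (real CARD('n) / 2))"
    using norm_theta_mean by blast
  define V where "V = real_of_int c ^ m * (real (card (box_mod c :: (int ^ 'n) set)) * (C * of_int c powr (- k) * W))"
  have "norm ((of_int c * z + of_int d) powr (- of_real k) * wtheta p 0 (moebius a b c d z)) \<le> V"
    if z: "Im z \<ge> 1" for z
  proof -
    define j where "j = of_int c * z + of_int d"
    define t where "t = - of_int c / j"
    have z': "Im z > 0" using z by simp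
    have j0: "j \<noteq> 0" unfolding j_def using linear_nonzero[OF z'] c by auto
    have "Im t = (of_int c)\<^sup>2 * Im z / (norm j)\<^sup>2"
      using Im_real_moebius[of 0 z "- of_int c" "of_int c" "of_int d"]
      by (simp add: t_def j_def power2_eq_square)
    hence t: "Im t > 0" using c z' j0 by simp
    have cc: "complex_of_int c \<noteq> 0" using c by simp
    have "complex_of_int a * of_int d = of_int b * of_int c + 1"
      using det by (metis add.commute diff_add_cancel of_int_1 of_int_add of_int_mult)
    hence mt: "moebius a b c d z = of_int a / of_int c + t / (of_int c)\<^sup>2"
      unfolding moebius_def t_def using j0 cc unfolding j_def
      by (simp add: divide_simps power2_eq_square) (simp add: algebra_simps)
    have dt: "dual_pt t = j / (4 * of_int c)"
      using j0 cc by (simp add: dual_pt_def t_def field_simps)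
    have "Im (dual_pt t) \<ge> 1 / 4"
    proof -
      have "dual_pt t = j / of_real (4 * of_int c)" by (simp add: dt)
      hence "Im (dual_pt t) = of_int c * Im z / (4 * of_int c)" by (simp only: Im_divide_of_real) (simp add: j_def)
      thus ?thesis using c z by simp
    qed
    hence w: "norm (wdual p' h t) \<le> W" for h by (rule W(2))
    have nt: "norm t = of_int c / norm j" using c by (simp add: t_def norm_divide)
    have "norm (theta_mean t * \<kappa> t) \<le> C * (of_int c / norm j) powr (- k)"
    proof -
      have "norm (theta_mean t * \<kappa> t) \<le> (C * norm t powr (- (real CARD('n) / 2))) * norm t powr (- real m)"
        unfolding norm_mult C(2)[OF t] using \<kappa>[OF t] C(1) by (intro mult_left_mono) auto
      also have "\<dots> = C * norm t powr (- k)"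
        unfolding k_def mult.assoc powr_add[symmetric] by simp
      finally show ?thesis by (simp only: nt)
    qed
    hence tm: "norm (wtheta p h t) \<le> C * (of_int c / norm j) powr (- k) * W" for h
      unfolding inv[OF t] norm_mult[of _ "wdual p' h t"] using w C(1) by (intro mult_mono) auto
    have "norm (wtheta p 0 (moebius a b c d z)) =
        norm (of_real (real_of_int c ^ m) * (\<Sum>g\<in>box_mod c. phase a c g * wtheta p ((1 / of_int c) *\<^sub>R int_vec g) t))"
      unfolding mt by (subst wtheta_cosets[OF c t p(1) hom]) simp
    also have "\<dots> \<le> real_of_int c ^ m * (\<Sum>g\<in>(box_mod c :: (int ^ 'n) set). C * (of_int c / norm j) powr (- k) * W)"
    proof -
      have "norm (\<Sum>g\<in>box_mod c. phase a c g * wtheta p ((1 / of_int c) *\<^sub>R int_vec g) t) \<le>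
          (\<Sum>g\<in>(box_mod c :: (int ^ 'n) set). C * (of_int c / norm j) powr (- k) * W)"
        by (rule sum_norm_le) (simp add: norm_mult tm)
      hence "real_of_int c ^ m * norm (\<Sum>g\<in>box_mod c. phase a c g * wtheta p ((1 / of_int c) *\<^sub>R int_vec g) t) \<le>
          real_of_int c ^ m * (\<Sum>g\<in>(box_mod c :: (int ^ 'n) set). C * (of_int c / norm j) powr (- k) * W)"
        using c by (intro mult_left_mono) auto
      thus ?thesis using c by (simp only: norm_mult norm_of_real) simp
    qed
    also have "\<dots> = norm j powr k * V"
      using c j0 by (simp add: V_def powr_minus powr_divide field_simps)
    finally have "norm (wtheta p 0 (moebius a b c d z)) \<le> norm j powr k * V" .
    hence "norm j powr (- k) * norm (wtheta p 0 (moebius a b c d z)) \<le> norm j powr (- k) * (norm j powr k * V)"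
      by (intro mult_left_mono) auto
    also have "\<dots> = V" using j0 by (simp add: mult.assoc[symmetric] flip: powr_add)
    finally show ?thesis
      using norm_powr_of_real[OF j0, of "- k"] by (simp add: norm_mult j_def)
  qed
  thus ?thesis by (auto simp: k_def)
qed

lemma cusp_bounded:
  assumes det: "a * d - b * c = 1"
    and p: "quad_growth p" "quad_growth p'"
    and hom: "\<And>k x. p (k *\<^sub>R x) = of_real (k ^ m) * p x"
    and inv: "\<And>h t. Im t > 0 \<Longrightarrow> wtheta p h t = theta_mean t * \<kappa> t * wdual p' h t"
    and \<kappa>: "\<And>t. Im t > 0 \<Longrightarrow> norm (\<kappa> t) \<le> norm t powr (- real m)"
  shows "\<exists>W. \<forall>z. Im z \<ge> 1 \<longrightarrow> norm ((of_int c * z + of_int d) powr (- of_real (real CARD('n) / 2 + real m)) *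
      wtheta p 0 (moebius a b c d z)) \<le> W"
proof (cases c "0 :: int" rule: linorder_cases)
  case greater
  thus ?thesis by (rule cusp_bounded_pos[OF det _ p hom inv \<kappa>])
next
  case less
  \<comment> \<open>Changing all signs keeps the Moebius map and alters the power of c z + d only by
    a factor of modulus 1.\<close>
  have det': "(- a) * (- d) - (- b) * (- c) = 1" using det by simp
  obtain W where W: "\<And>z. Im z \<ge> 1 \<Longrightarrow> norm ((of_int (- c) * z + of_int (- d)) powr (- of_real (real CARD('n) / 2 + real m)) *
      wtheta p 0 (moebius (- a) (- b) (- c) (- d) z)) \<le> W"
    using cusp_bounded_pos[OF det' _ p hom inv \<kappa>] less by auto
  have "norm ((of_int c * z + of_int d) powr (- of_real (real CARD('n) / 2 + real m)) *
      wtheta p 0 (moebius a b c d z)) \<le> W" if z: "Im z \<ge> 1" for z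
  proof -
    define w where "w = of_int c * z + of_int d"
    have w0: "w \<noteq> 0" unfolding w_def using linear_nonzero[of z c d] z less by auto
    have e: "of_int (- c) * z + of_int (- d) = - w" by (simp add: w_def)
    have "of_int (- a) * z + of_int (- b) = - (of_int a * z + of_int b)" by simp
    hence "(of_int (- a) * z + of_int (- b)) / (- w) = (of_int a * z + of_int b) / w"
      by (simp only: minus_divide_divide)
    hence m: "moebius (- a) (- b) (- c) (- d) z = moebius a b c d z"
      unfolding moebius_def e w_def .
    have s: "- complex_of_real (real CARD('n) / 2 + real m) = of_real (- (real CARD('n) / 2 + real m))" by simp
    have "norm ((- w) powr (- of_real (real CARD('n) / 2 + real m))) = norm (w powr (- of_real (real CARD('n) / 2 + real m)))"
      unfolding s using w0 by (simp only: norm_powr_of_real neg_equal_0_iff_equal norm_minus_cancel simp_thms)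
    thus ?thesis using W[OF z] unfolding e m norm_mult w_def by simp
  qed
  thus ?thesis by blast
next
  case equal
  hence ad: "a * d = 1" using det by simp
  hence "a = d" "d = 1 \<or> d = - 1" by (auto simp: zmult_eq_1_iff)
  hence m: "moebius a b c d z = z + of_int (b * d)" for z
    using equal by (auto simp: moebius_def)
  obtain W where W: "\<And>z. Im z \<ge> 1 \<Longrightarrow> norm (wtheta p 0 z) \<le> W"
    using norm_wtheta_bounded[OF p(1), of 1] by auto
  have s: "- complex_of_real (real CARD('n) / 2 + real m) = of_real (- (real CARD('n) / 2 + real m))" by simp
  have "norm (of_int d powr (- complex_of_real (real CARD('n) / 2 + real m))) = 1"
    unfolding s using \<open>d = 1 \<or> d = - 1\<close> by (subst norm_powr_of_real) auto
  thus ?thesis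
    using W equal unfolding m wtheta_periodic norm_mult by auto
qed

lemma theta_cusp_bounded:
  assumes det: "a * d - b * c = 1"
  shows "\<exists>W. \<forall>z. Im z \<ge> 1 \<longrightarrow> norm ((of_int c * z + of_int d) powr (- of_real (real CARD('n) / 2)) *
      wtheta (\<lambda>_. 1) 0 (moebius a b c d z)) \<le> W"
proof -
  have "norm (1 :: complex) \<le> norm t powr (- real 0)" if "Im t > 0" for t
    using that by auto
  from cusp_bounded[OF det quad_growth_const[of 1] quad_growth_const[of 1], of 0 "\<lambda>_. 1", OF _ _ this]
  show ?thesis by (simp add: theta_inversion_mean)
qed

lemma theta_qf_cusp_bounded:
  assumes det: "a * d - b * c = 1" and tr: "trace (B ** Ai) = 0"
  shows "\<exists>W. \<forall>z. Im z \<ge> 1 \<longrightarrow> norm ((of_int c * z + of_int d) powr (- of_real (real CARD('n) / 2 + real 2)) *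
      wtheta (\<lambda>x. of_real (qf B x)) 0 (moebius a b c d z)) \<le> W"
proof (rule cusp_bounded[OF det quad_growth_qf quad_growth_qf[of "conj_form B"], where m = 2 and \<kappa> = "\<lambda>t. 1 / (4 * t\<^sup>2)"])
  show "complex_of_real (qf B (k *\<^sub>R x)) = of_real (k ^ 2) * of_real (qf B x)" for k x
    by (simp add: qf_scaleR)
  show "wtheta (\<lambda>x. of_real (qf B x)) h t = theta_mean t * (1 / (4 * t\<^sup>2)) * wdual (\<lambda>x. of_real (qf (conj_form B) x)) h t"
    if "Im t > 0" for h t
    using theta_inversion_qf[OF that, of B h] tr by simp
  show "norm (1 / (4 * t\<^sup>2)) \<le> norm t powr (- real 2)" if "Im t > 0" for t
  proof -
    have t: "norm t > 0" using that by auto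
    hence e: "norm t powr (- real 2) = 1 / (norm t)\<^sup>2"
      by (simp add: powr_minus powr_numeral inverse_eq_divide)
    show ?thesis
      unfolding e norm_divide norm_mult norm_power using t by (simp add: field_simps)
  qed
qed

section \<open>Gauss sums\<close>

definition nondeg :: "int \<Rightarrow> bool" where
  "nondeg d \<longleftrightarrow> (\<forall>v. (\<forall>w. d dvd bl v w) \<longrightarrow> (\<exists>u. v = d *s u))"

lemma bl_adj: "bl (adj v) w = int l * (\<Sum>i\<in>UNIV. v $ i * w $ i)"
proof -
  have "(Ai *v int_vec v) \<bullet> (A *v int_vec w) = int_vec w \<bullet> int_vec v"
    by (subst inner_sym) simp
  hence "real_of_int (bl (adj v) w) = real l * (int_vec w \<bullet> int_vec v)"
    by (simp add: of_int_bl int_vec_adj)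
  also have "\<dots> = of_int (int l * (\<Sum>i\<in>UNIV. v $ i * w $ i))"
    by (simp add: inner_vec_def mult_ac)
  finally have "real_of_int (bl (adj v) w) = of_int (int l * (\<Sum>i\<in>UNIV. v $ i * w $ i))" .
  thus ?thesis by (simp only: of_int_eq_iff)
qed

text \<open>Pairing v with \<open>adj\<close> of a unit vector gives \<open>l\<close> times a
  coordinate of v, and \<open>l\<close> is invertible modulo d.\<close>

lemma nondeg_coprime:
  assumes "coprime d (int l)"
  shows "nondeg d"
  unfolding nondeg_def
proof (intro allI impI)
  fix v assume v: "\<forall>w. d dvd bl v w"
  have "d dvd v $ i" for i
  proof -
    have "d dvd bl v (adj (axis i 1))"
      using v by blast
    also have "bl v (adj (axis i 1)) = bl (adj (axis i 1)) v"
      by (rule bl_commute)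
    also have "\<dots> = int l * (\<Sum>j\<in>UNIV. if j = i then v $ j else 0)"
      unfolding bl_adj by (intro arg_cong2[of _ _ _ _ "(*)"] sum.cong) (auto simp: axis_def)
    also have "\<dots> = int l * v $ i" by simp
    finally show ?thesis using assms coprime_dvd_mult_right_iff by blast
  qed
  then obtain u where "\<And>i. v $ i = d * u i" unfolding dvd_def by metis
  hence "v = d *s (\<chi> i. u i)" by (simp add: vec_eq_iff)
  thus "\<exists>u. v = d *s u" ..
qed

lemma sum_box_bij:
  fixes F :: "int ^ 'n \<Rightarrow> 'b :: comm_monoid_add" and f f' :: "int ^ 'n \<Rightarrow> int ^ 'n"
  assumes d: "d > 0" and F: "periodic_mod d F"
    and f: "\<And>v. vmod d (f (vmod d (f' v))) = vmod d v" "\<And>v. vmod d (f' (vmod d (f v))) = vmod d v"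
  shows "(\<Sum>g\<in>box_mod d. F (f g)) = (\<Sum>g\<in>box_mod d. F g)"
proof (rule sum.reindex_bij_witness[of _ "\<lambda>g. vmod d (f' g)" "\<lambda>g. vmod d (f g)"])
  fix g :: "int ^ 'n" assume g: "g \<in> box_mod d"
  show "vmod d (f' (vmod d (f g))) = g" "vmod d (f (vmod d (f' g))) = g"
    using f vmod_box[OF g] by auto
  show "F (vmod d (f g)) = F (f g)" by (rule periodic_vmod[OF F])
qed (use d in \<open>auto simp: vmod_in_box\<close>)

lemma vmod_scale_vmod: "vmod d (k *s vmod d v) = vmod d (k *s v)"
  by (simp add: vmod_def vec_eq_iff mod_simps)

lemma sum_box_scale:
  fixes F :: "int ^ 'n \<Rightarrow> 'b :: comm_monoid_add"
  assumes d: "d > 0" and F: "periodic_mod d F" and t: "coprime t d"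
  shows "(\<Sum>g\<in>box_mod d. F (t *s g)) = (\<Sum>g\<in>box_mod d. F g)"
proof -
  obtain t' where t': "[t * t' = 1] (mod d)"
    using cong_solve_coprime_int[OF t] by blast
  have "vmod d ((t * t') *s v) = vmod d v" for v :: "int ^ 'n"
    using t' by (simp add: vmod_def vec_eq_iff cong_def) (metis mod_mult_left_eq mult_1)
  thus ?thesis
    by (intro sum_box_bij[OF d F, of "\<lambda>v. t *s v" "\<lambda>v. t' *s v"])
       (simp_all add: vmod_scale_vmod vector_smult_assoc mult.commute)
qed

lemma phase_cong:
  assumes "[b = b'] (mod d)" "d \<noteq> 0"
  shows "phase b d v = phase b' d v"
proof -
  obtain k where k: "b = b' + d * k" using assms(1) by (metis cong_iff_lin cong_sym)
  have "of_int (b * q v) / of_int d - of_int (b' * q v) / of_int d = (of_int (k * q v) :: complex)"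
    using assms(2) by (simp add: k field_simps)
  thus ?thesis unfolding phase_def by (intro ex_cong_Ints) (metis Ints_of_int)
qed

lemma gauss_cong: "[b = b'] (mod d) \<Longrightarrow> d \<noteq> 0 \<Longrightarrow> gauss b d = gauss b' d"
  unfolding gauss_def using phase_cong by (metis (no_types, lifting) sum.cong)

text \<open>Multiplication by t permutes the residues, so only the square class of b matters; this
  makes the quadratic symbol appear.\<close>

lemma gauss_square:
  assumes d: "d > 0" and t: "coprime t d"
  shows "gauss (b * t\<^sup>2) d = gauss b d"
proof -
  have "phase (b * t\<^sup>2) d g = phase b d (t *s g)" for g
    by (simp add: phase_def q_scale mult_ac)
  thus ?thesis
    unfolding gauss_def using sum_box_scale[OF d periodic_phase t, of b] d by simp
qed

lemma gauss_one [simp]: "gauss b 1 = 1"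
proof -
  have "0 \<le> x \<and> x < 1 \<longleftrightarrow> x = 0" for x :: int by auto
  hence "v \<in> box_mod 1 \<longleftrightarrow> v = 0" for v :: "int ^ 'n"
    unfolding box_mod_def mem_Collect_eq by (simp only: vec_eq_iff zero_index)
  hence "box_mod 1 = {0 :: int ^ 'n}" by blast
  thus ?thesis by (simp add: gauss_def phase_def q_def)
qed

text \<open>Orthogonality of characters: if the character is nontrivial at some w, shifting by w
  multiplies the sum by a factor different from 1.\<close>

lemma sum_box_character:
  assumes d: "d > 0"
  shows "(\<Sum>g\<in>box_mod d. ex (of_int (b * bl g h) / of_int d)) =
    (if \<forall>w. d dvd b * bl h w then of_int (d ^ CARD('n)) else 0)"
proof -
  let ?F = "\<lambda>g. ex (of_int (b * bl g h) / of_int d)"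
  have add: "?F (g + w) = ?F g * ?F w" for g w
  proof -
    have "of_int (b * bl (g + w) h) / of_int d = of_int (b * bl g h) / of_int d + (of_int (b * bl w h) / of_int d :: complex)"
      by (simp only: bl_add_left distrib_left of_int_add add_divide_distrib)
    thus ?thesis by (simp only: ex_add)
  qed
  have one: "?F w = 1" if "d dvd b * bl h w" for w
  proof -
    obtain k where "b * bl h w = d * k" using \<open>d dvd b * bl h w\<close> by (rule dvdE)
    hence k: "b * bl w h = d * k" by (simp only: bl_commute[of w h])
    have "of_int (b * bl w h) / of_int d = (of_int k :: complex)" unfolding k using d by simp
    thus ?thesis by (simp only: ex_int)
  qed
  have per: "periodic_mod d ?F"
    unfolding periodic_mod_def add by (subst one) (simp_all add: bl_scale_right)
  show ?thesis
  proof (cases "\<forall>w. d dvd b * bl h w")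
    case True
    have card: "card (box_mod d :: (int ^ 'n) set) = nat d ^ CARD('n)"
    proof -
      have "bij_betw vec_lambda (PiE UNIV (\<lambda>_::'n. {0..<d})) (box_mod d)"
        by (rule bij_betw_byWitness[where f' = vec_nth])
           (auto simp: box_mod_def PiE_UNIV_domain vec_lambda_inverse vec_nth_inverse)
      hence "card (box_mod d :: (int ^ 'n) set) = card (PiE UNIV (\<lambda>_::'n. {0..<d}))"
        by (rule bij_betw_same_card[symmetric])
      thus ?thesis by (simp add: card_PiE)
    qed
    have "(\<Sum>g\<in>box_mod d. ?F g) = of_nat (card (box_mod d :: (int ^ 'n) set))"
      using True one by simp
    also have "\<dots> = of_int (d ^ CARD('n))" 
    proof -
      have "of_nat (nat d) = (of_int d :: complex)" using d by simp
      thus ?thesis unfolding card by (simp only: of_nat_power of_int_power)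
    qed
    finally show ?thesis using True by simp
  next
    case False
    then obtain w where w: "\<not> d dvd b * bl h w" by blast
    have "?F w \<noteq> 1"
    proof
      assume "?F w = 1"
      hence "cis (2 * pi * (of_int (b * bl w h) / of_int d)) = 1"
        by (metis ex_of_real of_real_divide of_real_of_int_eq)
      then obtain k :: int where "2 * pi * (of_int (b * bl w h) / of_int d) = 2 * pi * of_int k"
        by (auto simp: complex_eq_iff cos_one_2pi_int mult_ac)
      hence "real_of_int (b * bl w h) = of_int (k * d)" using d by (simp add: field_simps)
      hence "b * bl w h = k * d" by (simp only: of_int_eq_iff)
      thus False using w by (simp add: bl_commute)
    qed
    moreover have "(\<Sum>g\<in>box_mod d. ?F g) * ?F w = (\<Sum>g\<in>box_mod d. ?F g)"
      using sum_box_shift[OF d per, of w] by (simp only: add sum_distrib_right)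
    ultimately show ?thesis using False by auto
  qed
qed

lemma cnj_phase: "cnj (phase b d v) = phase (- b) d v"
proof -
  have "of_int (b * q v) / of_int d = complex_of_real (of_int (b * q v) / of_int d)"
       "of_int (- b * q v) / of_int d = complex_of_real (- (of_int (b * q v) / of_int d))" by simp_all
  thus ?thesis unfolding phase_def by (simp only: ex_of_real) (simp add: cis_cnj)
qed

lemma cnj_gauss: "cnj (gauss b d) = gauss (- b) d"
  by (simp add: gauss_def cnj_phase)

text \<open>Replacing h by h + g in the double sum makes the sum over g a character sum, which
  confines h to a radical. For nondegenerate forms and b prime to d only h = 0 remains; modulo 2 the
  radical is retained and counted.\<close>

lemma gauss_norm_expand:
  assumes d: "d > 0"
  shows "gauss b d * cnj (gauss b d) =
    of_int (d ^ CARD('n)) * (\<Sum>h\<in>{h\<in>box_mod d. \<forall>w. d dvd b * bl h w}. phase b d h)"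
proof -
  have d0: "d \<noteq> 0" using d by simp
  have "gauss b d * cnj (gauss b d) = (\<Sum>h\<in>box_mod d. \<Sum>g\<in>box_mod d. phase b d h * phase (- b) d g)"
    by (simp add: gauss_def cnj_phase sum_product)
  also have "\<dots> = (\<Sum>g\<in>box_mod d. \<Sum>h\<in>box_mod d. phase b d h * phase (- b) d g)"
    by (rule sum.swap)
  also have "\<dots> = (\<Sum>g\<in>box_mod d. \<Sum>h\<in>box_mod d. phase b d (h + g) * phase (- b) d g)"
  proof (rule sum.cong[OF refl])
    fix g :: "int ^ 'n"
    show "(\<Sum>h\<in>box_mod d. phase b d h * phase (- b) d g) = (\<Sum>h\<in>box_mod d. phase b d (h + g) * phase (- b) d g)"
      using sum_box_shift[OF d periodic_phase[OF d0, of b], of g] by (simp flip: sum_distrib_right)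
  qed
  also have "\<dots> = (\<Sum>g\<in>box_mod d. \<Sum>h\<in>box_mod d. phase b d h * ex (of_int (b * bl g h) / of_int d))"
  proof (intro sum.cong refl)
    fix g h
    have "of_int (b * q (h + g)) / of_int d + of_int (- b * q g) / of_int d =
        of_int (b * q h) / of_int d + (of_int (b * bl g h) / of_int d :: complex)"
      by (simp add: q_add bl_commute[of h g] algebra_simps add_divide_distrib)
    thus "phase b d (h + g) * phase (- b) d g = phase b d h * ex (of_int (b * bl g h) / of_int d)"
      unfolding phase_def ex_add[symmetric] by (simp only:)
  qed
  also have "\<dots> = (\<Sum>h\<in>box_mod d. phase b d h * (\<Sum>g\<in>box_mod d. ex (of_int (b * bl g h) / of_int d)))"
    by (subst sum.swap) (simp add: sum_distrib_left)
  also have "\<dots> = (\<Sum>h\<in>box_mod d. if \<forall>w. d dvd b * bl h w then of_int (d ^ CARD('n)) * phase b d h else 0)"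
    unfolding sum_box_character[OF d] by (intro sum.cong) auto
  also have "\<dots> = of_int (d ^ CARD('n)) * (\<Sum>h\<in>{h\<in>box_mod d. \<forall>w. d dvd b * bl h w}. phase b d h)"
    by (subst sum.inter_filter[symmetric]) (auto simp: sum_distrib_left)
  finally show ?thesis .
qed

lemma gauss_norm:
  assumes d: "d > 0" and nd: "nondeg d" and b: "coprime b d"
  shows "gauss b d * cnj (gauss b d) = of_int (d ^ CARD('n))"
proof -
  have "{h \<in> box_mod d. \<forall>w. d dvd b * bl h w} = {0}"
  proof (intro equalityI subsetI)
    fix h assume "h \<in> {h \<in> box_mod d. \<forall>w. d dvd b * bl h w}"
    hence h: "h \<in> box_mod d" "\<forall>w. d dvd bl h w"
      using b by (auto simp: coprime_commute coprime_dvd_mult_right_iff)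
    then obtain u where "h = d *s u" using nd unfolding nondeg_def by blast
    hence "vmod d h = 0" by (simp add: vmod_def vec_eq_iff)
    thus "h \<in> {0}" using vmod_box[OF h(1)] by simp
  next
    fix h :: "int ^ 'n" assume "h \<in> {0}"
    moreover have "bl 0 w = 0" for w using bl_scale_left[of 0 0 w] by simp
    ultimately show "h \<in> {h \<in> box_mod d. \<forall>w. d dvd b * bl h w}"
      using d by (simp add: box_mod_def)
  qed
  moreover have "phase b d 0 = 1" by (simp add: phase_def q_def)
  ultimately show ?thesis using gauss_norm_expand[OF d, of b] by simp
qed

end

section \<open>One-dimensional Gauss sums and the quadratic symbol\<close>

definition eta :: "int \<Rightarrow> int \<Rightarrow> complex" where
  "eta d b = (\<Sum>t\<in>{0..<d}. ex (of_int (b * t\<^sup>2) / of_int d))"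

definition unit_form :: "real ^ 1 ^ 1" where
  "unit_form = mat 1"

lemma qf_unit_form: "qf unit_form x = (x $ 1)\<^sup>2"
  by (simp add: qf_def unit_form_def inner_vec_def power2_eq_square)

lemma unit_form_posdef: "unit_form \<in> Quad_pos"
proof -
  have "x \<bullet> (unit_form *v x) > 0" if "x \<noteq> 0" for x :: "real ^ 1"
  proof -
    have "x $ 1 \<noteq> 0" using that by (simp add: vec_eq_iff forall_1)
    thus ?thesis using qf_unit_form[of x] by (simp add: qf_def)
  qed
  thus ?thesis by (simp add: Quad_pos_def Quad_def) (simp add: unit_form_def transpose_mat)
qed

text \<open>For the form x^2 the inverse of 2A is 1/2, and 4 is the least l for which l / 2 is even:
  this gives the group Gamma_0(4) of Jacobi's theta function. Its Gauss sums are the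
  \<open>eta\<close>, which thereby inherit all general results.\<close>

interpretation unit_theta: integral_form unit_form 4
proof
  show "unit_form \<in> Quad_pos" by (rule unit_form_posdef)
  show "integer_valued unit_form"
    unfolding integer_valued_def qf_def[symmetric] qf_unit_form by (auto intro!: Ints_power)
  interpret posdef_form unit_form by unfold_locales (rule unit_form_posdef)
  have "matrix_inv (2 *\<^sub>R unit_form) = (1/2) *\<^sub>R mat 1"
  proof -
    have 1: "(2 *\<^sub>R unit_form) ** ((1/2) *\<^sub>R mat 1) = mat 1" "((1/2) *\<^sub>R mat 1) ** (2 *\<^sub>R unit_form) = mat 1"
      by (simp_all add: unit_form_def matrix_matrix_mult_def mat_def vec_eq_iff)
    hence "\<exists>X. (2 *\<^sub>R unit_form) ** X = mat 1 \<and> X ** (2 *\<^sub>R unit_form) = mat 1" by blast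
    hence "(2 *\<^sub>R unit_form) ** matrix_inv (2 *\<^sub>R unit_form) = mat 1"
      unfolding matrix_inv_def by (metis (mono_tags, lifting) someI_ex)
    thus ?thesis
      by (metis 1(2) matrix_mul_assoc matrix_mul_lid matrix_mul_rid)
  qed
  thus "even_mat unit_form 4"
    by (auto simp: even_mat_def even_integral_def mat_def intro!: exI[of _ "1 :: int"])
qed

lemma unit_theta_q: "unit_theta.q v = (v $ 1)\<^sup>2"
  unfolding unit_theta.q_def qf_unit_form int_vec_component by (metis floor_of_int of_int_power)

lemma unit_theta_gauss: "unit_theta.gauss b d = eta d b"
  unfolding unit_theta.gauss_def eta_def
  by (rule sum.reindex_bij_witness[of _ "\<lambda>t. vec t" "\<lambda>v :: int ^ 1. v $ 1"])
     (auto simp: box_mod_def vec_eq_iff unit_theta.phase_def unit_theta_q forall_1)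

lemma eta_norm:
  assumes "d > 0" "odd d" "coprime b d"
  shows "eta d b * cnj (eta d b) = of_int d"
proof -
  have "coprime d (int 4)" using assms(2) coprime_power_right_iff[of d 2 2] by simp
  thus ?thesis
    using unit_theta.gauss_norm[OF assms(1) unit_theta.nondeg_coprime assms(3)] by (simp add: unit_theta_gauss)
qed

lemma eta_nonzero: "d > 0 \<Longrightarrow> odd d \<Longrightarrow> coprime b d \<Longrightarrow> eta d b \<noteq> 0"
  using eta_norm[of d b] by auto

lemma eta_cong: "[b = b'] (mod d) \<Longrightarrow> d \<noteq> 0 \<Longrightarrow> eta d b = eta d b'"
  using unit_theta.gauss_cong by (simp add: unit_theta_gauss)

lemma eta_square: "d > 0 \<Longrightarrow> coprime t d \<Longrightarrow> eta d (b * t\<^sup>2) = eta d b"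
  using unit_theta.gauss_square by (simp add: unit_theta_gauss)

lemma sum_ex_residues:
  assumes p: "p > 0"
  shows "(\<Sum>b\<in>{0..<p}. ex (of_int (b * s) / of_int p)) = (if p dvd s then of_int p else 0)"
proof (cases "p dvd s")
  case True
  then obtain k where "s = p * k" by (rule dvdE)
  hence "ex (of_int (b * s) / of_int p) = 1" for b
    using p ex_int[of "b * k"] by simp
  thus ?thesis using True p by simp
next
  case False
  let ?x = "ex (of_int s / of_int p)"
  have pow: "ex (of_int (int j * s) / of_int p) = ?x ^ j" for j
  proof (induction j)
    case (Suc j)
    have "of_int (int (Suc j) * s) / of_int p = of_int s / of_int p + (of_int (int j * s) / of_int p :: complex)"
      using p by (simp add: field_simps)
    thus ?case using Suc by (simp only: ex_add power_Suc)
  qed simp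
  have "?x ^ nat p = 1"
    using pow[of "nat p"] p ex_int[of s] by simp
  moreover have "?x \<noteq> 1"
  proof
    assume "?x = 1"
    hence "cis (2 * pi * (of_int s / of_int p)) = 1"
      by (metis ex_of_real of_real_divide of_real_of_int_eq)
    then obtain k :: int where "2 * pi * (of_int s / of_int p) = 2 * pi * of_int k"
      by (auto simp: complex_eq_iff cos_one_2pi_int mult_ac)
    hence "real_of_int s = of_int (k * p)" using p by (simp add: field_simps)
    hence "s = k * p" by (simp only: of_int_eq_iff)
    thus False using False by simp
  qed
  moreover have "(\<Sum>b\<in>{0..<p}. ex (of_int (b * s) / of_int p)) = (\<Sum>j<nat p. ?x ^ j)"
    by (rule sum.reindex_bij_witness[of _ int nat]) (use p in \<open>auto simp: pow[symmetric]\<close>)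
  ultimately show ?thesis using False geometric_sum[of ?x "nat p"] by simp
qed

text \<open>Summing over b first leaves only t = 0 and gives p; the residue b = 0 alone already
  accounts for it.\<close>

lemma sum_eta_zero:
  assumes p: "prime p"
  shows "(\<Sum>b\<in>{1..<p}. eta p b) = 0"
proof -
  have p0: "p > 0" using p prime_gt_0_int by blast
  have "(\<Sum>b\<in>{0..<p}. eta p b) = (\<Sum>t\<in>{0..<p}. \<Sum>b\<in>{0..<p}. ex (of_int (b * t\<^sup>2) / of_int p))"
    unfolding eta_def by (rule sum.swap)
  also have "\<dots> = (\<Sum>t\<in>{0..<p}. if t = 0 then of_int p else 0)"
  proof (rule sum.cong[OF refl])
    fix t assume t: "t \<in> {0..<p}"
    have "p dvd t\<^sup>2 \<longleftrightarrow> t = 0"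
      using p t by (auto simp: prime_dvd_power_iff zdvd_not_zless dest: zdvd_imp_le)
    thus "(\<Sum>b\<in>{0..<p}. ex (of_int (b * t\<^sup>2) / of_int p)) = (if t = 0 then of_int p else 0)"
      unfolding sum_ex_residues[OF p0] by simp
  qed
  also have "\<dots> = of_int p" using p0 by simp
  finally have "(\<Sum>b\<in>{0..<p}. eta p b) = of_int p" .
  moreover have "{0..<p} = insert 0 {1..<p}" using p0 by auto
  moreover have "eta p 0 = of_int p" using p0 by (simp add: eta_def)
  ultimately show ?thesis by simp
qed

text \<open>Squares drop out, so the value at a power of a primitive root depends on the parity of
  the exponent only. Both parities occur equally often among the nonzero residues, so the vanishing
  total makes the two values opposite.\<close>

lemma eta_prime_power_root:
  assumes p: "prime p" "odd p"
  obtains g where "\<And>b. coprime b p \<Longrightarrow> \<exists>i::nat. [b = g ^ i] (mod p)" "coprime g p"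
    "\<And>i. eta p (g ^ i) = (- 1) ^ i * eta p 1"
proof -
  have p0: "p > 2" using p prime_ge_2_int[of p] by (cases "p = 2") auto
  define P where "P = nat p"
  have P: "prime P" "int P = p" using p(1) p0 by (auto simp: P_def)
  obtain g0 where g0: "residue_primroot P g0"
    using prime_primitive_root_exists[OF prime_gt_1_nat[OF P(1)]] P(1) by blast
  define g where "g = int g0"
  have cop: "coprime g p"
    using g0 P(2) by (auto simp: residue_primroot_def g_def coprime_commute simp flip: P(2))
  have gen: "bij_betw (\<lambda>i. g0 ^ i mod P) {..<totient P} (totatives P)"
    using residue_primroot_is_generator[OF prime_gt_1_nat[OF P(1)] g0] .
  have tot: "totient P = P - 1" by (rule totient_prime[OF P(1)])
  have ev: "eta p (g ^ (2 * j)) = eta p 1" for j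
    using eta_square[of p "g ^ j" 1] cop p0 by (simp add: power_mult[symmetric] mult.commute)
  have od: "eta p (g ^ (2 * j + 1)) = eta p g" for j
    using eta_square[of p "g ^ j" g] cop p0 by (simp add: power_mult[symmetric] mult.commute)
  have bij: "bij_betw (\<lambda>i. g ^ i mod p) {..<nat (p - 1)} {1..<p}"
  proof -
    have t: "totatives P = {1..<P}"
      using P(1) prime_gt_1_nat[OF P(1)] by (auto simp: totatives_prime)
    have "bij_betw (\<lambda>i. int (g0 ^ i mod P)) {..<totient P} (int ` {1..<P})"
      using bij_betw_trans[OF gen[unfolded t] bij_betw_imageI[of int "{1..<P}"]] by (simp add: o_def)
    moreover have "int ` {1..<P} = {1..<p}"
      using P(2) by (simp add: image_int_atLeastLessThan)
    moreover have "totient P = nat (p - 1)" unfolding tot using P(2) by linarith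
    moreover have "int (g0 ^ i mod P) = g ^ i mod p" for i
      by (simp add: g_def zmod_int P(2))
    ultimately show ?thesis by simp
  qed
  obtain h where h: "nat (p - 1) = 2 * h"
  proof -
    have "even (p - 1)" using p(2) by simp
    hence "even (nat (p - 1))" using p0 even_nat_iff[of "p - 1"] by simp
    thus ?thesis using that by (auto elim: evenE)
  qed
  have "0 = (\<Sum>b\<in>{1..<p}. eta p b)" using sum_eta_zero[OF p(1)] by simp
  also have "\<dots> = (\<Sum>i<nat (p - 1). eta p (g ^ i mod p))"
    by (rule sum.reindex_bij_betw[OF bij, symmetric])
  also have "\<dots> = (\<Sum>i<2 * h. eta p (g ^ i))"
    unfolding h by (intro sum.cong refl eta_cong) (use p0 in \<open>auto simp: cong_def\<close>)
  also have "\<dots> = of_nat h * (eta p 1 + eta p g)"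
  proof -
    have "(\<Sum>i<2 * h. eta p (g ^ i)) = of_nat h * (eta p 1 + eta p g)" for h
    proof (induction h)
      case (Suc h)
      have "(\<Sum>i<2 * Suc h. eta p (g ^ i)) = (\<Sum>i<2 * h. eta p (g ^ i)) + eta p (g ^ (2 * h)) + eta p (g ^ (2 * h + 1))"
        by simp
      thus ?case unfolding Suc ev od by (simp add: algebra_simps)
    qed simp
    thus ?thesis .
  qed
  finally have "eta p 1 + eta p g = 0"
    using h p0 by auto
  hence g1: "eta p g = - eta p 1" by (simp add: eq_neg_iff_add_eq_0 add.commute)
  show ?thesis
  proof (rule that)
    show "coprime g p" by fact
    show "eta p (g ^ i) = (- 1) ^ i * eta p 1" for i
    proof (cases "even i")
      case True thus ?thesis using ev by (auto elim!: evenE)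
    next
      case False thus ?thesis using od g1 by (auto elim!: oddE)
    qed
    show "\<exists>i::nat. [b = g ^ i] (mod p)" if "coprime b p" for b
    proof -
      have "\<not> p dvd b" using that p(1) p0 by (metis coprime_absorb_left coprime_commute not_prime_unit)
      hence "b mod p \<in> {1..<p}"
      proof -
        have "0 \<le> b mod p" "b mod p < p" using p0 by auto
        moreover have "b mod p \<noteq> 0" using \<open>\<not> p dvd b\<close> by (simp add: dvd_eq_mod_eq_0)
        ultimately show ?thesis by simp
      qed
      hence "b mod p \<in> (\<lambda>i. g ^ i mod p) ` {..<nat (p - 1)}"
        using bij by (simp add: bij_betw_def)
      thus ?thesis by (auto simp: cong_def)
    qed
  qed
qed

text \<open>For an odd prime p and b prime to p this is the Legendre symbol; as a quotient of Gauss
  sums it relates them by definition. At multiples of p its value is not 0, so multiplicativity is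
  stated for coprime arguments.\<close>

definition sgn_prime :: "int \<Rightarrow> int \<Rightarrow> complex" where
  "sgn_prime p b = eta p b / eta p 1"

lemma sgn_prime:
  assumes p: "prime p" "odd p"
  shows "coprime b p \<Longrightarrow> sgn_prime p b \<in> {1, - 1}"
    and "coprime b p \<Longrightarrow> coprime c p \<Longrightarrow> sgn_prime p (b * c) = sgn_prime p b * sgn_prime p c"
    and "eta p b = sgn_prime p b * eta p 1"
    and "[b = b'] (mod p) \<Longrightarrow> sgn_prime p b = sgn_prime p b'"
proof -
  have p0: "p > 0" using p(1) prime_gt_0_int by blast
  have nz: "eta p 1 \<noteq> 0" using eta_nonzero[OF p0 p(2)] by simp
  obtain g where g: "\<And>b. coprime b p \<Longrightarrow> \<exists>i::nat. [b = g ^ i] (mod p)" 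
    "\<And>i. eta p (g ^ i) = (- 1) ^ i * eta p 1"
    using eta_prime_power_root[OF p] by metis
  show cong: "sgn_prime p b = sgn_prime p b'" if "[b = b'] (mod p)" for b b'
    unfolding sgn_prime_def using eta_cong[OF that] p0 by simp
  have pw: "sgn_prime p (g ^ i) = (- 1) ^ i" for i
    unfolding sgn_prime_def g(2) using nz by simp
  show "sgn_prime p b \<in> {1, - 1}" if b: "coprime b p" for b
  proof -
    obtain i :: nat where "[b = g ^ i] (mod p)" using g(1)[OF b] by blast
    hence "sgn_prime p b = (- 1) ^ i" using cong pw by simp
    thus ?thesis by (cases "even i") auto
  qed
  show "sgn_prime p (b * c) = sgn_prime p b * sgn_prime p c" if bc: "coprime b p" "coprime c p" for b c
  proof -
    obtain i j :: nat where ij: "[b = g ^ i] (mod p)" "[c = g ^ j] (mod p)" using g(1) bc by blast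
    hence "[b * c = g ^ (i + j)] (mod p)" by (simp add: power_add cong_mult)
    hence "sgn_prime p (b * c) = (- 1) ^ (i + j)" using cong pw by metis
    moreover have "sgn_prime p b = (- 1) ^ i" "sgn_prime p c = (- 1) ^ j" using ij cong pw by metis+
    ultimately show ?thesis by (simp add: power_add)
  qed
  show "eta p b = sgn_prime p b * eta p 1" using nz by (simp add: sgn_prime_def)
qed

section \<open>Reduction of Gauss sums to prime moduli\<close>

context integral_form
begin

text \<open>Substitute d2 g + d1 h: the mixed term of \<open>q\<close> carries the factor d1 d2 and
  disappears from the phase.\<close>

lemma gauss_crt:
  assumes d: "d1 > 0" "d2 > 0" and cop: "coprime d1 d2"
  shows "gauss b (d1 * d2) = gauss (b * d2) d1 * gauss (b * d1) d2"
proof -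
  \<comment> \<open>The Bezout coefficients invert the substitution: g is e2 v modulo d1 and h is e1
    v modulo d2.\<close>
  obtain e1 e2 where e: "e1 * d1 + e2 * d2 = 1"
    using bezout_int[of d1 d2] cop by auto
  let ?D = "d1 * d2"
  have D: "?D > 0" using d by simp
  have n1: "(d2 * ((e2 * x) mod d1) + d1 * ((e1 * x) mod d2)) mod ?D = x mod ?D" for x
  proof -
    have "(d2 * ((e2 * x) mod d1) + d1 * ((e1 * x) mod d2)) mod ?D =
        ((d2 * (e2 * x)) mod ?D + (d1 * (e1 * x)) mod ?D) mod ?D"
      by (simp only: mult_mod_right mult.commute[of d2 d1])
    also have "\<dots> = (d2 * (e2 * x) + d1 * (e1 * x)) mod ?D" by (rule mod_add_eq)
    also have "d2 * (e2 * x) + d1 * (e1 * x) = (e1 * d1 + e2 * d2) * x" by (simp add: algebra_simps)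
    finally show ?thesis using e by simp
  qed
  have n2: "(e2 * ((d2 * x + d1 * y) mod ?D)) mod d1 = x mod d1" for x y
  proof -
    have "(e2 * ((d2 * x + d1 * y) mod ?D)) mod d1 = (e2 * (((d2 * x + d1 * y) mod ?D) mod d1)) mod d1"
      by (simp only: mod_mult_right_eq)
    also have "((d2 * x + d1 * y) mod ?D) mod d1 = (d2 * x + d1 * y) mod d1" by (simp add: mod_mod_cancel)
    also have "(e2 * ((d2 * x + d1 * y) mod d1)) mod d1 = (e2 * (d2 * x + d1 * y)) mod d1" by (simp only: mod_mult_right_eq)
    also have "e2 * (d2 * x + d1 * y) = (e1 * d1 + e2 * d2) * x + d1 * (e2 * y - e1 * x)" by (simp add: algebra_simps)
    finally show ?thesis using e by simp
  qed
  have n3: "(e1 * ((d2 * x + d1 * y) mod ?D)) mod d2 = y mod d2" for x y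
  proof -
    have "(e1 * ((d2 * x + d1 * y) mod ?D)) mod d2 = (e1 * (((d2 * x + d1 * y) mod ?D) mod d2)) mod d2"
      by (simp only: mod_mult_right_eq)
    also have "((d2 * x + d1 * y) mod ?D) mod d2 = (d2 * x + d1 * y) mod d2" by (simp add: mod_mod_cancel)
    also have "(e1 * ((d2 * x + d1 * y) mod d2)) mod d2 = (e1 * (d2 * x + d1 * y)) mod d2" by (simp only: mod_mult_right_eq)
    also have "e1 * (d2 * x + d1 * y) = (e1 * d1 + e2 * d2) * y + d2 * (e1 * x - e2 * y)" by (simp add: algebra_simps)
    finally show ?thesis using e by simp
  qed
  have ph: "phase b ?D (vmod ?D (d2 *s g + d1 *s h)) = phase (b * d2) d1 g * phase (b * d1) d2 h" for g h
  proof -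
    have "of_int (b * q (d2 *s g + d1 *s h)) / of_int ?D =
       of_int (b * d2 * q g) / of_int d1 + of_int (b * d1 * q h) / of_int d2 + (of_int (b * bl g h) :: complex)"
      using d by (simp add: q_add q_scale bl_scale_left bl_scale_right divide_simps) (simp add: algebra_simps power2_eq_square)
    hence "phase b ?D (d2 *s g + d1 *s h) = phase (b * d2) d1 g * phase (b * d1) d2 h"
      unfolding phase_def by (simp only: ex_add ex_int mult_1_right)
    thus ?thesis using periodic_vmod[OF periodic_phase[of ?D b]] d by simp
  qed
  have "gauss (b * d2) d1 * gauss (b * d1) d2 =
      (\<Sum>(g, h)\<in>box_mod d1 \<times> box_mod d2. phase (b * d2) d1 g * phase (b * d1) d2 h)"
    by (simp add: gauss_def sum_product sum.cartesian_product)
  also have "\<dots> = gauss b ?D"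
    unfolding gauss_def
  proof (rule sum.reindex_bij_witness[of _ "\<lambda>v. (vmod d1 (e2 *s v), vmod d2 (e1 *s v))"
        "\<lambda>(g, h). vmod ?D (d2 *s g + d1 *s h)"])
    fix v :: "int ^ 'n" assume v: "v \<in> box_mod ?D"
    show "(case (vmod d1 (e2 *s v), vmod d2 (e1 *s v)) of (g, h) \<Rightarrow> vmod ?D (d2 *s g + d1 *s h)) = v"
      using n1 v by (auto simp: vmod_def vec_eq_iff box_mod_def)
  next
    fix x :: "(int ^ 'n) \<times> (int ^ 'n)" assume x: "x \<in> box_mod d1 \<times> box_mod d2"
    show "(vmod d1 (e2 *s (case x of (g, h) \<Rightarrow> vmod ?D (d2 *s g + d1 *s h))),
           vmod d2 (e1 *s (case x of (g, h) \<Rightarrow> vmod ?D (d2 *s g + d1 *s h)))) = x"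
      using n2 n3 x by (auto simp: vmod_def vec_eq_iff box_mod_def)
  qed (use d D ph in \<open>auto simp: vmod_in_box\<close>)
  finally show ?thesis by simp
qed

text \<open>Write v = g + p m h with h modulo p. The phase depends on h only through a character,
  because the square of p m is divisible by the modulus. The sum over h therefore vanishes unless g
  = p u, and the phase of p u has modulus m.\<close>

lemma gauss_prime_square:
  assumes p: "p > 0" "nondeg p" "coprime b p" and m: "m > 0"
  shows "gauss b (p\<^sup>2 * m) = of_int (p ^ CARD('n)) * gauss b m"
proof -
  let ?D = "p\<^sup>2 * m"
  have D: "?D > 0" "p * m > 0" using p m by auto
  have DD: "?D = p * m * p" by (simp add: power2_eq_square)
  have ph: "phase b ?D (g + (p * m) *s h) = phase b ?D g * ex (of_int (b * bl h g) / of_int p)" for g h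
  proof -
    have "of_int (b * q (g + (p * m) *s h)) / of_int ?D = of_int (b * q g) / of_int ?D + of_int (b * bl h g) / of_int p
        + (of_int (b * m * q h) :: complex)"
      using p m by (simp add: q_add q_scale bl_scale_right bl_commute[of g h] divide_simps) (simp add: algebra_simps power2_eq_square)
    thus ?thesis unfolding phase_def by (simp only: ex_add ex_int mult_1_right)
  qed
  have "gauss b ?D = (\<Sum>(g, h)\<in>box_mod (p * m) \<times> box_mod p. phase b ?D (g + (p * m) *s h))"
    unfolding gauss_def
  proof (rule sum.reindex_bij_witness[of _ "\<lambda>(g, h). g + (p * m) *s h" "\<lambda>v. (vmod (p * m) v, \<chi> i. v $ i div (p * m))"])
    fix v :: "int ^ 'n" assume v: "v \<in> box_mod ?D"
    have "v $ i div (p * m) < p" for i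
    proof -
      have "v $ i < (p * m) * p" using v by (simp add: box_mod_def DD)
      moreover have "(p * m) * (v $ i div (p * m)) \<le> v $ i"
        using mult_div_mod_eq[of "p * m" "v $ i"] pos_mod_sign[OF D(2), of "v $ i"] by linarith
      ultimately have "(p * m) * (v $ i div (p * m)) < (p * m) * p" by linarith
      thus ?thesis using D(2) by (simp only: mult_less_cancel_left_pos)
    qed
    thus "(vmod (p * m) v, \<chi> i. v $ i div (p * m)) \<in> box_mod (p * m) \<times> box_mod p"
      using v D by (auto simp: vmod_in_box) (auto simp: box_mod_def pos_imp_zdiv_nonneg_iff)
    show "(case (vmod (p * m) v, \<chi> i. v $ i div (p * m)) of (g, h) \<Rightarrow> g + (p * m) *s h) = v"
      by (simp add: vmod_eq[symmetric])
    thus "(case (vmod (p * m) v, \<chi> i. v $ i div (p * m)) of (g, h) \<Rightarrow> phase b ?D (g + (p * m) *s h)) = phase b ?D v"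
      by simp
  next
    fix x :: "(int ^ 'n) \<times> (int ^ 'n)" assume "x \<in> box_mod (p * m) \<times> box_mod p"
    then obtain g h :: "int ^ 'n" where x: "x = (g, h)" and gh: "\<And>i. 0 \<le> g $ i" "\<And>i. g $ i < p * m" "\<And>i. 0 \<le> h $ i" "\<And>i. h $ i < p"
      by (auto simp: box_mod_def)
    have "g $ i + p * m * h $ i < ?D" for i
    proof -
      have "p * m * h $ i \<le> p * m * (p - 1)" using gh(4)[of i] D by (intro mult_left_mono) auto
      thus ?thesis using gh(2)[of i] by (simp add: DD right_diff_distrib)
    qed
    thus "(case x of (g, h) \<Rightarrow> g + (p * m) *s h) \<in> box_mod ?D"
      using gh D by (simp add: x box_mod_def)
    show "(vmod (p * m) (case x of (g, h) \<Rightarrow> g + (p * m) *s h), \<chi> i. (case x of (g, h) \<Rightarrow> g + (p * m) *s h) $ i div (p * m)) = x"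
    proof -
      have "(g $ i + p * m * h $ i) div (p * m) = h $ i" for i
      proof -
        have "g $ i div (p * m) = 0" by (rule div_pos_pos_trivial[OF gh(1,2)])
        thus ?thesis
          using div_mult_self2[where b = "p * m" and a = "g $ i" and c = "h $ i"] p(1) m by simp
      qed
      thus ?thesis using gh D by (simp add: x vec_eq_iff vmod_def)
    qed
  qed
  also have "\<dots> = (\<Sum>g\<in>box_mod (p * m). phase b ?D g * (\<Sum>h\<in>box_mod p. ex (of_int (b * bl h g) / of_int p)))"
    by (simp only: sum.cartesian_product[symmetric] ph sum_distrib_left)
  also have "\<dots> = (\<Sum>g\<in>box_mod (p * m). if \<exists>u. g = p *s u then of_int (p ^ CARD('n)) * phase b ?D g else 0)"
  proof (rule sum.cong[OF refl])
    fix g :: "int ^ 'n"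
    have "(\<forall>w. p dvd b * bl g w) \<longleftrightarrow> (\<exists>u. g = p *s u)"
      using p nondeg_def by (auto simp: coprime_commute coprime_dvd_mult_right_iff bl_scale_left)
    thus "phase b ?D g * (\<Sum>h\<in>box_mod p. ex (of_int (b * bl h g) / of_int p)) =
        (if \<exists>u. g = p *s u then of_int (p ^ CARD('n)) * phase b ?D g else 0)"
      unfolding sum_box_character[OF p(1)] by simp
  qed
  also have "\<dots> = (\<Sum>g\<in>{g\<in>box_mod (p * m). \<exists>u. g = p *s u}. of_int (p ^ CARD('n)) * phase b ?D g)"
    by (rule sum.inter_filter[symmetric]) simp
  also have "\<dots> = (\<Sum>u\<in>box_mod m. of_int (p ^ CARD('n)) * phase b m u)"
  proof (rule sum.reindex_bij_witness[of _ "\<lambda>u. p *s u" "\<lambda>g. \<chi> i. g $ i div p"])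
    fix u :: "int ^ 'n" assume u: "u \<in> box_mod m"
    thus "p *s u \<in> {g \<in> box_mod (p * m). \<exists>u. g = p *s u}" using p(1) by (auto simp: box_mod_def)
    show "(\<chi> i. (p *s u) $ i div p) = u" using p(1) by (simp add: vec_eq_iff)
  next
    fix g :: "int ^ 'n" assume g: "g \<in> {g \<in> box_mod (p * m). \<exists>u. g = p *s u}"
    then obtain u where u: "g = p *s u" by blast
    have gu: "(\<chi> i. g $ i div p) = u" using p(1) by (simp add: u vec_eq_iff)
    show "p *s (\<chi> i. g $ i div p) = g" using gu u by simp
    show "(\<chi> i. g $ i div p) \<in> box_mod m"
      using g p(1) unfolding gu by (auto simp: u box_mod_def zero_le_mult_iff)
    have "of_int (b * q g) / of_int ?D = (of_int (b * q u) / of_int m :: complex)"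
      using p m by (simp add: u q_scale divide_simps)
    thus "of_int (p ^ CARD('n)) * phase b m (\<chi> i. g $ i div p) = of_int (p ^ CARD('n)) * phase b ?D g"
      unfolding gu phase_def by simp
  qed
  finally show ?thesis by (simp add: gauss_def sum_distrib_left)
qed

lemma card_box_mod: "d > 0 \<Longrightarrow> card (box_mod d :: (int ^ 'n) set) = nat d ^ CARD('n)"
proof -
  have "bij_betw vec_lambda (PiE UNIV (\<lambda>_::'n. {0..<d})) (box_mod d)"
    by (rule bij_betw_byWitness[where f' = vec_nth])
       (auto simp: box_mod_def PiE_UNIV_domain vec_lambda_inverse vec_nth_inverse)
  hence "card (box_mod d :: (int ^ 'n) set) = card (PiE UNIV (\<lambda>_::'n. {0..<d}))"
    by (rule bij_betw_same_card[symmetric])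
  thus ?thesis by (simp add: card_PiE)
qed

text \<open>
  Over the field with \<open>p\<close> elements the form is diagonalised by splitting off one anisotropic vector
  after the other; each one-dimensional summand contributes one sign to the Gauss sum.
\<close>

lemma gauss_subspace:
  fixes W :: "(int ^ 'n) set"
  assumes p: "prime p" "odd p"
    and W: "\<And>v w. v \<in> W \<Longrightarrow> w \<in> W \<Longrightarrow> v + w \<in> W" "\<And>k v. v \<in> W \<Longrightarrow> k *s v \<in> W" "\<And>w. p *s w \<in> W"
  shows "\<exists>C k. (\<forall>b. coprime b p \<longrightarrow> (\<Sum>g\<in>W \<inter> box_mod p. phase b p g) = C * sgn_prime p b ^ k) \<and>
      C * cnj C * of_int p ^ k = (of_nat (card (W \<inter> box_mod p)))\<^sup>2"
  using W
proof (induction "card (W \<inter> box_mod p)" arbitrary: W rule: less_induct)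
  case less
  note W = less.prems
  have p0: "p > 0" using p prime_gt_0_int by blast
  have vW: "vmod p v \<in> W \<longleftrightarrow> v \<in> W" for v
  proof -
    let ?r = "\<chi> i. v $ i div p"
    have E: "v = vmod p v + p *s ?r" by (rule vmod_eq)
    have E': "vmod p v = v + (-1) *s (p *s ?r)"
      by (simp add: vec_eq_iff vmod_def minus_mult_div_eq_mod)
    show ?thesis
    proof
      assume "vmod p v \<in> W"
      hence "vmod p v + p *s ?r \<in> W" by (rule W(1)[OF _ W(3)])
      thus "v \<in> W" by (simp only: E[symmetric])
    next
      assume "v \<in> W"
      hence "v + (-1) *s (p *s ?r) \<in> W" by (rule W(1)[OF _ W(2)[OF W(3)]])
      thus "vmod p v \<in> W" by (simp only: E')
    qed
  qed
  show ?case
  proof (cases "\<forall>v\<in>W. p dvd q v")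
    case True
    have "phase b p g = 1" if g: "g \<in> W" for b g
    proof -
      have "p dvd q g" using True g by blast
      then obtain k where k: "q g = p * k" by (rule dvdE)
      have "of_int (b * q g) / of_int p = (of_int (b * k) :: complex)" using p0 by (simp add: k)
      thus ?thesis unfolding phase_def by (simp only: ex_int)
    qed
    thus ?thesis
      by (intro exI[of _ "of_nat (card (W \<inter> box_mod p))"] exI[of _ 0]) (simp add: power2_eq_square)
  next
    case False
    then obtain v where v: "v \<in> W" "\<not> p dvd q v" by blast
    have cq: "coprime (q v) p" using v(2) p(1) by (simp add: prime_imp_coprime coprime_commute)
    hence "coprime (2 * q v) p" using p(2) by (simp add: coprime_commute[of _ p])
    then obtain e where e: "[2 * q v * e = 1] (mod p)" using cong_solve_coprime_int by blast
    \<comment> \<open>The orthogonal complement of v in W modulo p. As e inverts the norm 2 q(v),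
      \<open>t x\<close> is the coefficient of x along v.\<close>
    define W' where "W' = {x \<in> W. p dvd bl x v}"
    define t where "t x = (bl x v * e) mod p" for x
    have blv: "bl (x - k *s v) v = bl x v - k * (2 * q v)" for x k
    proof -
      have xk: "x - k *s v = x + (- k) *s v" by (simp add: vec_eq_iff)
      show ?thesis unfolding xk bl_add_left bl_scale_left bl_self by simp
    qed
    have diffW: "x - k *s v \<in> W" if "x \<in> W" for x k
    proof -
      have "x - k *s v = x + (- k) *s v" by (simp add: vec_eq_iff)
      thus ?thesis using W(1)[OF that W(2)[OF v(1)]] by (simp only:)
    qed
    have blvmod: "p dvd bl (vmod p x) v \<longleftrightarrow> p dvd bl x v" for x
    proof -
      have "bl x v = bl (vmod p x) v + p * bl (\<chi> i. x $ i div p) v"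
        by (subst vmod_eq[of x p]) (simp only: bl_add_left bl_scale_left)
      thus ?thesis by (simp add: dvd_add_left_iff)
    qed
    have W'mod: "vmod p x \<in> W' \<longleftrightarrow> x \<in> W'" for x by (simp add: W'_def vW blvmod)
    have tx: "x - t x *s v \<in> W'" if "x \<in> W" for x
    proof -
      have "[t x * (2 * q v) = bl x v * e * (2 * q v)] (mod p)"
        unfolding t_def by (intro cong_mult) (auto simp: cong_def)
      also have "bl x v * e * (2 * q v) = bl x v * (2 * q v * e)" by (simp add: mult_ac)
      also have "[bl x v * (2 * q v * e) = bl x v * 1] (mod p)" by (intro cong_mult e) auto
      finally have "p dvd bl x v - t x * (2 * q v)"
        by (simp add: cong_iff_dvd_diff dvd_diff_commute)
      thus ?thesis using diffW[OF that] by (simp add: W'_def blv)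
    qed
    have bij: "(\<Sum>g\<in>W \<inter> box_mod p. F g) = (\<Sum>(s, y)\<in>{0..<p} \<times> (W' \<inter> box_mod p). F (vmod p (s *s v + y)))"
      for F :: "int ^ 'n \<Rightarrow> complex"
    proof (rule sum.reindex_bij_witness[of _ "\<lambda>(s, y). vmod p (s *s v + y)" "\<lambda>x. (t x, vmod p (x - t x *s v))"])
      fix x assume x: "x \<in> W \<inter> box_mod p"
      show 1: "(case (t x, vmod p (x - t x *s v)) of (s, y) \<Rightarrow> vmod p (s *s v + y)) = x"
        using x vmod_box[of x p] by simp
      show "(t x, vmod p (x - t x *s v)) \<in> {0..<p} \<times> (W' \<inter> box_mod p)"
        using x p0 tx W'mod by (auto simp: t_def vmod_in_box)
      show "(case (t x, vmod p (x - t x *s v)) of (s, y) \<Rightarrow> F (vmod p (s *s v + y))) = F x"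
        using 1 by simp
    next
      fix z assume "z \<in> {0..<p} \<times> (W' \<inter> box_mod p)"
      then obtain s y where z: "z = (s, y)" and s: "0 \<le> s" "s < p" and y: "y \<in> W'" "y \<in> box_mod p" by auto
      let ?x = "s *s v + y"
      have x: "?x \<in> W" using y(1) W(1)[OF W(2)[OF v(1)]] by (auto simp: W'_def)
      show "(case z of (s, y) \<Rightarrow> vmod p (s *s v + y)) \<in> W \<inter> box_mod p"
        using x p0 by (simp add: z vW vmod_in_box)
      have "t (vmod p ?x) = s"
      proof -
        have "p dvd bl y v" using y(1) by (simp add: W'_def)
        then obtain r where r: "bl y v = p * r" by (rule dvdE)
        have "bl ?x v = bl (vmod p ?x) v + p * bl (\<chi> i. ?x $ i div p) v"
          by (subst vmod_eq[of ?x p]) (simp only: bl_add_left bl_scale_left)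
        hence "bl (vmod p ?x) v = s * (2 * q v) + p * (r - bl (\<chi> i. ?x $ i div p) v)"
          by (simp add: bl_add_left bl_scale_left bl_self r algebra_simps)
        hence "[bl (vmod p ?x) v = s * (2 * q v)] (mod p)" by (simp add: cong_iff_dvd_diff)
        hence "[bl (vmod p ?x) v * e = s * (2 * q v) * e] (mod p)" by (rule cong_mult) auto
        also have "s * (2 * q v) * e = s * (2 * q v * e)" by (simp add: mult_ac)
        also have "[s * (2 * q v * e) = s * 1] (mod p)" by (intro cong_mult e) auto
        finally show ?thesis using s by (simp add: t_def cong_def)
      qed
      moreover have "vmod p (vmod p ?x - s *s v) = y"
        using vmod_box[OF y(2)] by simp
      ultimately show "(t (case z of (s, y) \<Rightarrow> vmod p (s *s v + y)),
          vmod p ((case z of (s, y) \<Rightarrow> vmod p (s *s v + y)) - t (case z of (s, y) \<Rightarrow> vmod p (s *s v + y)) *s v)) = z"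
        by (simp add: z)
    qed
    have "(of_nat (card (W \<inter> box_mod p)) :: complex) = of_nat (card ({0..<p} \<times> (W' \<inter> box_mod p)))"
      using bij[of "\<lambda>_. 1"] by (simp add: case_prod_unfold)
    hence card: "card (W \<inter> box_mod p) = nat p * card (W' \<inter> box_mod p)"
      by (simp only: of_nat_eq_iff card_cartesian_product) simp
    have "0 \<in> W \<inter> box_mod p" using W(3)[of 0] p0 by (simp add: box_mod_def)
    hence "card (W \<inter> box_mod p) > 0" by (metis card_gt_0_iff empty_iff finite_Int finite_box_mod)
    moreover have "p > 1" using p(1) prime_gt_1_int by blast
    ultimately have lt: "card (W' \<inter> box_mod p) < card (W \<inter> box_mod p)"
    proof -
      let ?k = "card (W' \<inter> box_mod p)"
      have "2 \<le> nat p" using \<open>p > 1\<close> by linarith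
      hence "2 * ?k \<le> nat p * ?k" by (rule mult_le_mono1)
      moreover have "?k > 0" using \<open>card (W \<inter> box_mod p) > 0\<close> card by (metis mult_0_right neq0_conv)
      ultimately show ?thesis unfolding card by linarith
    qed
    have "\<exists>C k. (\<forall>b. coprime b p \<longrightarrow> (\<Sum>g\<in>W' \<inter> box_mod p. phase b p g) = C * sgn_prime p b ^ k) \<and>
      C * cnj C * of_int p ^ k = (of_nat (card (W' \<inter> box_mod p)))\<^sup>2"
    proof (rule less.hyps[OF lt])
      show "x + y \<in> W'" if "x \<in> W'" "y \<in> W'" for x y
        using that W(1) by (auto simp: W'_def bl_add_left)
      show "k *s x \<in> W'" if "x \<in> W'" for k x
        using that W(2) by (auto simp: W'_def bl_scale_left)
      show "p *s w \<in> W'" for w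
        using W(3) by (auto simp: W'_def bl_scale_left)
    qed
    then obtain C k where Ck: "\<And>b. coprime b p \<Longrightarrow> (\<Sum>g\<in>W' \<inter> box_mod p. phase b p g) = C * sgn_prime p b ^ k"
      "C * cnj C * of_int p ^ k = (of_nat (card (W' \<inter> box_mod p)))\<^sup>2" by blast
    let ?C = "C * eta p (q v)"
    have ph: "phase b p (vmod p (s *s v + y)) = ex (of_int (b * q v * s\<^sup>2) / of_int p) * phase b p y" if y: "y \<in> W'" for b s y
    proof -
      have "p dvd bl y v" using y by (simp add: W'_def)
      then obtain r where r: "bl y v = p * r" by (rule dvdE)
      have "of_int (b * q (s *s v + y)) / of_int p =
          of_int (b * q v * s\<^sup>2) / of_int p + of_int (b * q y) / of_int p + (of_int (b * s * r) :: complex)"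
        using p0 by (simp add: q_add q_scale bl_scale_left bl_commute[of v y] r divide_simps) (simp add: algebra_simps)
      hence "phase b p (s *s v + y) = ex (of_int (b * q v * s\<^sup>2) / of_int p) * phase b p y"
        unfolding phase_def by (simp only: ex_add ex_int mult_1_right)
      thus ?thesis using periodic_vmod[OF periodic_phase[of p b]] p0 by simp
    qed
    have "(\<Sum>g\<in>W \<inter> box_mod p. phase b p g) = ?C * sgn_prime p b ^ Suc k" if b: "coprime b p" for b
    proof -
      have "(\<Sum>g\<in>W \<inter> box_mod p. phase b p g) =
          (\<Sum>(s, y)\<in>{0..<p} \<times> (W' \<inter> box_mod p). ex (of_int (b * q v * s\<^sup>2) / of_int p) * phase b p y)"
        unfolding bij by (rule sum.cong) (auto simp: ph)
      also have "\<dots> = eta p (b * q v) * (C * sgn_prime p b ^ k)"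
        unfolding eta_def Ck(1)[OF b, symmetric] sum_product sum.cartesian_product ..
      also have "eta p (b * q v) = sgn_prime p b * eta p (q v)"
        using sgn_prime(2)[OF p b cq] sgn_prime(3)[OF p] by (metis mult.assoc)
      finally show ?thesis by simp
    qed
    moreover have "?C * cnj ?C * of_int p ^ Suc k = (of_nat (card (W \<inter> box_mod p)))\<^sup>2"
    proof -
      have "?C * cnj ?C * of_int p ^ Suc k = (C * cnj C * of_int p ^ k) * (eta p (q v) * cnj (eta p (q v))) * of_int p"
        by (simp add: mult_ac)
      also have "\<dots> = (of_nat (card (W' \<inter> box_mod p)))\<^sup>2 * of_int p * of_int p"
        unfolding Ck(2) eta_norm[OF p0 p(2) cq] ..
      also have "\<dots> = (of_nat (card (W \<inter> box_mod p)))\<^sup>2"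
        unfolding card using p0 by (simp add: power2_eq_square mult_ac)
      finally show ?thesis .
    qed
    ultimately show ?thesis by blast
  qed
qed

text \<open>Absolute values identify the number k of signs: nondegeneracy gives C the squared
  modulus p^n, whereas the decomposition requires this times p^k to be p^(2 n). Hence k = n.\<close>

lemma gauss_prime:
  assumes p: "prime p" "odd p" and nd: "nondeg p" and b: "coprime b p"
  shows "gauss b p = sgn_prime p b ^ CARD('n) * gauss 1 p"
proof -
  have p0: "p > 1" using p prime_gt_1_int by blast
  obtain C k where Ck: "\<And>b. coprime b p \<Longrightarrow> gauss b p = C * sgn_prime p b ^ k"
      "C * cnj C * of_int p ^ k = (of_nat (card (box_mod p :: (int ^ 'n) set)))\<^sup>2"
    using gauss_subspace[OF p, of UNIV] by (auto simp: gauss_def)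
  have s1: "sgn_prime p 1 = 1" using sgn_prime_def eta_nonzero[of p 1] p0 p(2) by simp
  have "gauss 1 p = C" using Ck(1)[of 1] s1 by simp
  hence "of_int (p ^ CARD('n)) * of_int p ^ k = (of_nat (card (box_mod p :: (int ^ 'n) set)) :: complex)\<^sup>2"
    using gauss_norm[of p 1] nd p0 Ck(2) by simp
  also have "\<dots> = of_int (p ^ (2 * CARD('n)))"
    using card_box_mod[of p] p0 by (simp add: power_mult[symmetric] mult.commute)
  finally have "of_int (p ^ (CARD('n) + k)) = (of_int (p ^ (2 * CARD('n))) :: complex)"
    by (simp add: power_add)
  hence "p ^ (CARD('n) + k) = p ^ (2 * CARD('n))" by (simp only: of_int_eq_iff)
  hence "CARD('n) + k = 2 * CARD('n)" using p0 by (simp only: power_inject_exp)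
  hence "k = CARD('n)" by simp
  thus ?thesis using Ck(1)[OF b] \<open>gauss 1 p = C\<close> by simp
qed

end

text \<open>For odd \<open>d\<close> this is the Jacobi symbol \<open>(b/d)\<close>.\<close>

definition sgn_mod :: "int \<Rightarrow> int \<Rightarrow> complex" where
  "sgn_mod d b = (\<Prod>p\<in>#prime_factorization (nat d). sgn_prime (int p) b)"

lemma sgn_mod_one [simp]: "sgn_mod 1 b = 1"
  by (simp add: sgn_mod_def)

lemma sgn_mod_mult:
  assumes "prime p" "p > 0" "m > 0"
  shows "sgn_mod (p * m) b = sgn_prime p b * sgn_mod m b"
proof -
  have p: "prime (nat p)" by (rule prime_int_nat_transfer[THEN iffD1, THEN conjunct2, OF assms(1)])
  have nz: "nat p \<noteq> 0" "nat m \<noteq> 0" using assms by simp_all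
  have "nat (p * m) = nat p * nat m" using assms by (intro nat_mult_distrib) simp
  hence "prime_factorization (nat (p * m)) = {#nat p#} + prime_factorization (nat m)"
    unfolding prime_factorization_mult[OF nz] prime_factorization_prime[OF p, symmetric] by (simp only: prime_factorization_mult[OF nz])
  thus ?thesis using assms(2) by (simp add: sgn_mod_def)
qed

text \<open>The hypothesis is available for all smaller odd numbers and not just for m, since
  splitting off the square of p leads past m to m / p.\<close>

lemma odd_induct [consumes 2, case_names one mult]:
  fixes d :: int
  assumes "d > 0" "odd d"
    and one: "P 1"
    and mult: "\<And>p m. prime p \<Longrightarrow> odd p \<Longrightarrow> m > 0 \<Longrightarrow> odd m \<Longrightarrow> (\<And>k. 0 < k \<Longrightarrow> odd k \<Longrightarrow> k < p * m \<Longrightarrow> P k) \<Longrightarrow> P (p * m)"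
  shows "P d"
  using assms(1,2)
proof (induction "nat d" arbitrary: d rule: less_induct)
  case less
  show ?case
  proof (cases "d = 1")
    case False
    hence "\<not> is_unit d" using less.prems by (auto simp: zdvd1_eq)
    then obtain p where p: "prime p" "p dvd d" using less.prems prime_divisorE by (metis less_irrefl)
    then obtain m where m: "d = p * m" by (auto elim: dvdE)
    have p0: "p > 0" using p prime_gt_0_int by blast
    have m0: "m > 0" using less.prems m p0 by (simp add: zero_less_mult_iff)
    have "odd p" "odd m" using less.prems m by auto
    thus ?thesis unfolding m using less.hyps less.prems m
      by (intro mult p(1) m0) auto
  qed (use one in simp)
qed

lemma sgn_mod_values:
  assumes "d > 0" "odd d" "coprime b d"
  shows "sgn_mod d b \<in> {1, - 1}"
  using assms
proof (induction d rule: odd_induct)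
  case (mult p m)
  have "m < p * m" using mult prime_gt_1_int[of p] by simp
  hence "sgn_mod m b \<in> {1, - 1}" using mult by simp
  moreover have "sgn_prime p b \<in> {1, - 1}" using mult sgn_prime(1) by simp
  ultimately show ?case using mult prime_gt_0_int by (auto simp: sgn_mod_mult)
qed simp

lemma sgn_mod_mult_arg:
  assumes "d > 0" "odd d" "coprime b d" "coprime c d"
  shows "sgn_mod d (b * c) = sgn_mod d b * sgn_mod d c"
  using assms
proof (induction d rule: odd_induct)
  case (mult p m)
  have "m < p * m" using mult prime_gt_1_int[of p] by simp
  hence "sgn_mod m (b * c) = sgn_mod m b * sgn_mod m c" using mult by simp
  moreover have "sgn_prime p (b * c) = sgn_prime p b * sgn_prime p c" using mult sgn_prime(2) by simp
  ultimately show ?case using mult prime_gt_0_int by (simp add: sgn_mod_mult)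
qed simp

context integral_form
begin

text \<open>One prime p is removed at a time. If p divides m, the square of p splits off and its two
  signs cancel. Otherwise the Chinese remainder theorem applies; the factors m and p that it adds to
  the arguments are separated by multiplicativity of the symbols and recombined for b = 1.\<close>

lemma gauss_sign:
  assumes "d > 0" "odd d" "coprime d (int l)" "coprime b d"
  shows "gauss b d = sgn_mod d b ^ CARD('n) * gauss 1 d"
  using assms
proof (induction d arbitrary: b rule: odd_induct)
  case (mult p m)
  have p0: "p > 1" using mult prime_gt_1_int by blast
  have bp: "coprime b p" "coprime b m" and lp: "coprime p (int l)" "coprime m (int l)" using mult.prems by auto
  have mlt: "m < p * m" using p0 mult by simp
  have nd: "nondeg p" using nondeg_coprime lp by blast
  note sg = sgn_mod_mult[OF mult(1) _ mult(3)]
  show ?case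
  proof (cases "p dvd m")
    case True
    then obtain k where k: "m = p * k" by (rule dvdE)
    have k0: "k > 0" "odd k" using mult k p0 by (auto simp: zero_less_mult_iff)
    have "k < m" using k p0 k0 by simp
    hence klt: "k < p * m" using mlt by linarith
    have pm: "p * m = p\<^sup>2 * k" by (simp add: k power2_eq_square)
    have "coprime b k" "coprime k (int l)"
      using bp(2) lp(2) unfolding k coprime_mult_right_iff coprime_mult_left_iff by blast+
    hence IH: "gauss b k = sgn_mod k b ^ CARD('n) * gauss 1 k" by (intro mult.IH[OF k0 klt])
    have "sgn_prime p b * sgn_prime p b = 1" using sgn_prime(1)[OF mult(1,2) bp(1)] by auto
    hence "sgn_mod (p * m) b = sgn_mod k b"
      using sg p0 sgn_mod_mult[OF mult(1) _ k0(1)] by (simp add: k mult.assoc[symmetric])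
    thus ?thesis
      unfolding pm using gauss_prime_square[of p _ k] p0 nd bp(1) k0 IH by simp
  next
    case False
    hence cop: "coprime p m" using mult(1) prime_imp_coprime by blast
    have c1: "coprime m p" "coprime p m" using cop by (auto simp: coprime_commute)
    have G: "gauss b p = sgn_prime p b ^ CARD('n) * gauss 1 p" if "coprime b p" for b
      by (rule gauss_prime[OF mult(1,2) nd that])
    have H: "gauss b m = sgn_mod m b ^ CARD('n) * gauss 1 m" if "coprime b m" for b
      using mult.IH[OF mult(3,4) mlt lp(2) that] .
    have "gauss b (p * m) = gauss (b * m) p * gauss (b * p) m"
      by (rule gauss_crt[OF _ mult(3) cop]) (use p0 in simp)
    also have "gauss (b * m) p = sgn_prime p b ^ CARD('n) * gauss m p"
    proof -
      have "gauss (b * m) p = sgn_prime p (b * m) ^ CARD('n) * gauss 1 p" by (rule G) (use bp c1 in simp)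
      also have "\<dots> = sgn_prime p b ^ CARD('n) * (sgn_prime p m ^ CARD('n) * gauss 1 p)"
        unfolding sgn_prime(2)[OF mult(1,2) bp(1) c1(1)] power_mult_distrib by (simp only: mult.assoc)
      also have "sgn_prime p m ^ CARD('n) * gauss 1 p = gauss m p" by (rule G[OF c1(1), symmetric])
      finally show ?thesis .
    qed
    also have "gauss (b * p) m = sgn_mod m b ^ CARD('n) * gauss p m"
    proof -
      have "gauss (b * p) m = sgn_mod m (b * p) ^ CARD('n) * gauss 1 m" by (rule H) (use bp c1 in simp)
      also have "\<dots> = sgn_mod m b ^ CARD('n) * (sgn_mod m p ^ CARD('n) * gauss 1 m)"
        unfolding sgn_mod_mult_arg[OF mult(3,4) bp(2) c1(2)] power_mult_distrib by (simp only: mult.assoc)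
      also have "sgn_mod m p ^ CARD('n) * gauss 1 m = gauss p m" by (rule H[OF c1(2), symmetric])
      finally show ?thesis .
    qed
    also have "sgn_prime p b ^ CARD('n) * gauss m p * (sgn_mod m b ^ CARD('n) * gauss p m) =
        sgn_mod (p * m) b ^ CARD('n) * (gauss (1 * m) p * gauss (1 * p) m)"
      using sg p0 by (simp add: power_mult_distrib mult_ac)
    also have "gauss (1 * m) p * gauss (1 * p) m = gauss 1 (p * m)"
      by (rule gauss_crt[OF _ mult(3) cop, symmetric]) (use p0 in simp)
    finally show ?thesis .
  qed
qed simp

end

lemma eta_sign:
  assumes "d > 0" "odd d" "coprime b d"
  shows "eta d b = sgn_mod d b * eta d 1"
proof -
  have "coprime d (int 4)" using assms(2) coprime_power_right_iff[of d 2 2] by simp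
  thus ?thesis using unit_theta.gauss_sign[OF assms(1,2) _ assms(3)] by (simp add: unit_theta_gauss)
qed

text \<open>Conjugation turns b into - b, so \<open>eta d 1\<close> agrees with its conjugate up to
  sign and d is plus or minus its square; squaring removes the sign. The fourth power is what a
  change of the weight by 2 involves.\<close>

lemma eta_fourth:
  assumes d: "d > 0" "odd d" "coprime b d"
  shows "eta d b ^ 4 = (of_int d)\<^sup>2"
proof -
  have s: "sgn_mod d b \<in> {1, - 1}" "sgn_mod d (- 1) \<in> {1, - 1}" using sgn_mod_values d by auto
  have "cnj (eta d 1) = eta d (- 1)" using unit_theta.cnj_gauss[of 1 d] by (simp add: unit_theta_gauss)
  also have "\<dots> = sgn_mod d (- 1) * eta d 1" using eta_sign[of d "- 1"] d by simp
  finally have "of_int d = sgn_mod d (- 1) * (eta d 1)\<^sup>2"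
    using eta_norm[of d 1] d by (simp add: power2_eq_square mult_ac)
  hence "(of_int d)\<^sup>2 = (sgn_mod d (- 1))\<^sup>2 * eta d 1 ^ 4"
    by (simp add: power_mult_distrib flip: power_mult)
  moreover have "eta d b ^ 4 = sgn_mod d b ^ 4 * eta d 1 ^ 4"
    by (subst eta_sign[OF d]) (rule power_mult_distrib)
  ultimately show ?thesis using s by (auto simp: numeral_eq_Suc)
qed

section \<open>The theta function of Jacobi\<close>

lemma jacobi_theta_unit_form: "jacobi_theta z = unit_theta.wtheta (\<lambda>_. 1) 0 z"
  unfolding jacobi_theta_def unit_theta.wtheta_def
  by (rule infsum_reindex_bij_witness[of _ "\<lambda>v :: int ^ 1. v $ 1" "\<lambda>t. vec t"])
     (auto simp: vec_eq_iff forall_1 qf_unit_form ex_def mult_ac)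

lemma jacobi_theta_transform:
  assumes det: "a * d - b * c = 1" and c: "4 dvd c" and d: "d > 0" and z: "Im z > 0"
  shows "jacobi_theta (moebius a b c d z) = eta d b * rho c d z * jacobi_theta z"
  using unit_theta.theta_transform[OF det _ d z] c by (simp add: jacobi_theta_unit_form unit_theta_gauss)

lemma infsum_product_norm:
  fixes f :: "'a \<Rightarrow> complex" and g :: "'b \<Rightarrow> complex"
  assumes f: "(\<lambda>x. norm (f x)) summable_on A" and g: "(\<lambda>y. norm (g y)) summable_on B"
  shows "(\<lambda>(x, y). f x * g y) summable_on A \<times> B"
    and "(\<Sum>\<^sub>\<infinity>(x, y)\<in>A \<times> B. f x * g y) = infsum f A * infsum g B"
proof -
  have "(\<lambda>z. norm (f (fst z)) * norm (g (snd z))) summable_on A \<times> B"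
  proof (rule summable_on_SigmaI)
    show "((\<lambda>y. norm (f (fst (x, y))) * norm (g (snd (x, y)))) has_sum norm (f x) * infsum (\<lambda>y. norm (g y)) B) B" for x
      using has_sum_cmult_right[OF has_sum_infsum[OF g], of "norm (f x)"] by simp
    show "(\<lambda>x. norm (f x) * infsum (\<lambda>y. norm (g y)) B) summable_on A"
      by (rule summable_on_cmult_left[OF f])
  qed simp
  hence "(\<lambda>z. norm (case z of (x, y) \<Rightarrow> f x * g y)) summable_on A \<times> B"
    by (simp add: case_prod_unfold norm_mult)
  thus s: "(\<lambda>(x, y). f x * g y) summable_on A \<times> B"
    by (rule abs_summable_summable)
  have "(\<Sum>\<^sub>\<infinity>(x, y)\<in>A \<times> B. f x * g y) = (\<Sum>\<^sub>\<infinity>x\<in>A. \<Sum>\<^sub>\<infinity>y\<in>B. f x * g y)"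
    using infsum_Sigma'_banach[of "\<lambda>x y. f x * g y" A "\<lambda>_. B"] s by simp
  also have "\<dots> = infsum f A * infsum g B"
    by (simp add: infsum_cmult_right' infsum_cmult_left')
  finally show "(\<Sum>\<^sub>\<infinity>(x, y)\<in>A \<times> B. f x * g y) = infsum f A * infsum g B" .
qed

lemma jacobi_summable:
  assumes z: "Im z > 0"
  shows "(\<lambda>m::int. norm (ex (of_int (m\<^sup>2) * z))) summable_on UNIV"
proof -
  have "norm (ex (of_int (m\<^sup>2) * z)) = exp (- (2 * pi * Im z) * (real_of_int m)\<^sup>2)" for m
    by (simp add: norm_ex mult_ac)
  thus ?thesis using abs_summable_int_exp[of "2 * pi * Im z"] z by simp
qed

text \<open>
  In the product of the two series the terms with \<open>m + k\<close> odd cancel under swapping \<open>m\<close> and \<open>k\<close>;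
  the remaining ones are parametrised by \<open>m = u + v\<close>, \<open>k = u - v\<close>.
\<close>

lemma jacobi_theta_duplication:
  assumes z: "Im z > 0"
  shows "jacobi_theta z * jacobi_theta (z + 1 / 2) = (jacobi_theta (2 * z + 1 / 2))\<^sup>2"
proof -
  let ?e = "\<lambda>w (m::int). ex (of_int (m\<^sup>2) * w)"
  have jt: "jacobi_theta w = (\<Sum>\<^sub>\<infinity>m. ?e w m)" for w by (simp add: jacobi_theta_def ex_def mult_ac)
  have prod: "(\<Sum>\<^sub>\<infinity>m. ?e w m) * (\<Sum>\<^sub>\<infinity>m. ?e w' m) = (\<Sum>\<^sub>\<infinity>(m, k). ?e w m * ?e w' k)"
    and sm: "(\<lambda>(m, k). ?e w m * ?e w' k) summable_on UNIV"
    if "Im w > 0" "Im w' > 0" for w w'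
  proof -
    note n = infsum_product_norm[OF jacobi_summable[OF that(1)] jacobi_summable[OF that(2)]]
    show "(\<lambda>(m, k). ?e w m * ?e w' k) summable_on UNIV" using n(1) by simp
    show "(\<Sum>\<^sub>\<infinity>m. ?e w m) * (\<Sum>\<^sub>\<infinity>m. ?e w' m) = (\<Sum>\<^sub>\<infinity>(m, k). ?e w m * ?e w' k)"
      using n(2) by simp
  qed
  define F where "F = (\<lambda>(m, k). ?e z m * ?e (z + 1 / 2) k)"
  have sign: "?e (w + 1 / 2) k = (if even k then 1 else - 1) * ?e w k" for w k
  proof (cases "even k")
    case True
    then obtain j where "k = 2 * j" by (rule evenE)
    hence "of_int (k\<^sup>2) * (w + 1 / 2) = of_int (k\<^sup>2) * w + of_int (2 * j\<^sup>2)"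
      by (simp add: power2_eq_square algebra_simps)
    thus ?thesis using True by (simp only: ex_add ex_int) simp
  next
    case False
    then obtain j where "k = 2 * j + 1" by (rule oddE)
    hence "of_int (k\<^sup>2) * (w + 1 / 2) = of_int (k\<^sup>2) * w + of_int (2 * j\<^sup>2 + 2 * j) + 1 / 2"
      by (simp add: power2_eq_square algebra_simps)
    moreover have "ex (1 / 2) = - 1" by (simp add: ex_def)
    ultimately show ?thesis using False by (simp only: ex_add ex_int) simp
  qed
  define E where "E = {x :: int \<times> int. even (fst x + snd x)}"
  have F: "F summable_on UNIV" unfolding F_def using z by (intro sm) auto
  hence Fs: "F summable_on X" for X by (metis summable_on_subset_banach subset_UNIV)
  have swap: "F (k, m) = - F (m, k)" if "(m, k) \<in> - E" for m k
  proof -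
    have "(if even m then 1 else - 1) = - (if even k then 1 else - 1 :: complex)"
      using that by (auto simp: E_def)
    thus ?thesis unfolding F_def prod.case sign by (simp only: mult_ac) simp
  qed
  have "infsum F (- E) = infsum (\<lambda>x. - F x) (- E)"
  proof (rule infsum_reindex_bij_witness[of _ prod.swap prod.swap])
    show "- F (prod.swap x) = F x" if "x \<in> - E" for x
      using swap[of "snd x" "fst x"] that by (cases x) (simp add: E_def add.commute)
  qed (auto simp: E_def add.commute)
  hence odd0: "infsum F (- E) = 0" by (simp add: infsum_uminus)
  have "jacobi_theta z * jacobi_theta (z + 1 / 2) = infsum F UNIV"
    unfolding jt F_def using z by (intro prod) auto
  also have "\<dots> = infsum F (E \<union> - E)" by simp
  also have "\<dots> = infsum F E" using Fs odd0 by (subst infsum_Un_disjoint) auto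
  also have "\<dots> = (\<Sum>\<^sub>\<infinity>(u, v). ?e (2 * z + 1 / 2) u * ?e (2 * z + 1 / 2) v)"
  proof (rule infsum_reindex_bij_witness[of _ "\<lambda>(u, v). (u + v, u - v)" "\<lambda>(m, k). ((m + k) div 2, (m - k) div 2)"])
    fix x assume x: "x \<in> E"
    obtain m k where mk: "x = (m, k)" "even (m + k)" using x by (cases x) (auto simp: E_def)
    define u where "u = (m + k) div 2"
    define v where "v = (m - k) div 2"
    obtain r where r: "m + k = 2 * r" using mk(2) by (rule evenE)
    have u: "u = r" unfolding u_def r by simp
    have m: "m = 2 * r - k" using r by (simp add: eq_diff_eq)
    have d: "m - k = 2 * (r - k)" unfolding m by simp
    have v: "v = r - k" unfolding v_def d by simp
    have uv: "m = u + v" "k = u - v" unfolding u v m by simp_all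
    show "(case (case x of (m, k) \<Rightarrow> ((m + k) div 2, (m - k) div 2)) of (u, v) \<Rightarrow> (u + v, u - v)) = x"
      by (simp only: mk prod.case u_def[symmetric] v_def[symmetric] uv[symmetric])
    have "of_int (m\<^sup>2) * z + of_int (k\<^sup>2) * z = of_int (u\<^sup>2) * (2 * z) + of_int (v\<^sup>2) * (2 * z)"
      by (simp add: uv power2_eq_square algebra_simps)
    hence H: "?e z m * ?e z k = ?e (2 * z) u * ?e (2 * z) v" by (simp only: ex_add[symmetric])
    \<comment> \<open>The parity of k = u - v is that of u + v, so the sign attached to k splits
      between u and v; this puts the shift by 1 / 2 into both factors.\<close>
    let ?s = "\<lambda>k :: int. if even k then 1 else - 1 :: complex"
    have "?s k = ?s u * ?s v" using uv(2) by auto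
    hence "?s u * ?e (2 * z) u * (?s v * ?e (2 * z) v) = ?s k * (?e z m * ?e z k)"
      unfolding H by (simp only: mult_ac)
    also have "\<dots> = ?e z m * (?s k * ?e z k)" by (simp only: mult_ac)
    finally show "(case (case x of (m, k) \<Rightarrow> ((m + k) div 2, (m - k) div 2)) of (u, v) \<Rightarrow> ?e (2 * z + 1 / 2) u * ?e (2 * z + 1 / 2) v) = F x"
      unfolding mk F_def prod.case sign u_def[symmetric] v_def[symmetric] .
  qed (auto simp: E_def)
  also have "\<dots> = (jacobi_theta (2 * z + 1 / 2))\<^sup>2"
    unfolding power2_eq_square[of "jacobi_theta (2 * z + 1 / 2)"]
    unfolding jt
    by (rule prod[symmetric]) (use z in auto)
  finally show ?thesis .
qed

lemma jacobi_theta_nonzero_at_infinity: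
  obtains Y where "Y > 0" "\<And>z. Im z \<ge> Y \<Longrightarrow> jacobi_theta z \<noteq> 0"
proof -
  let ?b = "\<lambda>m::int. exp (- 1 * (real_of_int m)\<^sup>2)"
  define S where "S = infsum ?b UNIV"
  have s: "?b summable_on UNIV" using abs_summable_int_exp[of 1] by simp
  have S: "S \<ge> 0" unfolding S_def by (rule infsum_nonneg) simp
  \<comment> \<open>Chosen so that exp (- 2 pi Y) is exp (- 1) / (S + 1): the terms with m \<noteq>
    0 then add up to at most S / (S + 1), less than the constant term 1.\<close>
  define Y where "Y = (1 + ln (S + 1)) / (2 * pi)"
  have ln: "ln (S + 1) \<ge> 0" using S by simp
  have Y: "Y > 0" unfolding Y_def using ln by (intro divide_pos_pos add_pos_nonneg) auto
  have "jacobi_theta z \<noteq> 0" if z: "Im z \<ge> Y" for z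
  proof -
    let ?e = "\<lambda>m::int. ex (of_int (m\<^sup>2) * z)"
    have zp: "Im z > 0" using z Y by linarith
    have sz: "?e summable_on UNIV" by (rule abs_summable_summable[OF jacobi_summable[OF zp]])
    hence sz': "?e summable_on - {0}" by (metis summable_on_subset_banach subset_UNIV)
    have sb': "(\<lambda>m. ?b m * (1 / (S + 1))) summable_on - {0}"
      using summable_on_cmult_left[OF s, of "1 / (S + 1)"] by (metis summable_on_subset_banach subset_UNIV)
    have le: "norm (?e m) \<le> ?b m * (1 / (S + 1))" if m: "m \<in> - {0}" for m
    proof -
      have m1: "(real_of_int m)\<^sup>2 \<ge> 1"
      proof -
        have "m\<^sup>2 \<ge> 1" using m by (simp add: int_one_le_iff_zero_less)
        hence "real_of_int (m\<^sup>2) \<ge> 1" by linarith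
        thus ?thesis by simp
      qed
      have "2 * pi * Im z \<ge> 1 + ln (S + 1)" using z by (simp add: Y_def field_simps)
      hence "(real_of_int m)\<^sup>2 * (2 * pi * Im z) \<ge> (real_of_int m)\<^sup>2 * (1 + ln (S + 1))"
        by (intro mult_left_mono) auto
      moreover have "(real_of_int m)\<^sup>2 * ln (S + 1) \<ge> 1 * ln (S + 1)" using m1 ln by (intro mult_right_mono)
      ultimately have "norm (?e m) \<le> exp (- 1 * (real_of_int m)\<^sup>2 - ln (S + 1))"
        by (simp add: norm_ex algebra_simps)
      also have "\<dots> = ?b m * (1 / (S + 1))" using S by (simp add: exp_diff)
      finally show ?thesis .
    qed
    have "norm (infsum ?e (- {0})) \<le> infsum (\<lambda>m. ?b m * (1 / (S + 1))) (- {0})"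
      by (rule norm_infsum_le[OF has_sum_infsum[OF sz'] has_sum_infsum[OF sb'] le])
    also have "\<dots> \<le> infsum (\<lambda>m. ?b m * (1 / (S + 1))) UNIV"
      using S by (intro infsum_mono_neutral sb' summable_on_cmult_left s) auto
    also have "\<dots> = S / (S + 1)" by (simp only: infsum_cmult_left' S_def) simp
    also have "\<dots> < 1" using S by simp
    finally have lt: "norm (infsum ?e (- {0})) < 1" .
    have "jacobi_theta z = infsum ?e ({0} \<union> - {0})"
      by (simp add: jacobi_theta_def ex_def mult_ac)
    also have "\<dots> = infsum ?e {0} + infsum ?e (- {0})"
      by (rule infsum_Un_disjoint) (use sz' in auto)
    finally have "jacobi_theta z = 1 + infsum ?e (- {0})" by simp
    thus ?thesis using lt by (metis add.inverse_unique norm_minus_cancel norm_one less_irrefl)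
  qed
  thus ?thesis using that Y by blast
qed

text \<open>
  By the duplication formula a zero would propagate to arbitrarily large imaginary parts, where the
  constant term of the series dominates.
\<close>

lemma jacobi_theta_nonzero:
  assumes z: "Im z > 0"
  shows "jacobi_theta z \<noteq> 0"
proof
  assume zero: "jacobi_theta z = 0"
  obtain Y where Y: "Y > 0" "\<And>z. Im z \<ge> Y \<Longrightarrow> jacobi_theta z \<noteq> 0"
    using jacobi_theta_nonzero_at_infinity by blast
  have per: "jacobi_theta (w + of_int m) = jacobi_theta w" for w m
    unfolding jacobi_theta_unit_form by (rule unit_theta.wtheta_periodic)
  have step: "\<exists>w'. Im w' = 2 * Im w \<and> jacobi_theta w' = 0" if "Im w > 0" "jacobi_theta w = 0" for w
    using jacobi_theta_duplication[OF that(1)] that(2) by (intro exI[of _ "2 * w + 1 / 2"]) auto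
  have "\<exists>w. Im w = 2 ^ k * Im z \<and> jacobi_theta w = 0" for k
  proof (induction k)
    case (Suc k)
    then obtain w where w: "Im w = 2 ^ k * Im z" "jacobi_theta w = 0" by blast
    then obtain w' where "Im w' = 2 * Im w" "jacobi_theta w' = 0" using step[of w] z by auto
    thus ?case using w by (intro exI[of _ w']) simp
  qed (use zero in auto)
  moreover obtain k :: nat where "2 ^ k > Y / Im z" using real_arch_pow[of 2 "Y / Im z"] by auto
  hence "2 ^ k * Im z \<ge> Y" using z by (simp add: field_simps)
  ultimately show False using Y(2) by metis
qed

section \<open>The level\<close>

lemma square_eq_two_power:
  assumes "(s :: int)\<^sup>2 = 2 ^ n"
  shows "even n"
proof -
  have "s \<noteq> 0" using assms by auto
  hence "multiplicity 2 (s\<^sup>2) = 2 * multiplicity 2 s"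
    by (simp add: prime_elem_multiplicity_power_distrib)
  moreover have "multiplicity (2::int) (2 ^ n) = n" by simp
  ultimately show ?thesis using assms by simp
qed

text \<open>By Cramer's rule the inverse of the integral matrix 2A has denominator det (2A), so
  twice the determinant makes every entry even. Hence the minimum in \<open>form_level\<close> is
  attained.\<close>

lemma even_mat_exists:
  fixes A :: "real ^ 'n ^ 'n"
  assumes A: "A \<in> Quad_pos" and int: "integer_valued A"
  shows "\<exists>l. l > 0 \<and> even_integral (real l *\<^sub>R matrix_inv (2 *\<^sub>R A))"
proof -
  interpret posdef_form A by unfold_locales (rule A)
  let ?M = "2 *\<^sub>R A"
  have ax: "axis i 1 = int_vec (axis i 1)" for i :: 'n
    by (simp add: vec_eq_iff axis_def)
  have qi: "qf A (axis i 1) \<in> \<int>" for i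
    unfolding ax using int by (simp add: integer_valued_def qf_def)
  have entry: "?M $ i $ j \<in> \<int>" for i j
  proof -
    have "2 * (axis i 1 \<bullet> (A *v axis j 1)) = qf A (axis i 1 + axis j 1) - qf A (axis i 1) - qf A (axis j 1)"
      by (simp add: qf_add[OF sym])
    also have "axis i 1 + axis j 1 = int_vec (axis i 1 + axis j 1)"
      by (simp add: int_vec_add ax[symmetric])
    finally have "2 * (axis i 1 \<bullet> (A *v axis j 1)) \<in> \<int>"
      using qi int by (auto simp: integer_valued_def qf_def intro!: Ints_diff)
    thus ?thesis by (simp add: inner_axis' matrix_vector_mult_basis column_def)
  qed
  have det_int: "det (X :: real ^ 'n ^ 'n) \<in> \<int>" if "\<And>i j. X $ i $ j \<in> \<int>" for X :: "real ^ 'n ^ 'n"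
    unfolding det_def using that by (intro Ints_sum Ints_mult Ints_prod) auto
  have prod1: "?M ** ((1/2) *\<^sub>R Ai) = mat 1" "((1/2) *\<^sub>R Ai) ** ?M = mat 1"
    using A_Ai Ai_A by (simp_all add: matrix_matrix_mult_def)
  hence inv: "invertible ?M" unfolding invertible_def by blast
  hence "\<exists>X. ?M ** X = mat 1 \<and> X ** ?M = mat 1" unfolding invertible_def .
  hence MI: "?M ** matrix_inv ?M = mat 1"
    unfolding matrix_inv_def by (metis (mono_tags, lifting) someI_ex)
  have dnz: "det ?M \<noteq> 0" using inv invertible_det_nz by blast
  obtain D where D: "det ?M = of_int D" using det_int[OF entry] by (auto elim: Ints_cases)
  define l where "l = nat (2 * \<bar>D\<bar>)"
  have l: "real l = 2 * \<bar>of_int D\<bar>" by (simp add: l_def)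
  have ent: "\<exists>k::int. (real l *\<^sub>R matrix_inv ?M) $ i $ j = 2 * of_int k" for i j
  proof -
    let ?x = "matrix_inv ?M *v axis j 1"
    let ?X = "\<chi> r c. if c = i then (axis j 1 :: real ^ 'n) $ r else ?M $ r $ c"
    have "?M *v ?x = axis j 1" by (simp only: matrix_vector_mul_assoc MI matrix_vector_mul_lid)
    hence "?x = (\<chi> k. det (\<chi> r c. if c = k then (axis j 1 :: real ^ 'n) $ r else ?M $ r $ c) / det ?M)"
      by (rule cramer[OF dnz, THEN iffD1])
    from arg_cong[OF this, of "\<lambda>x. x $ i"] have "?x $ i = det ?X / det ?M" by (simp only: vec_lambda_beta)
    moreover have "?x $ i = matrix_inv ?M $ i $ j" by (simp add: matrix_vector_mult_basis column_def)
    ultimately have e: "matrix_inv ?M $ i $ j = det ?X / of_int D" by (simp only: D)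
    have "det ?X \<in> \<int>" by (rule det_int) (use entry in \<open>auto simp: axis_def\<close>)
    then obtain m where m: "det ?X = of_int m" by (auto elim: Ints_cases)
    have "D \<noteq> 0" using dnz D by auto
    hence "(real l *\<^sub>R matrix_inv ?M) $ i $ j = 2 * of_int (sgn D * m)"
      by (simp add: e m l) (simp add: abs_if sgn_if)
    thus ?thesis by blast
  qed
  have "even_integral (real l *\<^sub>R matrix_inv ?M)"
    unfolding even_integral_def
  proof (intro conjI allI)
    fix i j
    obtain k :: int where "(real l *\<^sub>R matrix_inv ?M) $ i $ j = 2 * of_int k" using ent by blast
    thus "(real l *\<^sub>R matrix_inv ?M) $ i $ j \<in> \<int>" by simp
    show "\<exists>m::int. (real l *\<^sub>R matrix_inv ?M) $ i $ i = 2 * of_int m" by (rule ent)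
  qed
  moreover have "l > 0" using dnz D by (auto simp: l_def)
  ultimately show ?thesis by blast
qed

lemma form_level_even_mat:
  assumes "A \<in> Quad_pos" "integer_valued A"
  shows "even_mat A (form_level A)"
  using LeastI_ex[OF even_mat_exists[OF assms]] by (simp add: even_mat_def form_level_def)

section \<open>Gauss sums modulo 2 and divisibility of the level by 4\<close>

context integral_form
begin

definition rad2 :: "(int ^ 'n) set" where
  "rad2 = {h \<in> box_mod 2. \<forall>w. 2 dvd bl h w}"

lemma phase_2_int: "\<exists>s::int. phase 1 2 v = of_int s"
proof (cases "even (q v)")
  case True
  then obtain k where "q v = 2 * k" by (rule evenE)
  hence "of_int (1 * q v) / of_int 2 = (of_int k :: complex)" by simp
  hence "phase 1 2 v = 1" unfolding phase_def by (simp only: ex_int)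
  thus ?thesis by (intro exI[of _ 1]) simp
next
  case False
  then obtain k where "q v = 2 * k + 1" by (rule oddE)
  hence "of_int (1 * q v) / of_int 2 = (of_int k + 1 / 2 :: complex)" by (simp add: field_simps)
  moreover have "ex (1 / 2) = - 1" by (simp add: ex_def)
  ultimately have "phase 1 2 v = - 1" unfolding phase_def by (simp only: ex_add ex_int) simp
  thus ?thesis by (intro exI[of _ "- 1"]) simp
qed

text \<open>Modulo 2 all phases are signs, so the Gauss sum is an integer. Its square is 2^n times
  the sum of the phases over the radical, each of which is 1 by assumption.\<close>

lemma gauss_2_square:
  assumes "\<And>h. h \<in> rad2 \<Longrightarrow> even (q h)"
  shows "\<exists>s::int. s\<^sup>2 = 2 ^ CARD('n) * int (card rad2)"
proof -
  obtain \<sigma> where \<sigma>: "\<And>v. phase 1 2 v = of_int (\<sigma> v)" using phase_2_int by metis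
  have g: "gauss 1 2 = of_int (\<Sum>g\<in>box_mod 2. \<sigma> g)" by (simp add: gauss_def \<sigma>)
  have "phase 1 2 h = 1" if "h \<in> rad2" for h
  proof -
    have "even (q h)" using assms that by blast
    then obtain k where "q h = 2 * k" by (rule evenE)
    hence "of_int (1 * q h) / of_int 2 = (of_int k :: complex)" by simp
    thus ?thesis unfolding phase_def by (simp only: ex_int)
  qed
  hence "gauss 1 2 * cnj (gauss 1 2) = of_int (2 ^ CARD('n) * int (card rad2))"
    using gauss_norm_expand[of 2 1] by (simp add: rad2_def)
  hence "of_int ((\<Sum>g\<in>box_mod 2. \<sigma> g)\<^sup>2) = (of_int (2 ^ CARD('n) * int (card rad2)) :: complex)"
    unfolding g by (simp add: power2_eq_square)
  thus ?thesis by (intro exI[of _ "\<Sum>g\<in>box_mod 2. \<sigma> g"]) (simp only: of_int_eq_iff)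
qed

text \<open>The matrix 2A on integer vectors; it is inverse to \<open>adj\<close> up to the factor
  \<open>l\<close>.\<close>

definition gram :: "int ^ 'n \<Rightarrow> int ^ 'n" where
  "gram v = (\<chi> i. bl v (axis i 1))"

lemma int_vec_gram: "int_vec (gram v) = 2 *\<^sub>R (A *v int_vec v)"
proof (subst vec_eq_iff, intro allI)
  fix i :: 'n
  have "int_vec (axis i 1) = axis i (1::real)" by (simp add: vec_eq_iff axis_def)
  thus "int_vec (gram v) $ i = (2 *\<^sub>R (A *v int_vec v)) $ i"
    by (simp add: gram_def bl_commute[of v] of_int_bl inner_axis')
qed

lemma int_vec_inj: "int_vec v = int_vec w \<Longrightarrow> v = w"
  by (simp add: vec_eq_iff)

lemma adj_gram: "adj (gram v) = int l *s v"
  by (rule int_vec_inj) (simp add: int_vec_adj int_vec_gram matrix_vector_mult_scaleR int_vec_scale)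

lemma gram_adj: "gram (adj v) = int l *s v"
  by (rule int_vec_inj) (simp add: int_vec_adj int_vec_gram matrix_vector_mult_scaleR int_vec_scale)

lemma gram_add: "gram (v + w) = gram v + gram w"
  by (simp add: gram_def vec_eq_iff bl_add_left)

lemma gram_scale: "gram (k *s v) = k *s gram v"
  by (simp add: gram_def vec_eq_iff bl_scale_left)

lemma adj_scale: "adj (k *s v) = k *s adj v"
  by (rule int_vec_inj) (simp add: int_vec_adj int_vec_scale matrix_vector_mult_scaleR)

lemma adj_add: "adj (v + w) = adj v + adj w"
  by (rule int_vec_inj) (simp add: int_vec_adj int_vec_add matrix_vector_right_distrib scaleR_add_right)

lemma bl_gram: "bl v w = (\<Sum>i\<in>UNIV. gram v $ i * w $ i)"
proof -
  have "real_of_int (bl v w) = int_vec (gram v) \<bullet> int_vec w"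
    by (simp add: int_vec_gram of_int_bl inner_commute[of "A *v int_vec v"] inner_sym)
  also have "\<dots> = of_int (\<Sum>i\<in>UNIV. gram v $ i * w $ i)" by (simp add: inner_vec_def)
  finally show ?thesis by (simp only: of_int_eq_iff)
qed

lemma rad2_iff: "h \<in> rad2 \<longleftrightarrow> h \<in> box_mod 2 \<and> (\<exists>u. gram h = 2 *s u)"
proof -
  have "(\<forall>w. 2 dvd bl h w) \<longleftrightarrow> (\<exists>u. gram h = 2 *s u)"
  proof
    assume "\<forall>w. 2 dvd bl h w"
    hence "\<forall>i. \<exists>k. gram h $ i = 2 * k" by (simp add: gram_def dvd_def)
    then obtain u where "\<And>i. gram h $ i = 2 * u i" by metis
    hence "gram h = 2 *s (\<chi> i. u i)" by (simp add: vec_eq_iff)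
    thus "\<exists>u. gram h = 2 *s u" ..
  next
    assume "\<exists>u. gram h = 2 *s u"
    thus "\<forall>w. 2 dvd bl h w" by (auto simp: bl_gram intro!: dvd_sum)
  qed
  thus ?thesis by (simp add: rad2_def)
qed

lemma even_q_adj:
  assumes "even l"
  shows "even (q (adj u))"
proof -
  obtain k where k: "real l * qf Ai (int_vec u) / 4 = of_int k"
    using level_qf by (metis Ints_cases)
  have "real_of_int (q (adj u)) = of_int (int l * k)"
    by (simp add: of_int_q int_vec_adj qf_scaleR qf_Ai k[symmetric] power2_eq_square)
  hence "q (adj u) = int l * k" by (simp only: of_int_eq_iff)
  thus ?thesis using assms by simp
qed

text \<open>From 2A h = 2 u one gets adj u = m h. Since q (adj u) is a multiple of the even number l
  and m is odd, q h is even.\<close>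

lemma even_q_rad2:
  assumes l: "l = 2 * m" "odd m" and h: "h \<in> rad2"
  shows "even (q h)"
proof -
  obtain u where u: "gram h = 2 *s u" using h rad2_iff by blast
  have li: "int l = 2 * int m" using l by simp
  have "2 *s adj u = 2 *s (int m *s h)"
    using adj_gram[of h] by (simp add: u adj_scale li vector_smult_assoc)
  hence "adj u = int m *s h" by (simp add: vec_eq_iff)
  hence "even ((int m)\<^sup>2 * q h)" using even_q_adj[of u] l(1) by (simp add: q_scale)
  thus ?thesis using l(2) by simp
qed

text \<open>Doubling this form gives \<open>l (2A)\<^sup>-\<^sup>1\<close>, the matrix of
  \<open>adj\<close>. The same \<open>l\<close> serves it, because \<open>l\<close> times the
  inverse of that matrix is 2A again, and 2A is even.\<close>

lemma dual_integral_form: "integral_form ((real l / 4) *\<^sub>R Ai) l"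
proof
  let ?A = "(real l / 4) *\<^sub>R Ai"
  have l0: "real l / 4 > 0" using l_pos by simp
  have qA: "x \<bullet> (?A *v x) = (real l / 4) * qf Ai x" for x
    by (simp add: qf_def flip: scaleR_matrix_vector_assoc)
  show "?A \<in> Quad_pos"
    using Ai_posdef l0 by (auto simp: Quad_pos_def Quad_def qA transpose_scalar) (simp_all add: qf_def)
  show "integer_valued ?A" using level_qf by (simp add: integer_valued_def qA mult.commute)
  have p1: "(2 *\<^sub>R ?A) ** ((2 / real l) *\<^sub>R A) = mat 1" "((2 / real l) *\<^sub>R A) ** (2 *\<^sub>R ?A) = mat 1"
    using l_pos A_Ai Ai_A by (simp_all add: matrix_matrix_mult_def)
  hence "\<exists>X. (2 *\<^sub>R ?A) ** X = mat 1 \<and> X ** (2 *\<^sub>R ?A) = mat 1" by blast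
  hence "(2 *\<^sub>R ?A) ** matrix_inv (2 *\<^sub>R ?A) = mat 1"
    unfolding matrix_inv_def by (metis (mono_tags, lifting) someI_ex)
  hence "matrix_inv (2 *\<^sub>R ?A) = (2 / real l) *\<^sub>R A"
    by (metis p1(2) matrix_mul_assoc matrix_mul_lid matrix_mul_rid)
  hence eq: "real l *\<^sub>R matrix_inv (2 *\<^sub>R ?A) = 2 *\<^sub>R A" using l_pos by simp
  have ent: "(2 *\<^sub>R A) $ i $ j = of_int (bl (axis i 1) (axis j 1))" for i j
  proof -
    have "int_vec (axis i 1) = axis i (1::real)" for i :: 'n by (simp add: vec_eq_iff axis_def)
    thus ?thesis by (simp add: of_int_bl inner_axis' matrix_vector_mult_basis column_def)
  qed
  show "even_mat ?A l"
    unfolding even_mat_def eq even_integral_def ent bl_self using l_pos by auto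
qed

text \<open>Modulo 2 the kernel of \<open>gram\<close> is \<open>rad2\<close>. Both compositions of
  \<open>gram\<close> with \<open>adj\<close> are 2 m with m odd, which makes the image of
  \<open>gram\<close> modulo 2 equal to the kernel of \<open>adj\<close>, the radical of the dual
  form. Kernel and image have sizes with product 2^n.\<close>

lemma card_rad2_dual:
  assumes l: "l = 2 * m" "odd m"
  shows "card rad2 * card (integral_form.rad2 ((real l / 4) *\<^sub>R Ai)) = 2 ^ CARD('n)"
proof -
  interpret D: integral_form "(real l / 4) *\<^sub>R Ai" l by (rule dual_integral_form)
  have li: "int l = 2 * int m" using l by simp
  have Dgram: "D.gram v = adj v" for v
    by (rule int_vec_inj) (simp add: D.int_vec_gram int_vec_adj flip: scaleR_matrix_vector_assoc)
  define f where "f v = vmod 2 (gram v)" for v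
  have vm: "vmod 2 v = vmod 2 w \<longleftrightarrow> (\<exists>u. v - w = 2 *s u)" for v w :: "int ^ 'n"
  proof
    assume eq: "vmod 2 v = vmod 2 w"
    have "v - w = 2 *s ((\<chi> i. v $ i div 2) - (\<chi> i. w $ i div 2))"
      using vmod_eq[of v 2] vmod_eq[of w 2] eq by (metis add_diff_cancel_left vector_ssub_ldistrib)
    thus "\<exists>u. v - w = 2 *s u" ..
  next
    assume "\<exists>u. v - w = 2 *s u"
    then obtain u where "v = w + 2 *s u" by (metis add.commute diff_add_cancel)
    thus "vmod 2 v = vmod 2 w" by simp
  qed
  have mvm: "f (vmod 2 v) = f v" for v
  proof -
    have "gram v - gram (vmod 2 v) = 2 *s gram (\<chi> i. v $ i div 2)"
      by (subst (1) vmod_eq[of v 2]) (simp only: gram_add gram_scale add_diff_cancel_left')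
    hence "vmod 2 (gram v) = vmod 2 (gram (vmod 2 v))" using vm by blast
    thus ?thesis by (simp add: f_def)
  qed
  have img: "f ` box_mod 2 = D.rad2"
  proof (intro equalityI subsetI)
    fix y assume "y \<in> f ` box_mod 2"
    then obtain v where y: "y = vmod 2 (gram v)" by (auto simp: f_def)
    have "\<exists>u. gram v - y = 2 *s u" using vm[of "gram v" y] y vmod_vmod_add(1)[of 2 "gram v" 0] by simp
    then obtain u where u: "gram v = y + 2 *s u" by (metis add.commute diff_add_cancel)
    have "adj y = adj (gram v) + 2 *s (- adj u)"
      by (simp add: u adj_add adj_scale vec_eq_iff)
    also have "adj (gram v) = 2 *s (int m *s v)" by (simp add: adj_gram li vector_smult_assoc)
    also have "2 *s (int m *s v) + 2 *s (- adj u) = 2 *s (int m *s v + - adj u)" by (simp only: vector_add_ldistrib)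
    finally have "\<exists>u. adj y = 2 *s u" by blast
    thus "y \<in> D.rad2" by (simp add: D.rad2_iff Dgram y vmod_in_box)
  next
    fix y assume "y \<in> D.rad2"
    then obtain u where y: "y \<in> box_mod 2" and u: "adj y = 2 *s u" by (auto simp: D.rad2_iff Dgram)
    have "2 *s gram u = 2 *s (int m *s y)"
      using gram_adj[of y] by (simp add: u gram_scale li vector_smult_assoc)
    hence mu: "gram u = int m *s y" by (simp add: vec_eq_iff)
    obtain r where r: "int m = 2 * r + 1" using l(2) by (metis even_of_nat oddE)
    have "gram u - y = 2 *s (r *s y)" by (simp add: mu r vec_eq_iff algebra_simps)
    hence "vmod 2 (gram u) = vmod 2 y" using vm by blast
    hence "f (vmod 2 u) = y" unfolding mvm using vmod_box[OF y] by (simp add: f_def)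
    thus "y \<in> f ` box_mod 2" using vmod_in_box[of 2 u] by force
  qed
  have fib: "card {v \<in> box_mod 2. f v = y} = card rad2" if y: "y \<in> D.rad2" for y
  proof -
    have "y \<in> f ` box_mod 2" unfolding img by (rule y)
    then obtain w where w: "w \<in> box_mod 2" "f w = y" by blast
    have md: "(\<exists>u. gram (vmod 2 (v - w)) = 2 *s u) \<longleftrightarrow> f v = f w" for v
    proof -
      have "gram v - gram w = gram (v - w)" using gram_add[of "v - w" w] by simp
      hence "f v = f w \<longleftrightarrow> (\<exists>u. gram (v - w) = 2 *s u)" by (simp add: f_def vm)
      also have "\<dots> \<longleftrightarrow> f (v - w) = 0"
        using vm[of "gram (v - w)" 0] by (simp add: f_def) (simp add: vmod_def vec_eq_iff)
      also have "\<dots> \<longleftrightarrow> f (vmod 2 (v - w)) = 0" by (simp add: mvm)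
      also have "\<dots> \<longleftrightarrow> (\<exists>u. gram (vmod 2 (v - w)) = 2 *s u)"
        using vm[of "gram (vmod 2 (v - w))" 0] by (simp add: f_def) (simp add: vmod_def vec_eq_iff)
      finally show ?thesis by blast
    qed
    have "bij_betw (\<lambda>v. vmod 2 (v - w)) {v \<in> box_mod 2. f v = y} rad2"
    proof (rule bij_betw_byWitness[where f' = "\<lambda>v. vmod 2 (v + w)"])
      show "\<forall>v\<in>{v \<in> box_mod 2. f v = y}. vmod 2 (vmod 2 (v - w) + w) = v"
        using vmod_box by auto
      show "\<forall>v\<in>rad2. vmod 2 (vmod 2 (v + w) - w) = v"
        using vmod_box by (auto simp: rad2_def)
      show "(\<lambda>v. vmod 2 (v - w)) ` {v \<in> box_mod 2. f v = y} \<subseteq> rad2"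
        using md w(2) by (auto simp: rad2_iff vmod_in_box)
      show "(\<lambda>v. vmod 2 (v + w)) ` rad2 \<subseteq> {v \<in> box_mod 2. f v = y}"
      proof (intro subsetI, elim imageE)
        fix x v assume x: "x = vmod 2 (v + w)" and v: "v \<in> rad2"
        have "vmod 2 (v + w - w) = v" using v vmod_box by (auto simp: rad2_def)
        hence "f (v + w) = f w" using md[of "v + w"] v by (auto simp: rad2_iff)
        thus "x \<in> {v \<in> box_mod 2. f v = y}" using w(2) by (simp add: x mvm vmod_in_box)
      qed
    qed
    thus ?thesis by (rule bij_betw_same_card)
  qed
  have "2 ^ CARD('n) = card (box_mod 2 :: (int ^ 'n) set)" using card_box_mod[of 2] by simp
  also have "\<dots> = (\<Sum>y\<in>f ` box_mod 2. card {v \<in> box_mod 2. f v = y})"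
    using sum.image_gen[of "box_mod 2 :: (int ^ 'n) set" "\<lambda>_. 1 :: nat" f] by simp
  also have "\<dots> = card rad2 * card D.rad2" unfolding img using fib by simp
  finally show ?thesis by simp
qed

text \<open>
  If \<open>4\<close> does not divide \<open>l\<close>, then the Gauss sums modulo \<open>2\<close> of \<open>A\<close> and of the dual form are integers
  whose squares multiply to \<open>2\<^sup>3\<^sup>n\<close>; for odd \<open>l\<close> the square of the former is already \<open>2\<^sup>n\<close>.
\<close>

lemma four_dvd_level:
  assumes n: "odd CARD('n)"
  shows "4 dvd l"
proof (rule ccontr)
  assume l4: "\<not> 4 dvd l"
  show False
  proof (cases "even l")
    case False
    hence "nondeg 2" by (intro nondeg_coprime) simp
    hence "h = 0" if h: "h \<in> rad2" for h
    proof -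
      obtain u where u: "h = 2 *s u" using \<open>nondeg 2\<close> h unfolding nondeg_def rad2_def by blast
      hence "vmod 2 h = 0" by (simp add: vmod_def vec_eq_iff)
      thus ?thesis using h vmod_box[of h 2] by (simp add: rad2_def)
    qed
    moreover have "bl 0 w = 0" for w using bl_scale_left[of 0 0 w] by simp
    hence "0 \<in> rad2" by (simp add: rad2_def box_mod_def)
    ultimately have r: "rad2 = {0}" by blast
    have "q 0 = 0" by (simp add: q_def)
    then obtain s :: int where "s\<^sup>2 = 2 ^ CARD('n)" using gauss_2_square r by auto
    thus False using square_eq_two_power n by blast
  next
    case True
    then obtain m where m: "l = 2 * m" by (rule evenE)
    hence om: "odd m" using l4 by auto
    interpret D: integral_form "(real l / 4) *\<^sub>R Ai" l by (rule dual_integral_form)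
    obtain s where s: "s\<^sup>2 = 2 ^ CARD('n) * int (card rad2)"
      using gauss_2_square even_q_rad2[OF m om] by blast
    obtain t where t: "t\<^sup>2 = 2 ^ CARD('n) * int (card D.rad2)"
      using D.gauss_2_square D.even_q_rad2[OF m om] by blast
    have "(s * t)\<^sup>2 = 2 ^ CARD('n) * 2 ^ CARD('n) * int (card rad2 * card D.rad2)"
      by (simp add: power_mult_distrib s t)
    also have "\<dots> = 2 ^ (3 * CARD('n))"
      unfolding card_rad2_dual[OF m om] by (simp add: power_add[symmetric] mult.commute)
    finally have "even (3 * CARD('n))" by (rule square_eq_two_power)
    thus False using n by simp
  qed
qed

end

section \<open>The character\<close>

lemma moebius_comp:
  assumes "a * d - b * c = 1" "a' * d' - b' * c' = 1" and z: "Im z > 0"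
  shows "moebius (a * a' + b * c') (a * b' + b * d') (c * a' + d * c') (c * b' + d * d') z =
    moebius a b c d (moebius a' b' c' d' z)"
    and "of_int (c * a' + d * c') * z + of_int (c * b' + d * d') =
      (of_int c * moebius a' b' c' d' z + of_int d) * (of_int c' * z + of_int d')"
proof -
  have "c' \<noteq> 0 \<or> d' \<noteq> 0" using assms(2) by auto
  hence nz: "of_int c' * z + of_int d' \<noteq> 0" using linear_nonzero[OF z] by blast
  let ?j = "of_int c' * z + of_int d'" and ?u = "of_int a' * z + of_int b'"
  have m: "moebius a' b' c' d' z = ?u / ?j" by (simp add: moebius_def)
  show 2: "of_int (c * a' + d * c') * z + of_int (c * b' + d * d') =
      (of_int c * moebius a' b' c' d' z + of_int d) * ?j"
  proof -
    have "(of_int c * (?u / ?j) + of_int d) * ?j = of_int c * ?u + of_int d * ?j"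
      using nz by (simp add: distrib_right)
    thus ?thesis unfolding m by (simp add: algebra_simps)
  qed
  have 1: "of_int (a * a' + b * c') * z + of_int (a * b' + b * d') =
      (of_int a * moebius a' b' c' d' z + of_int b) * ?j"
  proof -
    have "(of_int a * (?u / ?j) + of_int b) * ?j = of_int a * ?u + of_int b * ?j"
      using nz by (simp add: distrib_right)
    thus ?thesis unfolding m by (simp add: algebra_simps)
  qed
  show "moebius (a * a' + b * c') (a * b' + b * d') (c * a' + d * c') (c * b' + d * d') z =
    moebius a b c d (moebius a' b' c' d' z)"
    unfolding moebius_def[of "a * a' + b * c'"] moebius_def[of a b c d] 1 2
    using nz by simp
qed

lemma moebius_minus: "moebius (- a) (- b) (- c) (- d) z = moebius a b c d z"
proof -
  have "of_int (- a) * z + of_int (- b) = - (of_int a * z + of_int b)"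
       "of_int (- c) * z + of_int (- d) = - (of_int c * z + of_int d)" by simp_all
  thus ?thesis unfolding moebius_def by (simp only: minus_divide_divide)
qed

lemma eta_d_one [simp]: "eta 1 b = 1"
proof -
  have "{0..<1 :: int} = {0}" by auto
  thus ?thesis by (simp add: eta_def)
qed

lemma det_coprime:
  fixes a b c d :: int
  assumes "a * d - b * c = 1"
  shows "coprime b d" "coprime c d"
proof -
  have "is_unit k" if "k dvd d" "k dvd b \<or> k dvd c" for k
  proof -
    have "k dvd a * d" "k dvd b * c" using that by auto
    hence "k dvd a * d - b * c" by (rule dvd_diff)
    thus ?thesis using assms by simp
  qed
  thus "coprime b d" "coprime c d" by (auto intro!: coprimeI)
qed

lemma coprime_add_modulus: "coprime (d + m) m \<longleftrightarrow> coprime d (m :: int)"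
  by (simp add: coprime_iff_gcd_eq_1)

context integral_form
begin

abbreviation "\<Theta> \<equiv> wtheta (\<lambda>_. 1) 0"

abbreviation "\<Theta>B B \<equiv> wtheta (\<lambda>x. of_real (qf B x)) 0"

definition J :: "int \<Rightarrow> int \<Rightarrow> int \<Rightarrow> int \<Rightarrow> complex \<Rightarrow> complex" where
  "J a b c d z = automorphy_factor (real CARD('n) / 2) a b c d z"

lemma J_even: "even CARD('n) \<Longrightarrow> J a b c d z = (of_int c * z + of_int d) ^ (CARD('n) div 2)"
proof -
  assume "even CARD('n)"
  then obtain k where k: "CARD('n) = 2 * k" by (rule evenE)
  thus ?thesis by (simp add: J_def automorphy_factor_def)
qed

lemma half_not_int: "odd m \<Longrightarrow> real m / 2 \<notin> \<int>"
proof
  assume m: "odd m" "real m / 2 \<in> \<int>"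
  then obtain k :: int where "real m / 2 = of_int k" by (auto elim: Ints_cases)
  hence "real_of_int (int m) = of_int (2 * k)" by simp
  hence "int m = 2 * k" by (simp only: of_int_eq_iff)
  thus False using m(1) by presburger
qed

lemma J_odd: "odd CARD('n) \<Longrightarrow> J a b c d z = (jacobi_theta (moebius a b c d z) / jacobi_theta z) ^ CARD('n)"
  using half_not_int[of "CARD('n)"] by (simp add: J_def automorphy_factor_def)

lemma level4: "odd CARD('n) \<Longrightarrow> int l dvd c \<Longrightarrow> 4 dvd c"
  using four_dvd_level by (metis dvd_trans int_dvd_int_iff of_nat_numeral)

lemma J_nonzero:
  assumes "a * d - b * c = 1" "Im z > 0"
  shows "J a b c d z \<noteq> 0"
proof -
  have "c \<noteq> 0 \<or> d \<noteq> 0" using assms(1) by auto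
  thus ?thesis
    using linear_nonzero[OF assms(2)] jacobi_theta_nonzero[OF assms(2)]
      jacobi_theta_nonzero[OF Im_moebius_pos[OF assms]]
    by (cases "even CARD('n)") (auto simp: J_even J_odd)
qed

text \<open>Also in half-integral weight the factor is an honest cocycle, being a power of
  \<theta>(g z) / \<theta>(z), in which the intermediate nonzero value cancels.\<close>

lemma J_comp:
  assumes "a * d - b * c = 1" "a' * d' - b' * c' = 1" and z: "Im z > 0"
  shows "J (a * a' + b * c') (a * b' + b * d') (c * a' + d * c') (c * b' + d * d') z =
    J a b c d (moebius a' b' c' d' z) * J a' b' c' d' z"
proof (cases "even CARD('n)")
  case True
  thus ?thesis unfolding J_even[OF True] moebius_comp(2)[OF assms] by (simp add: power_mult_distrib)
next
  case False
  show ?thesis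
    unfolding J_odd[OF False] moebius_comp(1)[OF assms]
    using jacobi_theta_nonzero[OF Im_moebius_pos[OF assms(2) z]]
    by (simp flip: power_mult_distrib)
qed

text \<open>A single number governs the theta series and all weights of trace zero; this equips both
  kinds of series with the same character.\<close>

definition multiplier :: "int \<Rightarrow> int \<Rightarrow> int \<Rightarrow> int \<Rightarrow> complex \<Rightarrow> bool" where
  "multiplier a b c d x \<longleftrightarrow> (\<forall>z. Im z > 0 \<longrightarrow>
     \<Theta> (moebius a b c d z) = x * J a b c d z * \<Theta> z \<and>
     (\<forall>B. trace (B ** Ai) = 0 \<longrightarrow>
       \<Theta>B B (moebius a b c d z) = x * J a b c d z * (of_int c * z + of_int d)\<^sup>2 * \<Theta>B B z))"

text \<open>The Gauss sum of A for b = 1, normalised by d^(n/2) for even n and by the Gauss sum of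
  the n-th power of Jacobi's theta function for odd n. It depends on d alone, which later allows
  matrices with the same d to be compared.\<close>

definition odd_multiplier :: "int \<Rightarrow> complex" where
  "odd_multiplier d = (if even CARD('n) then gauss 1 d / of_int d ^ (CARD('n) div 2) else gauss 1 d / eta d 1 ^ CARD('n))"

lemma multiplier_odd:
  assumes det: "a * d - b * c = 1" and lc: "int l dvd c" and d: "d > 0" "odd d"
  shows "multiplier a b c d (odd_multiplier d)"
proof -
  have "coprime b d" "coprime c d" using det_coprime[OF det] .
  hence cl: "coprime d (int l)" using lc by (metis coprime_commute coprime_divisors dvd_refl)
  have g: "gauss b d = sgn_mod d b ^ CARD('n) * gauss 1 d"
    by (rule gauss_sign[OF d cl \<open>coprime b d\<close>])
  have s: "sgn_mod d b \<in> {1, - 1}" by (rule sgn_mod_values[OF d \<open>coprime b d\<close>])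
  have key: "gauss b d * rho c d z ^ CARD('n) = odd_multiplier d * J a b c d z" if z: "Im z > 0" for z
  proof (cases "even CARD('n)")
    case True
    then obtain k where k: "CARD('n) = 2 * k" by (rule evenE)
    have d0: "d \<noteq> 0" using d by simp
    have "sgn_mod d b ^ CARD('n) = 1" using s True by auto
    hence "gauss b d = gauss 1 d" using g by simp
    moreover have "rho c d z ^ CARD('n) = ((of_int c * z + of_int d) / of_int d) ^ k"
      unfolding k power_mult rho_sq[OF z d0] ..
    ultimately show ?thesis
      using True k d0 by (simp add: odd_multiplier_def J_even power_divide)
  next
    case False
    have "jacobi_theta (moebius a b c d z) / jacobi_theta z = eta d b * rho c d z"
      using jacobi_theta_transform[OF det level4[OF False lc] d(1) z] jacobi_theta_nonzero[OF z] by simp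
    hence "J a b c d z = (sgn_mod d b * eta d 1) ^ CARD('n) * rho c d z ^ CARD('n)"
      unfolding J_odd[OF False] eta_sign[OF d \<open>coprime b d\<close>, symmetric] by (simp add: power_mult_distrib)
    thus ?thesis
      using False g eta_nonzero[of d 1] d by (simp add: odd_multiplier_def power_mult_distrib)
  qed
  show ?thesis
    unfolding multiplier_def
  proof (intro allI impI conjI)
    fix z :: complex assume z: "Im z > 0"
    show "\<Theta> (moebius a b c d z) = odd_multiplier d * J a b c d z * \<Theta> z"
      unfolding theta_transform[OF det lc d(1) z] key[OF z] ..
    fix B :: "real ^ 'n ^ 'n" assume "trace (B ** Ai) = 0"
    thus "\<Theta>B B (moebius a b c d z) = odd_multiplier d * J a b c d z * (of_int c * z + of_int d)\<^sup>2 * \<Theta>B B z"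
      using theta_qf_transform[OF det lc d(1) z, of B] unfolding key[OF z] by simp
  qed
qed

text \<open>Evaluated at i, where neither the theta series nor the automorphy factor
  vanishes.\<close>

lemma multiplier_unique:
  assumes det: "a * d - b * c = 1" and "multiplier a b c d x" "multiplier a b c d y"
  shows "x = y"
proof -
  have i: "Im \<i> > 0" by simp
  have "\<Theta> \<i> \<noteq> 0" using theta_nonzero[of 1] by simp
  moreover have "x * J a b c d \<i> * \<Theta> \<i> = y * J a b c d \<i> * \<Theta> \<i>"
    using assms(2,3) i unfolding multiplier_def by metis
  ultimately show ?thesis using J_nonzero[OF det i] by simp
qed

lemma multiplier_comp:
  assumes det: "a * d - b * c = 1" "a' * d' - b' * c' = 1" and r: "multiplier a b c d x" "multiplier a' b' c' d' y"
  shows "multiplier (a * a' + b * c') (a * b' + b * d') (c * a' + d * c') (c * b' + d * d') (x * y)"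
  unfolding multiplier_def
proof (intro allI impI conjI)
  fix z :: complex assume z: "Im z > 0"
  note z' = Im_moebius_pos[OF det(2) z]
  show "\<Theta> (moebius (a * a' + b * c') (a * b' + b * d') (c * a' + d * c') (c * b' + d * d') z) =
    x * y * J (a * a' + b * c') (a * b' + b * d') (c * a' + d * c') (c * b' + d * d') z * \<Theta> z"
    using r z z' unfolding multiplier_def moebius_comp[OF det z] J_comp[OF det z] by (simp add: mult_ac)
  fix B :: "real ^ 'n ^ 'n" assume "trace (B ** Ai) = 0"
  thus "\<Theta>B B (moebius (a * a' + b * c') (a * b' + b * d') (c * a' + d * c') (c * b' + d * d') z) =
    x * y * J (a * a' + b * c') (a * b' + b * d') (c * a' + d * c') (c * b' + d * d') z *
      (of_int (c * a' + d * c') * z + of_int (c * b' + d * d'))\<^sup>2 * \<Theta>B B z"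
    using r z z' unfolding multiplier_def moebius_comp[OF det z] J_comp[OF det z] by (simp add: mult_ac power_mult_distrib)
qed

lemma multiplier_translation: "multiplier 1 m 0 1 1"
proof -
  have m: "moebius 1 m 0 1 z = z + of_int m" for z by (simp add: moebius_def)
  have "jacobi_theta (z + of_int m) = jacobi_theta z" for z
    unfolding jacobi_theta_unit_form by (rule unit_theta.wtheta_periodic)
  hence "J 1 m 0 1 z = 1" if "Im z > 0" for z
    using jacobi_theta_nonzero[OF that] by (cases "even CARD('n)") (simp_all add: J_even J_odd m)
  thus ?thesis unfolding multiplier_def m wtheta_periodic by simp
qed

lemma multiplier_lower:
  assumes "int l dvd c"
  shows "multiplier 1 0 c 1 1"
proof -
  have "odd_multiplier 1 = 1" by (simp add: odd_multiplier_def)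
  thus ?thesis using multiplier_odd[of 1 1 0 c] assms by simp
qed

lemma multiplier_translate_iff:
  assumes det: "a * d - b * c = 1"
  shows "multiplier a (b + k * a) c (d + k * c) x \<longleftrightarrow> multiplier a b c d x"
proof
  assume "multiplier a b c d x"
  from multiplier_comp[OF det _ this multiplier_translation[of k]]
  show "multiplier a (b + k * a) c (d + k * c) x" by (simp add: algebra_simps)
next
  assume r: "multiplier a (b + k * a) c (d + k * c) x"
  have "a * (d + k * c) - (b + k * a) * c = 1" using det by (simp add: algebra_simps)
  from multiplier_comp[OF this _ r multiplier_translation[of "- k"]]
  show "multiplier a b c d x" by (simp add: algebra_simps)
qed

lemma multiplier_lower_iff:
  assumes det: "a * d - b * c = 1" and e: "int l dvd e"
  shows "multiplier (a + b * e) b (c + d * e) d x \<longleftrightarrow> multiplier a b c d x"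
proof
  assume "multiplier a b c d x"
  from multiplier_comp[OF det _ this multiplier_lower[OF e]]
  show "multiplier (a + b * e) b (c + d * e) d x" by simp
next
  assume r: "multiplier (a + b * e) b (c + d * e) d x"
  have "(a + b * e) * d - b * (c + d * e) = 1" using det by (simp add: algebra_simps)
  from multiplier_comp[OF this _ r multiplier_lower[of "- e"]] e
  show "multiplier a b c d x" by simp
qed

text \<open>
  A translation on the right makes \<open>d\<close> odd and positive without changing the multiplier.
\<close>

lemma multiplier_same_d_nonzero:
  assumes det: "a * d - b * c = 1" "a' * d - b' * c' = 1" and lc: "int l dvd c" "int l dvd c'"
    and c: "c \<noteq> 0" "c' \<noteq> 0"
  shows "\<exists>x. multiplier a b c d x \<and> multiplier a' b' c' d x"
proof -
  \<comment> \<open>A multiple of c c' allows one e for both matrices. The sign makes the increment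
    positive, its size exceeds the modulus of d, and its last factor is even for odd d and odd for
    even d, in which case c and c' are odd; so e is odd and positive.\<close>
  define s where "s = sgn (c * c') * (if odd d then 2 * (\<bar>d\<bar> + 1) else 2 * \<bar>d\<bar> + 1)"
  define e where "e = d + s * (c * c')"
  have e_eq: "e = d + \<bar>c * c'\<bar> * (if odd d then 2 * (\<bar>d\<bar> + 1) else 2 * \<bar>d\<bar> + 1)"
  proof -
    have "sgn (c * c') * t * (c * c') = \<bar>c * c'\<bar> * t" for t
      using mult_sgn_abs[of "c * c'"] by (simp add: abs_sgn mult_ac)
    thus ?thesis unfolding e_def s_def by simp
  qed
  have cc: "\<bar>c * c'\<bar> \<ge> 1" using c by (simp add: int_one_le_iff_zero_less)
  have "\<bar>c * c'\<bar> * (if odd d then 2 * (\<bar>d\<bar> + 1) else 2 * \<bar>d\<bar> + 1) \<ge> 1 * (2 * \<bar>d\<bar> + 1)"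
    using cc by (intro mult_mono) auto
  moreover define t where "t = \<bar>c * c'\<bar> * (if odd d then 2 * (\<bar>d\<bar> + 1) else 2 * \<bar>d\<bar> + 1)"
  ultimately have "t \<ge> 2 * \<bar>d\<bar> + 1" "e = d + t" unfolding e_eq by simp_all
  hence e: "e > 0" by linarith
  have od: "odd e"
  proof (cases "odd d")
    case True thus ?thesis unfolding e_eq by simp
  next
    case False
    hence "odd c" "odd c'"
      using det_coprime(2)[OF det(1)] det_coprime(2)[OF det(2)] by (auto dest: coprime_common_divisor_int)
    thus ?thesis using False unfolding e_eq by simp
  qed
  have d1: "e = d + (s * c') * c" and d2: "e = d + (s * c) * c'" by (simp_all add: e_def mult_ac)
  have "multiplier a (b + (s * c') * a) c e (odd_multiplier e)"
    by (rule multiplier_odd) (use det lc e od in \<open>simp_all add: d1 algebra_simps\<close>)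
  moreover have "multiplier a' (b' + (s * c) * a') c' e (odd_multiplier e)"
    by (rule multiplier_odd) (use det lc e od in \<open>simp_all add: d2 algebra_simps\<close>)
  ultimately show ?thesis
    using multiplier_translate_iff[OF det(1), of "s * c'"] multiplier_translate_iff[OF det(2), of "s * c"]
    unfolding d1[symmetric] d2[symmetric] by blast
qed

text \<open>A vanishing lower left entry is removed by multiplying with (1, 0; e, 1) on the right,
  which adds d e to it and leaves d and the multiplier alone.\<close>

lemma multiplier_same_d:
  assumes det: "a * d - b * c = 1" "a' * d - b' * c' = 1" and lc: "int l dvd c" "int l dvd c'"
  shows "\<exists>x. multiplier a b c d x \<and> multiplier a' b' c' d x"
proof -
  have fix0: "\<exists>e. int l dvd e \<and> c + d * e \<noteq> 0" if "a * d - b * c = 1" for a b c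
  proof (cases "c = 0")
    case True
    hence "d \<noteq> 0" using that by auto
    thus ?thesis using l_pos True by (intro exI[of _ "int l"]) simp
  qed (intro exI[of _ 0], simp)
  obtain e where e: "int l dvd e" "c + d * e \<noteq> 0" using fix0[OF det(1)] by blast
  obtain e' where e': "int l dvd e'" "c' + d * e' \<noteq> 0" using fix0[OF det(2)] by blast
  have "\<exists>x. multiplier (a + b * e) b (c + d * e) d x \<and> multiplier (a' + b' * e') b' (c' + d * e') d x"
    by (rule multiplier_same_d_nonzero) (use det lc e e' in \<open>auto simp: algebra_simps\<close>)
  thus ?thesis using multiplier_lower_iff[OF det(1) e(1)] multiplier_lower_iff[OF det(2) e'(1)] by blast
qed

text \<open>A matrix with lower row (l, d) mediates: a translation turns it into one with lower row
  (l, d + k l) and the same multiplier, and matrices with equal d share their multipliers.\<close>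

lemma multiplier_cong_d:
  assumes det: "a * d - b * c = 1" "a' * d' - b' * c' = 1" and lc: "int l dvd c" "int l dvd c'"
    and dd: "[d = d'] (mod int l)" and r: "multiplier a b c d x" "multiplier a' b' c' d' y"
  shows "x = y"
proof -
  obtain k where k: "d' = d + k * int l" using dd by (metis cong_iff_lin mult.commute)
  have "coprime d (int l)"
  proof -
    obtain c0 where "c = int l * c0" using lc(1) by (rule dvdE)
    thus ?thesis using det_coprime(2)[OF det(1)] by (auto simp: coprime_commute)
  qed
  then obtain u v where uv: "u * d + v * int l = 1" using bezout_int[of d "int l"] by auto
  have det0: "u * d - (- v) * int l = 1" using uv by simp
  have det1: "u * d' - (- v + k * u) * int l = 1" using uv by (simp add: k algebra_simps)
  obtain x0 where x0: "multiplier a b c d x0" "multiplier u (- v) (int l) d x0"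
    using multiplier_same_d[OF det(1) det0 lc(1)] by auto
  have x0': "multiplier u (- v + k * u) (int l) d' x0"
    unfolding k using multiplier_translate_iff[OF det0, of k x0] x0(2) by simp
  obtain x1 where x1: "multiplier u (- v + k * u) (int l) d' x1" "multiplier a' b' c' d' x1"
    using multiplier_same_d[OF det1 det(2) _ lc(2)] by auto
  have "x = x0" by (rule multiplier_unique[OF det(1) r(1) x0(1)])
  moreover have "x0 = x1" by (rule multiplier_unique[OF det1 x0' x1(1)])
  moreover have "x1 = y" by (rule multiplier_unique[OF det(2) x1(2) r(2)])
  ultimately show ?thesis by simp
qed

text \<open>For x = 0 the theta series would vanish at every g z, in particular at i, the image
  under g of the point obtained from i by the inverse matrix.\<close>

lemma multiplier_nonzero:
  assumes det: "a * d - b * c = 1" and r: "multiplier a b c d x"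
  shows "x \<noteq> 0"
proof
  assume "x = 0"
  have det': "d * a - (- b) * (- c) = 1" using det by (simp add: mult.commute)
  let ?z = "moebius d (- b) (- c) a \<i>"
  have z: "Im ?z > 0" by (rule Im_moebius_pos[OF det']) simp
  have "moebius a b c d ?z = moebius 1 0 0 1 \<i>"
    using moebius_comp(1)[OF det det', of \<i>] det by (simp add: mult.commute)
  hence "\<Theta> \<i> = 0" using r z \<open>x = 0\<close> unfolding multiplier_def by (metis mult_zero_left moebius_def
        add_0_right div_by_1 mult_1 of_int_0 of_int_1 add_0)
  thus False using theta_nonzero[of 1] by simp
qed

text \<open>The value at d is the multiplier of any matrix of the group with lower right entry
  congruent to d. It is multiplicative because modulo l the lower right entry of a product is the
  product of the lower right entries.\<close>

lemma dirichlet_char_exists: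
  "\<exists>\<psi>. dirichlet_char l \<psi> \<and> (\<forall>a b c d. a * d - b * c = 1 \<longrightarrow> int l dvd c \<longrightarrow> multiplier a b c d (\<psi> d))"
proof -
  define P where "P d x \<longleftrightarrow> (\<exists>a b c d'. a * d' - b * c = 1 \<and> int l dvd c \<and> [d' = d] (mod int l) \<and> multiplier a b c d' x)" for d x
  have P_unique: "x = y" if "P d x" "P d y" for d x y
    using that multiplier_cong_d unfolding P_def by (meson cong_sym cong_trans)
  have P_ex: "\<exists>x. P d x" if "coprime d (int l)" for d
  proof -
    obtain u v where uv: "u * d + v * int l = 1" using bezout_int[of d "int l"] \<open>coprime d (int l)\<close> by auto
    have det: "u * d - (- v) * int l = 1" using uv by simp
    obtain x where "multiplier u (- v) (int l) d x" using multiplier_same_d[OF det det dvd_refl dvd_refl] by blast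
    thus ?thesis unfolding P_def using det by (meson cong_refl dvd_refl)
  qed
  have P_cop: "coprime d (int l)" if "P d x" for d x
  proof -
    obtain a b c d' where *: "a * d' - b * c = 1" "int l dvd c" "[d' = d] (mod int l)"
      using \<open>P d x\<close> unfolding P_def by blast
    obtain c0 where "c = int l * c0" using *(2) by (rule dvdE)
    hence "coprime d' (int l)" using det_coprime(2)[OF *(1)] by (auto simp: coprime_commute)
    thus ?thesis using *(3) by (metis cong_imp_coprime cong_sym coprime_commute)
  qed
  define \<psi> where "\<psi> d = (if coprime d (int l) then SOME x. P d x else 0)" for d
  have \<psi>: "\<psi> d = x" if "P d x" for d x
    using P_cop[OF that] P_unique[OF someI[of "P d", OF that] that] by (simp add: \<psi>_def)
  have main: "multiplier a b c d (\<psi> d)" if det: "a * d - b * c = 1" and c: "int l dvd c" for a b c d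
  proof -
    obtain x where x: "multiplier a b c d x" using multiplier_same_d[OF det det c c] by blast
    hence "P d x" using det c unfolding P_def by (meson cong_refl)
    thus ?thesis using \<psi> x by simp
  qed
  have "dirichlet_char l \<psi>"
    unfolding dirichlet_char_def
  proof (intro conjI allI)
    have "P 1 1" unfolding P_def using multiplier_translation[of 0]
      by (intro exI[of _ 1] exI[of _ 0]) simp
    thus "\<psi> 1 = 1" by (rule \<psi>)
  next
    fix d e
    show "\<psi> (d * e) = \<psi> d * \<psi> e"
    proof (cases "coprime d (int l) \<and> coprime e (int l)")
      case True
      then obtain x y where xy: "P d x" "P e y" using P_ex by blast
      obtain a b c d' where 1: "a * d' - b * c = 1" "int l dvd c" "[d' = d] (mod int l)" "multiplier a b c d' x"
        using xy(1) unfolding P_def by blast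
      obtain a' b' c' e' where 2: "a' * e' - b' * c' = 1" "int l dvd c'" "[e' = e] (mod int l)" "multiplier a' b' c' e' y"
        using xy(2) unfolding P_def by blast
      have "P (d * e) (x * y)"
        unfolding P_def
      proof (intro exI conjI)
        show "multiplier (a * a' + b * c') (a * b' + b * e') (c * a' + d' * c') (c * b' + d' * e') (x * y)"
          by (rule multiplier_comp[OF 1(1) 2(1) 1(4) 2(4)])
        have "(a * a' + b * c') * (c * b' + d' * e') - (a * b' + b * e') * (c * a' + d' * c') =
            (a * d' - b * c) * (a' * e' - b' * c')" by (simp add: algebra_simps)
        thus "(a * a' + b * c') * (c * b' + d' * e') - (a * b' + b * e') * (c * a' + d' * c') = 1"
          using 1(1) 2(1) by simp
        show "int l dvd c * a' + d' * c'" using 1(2) 2(2) by simp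
        have "[c * b' + d' * e' = 0 * b' + d * e] (mod int l)"
          using 1(2,3) 2(3) by (intro cong_add cong_mult) (auto simp: cong_0_iff)
        thus "[c * b' + d' * e' = d * e] (mod int l)" by simp
      qed
      thus ?thesis using \<psi> xy by metis
    next
      case False
      thus ?thesis by (auto simp: \<psi>_def)
    qed
  next
    fix d
    have "P (d + int l) = P d" unfolding P_def by (simp add: cong_def)
    thus "\<psi> (d + int l) = \<psi> d" by (simp add: \<psi>_def coprime_add_modulus)
    show "\<psi> d = 0 \<longleftrightarrow> \<not> coprime d (int l)"
    proof
      assume 0: "\<psi> d = 0"
      show "\<not> coprime d (int l)"
      proof
        assume "coprime d (int l)"
        then obtain x where x: "P d x" using P_ex by blast
        hence "x \<noteq> 0" using multiplier_nonzero unfolding P_def by blast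
        thus False using \<psi>[OF x] 0 by simp
      qed
    qed (simp add: \<psi>_def)
  qed
  thus ?thesis using main by blast
qed

end

section \<open>Modular forms\<close>

text \<open>Raising a half-integral weight by 2 multiplies the automorphy factor by this fourth
  power, which has to agree with the factor of weight 2. For d > 0 it is the product of the fourth
  powers of \<open>eta\<close> and \<open>rho\<close>; for d < 0 the matrix is replaced by its
  negative.\<close>

lemma jacobi_ratio_fourth:
  assumes det: "a * d - b * c = 1" and c: "4 dvd c" and z: "Im z > 0"
  shows "(jacobi_theta (moebius a b c d z) / jacobi_theta z) ^ 4 = (of_int c * z + of_int d)\<^sup>2"
proof -
  have pos: "(jacobi_theta (moebius a b c d z) / jacobi_theta z) ^ 4 = (of_int c * z + of_int d)\<^sup>2"
    if det: "a * d - b * c = 1" and c: "4 dvd c" and d: "d > 0" for a b c d :: int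
  proof -
    have "even c" using c by (rule dvd_trans[rotated]) simp
    hence od: "odd d" using det_coprime(2)[OF det] by (auto dest: coprime_common_divisor_int)
    have d0: "d \<noteq> 0" using d by simp
    have "jacobi_theta (moebius a b c d z) / jacobi_theta z = eta d b * rho c d z"
      using jacobi_theta_transform[OF det c d z] jacobi_theta_nonzero[OF z] by simp
    moreover have "eta d b ^ 4 = (of_int d)\<^sup>2" by (rule eta_fourth[OF d od det_coprime(1)[OF det]])
    moreover have "rho c d z ^ 4 = ((of_int c * z + of_int d) / of_int d)\<^sup>2"
      unfolding rho_sq[OF z d0, symmetric] by (simp flip: power_mult)
    ultimately show ?thesis using d0 by (simp add: power_mult_distrib power_divide)
  qed
  have "even c" using c by (rule dvd_trans[rotated]) simp
  hence "d \<noteq> 0" using det_coprime(2)[OF det] by (auto dest: coprime_common_divisor_int)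
  then consider "d > 0" | "- d > 0" by linarith
  thus ?thesis
  proof cases
    case 1 thus ?thesis using pos det c by blast
  next
    case 2
    have "(of_int (- c) * z + of_int (- d))\<^sup>2 = (of_int c * z + of_int d)\<^sup>2"
      by (simp add: power2_eq_square algebra_simps)
    moreover have "(- a) * (- d) - (- b) * (- c) = 1" "4 dvd - c" using det c by simp_all
    ultimately show ?thesis using pos[of "- a" "- d" "- b" "- c"] 2 by (simp add: moebius_minus)
  qed
qed

context integral_form
begin

lemma J_weight4:
  assumes det: "a * d - b * c = 1" and lc: "int l dvd c" and z: "Im z > 0"
  shows "automorphy_factor ((real CARD('n) + 4) / 2) a b c d z = J a b c d z * (of_int c * z + of_int d)\<^sup>2"
proof (cases "even CARD('n)")
  case True
  then obtain k where k: "CARD('n) = 2 * k" by (rule evenE)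
  have e: "(real CARD('n) + 4) / 2 = real (k + 2)" by (simp add: k)
  have f: "\<lfloor>real (k + 2)\<rfloor> = int (k + 2)" by (rule floor_of_nat)
  have "automorphy_factor ((real CARD('n) + 4) / 2) a b c d z = (of_int c * z + of_int d) ^ (k + 2)"
    unfolding automorphy_factor_def e f power_int_of_nat by simp
  thus ?thesis by (simp only: J_even[OF True] k power_add) simp
next
  case False
  have e: "(real CARD('n) + 4) / 2 = real (CARD('n) + 4) / 2" by simp
  have f: "\<lfloor>2 * (real (CARD('n) + 4) / 2)\<rfloor> = int (CARD('n) + 4)"
  proof -
    have "2 * (real m / 2) = real m" for m by simp
    thus ?thesis by (simp only: floor_of_nat)
  qed
  have ni: "real (CARD('n) + 4) / 2 \<notin> \<int>" by (rule half_not_int) (use False in simp)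
  show ?thesis
    unfolding automorphy_factor_def e f if_not_P[OF ni] power_int_of_nat power_add
      jacobi_ratio_fourth[OF det level4[OF False lc] z] J_odd[OF False] ..
qed

lemma modular_form_intro:
  assumes hol: "f holomorphic_on {z. Im z > 0}"
    and k: "k = real CARD('n) / 2 + real m"
    and tr: "\<exists>\<psi>. dirichlet_char l \<psi> \<and> (\<forall>a b c d. a * d - b * c = 1 \<longrightarrow> int l dvd c \<longrightarrow>
       (\<forall>z. Im z > 0 \<longrightarrow> f (moebius a b c d z) = \<psi> d * automorphy_factor k a b c d z * f z))"
    and bd: "\<And>a b c d. a * d - b * c = 1 \<Longrightarrow>
       \<exists>W. \<forall>z. Im z \<ge> 1 \<longrightarrow> norm ((of_int c * z + of_int d) powr (- of_real k) * f (moebius a b c d z)) \<le> W"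
  shows "modular_form k l f"
  unfolding modular_form_def
proof (intro conjI impI allI)
  show "l > 0" by (rule l_pos)
  have "2 * k = real (CARD('n) + 2 * m)" by (simp add: k)
  thus "2 * k \<in> \<int>" by (metis Ints_of_nat)
  show "4 dvd l" if "k \<notin> \<int>"
  proof (rule four_dvd_level, rule notI)
    assume "even CARD('n)"
    then obtain j where "CARD('n) = 2 * j" by (rule evenE)
    hence "k = real (j + m)" by (simp add: k)
    thus False using that by (metis Ints_of_nat)
  qed
  show "f holomorphic_on upper_half_plane" using hol by (simp add: upper_half_plane_def)
  show "\<exists>\<psi>. dirichlet_char l \<psi> \<and> (\<forall>a b c d. a * d - b * c = 1 \<longrightarrow> int l dvd c \<longrightarrow>
       (\<forall>z\<in>upper_half_plane. f (moebius a b c d z) = \<psi> d * automorphy_factor k a b c d z * f z))"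
    using tr by (simp add: upper_half_plane_def)
  fix a b c d :: int assume det: "a * d - b * c = 1"
  obtain W where "\<And>z. Im z \<ge> 1 \<Longrightarrow>
      norm ((of_int c * z + of_int d) powr (- of_real k) * f (moebius a b c d z)) \<le> W"
    using bd[OF det] by blast
  thus "\<exists>Y>0. bounded ((\<lambda>z. (of_int c * z + of_int d) powr (- of_real k) * f (moebius a b c d z)) ` {z. Im z \<ge> Y})"
    by (intro exI[of _ 1]) (auto simp: bounded_iff)
qed

lemma theta_series_modular: "modular_form (real CARD('n) / 2) l (theta_series A)"
proof (rule modular_form_intro[where m = 0])
  have ts: "theta_series A = \<Theta>" by (rule ext) (rule theta_series_wtheta)
  show "theta_series A holomorphic_on {z. Im z > 0}"
    unfolding ts by (rule wtheta_holomorphic) (rule quad_growth_const)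
  show "\<exists>\<psi>. dirichlet_char l \<psi> \<and> (\<forall>a b c d. a * d - b * c = 1 \<longrightarrow> int l dvd c \<longrightarrow>
       (\<forall>z. Im z > 0 \<longrightarrow> theta_series A (moebius a b c d z) =
          \<psi> d * automorphy_factor (real CARD('n) / 2) a b c d z * theta_series A z))"
    using dirichlet_char_exists unfolding multiplier_def J_def ts by meson
  show "\<exists>W. \<forall>z. Im z \<ge> 1 \<longrightarrow> norm ((of_int c * z + of_int d) powr (- of_real (real CARD('n) / 2)) *
      theta_series A (moebius a b c d z)) \<le> W" if "a * d - b * c = 1" for a b c d
    unfolding ts by (rule theta_cusp_bounded[OF that])
qed simp

lemma partial_theta_modular:
  assumes trB: "trace (B ** Ai) = 0"
  shows "modular_form ((real CARD('n) + 4) / 2) l (partial_theta B A)"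
proof (rule modular_form_intro[where m = 2])
  have k: "(real CARD('n) + 4) / 2 = real CARD('n) / 2 + real 2" by simp
  have pt: "partial_theta B A z = \<Theta>B B z" if "Im z > 0" for z
    using partial_theta_wtheta[OF that] .
  have "\<Theta>B B holomorphic_on {z. Im z > 0}"
    by (rule wtheta_holomorphic) (rule quad_growth_qf)
  thus "partial_theta B A holomorphic_on {z. Im z > 0}"
    by (rule holomorphic_transform) (simp add: pt)
  show "\<exists>\<psi>. dirichlet_char l \<psi> \<and> (\<forall>a b c d. a * d - b * c = 1 \<longrightarrow> int l dvd c \<longrightarrow>
       (\<forall>z. Im z > 0 \<longrightarrow> partial_theta B A (moebius a b c d z) =
          \<psi> d * automorphy_factor ((real CARD('n) + 4) / 2) a b c d z * partial_theta B A z))"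
  proof -
    obtain \<psi> where \<psi>: "dirichlet_char l \<psi>"
        "\<And>a b c d. a * d - b * c = 1 \<Longrightarrow> int l dvd c \<Longrightarrow> multiplier a b c d (\<psi> d)"
      using dirichlet_char_exists by blast
    show ?thesis
    proof (intro exI conjI allI impI)
      fix a b c d :: int and z :: complex
      assume det: "a * d - b * c = 1" and lc: "int l dvd c" and z: "Im z > 0"
      show "partial_theta B A (moebius a b c d z) =
          \<psi> d * automorphy_factor ((real CARD('n) + 4) / 2) a b c d z * partial_theta B A z"
        unfolding pt[OF z] pt[OF Im_moebius_pos[OF det z]] J_weight4[OF det lc z]
        using \<psi>(2)[OF det lc] z trB unfolding multiplier_def by (simp add: mult.assoc)
    qed (rule \<psi>(1))
  qed
  show "\<exists>W. \<forall>z. Im z \<ge> 1 \<longrightarrow> norm ((of_int c * z + of_int d) powr (- of_real ((real CARD('n) + 4) / 2)) *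
      partial_theta B A (moebius a b c d z)) \<le> W" if det: "a * d - b * c = 1" for a b c d
  proof -
    have "Im (moebius a b c d z) > 0" if "Im z \<ge> 1" for z using Im_moebius_pos[OF det] that by simp
    thus ?thesis using theta_qf_cusp_bounded[OF det trB] unfolding k by (simp add: pt)
  qed
qed simp

text \<open>
  For \<open>g = (1, 0; c, 1)\<close> every character and every Gauss sum is trivial, so only the trace term remains.
\<close>

lemma modular_form_imp_traceless:
  assumes N: "N > 0" and \<psi>: "\<psi> 1 = 1"
    and tr: "\<And>c z. int N dvd c \<Longrightarrow> Im z > 0 \<Longrightarrow> \<Theta>B B (moebius 1 0 c 1 z) =
       \<psi> 1 * automorphy_factor ((real CARD('n) + 4) / 2) 1 0 c 1 z * \<Theta>B B z"
  shows "trace (B ** Ai) = 0"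
proof -
  \<comment> \<open>A multiple of N, for the law assumed here, and of l, for the law already
    proved.\<close>
  define c where "c = int N * int l"
  have c: "c > 0" "int N dvd c" "int l dvd c" using N l_pos by (simp_all add: c_def)
  have det: "1 * 1 - 0 * c = (1 :: int)" by simp
  have i: "Im \<i> > 0" by simp
  let ?j = "rho c 1 \<i> ^ CARD('n)" and ?w = "of_int c * \<i> + 1 :: complex" and ?t = "of_real (trace (B ** Ai)) :: complex"
  have w: "?w \<noteq> 0" using linear_nonzero[OF i, of c 1] by simp
  have j: "?j \<noteq> 0" using rho_nonzero[OF i, of 1] by simp
  have \<Theta>: "\<Theta> (moebius 1 0 c 1 \<i>) = ?j * \<Theta> \<i>"
    using theta_transform[OF det c(3) _ i] by simp
  have \<Theta>0: "\<Theta> \<i> \<noteq> 0" using theta_nonzero[of 1] by simp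
  have "J 1 0 c 1 \<i> = ?j"
  proof -
    have "\<Theta> (moebius 1 0 c 1 \<i>) = J 1 0 c 1 \<i> * \<Theta> \<i>"
      using multiplier_lower[OF c(3)] i unfolding multiplier_def by (metis mult_1)
    thus ?thesis using \<Theta> \<Theta>0 by simp
  qed
  hence "\<Theta>B B (moebius 1 0 c 1 \<i>) = ?j * ?w\<^sup>2 * \<Theta>B B \<i>"
    using tr[OF c(2) i] J_weight4[OF det c(3) i] \<psi> by simp
  moreover have "\<Theta>B B (moebius 1 0 c 1 \<i>) = ?j * ?w\<^sup>2 * (\<Theta>B B \<i> + ?t / (4 * of_real pi * \<i> * \<i>) * \<Theta> \<i>)
      - ?t / (4 * of_real pi * \<i> * tau c 1 \<i>) * (?j * \<Theta> \<i>)"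
    using theta_qf_transform[OF det c(3) _ i, of B] unfolding \<Theta> by simp
  ultimately have eq: "?j * ?w\<^sup>2 * (?t / (4 * of_real pi * \<i> * \<i>) * \<Theta> \<i>) = ?t / (4 * of_real pi * \<i> * tau c 1 \<i>) * (?j * \<Theta> \<i>)"
    by (simp add: distrib_left)
  have tau: "tau c 1 \<i> = \<i> / ?w" by (simp add: tau_def)
  \<comment> \<open>The trace terms at i and at \<tau> differ by a multiple of w^2 - w with w = c i
    + 1, which is nonzero as c > 0.\<close>
  have "(?j * \<Theta> \<i>) * (?t * (?w\<^sup>2 - ?w)) = 0"
    using eq w unfolding tau by (simp add: field_simps)
  hence "?t * (?w\<^sup>2 - ?w) = 0" using j \<Theta>0 by (metis mult_eq_0_iff)
  moreover have "?w\<^sup>2 - ?w = ?w * (of_int c * \<i>)" by (simp add: power2_eq_square algebra_simps)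
  ultimately show ?thesis using w c(1) by simp
qed

lemma partial_theta_modular_imp_traceless:
  assumes "modular_form ((real CARD('n) + 4) / 2) N (partial_theta B A)"
  shows "trace (B ** Ai) = 0"
proof -
  let ?T = "\<lambda>\<psi>. \<forall>a b c d. a * d - b * c = 1 \<longrightarrow> int N dvd c \<longrightarrow>
     (\<forall>z\<in>upper_half_plane. partial_theta B A (moebius a b c d z) =
         \<psi> d * automorphy_factor ((real CARD('n) + 4) / 2) a b c d z * partial_theta B A z)"
  have "N > 0 \<and> (\<exists>\<psi>. dirichlet_char N \<psi> \<and> ?T \<psi>)"
    using assms unfolding modular_form_def by (elim conjE) (intro conjI)
  then obtain \<psi> where N: "N > 0" and \<psi>: "dirichlet_char N \<psi>" and T: "?T \<psi>" by blast
  show ?thesis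
  proof (rule modular_form_imp_traceless[OF N])
    show "\<psi> 1 = 1" using \<psi> by (simp add: dirichlet_char_def)
    fix c z assume c: "int N dvd c" and z: "Im z > 0"
    have det: "1 * 1 - 0 * c = (1 :: int)" by simp
    show "\<Theta>B B (moebius 1 0 c 1 z) = \<psi> 1 * automorphy_factor ((real CARD('n) + 4) / 2) 1 0 c 1 z * \<Theta>B B z"
      using T[rule_format, OF det c, of z] z
      unfolding upper_half_plane_def mem_Collect_eq partial_theta_wtheta[OF z] partial_theta_wtheta[OF Im_moebius_pos[OF det z]] .
  qed
qed

text \<open>The zero function obeys the transformation law trivially, with N = 1 and the trivial
  character.\<close>

lemma partial_theta_zero_imp_traceless:
  assumes "\<And>z. Im z > 0 \<Longrightarrow> partial_theta B A z = 0"
  shows "trace (B ** Ai) = 0"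
proof (rule modular_form_imp_traceless[of 1 "\<lambda>_. 1"])
  fix c z assume z: "Im z > 0"
  have det: "1 * 1 - 0 * c = (1 :: int)" by simp
  show "\<Theta>B B (moebius 1 0 c 1 z) = 1 * automorphy_factor ((real CARD('n) + 4) / 2) 1 0 c 1 z * \<Theta>B B z"
    using assms[OF z] assms[OF Im_moebius_pos[OF det z]]
    unfolding partial_theta_wtheta[OF z] partial_theta_wtheta[OF Im_moebius_pos[OF det z]] by simp
qed simp_all

end

section \<open>The series of type (1,1)\<close>

lemma sum_pair_linear:
  fixes a b :: "'a :: semiring_0"
  shows "(\<Sum>(i, j)\<in>S. a * X i j + b * Y i j) = a * (\<Sum>(i, j)\<in>S. X i j) + b * (\<Sum>(i, j)\<in>S. Y i j)"
  by (simp only: case_prod_unfold sum.distrib sum_distrib_left)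

lemma sum_pair_single:
  fixes X :: "'n :: finite \<Rightarrow> 'n \<Rightarrow> 'a :: comm_monoid_add"
  shows "(\<Sum>a\<in>UNIV. \<Sum>b\<in>UNIV. if a = u then (if b = v then X a b else 0) else 0) = X u v"
proof -
  have "(\<Sum>b\<in>UNIV. if a = u then (if b = v then X a b else 0) else 0) = (if a = u then X a v else 0)" for a
    by simp
  thus ?thesis by simp
qed

section \<open>Coordinates in which A is the unit form\<close>

context posdef_form
begin

text \<open>Gram-Schmidt for A: as long as fewer than n vectors are chosen, some nonzero x is
  orthogonal to all A f_i, and it is divided by the square root of A[x].\<close>

lemma orthonormal_frame_ex:
  assumes "finite I"
  shows "\<exists>f :: 'n \<Rightarrow> real ^ 'n. \<forall>i\<in>I. \<forall>j\<in>I. f i \<bullet> (A *v f j) = (if i = j then 1 else 0)"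
  using assms
proof (induction I rule: finite_induct)
  case (insert k I)
  obtain f :: "'n \<Rightarrow> real ^ 'n" where f: "\<And>i j. i \<in> I \<Longrightarrow> j \<in> I \<Longrightarrow> f i \<bullet> (A *v f j) = (if i = j then 1 else 0)"
    using insert.IH by blast
  have "card I < card (insert k I)" using insert.hyps by simp
  also have "\<dots> \<le> CARD('n)" by (intro card_mono) auto
  finally have "card I < CARD('n)" .
  moreover have "dim ((\<lambda>i. A *v f i) ` I) \<le> card ((\<lambda>i. A *v f i) ` I)"
    by (rule dim_le_card') (use insert.hyps in simp)
  moreover have "card ((\<lambda>i. A *v f i) ` I) \<le> card I" by (rule card_image_le) (rule insert.hyps)
  ultimately have "dim ((\<lambda>i. A *v f i) ` I) < DIM(real ^ 'n)" by simp
  then obtain x where x: "x \<noteq> 0" "\<And>y. y \<in> span ((\<lambda>i. A *v f i) ` I) \<Longrightarrow> orthogonal x y"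
    by (rule orthogonal_to_subspace_exists) blast
  have odd_multiplier: "x \<bullet> (A *v f i) = 0" if "i \<in> I" for i
    using x(2)[OF span_base, of "A *v f i"] that by (simp add: orthogonal_def)
  define w where "w = (1 / sqrt (qf A x)) *\<^sub>R x"
  have "qf A w = 1" using pos[OF x(1)] by (simp add: w_def qf_scaleR power_divide)
  moreover have wi: "w \<bullet> (A *v f i) = 0" if "i \<in> I" for i using odd_multiplier[OF that] by (simp add: w_def)
  moreover have "f i \<bullet> (A *v w) = 0" if "i \<in> I" for i using wi[OF that] inner_sym[of "f i" w] by simp
  ultimately have "\<forall>i\<in>insert k I. \<forall>j\<in>insert k I. (f(k := w)) i \<bullet> (A *v (f(k := w)) j) = (if i = j then 1 else 0)"
    using f insert.hyps(2) by (auto simp: qf_def)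
  thus ?case by blast
qed simp

text \<open>P has the orthonormal frame as its columns, and orthonormality says that the product of
  its transpose with A is the inverse Q.\<close>

lemma gram_root_ex:
  obtains Q P :: "real ^ 'n ^ 'n" where "A = transpose Q ** Q" "Q ** P = mat 1" "P ** Q = mat 1"
proof -
  obtain f :: "'n \<Rightarrow> real ^ 'n" where f: "\<And>i j. f i \<bullet> (A *v f j) = (if i = j then 1 else 0)"
    using orthonormal_frame_ex[of UNIV] by auto
  define P :: "real ^ 'n ^ 'n" where "P = (\<chi> i j. f j $ i)"
  define Q where "Q = transpose P ** A"
  have 1: "(A ** P) $ k $ j = (A *v f j) $ k" for k j
    by (simp add: P_def matrix_matrix_mult_def matrix_vector_mult_def)
  have 2: "(transpose P ** X) $ i $ j = (\<Sum>k\<in>UNIV. f i $ k * X $ k $ j)" for i j and X :: "real ^ 'n ^ 'n"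
    by (simp add: P_def matrix_matrix_mult_def transpose_def)
  have "(Q ** P) $ i $ j = f i \<bullet> (A *v f j)" for i j
    unfolding Q_def matrix_mul_assoc[symmetric] 2 1 by (simp add: inner_vec_def)
  hence QP: "Q ** P = mat 1" by (simp add: vec_eq_iff mat_def f)
  hence PQ: "P ** Q = mat 1" by (rule matrix_left_right_inverse1)
  have "transpose Q ** Q = A ** (P ** Q)"
    by (simp add: Q_def matrix_transpose_mul sym matrix_mul_assoc)
  hence "A = transpose Q ** Q" by (simp add: PQ)
  thus ?thesis using QP PQ that by blast
qed

end

locale gram_root = posdef_form A for A :: "real ^ 'n ^ 'n" +
  fixes Q P :: "real ^ 'n ^ 'n"
  assumes QQ: "A = transpose Q ** Q" and QP: "Q ** P = mat 1" and PQ: "P ** Q = mat 1"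
begin

text \<open>The inner product with the row \<open>Q $ i\<close> is the i-th coordinate of Q x, so
  these series have the quadratic monomials in the orthonormal coordinates as weights.\<close>

definition E :: "'n \<Rightarrow> 'n \<Rightarrow> complex \<Rightarrow> complex" where
  "E i j = wtheta (\<lambda>x. of_real ((x \<bullet> Q $ i) * (x \<bullet> Q $ j))) 0"

definition F :: "'n \<Rightarrow> 'n \<Rightarrow> complex \<Rightarrow> complex" where
  "F i j z = E i j z - (if i = j then (\<Sum>k\<in>UNIV. E k k z) / of_nat CARD('n) else 0)"

lemma E_sym: "E i j = E j i"
  by (simp add: E_def mult.commute)

lemma Ai_PP: "Ai = P ** transpose P"
proof -
  have "A ** (P ** transpose P) = transpose Q ** (Q ** P) ** transpose P"
    by (simp add: QQ matrix_mul_assoc)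
  also have "\<dots> = transpose (P ** Q)" by (simp add: QP matrix_transpose_mul)
  finally have 1: "A ** (P ** transpose P) = mat 1" by (simp add: PQ)
  have "Ai = Ai ** (A ** (P ** transpose P))" by (simp add: 1)
  thus ?thesis by (simp only: matrix_mul_assoc Ai_A matrix_mul_lid)
qed

text \<open>In the new coordinates N the tangent condition becomes the vanishing of the ordinary
  trace.\<close>

lemma trace_conj: "trace (transpose Q ** N ** Q ** Ai) = trace N"
proof -
  have "transpose Q ** N ** Q ** Ai = transpose Q ** N ** (Q ** P) ** transpose P"
    by (simp add: Ai_PP matrix_mul_assoc)
  also have "\<dots> = (transpose Q ** N) ** transpose P" by (simp add: QP)
  finally have "trace (transpose Q ** N ** Q ** Ai) = trace ((transpose Q ** N) ** transpose P)" by simp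
  also have "\<dots> = trace (transpose P ** (transpose Q ** N))" by (rule trace_mul_sym)
  also have "transpose P ** (transpose Q ** N) = transpose (Q ** P) ** N"
    by (simp add: matrix_mul_assoc matrix_transpose_mul)
  finally show ?thesis by (simp add: QP)
qed

lemma conj_cancel: "transpose Q ** (transpose P ** B ** P) ** Q = B"
proof -
  have "transpose Q ** (transpose P ** B ** P) ** Q = transpose (P ** Q) ** B ** (P ** Q)"
    by (simp add: matrix_mul_assoc matrix_transpose_mul)
  thus ?thesis by (simp add: PQ)
qed

lemma wtheta_conj:
  assumes z: "Im z > 0"
  shows "wtheta (\<lambda>x. of_real (qf (transpose Q ** N ** Q) x)) 0 z = (\<Sum>(i, j)\<in>UNIV. of_real (N $ i $ j) * E i j z)"
proof -
  have "qf (transpose Q ** N ** Q) x = qf N (Q *v x)" for x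
  proof -
    have "x \<bullet> (transpose Q *v y) = (Q *v x) \<bullet> y" for y
      using dot_lmul_matrix[of x "transpose Q" y] by simp
    thus ?thesis by (simp add: qf_def flip: matrix_vector_mul_assoc)
  qed
  hence "complex_of_real (qf (transpose Q ** N ** Q) x) =
      (\<Sum>p\<in>UNIV. of_real (N $ fst p $ snd p) * of_real ((x \<bullet> Q $ fst p) * (x \<bullet> Q $ snd p)))" for x
    by (simp add: qf_expand case_prod_beta matrix_vector_mul_component inner_commute)
  hence "wtheta (\<lambda>x. of_real (qf (transpose Q ** N ** Q) x)) 0 z =
      (\<Sum>p\<in>UNIV. of_real (N $ fst p $ snd p) * wtheta (\<lambda>x. of_real ((x \<bullet> Q $ fst p) * (x \<bullet> Q $ snd p))) 0 z)"
    by (simp only:) (rule wtheta_sum[OF z quad_growth_bilinear], simp)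
  thus ?thesis by (simp add: E_def case_prod_beta)
qed

lemma wtheta_traceless:
  assumes z: "Im z > 0" and N: "trace N = 0"
  shows "wtheta (\<lambda>x. of_real (qf (transpose Q ** N ** Q) x)) 0 z = (\<Sum>(i, j)\<in>UNIV. of_real (N $ i $ j) * F i j z)"
proof -
  define T where "T = (\<Sum>k\<in>UNIV. E k k z) / of_nat CARD('n)"
  have F: "F i j z = E i j z - (if i = j then T else 0)" for i j by (simp add: F_def T_def)
  have "(\<Sum>(i, j)\<in>UNIV. of_real (N $ i $ j) * F i j z) =
      (\<Sum>(i, j)\<in>UNIV. of_real (N $ i $ j) * E i j z) - (\<Sum>(i, j)\<in>UNIV. of_real (N $ i $ j) * (if i = j then T else 0))"
    by (simp add: F right_diff_distrib sum_subtractf case_prod_beta)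
  also have "(\<Sum>(i, j)\<in>UNIV. of_real (N $ i $ j) * (if i = j then T else 0)) =
      (\<Sum>i\<in>UNIV. \<Sum>j\<in>UNIV. of_real (N $ i $ j) * (if i = j then T else 0))"
    by (simp add: sum.cartesian_product)
  also have "\<dots> = of_real (trace N) * T"
    by (simp add: if_distrib[of "\<lambda>x. _ * x"] sum.delta' sum.delta trace_def sum_distrib_right cong: if_cong)
  finally show ?thesis using N wtheta_conj[OF z] by simp
qed

lemma inner_A: "x \<bullet> (A *v y) = (\<Sum>i\<in>UNIV. (x \<bullet> Q $ i) * (y \<bullet> Q $ i))"
proof -
  have "x \<bullet> (A *v y) = (Q *v x) \<bullet> (Q *v y)" by (rule gram_inner[OF QQ, symmetric])
  thus ?thesis by (simp add: inner_vec_def[of "Q *v x"] matrix_vector_mul_component inner_commute)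
qed

text \<open>The square of the inner product of \<gamma> and \<delta> is the sum over i, j of
  (\<gamma>_i \<gamma>_j) (\<delta>_i \<delta>_j), so the double series splits into squares of the
  \<open>E i j\<close>; the product of the squared norms gives the square of their trace.\<close>

lemma theta11_eq:
  assumes z: "Im z > 0"
  shows "theta11_form A z = 1 / 2 * (\<Sum>(i, j)\<in>UNIV. (E i j z)\<^sup>2) -
    1 / (2 * of_nat CARD('n)) * (\<Sum>i\<in>UNIV. E i i z)\<^sup>2"
proof -
  define n where "n = real CARD('n)"
  define e where "e v = ex (of_real (qf A (int_vec v)) * z)" for v :: "int ^ 'n"
  define m where "m i v = int_vec v \<bullet> Q $ i" for i and v :: "int ^ 'n"
  define f where "f i j v = of_real (m i v * m j v) * e v" for i j v
  have E: "E i j z = infsum (f i j) UNIV" for i j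
    by (simp add: E_def wtheta_def f_def[abs_def] m_def e_def)
  have sm: "(\<lambda>v. norm (f i j v)) summable_on UNIV" for i j
    using wtheta_summable[OF quad_growth_bilinear[of "Q $ i" "Q $ j"] z, of 0]
    unfolding f_def m_def e_def by (simp only: add_0_right)
  have prod: "((\<lambda>(v, w). f i j v * f k r w) has_sum E i j z * E k r z) UNIV" for i j k r
    using infsum_product_norm[OF sm sm, of i j k r] unfolding E UNIV_Times_UNIV
    by (metis has_sum_infsum)
  \<comment> \<open>The lattice picked in the definition of \<open>theta11_form\<close> may be
    replaced by the one spanned by the columns of Q.\<close>
  have "associated_lattice A (column_lattice Q)" using QQ by (auto simp: associated_lattice_def)
  hence "theta11_form A = theta11_lattice (column_lattice Q)"
    unfolding theta11_form_def by (metis (mono_tags) posdef someI theta11_lattice_unique)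
  hence "theta11_form A z = (\<Sum>\<^sub>\<infinity>(v, w)\<in>UNIV.
        of_real (1 / 2 * (int_vec v \<bullet> (A *v int_vec w))\<^sup>2 - 1 / (2 * real CARD('n)) *
           (int_vec v \<bullet> (A *v int_vec v)) * (int_vec w \<bullet> (A *v int_vec w)))
        * exp (2 * of_real pi * \<i> *
            of_real (int_vec v \<bullet> (A *v int_vec v) + int_vec w \<bullet> (A *v int_vec w)) * z))"
    by (simp add: theta11_lattice_gram[OF posdef QQ])
  also have "\<dots> = (\<Sum>\<^sub>\<infinity>(v, w)\<in>UNIV. \<Sum>(i, j)\<in>UNIV.
      1 / 2 * (f i j v * f i j w) + (- 1 / (2 * of_real n)) * (f i i v * f j j w))"
  proof (rule infsum_cong, clarify)
    fix v w :: "int ^ 'n"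
    have ee: "exp (2 * of_real pi * \<i> *
            of_real (int_vec v \<bullet> (A *v int_vec v) + int_vec w \<bullet> (A *v int_vec w)) * z) = e v * e w"
      by (simp add: e_def ex_def qf_def ring_distribs mult.assoc flip: exp_add)
    have sq: "1 / 2 * (int_vec v \<bullet> (A *v int_vec w))\<^sup>2 - 1 / (2 * n) *
           (int_vec v \<bullet> (A *v int_vec v)) * (int_vec w \<bullet> (A *v int_vec w)) =
        (\<Sum>(i, j)\<in>UNIV. 1 / 2 * ((m i v * m j v) * (m i w * m j w)) + (- 1 / (2 * n)) * ((m i v * m i v) * (m j w * m j w)))"
      (is "_ = ?s")
    proof -
      have "(int_vec v \<bullet> (A *v int_vec w))\<^sup>2 = (\<Sum>(i, j)\<in>UNIV. (m i v * m j v) * (m i w * m j w))"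
        unfolding inner_A power2_eq_square sum_product m_def[symmetric]
        by (simp add: sum.cartesian_product mult_ac)
      moreover have "(int_vec v \<bullet> (A *v int_vec v)) * (int_vec w \<bullet> (A *v int_vec w)) =
          (\<Sum>(i, j)\<in>UNIV. (m i v * m i v) * (m j w * m j w))"
        unfolding inner_A sum_product m_def[symmetric] by (simp add: sum.cartesian_product)
      ultimately show ?thesis
        unfolding sum_pair_linear by (simp add: mult.assoc)
    qed
    have "of_real ?s * (e v * e w) = (\<Sum>(i, j)\<in>UNIV.
      1 / 2 * (f i j v * f i j w) + (- 1 / (2 * of_real n)) * (f i i v * f j j w))"
      unfolding of_real_sum sum_distrib_right
      by (rule sum.cong) (auto simp: f_def ring_distribs mult_ac)
    thus "of_real (1 / 2 * (int_vec v \<bullet> (A *v int_vec w))\<^sup>2 - 1 / (2 * real CARD('n)) *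
           (int_vec v \<bullet> (A *v int_vec v)) * (int_vec w \<bullet> (A *v int_vec w))) *
        exp (2 * of_real pi * \<i> *
            of_real (int_vec v \<bullet> (A *v int_vec v) + int_vec w \<bullet> (A *v int_vec w)) * z) =
      (\<Sum>(i, j)\<in>UNIV. 1 / 2 * (f i j v * f i j w) + (- 1 / (2 * of_real n)) * (f i i v * f j j w))"
      unfolding ee n_def[symmetric] sq .
  qed
  also have "\<dots> = (\<Sum>(i, j)\<in>UNIV. 1 / 2 * (E i j z * E i j z) + (- 1 / (2 * of_real n)) * (E i i z * E j j z))"
  proof -
    let ?g = "\<lambda>p x. 1 / 2 * (f (fst p) (snd p) (fst x) * f (fst p) (snd p) (snd x)) +
        (- 1 / (2 * of_real n)) * (f (fst p) (fst p) (fst x) * f (snd p) (snd p) (snd x))"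
    have g: "(?g p has_sum 1 / 2 * (E (fst p) (snd p) z * E (fst p) (snd p) z) +
        (- 1 / (2 * of_real n)) * (E (fst p) (fst p) z * E (snd p) (snd p) z)) UNIV" for p
      by (intro has_sum_add has_sum_cmult_right prod[unfolded case_prod_unfold])
    have "(\<Sum>\<^sub>\<infinity>x. \<Sum>p\<in>UNIV. ?g p x) = (\<Sum>p\<in>UNIV. \<Sum>\<^sub>\<infinity>x. ?g p x)"
      using infsum_finite_sum[of UNIV ?g UNIV] has_sum_imp_summable[OF g] by simp
    thus ?thesis using infsumI[OF g] by (simp only: case_prod_unfold)
  qed
  also have "\<dots> = 1 / 2 * (\<Sum>(i, j)\<in>UNIV. (E i j z)\<^sup>2) +
      (- 1 / (2 * of_real n)) * (\<Sum>(i, j)\<in>UNIV. E i i z * E j j z)"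
    unfolding power2_eq_square by (rule sum_pair_linear)
  also have "(\<Sum>(i, j)\<in>UNIV. E i i z * E j j z) = (\<Sum>i\<in>UNIV. E i i z)\<^sup>2"
    by (simp add: power2_eq_square sum_product sum.cartesian_product)
  finally show ?thesis by (simp add: n_def)
qed

text \<open>Removing the scalar part lowers the sum of squares by the squared trace over n, which is
  the subtracted term with its coefficient 1 / (2 n).\<close>

lemma theta11_traceless:
  assumes z: "Im z > 0"
  shows "theta11_form A z = 1 / 2 * (\<Sum>(i, j)\<in>UNIV. (F i j z)\<^sup>2)"
proof -
  define n where "n = complex_of_nat CARD('n)"
  have n: "n \<noteq> 0" by (simp add: n_def)
  define T where "T = (\<Sum>i\<in>UNIV. E i i z)"
  have "(F i j z)\<^sup>2 = (E i j z)\<^sup>2 + (if i = j then (T / n)\<^sup>2 - 2 * (T / n) * E i j z else 0)" for i j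
    by (simp add: F_def T_def n_def power2_eq_square algebra_simps)
  hence "(\<Sum>i\<in>UNIV. \<Sum>j\<in>UNIV. (F i j z)\<^sup>2) =
      (\<Sum>i\<in>UNIV. \<Sum>j\<in>UNIV. (E i j z)\<^sup>2) + (\<Sum>i\<in>UNIV. (T / n)\<^sup>2 - 2 * (T / n) * E i i z)"
    by (simp add: sum.distrib)
  also have "(\<Sum>i\<in>UNIV. (T / n)\<^sup>2 - 2 * (T / n) * E i i z) = n * (T / n)\<^sup>2 - 2 * (T / n) * T"
    by (simp only: sum_subtractf sum_distrib_left[symmetric] T_def[symmetric]) (simp add: n_def)
  also have "\<dots> = - T\<^sup>2 / n" using n by (simp add: power2_eq_square field_simps)
  finally have "(\<Sum>(i, j)\<in>UNIV. (F i j z)\<^sup>2) = (\<Sum>(i, j)\<in>UNIV. (E i j z)\<^sup>2) - T\<^sup>2 / n"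
    by (simp add: sum.cartesian_product)
  hence "theta11_form A z = 1 / 2 * ((\<Sum>(i, j)\<in>UNIV. (F i j z)\<^sup>2) + T\<^sup>2 / n) - 1 / (2 * n) * T\<^sup>2"
    unfolding theta11_eq[OF z] n_def[symmetric] T_def[symmetric] by simp
  thus ?thesis by (simp add: ring_distribs)
qed

lemma F_real:
  assumes y: "y > 0"
  shows "F i j (\<i> * of_real y) \<in> \<real>"
proof -
  have "E i j (\<i> * of_real y) \<in> \<real>" for i j
  proof -
    have "cnj (ex (of_real r * (\<i> * of_real y))) = ex (of_real r * (\<i> * of_real y))" for r
      by (simp add: ex_def exp_cnj mult_ac)
    hence "cnj (E i j (\<i> * of_real y)) = E i j (\<i> * of_real y)"
      unfolding E_def wtheta_def by (simp flip: infsum_cnj)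
    thus ?thesis by (simp add: Reals_cnj_iff)
  qed
  thus ?thesis unfolding F_def by (auto intro!: Reals_diff Reals_divide sum_in_Reals Reals_of_nat)
qed

lemma DTheta_vanishes_iff:
  "DTheta_vanishes_on A (tangent0 A) \<longleftrightarrow> (\<forall>z\<in>upper_half_plane. theta11_form A z = 0)"
proof
  assume van: "DTheta_vanishes_on A (tangent0 A)"
  have "F i j z = 0" if z: "Im z > 0" for i j z
  proof -
    \<comment> \<open>The symmetrised matrix unit at (i, j) minus its scalar part; pairing it with
      \<open>E\<close> yields \<open>F i j\<close>.\<close>
    define N :: "real ^ 'n ^ 'n" where
      "N = (\<chi> a b. (if a = i then (if b = j then 1 / 2 else 0) else 0) +
          (if a = j then (if b = i then 1 / 2 else 0) else 0) -
          (if a = b then (if i = j then 1 / real CARD('n) else 0) else 0))"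
    let ?B = "transpose Q ** N ** Q"
    have "transpose N = N" by (simp add: N_def transpose_def vec_eq_iff)
    hence "transpose ?B = ?B" by (simp add: matrix_transpose_mul matrix_mul_assoc)
    moreover have "trace N = 0"
      by (cases "i = j") (simp_all add: trace_def N_def sum.distrib sum_subtractf flip: sum_distrib_left)
    ultimately have "?B \<in> tangent0 A"
      by (simp add: tangent0_def Quad_def trace_conj flip: Ai_def)
    hence "wtheta (\<lambda>x. of_real (qf ?B x)) 0 z = 0"
      using van z partial_theta_wtheta[OF z, of ?B] by (simp add: DTheta_vanishes_on_def upper_half_plane_def)
    hence "0 = (\<Sum>a\<in>UNIV. \<Sum>b\<in>UNIV. of_real (N $ a $ b) * E a b z)"
      by (simp add: wtheta_conj[OF z] sum.cartesian_product)
    also have "\<dots> = (\<Sum>a\<in>UNIV. \<Sum>b\<in>UNIV. (if a = i then (if b = j then E a b z / 2 else 0) else 0) +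
        (if a = j then (if b = i then E a b z / 2 else 0) else 0) -
        (if a = b then (if i = j then E a b z / of_nat CARD('n) else 0) else 0))"
      by (intro sum.cong refl) (simp add: N_def ring_distribs)
    also have "\<dots> = E i j z / 2 + E j i z / 2 - (\<Sum>a\<in>UNIV. if i = j then E a a z / of_nat CARD('n) else 0)"
      by (simp only: sum.distrib sum_subtractf sum_pair_single) simp
    also have "\<dots> = F i j z"
      by (simp add: E_sym[of j i] F_def sum_divide_distrib)
    finally show ?thesis by simp
  qed
  thus "\<forall>z\<in>upper_half_plane. theta11_form A z = 0"
    by (simp add: upper_half_plane_def theta11_traceless)
next
  assume 0: "\<forall>z\<in>upper_half_plane. theta11_form A z = 0"
  have F0: "F i j (\<i> * of_real y) = 0" if y: "y > 0" for i j y
  proof -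
    have iy: "Im (\<i> * of_real y) > 0" using y by simp
    have re: "F i j (\<i> * of_real y) = of_real (Re (F i j (\<i> * of_real y)))" for i j
      using F_real[OF y, of i j] by (metis of_real_Re)
    have "(\<Sum>(i, j)\<in>UNIV. (F i j (\<i> * of_real y))\<^sup>2) = 0"
      using 0 iy theta11_traceless[OF iy] by (simp add: upper_half_plane_def)
    also have "(\<Sum>(i, j)\<in>UNIV. (F i j (\<i> * of_real y))\<^sup>2) =
        of_real (\<Sum>p\<in>UNIV. (Re (F (fst p) (snd p) (\<i> * of_real y)))\<^sup>2)"
      by (subst re) (simp add: case_prod_beta)
    finally have "(\<Sum>p\<in>UNIV. (Re (F (fst p) (snd p) (\<i> * of_real y)))\<^sup>2) = 0"
      by (simp only: of_real_eq_0_iff)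
    hence "(Re (F (fst (i, j)) (snd (i, j)) (\<i> * of_real y)))\<^sup>2 = 0"
      by (subst (asm) sum_nonneg_eq_0_iff) auto
    thus ?thesis by (subst re) simp
  qed
  show "DTheta_vanishes_on A (tangent0 A)"
    unfolding DTheta_vanishes_on_def
  proof (intro ballI)
    fix B z assume B: "B \<in> tangent0 A" and "z \<in> upper_half_plane"
    hence z: "Im z > 0" by (simp add: upper_half_plane_def)
    let ?N = "transpose P ** B ** P" and ?p = "\<lambda>x. complex_of_real (qf B x)"
    have "trace ?N = trace (B ** Ai)" using trace_conj[of ?N] by (simp add: conj_cancel)
    hence N: "trace ?N = 0" using B by (simp add: tangent0_def Ai_def)
    \<comment> \<open>The \<open>F i j\<close> are known to vanish only on the imaginary axis;
      holomorphy of the weighted series carries this to the whole half plane.\<close>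
    have "wtheta ?p 0 z = 0"
    proof (rule analytic_continuation[of "wtheta ?p 0" "{z. Im z > 0}" "(\<lambda>y. \<i> * of_real y) ` {0<..}" \<i>])
      show "wtheta ?p 0 holomorphic_on {z. Im z > 0}" by (rule wtheta_holomorphic) (rule quad_growth_qf)
      show "open {z. Im z > 0}" by (rule open_upper_half_plane)
      show "connected {z. Im z > 0}" by (intro convex_connected convex_halfspace_Im_gt)
      show "(\<lambda>y. \<i> * of_real y) ` {0<..} \<subseteq> {z. Im z > 0}" by auto
      show "\<i> islimpt (\<lambda>y. \<i> * of_real y) ` {0<..}"
        unfolding islimpt_approachable
      proof (intro allI impI)
        fix \<epsilon> :: real assume "\<epsilon> > 0"
        hence "\<i> * of_real (1 + \<epsilon> / 2) \<in> (\<lambda>y. \<i> * of_real y) ` {0<..}"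
          by (intro imageI) simp
        moreover have "\<i> * of_real (1 + \<epsilon> / 2) \<noteq> \<i>"
            "dist (\<i> * of_real (1 + \<epsilon> / 2)) \<i> < \<epsilon>"
          using \<open>\<epsilon> > 0\<close> by (auto simp: dist_norm ring_distribs norm_mult)
        ultimately show "\<exists>x'\<in>(\<lambda>y. \<i> * of_real y) ` {0<..}. x' \<noteq> \<i> \<and> dist x' \<i> < \<epsilon>" by blast
      qed
      fix w assume "w \<in> (\<lambda>y. \<i> * of_real y) ` {0<..}"
      then obtain y :: real where y: "y > 0" "w = \<i> * of_real y" by auto
      hence "Im w > 0" by simp
      thus "wtheta ?p 0 w = 0"
        using wtheta_traceless[OF _ N, of w] F0[OF y(1)] by (simp add: conj_cancel y(2) case_prod_beta)
    qed (use z in simp_all)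
    thus "partial_theta B A z = 0" using partial_theta_wtheta[OF z] by simp
  qed
qed

end

theorem proposition2p4:
  fixes A :: "real ^ 'n ^ 'n" and l :: nat
  assumes "A \<in> Quad_pos" and "integer_valued A" and "l = form_level A"
  shows
    "modular_form (real CARD('n) / 2) l (theta_series A) \<and>
     (\<forall>B\<in>Quad.
        (modular_form ((real CARD('n) + 4) / 2) l (partial_theta B A) \<longleftrightarrow> B \<in> tangent0 A) \<and>
        ((\<exists>N. modular_form ((real CARD('n) + 4) / 2) N (partial_theta B A)) \<longleftrightarrow> B \<in> tangent0 A) \<and>
        ((\<forall>z\<in>upper_half_plane. partial_theta B A z = 0) \<longrightarrow> B \<in> tangent0 A)) \<and>
     (DTheta_vanishes_on A (tangent0 A) \<longleftrightarrow>
        (\<forall>z\<in>upper_half_plane. theta11_form A z = 0))"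
proof (intro conjI ballI)
  interpret integral_form A l
    using assms form_level_even_mat by unfold_locales simp_all
  show "modular_form (real CARD('n) / 2) l (theta_series A)" by (rule theta_series_modular)
  fix B :: "real ^ 'n ^ 'n" assume "B \<in> Quad"
  hence tangent: "B \<in> tangent0 A \<longleftrightarrow> trace (B ** Ai) = 0" by (simp add: tangent0_def Ai_def)
  show "modular_form ((real CARD('n) + 4) / 2) l (partial_theta B A) \<longleftrightarrow> B \<in> tangent0 A"
    and "(\<exists>N. modular_form ((real CARD('n) + 4) / 2) N (partial_theta B A)) \<longleftrightarrow> B \<in> tangent0 A"
    unfolding tangent using partial_theta_modular partial_theta_modular_imp_traceless by blast+
  show "(\<forall>z\<in>upper_half_plane. partial_theta B A z = 0) \<longrightarrow> B \<in> tangent0 A"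
    unfolding tangent using partial_theta_zero_imp_traceless by (simp add: upper_half_plane_def)
next
  interpret posdef_form A by unfold_locales (rule assms)
  obtain Q P where "gram_root A Q P"
    using gram_root_ex posdef_form_axioms unfolding gram_root_def gram_root_axioms_def by metis
  thus "DTheta_vanishes_on A (tangent0 A) \<longleftrightarrow> (\<forall>z\<in>upper_half_plane. theta11_form A z = 0)"
    by (rule gram_root.DTheta_vanishes_iff)
qed

end
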